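(* Consider the Gaussian/Poisson product mixture model described in the context, with bounded parameter space $\Theta$ and true mixing distribution $g_0\in\mathcal G$. Let $L_n(\mathcal G,g_0)=2\{\ell_n(f_{\hat g})-\ell_n(f_{g_0})\}$. (1) If $g_0$ is discrete with finitely many support points, then, with $\mathcal S$ the score set defined in the context, $$L_n(\mathcal G,g_0)\ \stackrel{\mathcal D}{\longrightarrow}\ \sup_{s\in\mathcal S}\bigl[(\mathbb G(s))_+\bigr]^2,$$ where $x_+=\max\{x,0\}$ and $\mathbb G$ is a centered Gaussian process indexed by $\mathcal S$ with covariance $\mathbb E[\mathbb G(s_1)\mathbb G(s_2)]=\mathbb E[s_1(X)s_2(X)]$, $X\sim f_{g_0}$. (2) If $g_0$ is not finitely discrete, then $L_n(\mathcal G,g_0)$ diverges to infinity in probability.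
   Context: Model: let $\mathbb N=\{0,1,2,\dots\}$, $d\ge 1$, fix $b\in\{0,1,\dots,d\}$, and let $\Theta\subseteq\mathbb R^b\times(0,\infty)^{d-b}$ be bounded. For $\theta\in\Theta$ let $p_\theta(x)=\prod_{l=1}^d p_{\theta_l}(x_l)$ for $x\in\mathbb R^b\times\mathbb N^{d-b}$, where $p_{\theta_l}(x_l)=\phi(x_l-\theta_l)$ with $\phi(t)=\frac{1}{\sqrt{2\pi}}e^{-t^2/2}$ for $1\le l\le b$, and $p_{\theta_l}(x_l)=\frac{\theta_l^{x_l}}{x_l!}e^{-\theta_l}$ for $b+1\le l\le d$. The base measure $\mu$ is the product of Lebesgue measure on $\mathbb R^b$ and counting measure on $\mathbb N^{d-b}$. $\mathcal G$ is the set of all probability measures supported on $\Theta$, and $f_g(x)=\int_\Theta p_\theta(x)\,dg(\theta)$ for $g\in\mathcal G$. One observes i.i.d. $X_1,\dots,X_n$ with density $f_{g_0}$ with respect to $\mu$, where $g_0\in\mathcal G$ is fixed. The log-likelihood is $\ell_n(f)=\sum_{i=1}^n\log f(X_i)$, and the NPMLE $\hat g$ is any maximizer of $g\mapsto\ell_n(f_g)$ over $\mathcal G$. The chi-square divergence is $\chi^2(f,f_0)=\|f/f_0-1\|^2_{L_2(f_0\,d\mu)}$ and $\chi(f,f_0)$ is its nonnegative square root. "Finitely discrete" means discrete and supported on finitely many points. Score set: fix a support point $\theta_0$ of $g_0$ (finitely discrete). For a multi-index $\alpha\in\mathbb N^d$ write $\theta^\alpha=\prod_l\theta_l^{\alpha_l}$,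 $\alpha!=\prod_l\alpha_l!$, $|\alpha|=\sum_l\alpha_l$, $m_{\alpha,g}=\int_\Theta(\theta-\theta_0)^\alpha\,dg(\theta)$, and $$q_\alpha(x)=\left.\frac{\partial^\alpha}{\partial\theta^\alpha}\Big(\frac{p_\theta(x)}{p_{\theta_0}(x)}\Big)\right|_{\theta=\theta_0}.$$ Then $$\mathcal S=\Bigg\{s(\cdot)=\sqrt{\frac{p_{\theta_0}(\cdot)}{f_{g_0}(\cdot)}}\Bigg(\sum_{k=1}^\infty\sum_{|\alpha|=k}\frac{m_{\alpha,g}-m_{\alpha,g_0}}{\alpha!\,\chi(f_g,f_{g_0})}\,q_\alpha(\cdot)\Bigg)\sqrt{\frac{p_{\theta_0}(\cdot)}{f_{g_0}(\cdot)}}:\ g\in\mathcal G,\ g\ne g_0\Bigg\}.$$ As usual for limits of empirical processes, $\mathbb G$ denotes a tight version, i.e. one with bounded and uniformly $L_2(f_{g_0}\,d\mu)$-continuous sample paths. *)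

theory Defs
  imports "HOL-Probability.Probability"
begin

section \<open>The Gaussian/Poisson product mixture model\<close>

text \<open>
  A point of \<open>R\<^sup>d\<close> is an extensional function on the index set \<open>{1..d}\<close>.  An observation, i.e. a
  point of \<open>R\<^sup>b \<times> N\<^sup>d\<^sup>-\<^sup>b\<close>, is a pair of extensional functions: the Gaussian coordinates
  \<open>1, \<dots>, b\<close> and the Poisson coordinates \<open>b + 1, \<dots>, d\<close>.
\<close>

type_synonym param = "nat \<Rightarrow> real"
type_synonym obs = "(nat \<Rightarrow> real) \<times> (nat \<Rightarrow> nat)"

definition base_measure :: "nat \<Rightarrow> nat \<Rightarrow> obs measure" where
  "base_measure d b =
     (\<Pi>\<^sub>M l\<in>{1..b}. lborel) \<Otimes>\<^sub>M (\<Pi>\<^sub>M l\<in>{b+1..d}. count_space UNIV)"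

definition param_space :: "nat \<Rightarrow> nat \<Rightarrow> param set" where
  "param_space d b = (\<Pi>\<^sub>E l\<in>{1..d}. if l \<le> b then UNIV else {0<..})"

text \<open>
  Not the library's \<open>bounded\<close>: its metric on \<open>nat \<Rightarrow> real\<close> is that of a countable product and is
  itself bounded, which would make the condition void.
\<close>

definition bounded_params :: "nat \<Rightarrow> param set \<Rightarrow> bool" where
  "bounded_params d \<Theta> \<longleftrightarrow> (\<exists>R. \<forall>\<theta>\<in>\<Theta>. \<forall>l\<in>{1..d}. \<bar>\<theta> l\<bar> \<le> R)"

definition comp_density :: "nat \<Rightarrow> nat \<Rightarrow> param \<Rightarrow> obs \<Rightarrow> real" where
  "comp_density d b \<theta> x =
     (\<Prod>l=1..b. std_normal_density (fst x l - \<theta> l)) *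
     (\<Prod>l=b+1..d. \<theta> l ^ snd x l / fact (snd x l) * exp (- \<theta> l))"

text \<open>
  The set of all probability measures on \<open>\<Theta>\<close>.  They live on the trace of the Borel sets, so that
  \<open>\<Theta>\<close> itself need not be Borel.
\<close>

definition mixing_dists :: "nat \<Rightarrow> param set \<Rightarrow> param measure set" where
  "mixing_dists d \<Theta> =
     {g. prob_space g \<and> sets g = sets (restrict_space (\<Pi>\<^sub>M l\<in>{1..d}. borel) \<Theta>)}"

definition mix_density :: "nat \<Rightarrow> nat \<Rightarrow> param measure \<Rightarrow> obs \<Rightarrow> real" where
  "mix_density d b g x = (LINT \<theta>|g. comp_density d b \<theta> x)"

definition mix_dist :: "nat \<Rightarrow> nat \<Rightarrow> param measure \<Rightarrow> obs measure" where
  "mix_dist d b g = density (base_measure d b) (\<lambda>x. ennreal (mix_density d b g x))"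

definition finitely_discrete :: "param measure \<Rightarrow> bool" where
  "finitely_discrete g \<longleftrightarrow> (\<exists>A. finite A \<and> A \<subseteq> space g \<and> emeasure g A = 1)"

text \<open>Only used for finitely discrete \<open>g\<close>, whose support points are its atoms.\<close>

definition support_point :: "param measure \<Rightarrow> param \<Rightarrow> bool" where
  "support_point g \<theta> \<longleftrightarrow> \<theta> \<in> space g \<and> emeasure g {\<theta>} > 0"


section \<open>Likelihood\<close>

definition log_lik :: "nat \<Rightarrow> (nat \<Rightarrow> obs) \<Rightarrow> (obs \<Rightarrow> real) \<Rightarrow> real" where
  "log_lik n xs f = (\<Sum>i=1..n. ln (f (xs i)))"

definition is_npmle ::
  "nat \<Rightarrow> nat \<Rightarrow> param set \<Rightarrow> nat \<Rightarrow> (nat \<Rightarrow> obs) \<Rightarrow> param measure \<Rightarrow> bool" where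
  "is_npmle d b \<Theta> n xs g \<longleftrightarrow> g \<in> mixing_dists d \<Theta> \<and>
     (\<forall>h\<in>mixing_dists d \<Theta>.
        log_lik n xs (mix_density d b h) \<le> log_lik n xs (mix_density d b g))"

definition lr_stat ::
  "nat \<Rightarrow> nat \<Rightarrow> nat \<Rightarrow> (nat \<Rightarrow> obs) \<Rightarrow> param measure \<Rightarrow> param measure \<Rightarrow> real" where
  "lr_stat d b n xs g g0 =
     2 * (log_lik n xs (mix_density d b g) - log_lik n xs (mix_density d b g0))"


section \<open>The score set\<close>

definition chi_div :: "nat \<Rightarrow> nat \<Rightarrow> param measure \<Rightarrow> param measure \<Rightarrow> real" where
  "chi_div d b g g0 =
     sqrt (LINT x|mix_dist d b g0. (mix_density d b g x / mix_density d b g0 x - 1)\<^sup>2)"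

definition multi_indices :: "nat \<Rightarrow> nat \<Rightarrow> (nat \<Rightarrow> nat) set" where
  "multi_indices d k = {\<alpha> \<in> {1..d} \<rightarrow>\<^sub>E UNIV. (\<Sum>l=1..d. \<alpha> l) = k}"

definition multi_fact :: "nat \<Rightarrow> (nat \<Rightarrow> nat) \<Rightarrow> real" where
  "multi_fact d \<alpha> = (\<Prod>l=1..d. fact (\<alpha> l))"

definition mix_moment :: "nat \<Rightarrow> param \<Rightarrow> (nat \<Rightarrow> nat) \<Rightarrow> param measure \<Rightarrow> real" where
  "mix_moment d \<theta>0 \<alpha> g = (LINT \<theta>|g. (\<Prod>l=1..d. (\<theta> l - \<theta>0 l) ^ \<alpha> l))"

definition partial_deriv :: "nat \<Rightarrow> (param \<Rightarrow> real) \<Rightarrow> param \<Rightarrow> real" where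
  "partial_deriv l F \<theta> = deriv (\<lambda>t. F (\<theta>(l := t))) (\<theta> l)"

text \<open>
  \<open>\<partial>\<^sub>1\<close> to the power \<open>\<alpha>\<^sub>1\<close>, \dots, \<open>\<partial>\<^sub>d\<close> to the power \<open>\<alpha>\<^sub>d\<close>; below it is only applied to functions
  that are smooth in \<open>\<theta>\<close>, so the order does not matter.
\<close>

definition multi_deriv :: "nat \<Rightarrow> (nat \<Rightarrow> nat) \<Rightarrow> (param \<Rightarrow> real) \<Rightarrow> param \<Rightarrow> real" where
  "multi_deriv d \<alpha> F = foldr (\<lambda>l. partial_deriv l ^^ \<alpha> l) [1..<d+1] F"

definition score_poly :: "nat \<Rightarrow> nat \<Rightarrow> param \<Rightarrow> (nat \<Rightarrow> nat) \<Rightarrow> obs \<Rightarrow> real" where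
  "score_poly d b \<theta>0 \<alpha> x =
     multi_deriv d \<alpha> (\<lambda>\<theta>. comp_density d b \<theta> x / comp_density d b \<theta>0 x) \<theta>0"

definition score ::
  "nat \<Rightarrow> nat \<Rightarrow> param measure \<Rightarrow> param \<Rightarrow> param measure \<Rightarrow> obs \<Rightarrow> real" where
  "score d b g0 \<theta>0 g x =
     sqrt (comp_density d b \<theta>0 x / mix_density d b g0 x) *
     (\<Sum>k. \<Sum>\<alpha>\<in>multi_indices d (Suc k).
        (mix_moment d \<theta>0 \<alpha> g - mix_moment d \<theta>0 \<alpha> g0) / (multi_fact d \<alpha> * chi_div d b g g0) *
        score_poly d b \<theta>0 \<alpha> x) *
     sqrt (comp_density d b \<theta>0 x / mix_density d b g0 x)"

definition score_set ::
  "nat \<Rightarrow> nat \<Rightarrow> param set \<Rightarrow> param measure \<Rightarrow> param \<Rightarrow> (obs \<Rightarrow> real) set" where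
  "score_set d b \<Theta> g0 \<theta>0 = {score d b g0 \<theta>0 g | g. g \<in> mixing_dists d \<Theta> \<and> g \<noteq> g0}"


section \<open>Gaussian processes\<close>

definition gaussian_measure :: "real \<Rightarrow> real \<Rightarrow> real measure" where
  "gaussian_measure m \<sigma> =
     (if \<sigma> = 0 then return borel m else density lborel (\<lambda>x. ennreal (normal_density m \<sigma> x)))"

definition centered_gaussian_process ::
  "'v measure \<Rightarrow> 's set \<Rightarrow> ('s \<Rightarrow> 's \<Rightarrow> real) \<Rightarrow> ('s \<Rightarrow> 'v \<Rightarrow> real) \<Rightarrow> bool" where
  "centered_gaussian_process N S K G \<longleftrightarrow> prob_space N \<and>
     (\<forall>s\<in>S. G s \<in> borel_measurable N) \<and>
     (\<forall>F c. finite F \<and> F \<subseteq> S \<longrightarrow>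
        (\<exists>m \<sigma>. \<sigma> \<ge> 0 \<and> distr N borel (\<lambda>\<omega>. \<Sum>s\<in>F. c s * G s \<omega>) = gaussian_measure m \<sigma>)) \<and>
     (\<forall>s\<in>S. (LINT \<omega>|N. G s \<omega>) = 0) \<and>
     (\<forall>s\<in>S. \<forall>t\<in>S. (LINT \<omega>|N. G s \<omega> * G t \<omega>) = K s t)"

definition bounded_uc_paths ::
  "'v measure \<Rightarrow> 's set \<Rightarrow> ('s \<Rightarrow> 's \<Rightarrow> real) \<Rightarrow> ('s \<Rightarrow> 'v \<Rightarrow> real) \<Rightarrow> bool" where
  "bounded_uc_paths N S \<rho> G \<longleftrightarrow> (\<forall>\<omega>\<in>space N.
     bounded ((\<lambda>s. G s \<omega>) ` S) \<and>
     (\<forall>\<epsilon>>0. \<exists>\<delta>>0. \<forall>s\<in>S. \<forall>t\<in>S. \<rho> s t < \<delta> \<longrightarrow> \<bar>G s \<omega> - G t \<omega>\<bar> < \<epsilon>))"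

definition L2_inner :: "'a measure \<Rightarrow> ('a \<Rightarrow> real) \<Rightarrow> ('a \<Rightarrow> real) \<Rightarrow> real" where
  "L2_inner P s t = (LINT x|P. s x * t x)"

definition L2_dist :: "'a measure \<Rightarrow> ('a \<Rightarrow> real) \<Rightarrow> ('a \<Rightarrow> real) \<Rightarrow> real" where
  "L2_dist P s t = sqrt (LINT x|P. (s x - t x)\<^sup>2)"

definition tight_gaussian_process ::
  "'v measure \<Rightarrow> 'a measure \<Rightarrow> ('a \<Rightarrow> real) set \<Rightarrow> (('a \<Rightarrow> real) \<Rightarrow> 'v \<Rightarrow> real) \<Rightarrow> bool" where
  "tight_gaussian_process N P S G \<longleftrightarrow>
     centered_gaussian_process N S (L2_inner P) G \<and> bounded_uc_paths N S (L2_dist P) G"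

text \<open>
  The supremum is taken in \<open>[0, \<infinity>]\<close>, so that it is \<open>0\<close> for \<open>S = {}\<close> (which happens when \<open>\<Theta>\<close> is a
  singleton); for processes with bounded paths it is finite.
\<close>

definition sup_sq_pos :: "'s set \<Rightarrow> ('s \<Rightarrow> 'v \<Rightarrow> real) \<Rightarrow> 'v \<Rightarrow> real" where
  "sup_sq_pos S G \<omega> = enn2real (SUP s\<in>S. ennreal ((max (G s \<omega>) 0)\<^sup>2))"

end

theory Submission
  imports Defs
begin

text \<open>
  Write \<open>f\<^sub>g\<close> for the mixture density of \<open>g\<close>, \<open>\<chi>\<^sub>g\<close> for its chi-square distance to the truth and
  \<open>s\<^sub>g = (f\<^sub>g / f\<^sub>g\<^sub>0 - 1) / \<chi>\<^sub>g\<close>.  The statistic is the maximum over \<open>g\<close> of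
  \<open>2 \<Sum>\<^sub>i ln (1 + \<chi>\<^sub>g s\<^sub>g (X\<^sub>i))\<close>, and \<open>ln (1 + u) \<approx> u - u\<^sup>2/2\<close> turns this into the supremum over \<open>s\<close> of the
  squared positive part of the empirical process, because mixing distributions form a convex set
  and every small multiple of a score is therefore available.  Both halves of the theorem are about
  how large the set of scores is.

  \<^bold>\<open>Finitely discrete truth.\<close>  Around an atom \<open>\<theta>0\<close> the ratio \<open>p\<^sub>\<theta> / p\<^sub>\<theta>\<^sub>0\<close> is an entire function of
  \<open>\<theta>\<close>, a product of one power series per coordinate, so that a score is a series in the functions
  \<open>psi \<alpha>\<close> (products of Hermite and Charlier polynomials) whose coefficients are the moment differences
  divided by \<open>\<chi>\<^sub>g\<close>.  The decisive estimate, \<open>moment_bound\<close>, is that these normalised coefficients are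
  at most \<open>C \<rho>\<^sup>|\<^sup>\<alpha>\<^sup>|\<close> with constants independent of \<open>g\<close>.  A single coefficient is controlled
  because \<open>psi \<alpha>\<close> estimates the corresponding moment without bias; all of them together are controlled
  because moments of high order reduce, modulo nonnegative polynomials vanishing on the support
  of \<open>g0\<close>, to finitely many.  Since \<open>psi \<alpha>\<close> decays faster than any geometric sequence, the scores
  become a subset of a fixed box in \<open>\<ell>\<^sub>1\<close>, along functions with one common majorant.
  Such a box has finite nets in \<open>\<ell>\<^sub>1\<close>, and one random series bounds the oscillation of the
  empirical process between neighbours.  This squeezes the statistic
  between maxima over finite sets of scores, whose laws converge by characteristic functions
  (\<open>orthant_transfer\<close>, \<open>likelihood_ratio_limit\<close>).  The same series, with Gaussian variables in
  place of the empirical process, constructs the limiting process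
  (\<open>tight_gaussian_process_exists\<close>).

  \<^bold>\<open>Any other truth.\<close>  Some coordinate takes infinitely many values under \<open>g0\<close>.  Tilting \<open>g0\<close> by
  centred polynomials in that coordinate yields bounded scores, and the unbiasedness of \<open>psi \<alpha>\<close>
  shows that they are linearly independent in \<open>L\<^sub>2\<close>.  Gram--Schmidt produces arbitrarily many
  orthonormal scores; the statistic is asymptotically at least the largest squared positive part of
  as many independent standard normal variables (\<open>likelihood_ratio_diverges\<close>).
\<close>

section \<open>Limits of the joint law of finitely many variables\<close>

text \<open>
  The indicator of an interval smoothed by a Gaussian.  It is a superposition of characters, so
  its expectation is determined by a characteristic function.
\<close>

definition soft_indicator :: "real => real => real => real => real" where
  "soft_indicator a b \<sigma> y = (LINT z|density lborel (\<lambda>z. ennreal (indicator {a..b} z)). normal_density y \<sigma> z)"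

lemma soft_indicator_eq_measure:
  assumes "\<sigma> > 0"
  shows "soft_indicator a b \<sigma> y = measure (density lborel (normal_density y \<sigma>)) {a..b}"
proof -
  have "soft_indicator a b \<sigma> y = (LINT z|lborel. indicator {a..b} z * normal_density y \<sigma> z)"
    unfolding soft_indicator_def
    by (subst integral_density) auto
  also have "\<dots> = (LINT z|density lborel (normal_density y \<sigma>). indicator {a..b} z)"
    by (subst integral_density) (auto simp: mult.commute)
  also have "\<dots> = measure (density lborel (normal_density y \<sigma>)) {a..b}"
    by simp
  finally show ?thesis .
qed

lemma normal_tail_bound:
  assumes "\<sigma> > 0" "\<delta> > 0"
  shows "measure (density lborel (normal_density y \<sigma>)) {z. \<bar>z - y\<bar> \<ge> \<delta>} \<le> \<sigma>\<^sup>2 / \<delta>\<^sup>2"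
proof -
  interpret D: prob_space "density lborel (normal_density y \<sigma>)"
    using prob_space_normal_density[OF assms(1)] .
  have eq: "(LINT z|density lborel (normal_density y \<sigma>). (z - y)\<^sup>2) = \<sigma>\<^sup>2"
    using integral_normal_moment_even[OF assms(1), of y 1]
    by (subst integral_density) (auto simp: fact_numeral)
  have int: "integrable (density lborel (normal_density y \<sigma>)) (\<lambda>z. (z - y)\<^sup>2)"
    using integrable_normal_moment[OF assms(1), of y 2]
    by (subst integrable_density) auto
  have "measure (density lborel (normal_density y \<sigma>)) {z \<in> space (density lborel (normal_density y \<sigma>)). (z - y)\<^sup>2 \<ge> \<delta>\<^sup>2}
      \<le> (LINT z|density lborel (normal_density y \<sigma>). (z - y)\<^sup>2) / \<delta>\<^sup>2"
    using assms by (intro integral_Markov_inequality_measure[where A="{}"] int) auto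
  moreover have "{z. \<bar>z - y\<bar> \<ge> \<delta>} = {z. (z - y)\<^sup>2 \<ge> \<delta>\<^sup>2}"
    using assms(2) by (auto simp: abs_le_square_iff[symmetric])
  ultimately show ?thesis using eq by simp
qed

lemma soft_indicator_bounds:
  assumes "\<sigma> > 0"
  shows "0 \<le> soft_indicator a b \<sigma> y" "soft_indicator a b \<sigma> y \<le> 1"
proof -
  interpret D: prob_space "density lborel (normal_density y \<sigma>)"
    using prob_space_normal_density[OF assms(1)] .
  show "0 \<le> soft_indicator a b \<sigma> y" "soft_indicator a b \<sigma> y \<le> 1"
    unfolding soft_indicator_eq_measure[OF assms] by auto
qed

lemma soft_indicator_inside:
  assumes "\<sigma> > 0" "\<delta> > 0" "a + \<delta> \<le> y" "y \<le> b - \<delta>"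
  shows "soft_indicator a b \<sigma> y \<ge> 1 - \<sigma>\<^sup>2 / \<delta>\<^sup>2"
proof -
  interpret D: prob_space "density lborel (normal_density y \<sigma>)"
    using prob_space_normal_density[OF assms(1)] .
  have "1 = D.prob ({a..b} \<union> (- {a..b}))" using D.prob_space by simp
  also have "\<dots> \<le> D.prob {a..b} + D.prob (- {a..b})"
    by (rule measure_Un_le) auto
  also have "D.prob (- {a..b}) \<le> D.prob {z. \<bar>z - y\<bar> \<ge> \<delta>}"
    using assms by (intro D.finite_measure_mono) (auto, measurable)
  also have "\<dots> \<le> \<sigma>\<^sup>2 / \<delta>\<^sup>2" by (rule normal_tail_bound[OF assms(1,2)])
  finally show ?thesis unfolding soft_indicator_eq_measure[OF assms(1)] by simp
qed

lemma soft_indicator_outside: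
  assumes "\<sigma> > 0" "\<delta> > 0" "y \<ge> b + \<delta>"
  shows "soft_indicator a b \<sigma> y \<le> \<sigma>\<^sup>2 / \<delta>\<^sup>2"
proof -
  interpret D: prob_space "density lborel (normal_density y \<sigma>)"
    using prob_space_normal_density[OF assms(1)] .
  have "D.prob {a..b} \<le> D.prob {z. \<bar>z - y\<bar> \<ge> \<delta>}"
    using assms by (intro D.finite_measure_mono) (auto, measurable)
  also have "\<dots> \<le> \<sigma>\<^sup>2 / \<delta>\<^sup>2" by (rule normal_tail_bound[OF assms(1,2)])
  finally show ?thesis unfolding soft_indicator_eq_measure[OF assms(1)] by simp
qed

lemma soft_indicator_measurable[measurable]: "soft_indicator a b \<sigma> \<in> borel_measurable borel"
proof -
  interpret F: finite_measure "density lborel (\<lambda>z. ennreal (indicator {a..b} z)) :: real measure"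
    by standard (auto simp: emeasure_density ennreal_indicator emeasure_lborel_Icc_eq)
  have "(\<lambda>(y, z). normal_density y \<sigma> z) \<in> borel_measurable (borel \<Otimes>\<^sub>M density lborel (\<lambda>z. ennreal (indicator {a..b} z)))"
    unfolding normal_density_def by measurable
  then show ?thesis unfolding soft_indicator_def[abs_def]
    by (intro F.borel_measurable_lebesgue_integral) auto
qed

text \<open>
  The Gaussian density is, up to scaling, its own Fourier transform.
\<close>

lemma normal_density_eq_char:
  assumes "\<sigma> > 0"
  shows "complex_of_real (normal_density y \<sigma> z) =
    (CLINT t|std_normal_distribution. complex_of_real (1 / sqrt (2 * pi * \<sigma>\<^sup>2)) * iexp (t * ((y - z) / \<sigma>)))"
proof -
  have "(CLINT t|std_normal_distribution. iexp (t * ((y - z) / \<sigma>))) = char std_normal_distribution ((y - z) / \<sigma>)"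
    unfolding char_def by (simp add: mult.commute)
  also have "\<dots> = complex_of_real (exp (- ((y - z) / \<sigma>)\<^sup>2 / 2))"
    by (simp add: char_std_normal_distribution)
  finally show ?thesis
    unfolding normal_density_def
    by (subst integral_mult_right_zero) (simp add: power_divide power2_commute)
qed

locale two_systems =
  M: prob_space M + N: prob_space N
  for M :: "'w measure" and N :: "'v measure" +
  fixes J :: "'j set" and Yn :: "nat => 'j => 'w => real" and Y :: "'j => 'v => real"
  assumes finJ: "finite J"
    and Yn_meas[measurable]: "\<And>n j. j \<in> J ==> Yn n j \<in> borel_measurable M"
    and Y_meas[measurable]: "\<And>j. j \<in> J ==> Y j \<in> borel_measurable N"
begin

text \<open>
  Convergence of integrals against all characters of the variables.  The extra weight allows an
  induction that attaches one factor per variable.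
\<close>

definition fourier_conv :: "(nat => 'w => complex) => ('v => complex) => bool" where
  "fourier_conv Hn H \<longleftrightarrow>
    (\<forall>n. Hn n \<in> borel_measurable M) \<and> H \<in> borel_measurable N \<and>
    (\<forall>u. (\<lambda>n. CLINT \<omega>|M. Hn n \<omega> * iexp (\<Sum>j\<in>J. u j * Yn n j \<omega>))
        \<longlonglongrightarrow> (CLINT \<omega>|N. H \<omega> * iexp (\<Sum>j\<in>J. u j * Y j \<omega>)))"

text \<open>
  A character of one of the variables only shifts the frequency vector.
\<close>

lemma fourier_conv_modulate:
  assumes "fourier_conv Hn H" "j \<in> J"
  shows "fourier_conv (\<lambda>n \<omega>. Hn n \<omega> * (c * iexp (t * ((Yn n j \<omega> - z) / \<sigma>))))
      (\<lambda>\<omega>. H \<omega> * (c * iexp (t * ((Y j \<omega> - z) / \<sigma>))))"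
proof -
  have [measurable]: "\<And>n. Hn n \<in> borel_measurable M" "H \<in> borel_measurable N"
    using assms(1) by (auto simp: fourier_conv_def)
  have shift: "(\<Sum>i\<in>J. (u i + (if i = j then t / \<sigma> else 0)) * f i) = (\<Sum>i\<in>J. u i * f i) + t / \<sigma> * f j"
    for u f :: "'j => real"
    using finJ assms(2) by (simp add: distrib_right sum.distrib if_distrib[of "\<lambda>x. x * _"] sum.delta cong: if_cong)
  have prod: "h * (c * iexp (t * ((y - z) / \<sigma>))) * iexp s
      = c * iexp (- (t * z / \<sigma>)) * (h * iexp (s + t / \<sigma> * y))" for h :: complex and y s :: real
  proof -
    have "iexp (t * ((y - z) / \<sigma>)) * iexp s = iexp (- (t * z / \<sigma>)) * iexp (s + t / \<sigma> * y)"
      unfolding exp_add[symmetric]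
      by (rule arg_cong[of _ _ exp]) (simp add: field_simps diff_divide_distrib)
    then show ?thesis by (simp add: mult_ac) 
  qed
  show ?thesis unfolding fourier_conv_def
  proof (intro conjI allI)
    fix u :: "'j => real"
    let ?v = "\<lambda>i. u i + (if i = j then t / \<sigma> else 0)"
    have "(\<lambda>n. CLINT \<omega>|M. Hn n \<omega> * iexp (\<Sum>j\<in>J. ?v j * Yn n j \<omega>))
        \<longlonglongrightarrow> (CLINT \<omega>|N. H \<omega> * iexp (\<Sum>j\<in>J. ?v j * Y j \<omega>))"
      by (rule assms(1)[unfolded fourier_conv_def, THEN conjunct2, THEN conjunct2, THEN spec, of ?v])
    then have "(\<lambda>n. c * iexp (- (t * z / \<sigma>)) * (CLINT \<omega>|M. Hn n \<omega> * iexp (\<Sum>j\<in>J. ?v j * Yn n j \<omega>)))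
        \<longlonglongrightarrow> c * iexp (- (t * z / \<sigma>)) * (CLINT \<omega>|N. H \<omega> * iexp (\<Sum>j\<in>J. ?v j * Y j \<omega>))"
      by (intro tendsto_mult tendsto_const)
    then show "(\<lambda>n. CLINT \<omega>|M. Hn n \<omega> * (c * iexp (t * ((Yn n j \<omega> - z) / \<sigma>))) * iexp (\<Sum>i\<in>J. u i * Yn n i \<omega>))
       \<longlonglongrightarrow> (CLINT \<omega>|N. H \<omega> * (c * iexp (t * ((Y j \<omega> - z) / \<sigma>))) * iexp (\<Sum>i\<in>J. u i * Y i \<omega>))"
      unfolding prod shift integral_mult_right_zero .
  qed (use assms(2) in measurable)
qed

lemma mixed_integral_swap:
  fixes h :: "'z => real => complex"
  assumes "finite_measure Q" "finite_measure \<tau>"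
    and m: "(\<lambda>(\<omega>, t). h \<omega> t) \<in> borel_measurable (Q \<Otimes>\<^sub>M \<tau>)"
    and f[measurable]: "f \<in> borel_measurable Q" and f1: "\<And>\<omega>. cmod (f \<omega>) \<le> 1"
    and b: "\<And>\<omega> t. \<omega> \<in> space Q ==> cmod (h \<omega> t) \<le> B"
  shows "(CLINT \<omega>|Q. (CLINT t|\<tau>. h \<omega> t) * f \<omega>) = (CLINT t|\<tau>. (CLINT \<omega>|Q. h \<omega> t * f \<omega>))"
proof -
  interpret Q: finite_measure Q by fact
  interpret T: finite_measure \<tau> by fact
  interpret P: pair_sigma_finite Q \<tau> ..
  interpret PF: finite_measure "Q \<Otimes>\<^sub>M \<tau>" by (rule finite_measure_pair_measure) fact+
  note m[measurable]
  have "integrable (Q \<Otimes>\<^sub>M \<tau>) (\<lambda>(\<omega>, t). h \<omega> t * f \<omega>)"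
  proof (rule PF.integrable_const_bound)
    show "AE x in Q \<Otimes>\<^sub>M \<tau>. cmod (case x of (\<omega>, t) => h \<omega> t * f \<omega>) \<le> B"
    proof (rule AE_I2, clarsimp simp: space_pair_measure norm_mult)
      fix \<omega> t assume "\<omega> \<in> space Q"
      then show "cmod (h \<omega> t) * cmod (f \<omega>) \<le> B"
        using b[of \<omega> t] f1[of \<omega>] by (meson mult_left_le norm_ge_zero order_trans)
    qed
  qed measurable
  from P.Fubini_integral[of "\<lambda>\<omega> t. h \<omega> t * f \<omega>", OF this] show ?thesis
    by simp
qed

text \<open>
  Dominated convergence in the mixing parameter, after exchanging the order of integration.
\<close>

lemma fourier_conv_mix:
  fixes Hn :: "nat => 'w => real => complex" and H :: "'v => real => complex"
  assumes fin: "finite_measure \<tau>"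
    and m1: "\<And>n. (\<lambda>(\<omega>, t). Hn n \<omega> t) \<in> borel_measurable (M \<Otimes>\<^sub>M \<tau>)"
    and m2: "(\<lambda>(\<omega>, t). H \<omega> t) \<in> borel_measurable (N \<Otimes>\<^sub>M \<tau>)"
    and b1: "\<And>n \<omega> t. \<omega> \<in> space M ==> cmod (Hn n \<omega> t) \<le> B"
    and b2: "\<And>\<omega> t. \<omega> \<in> space N ==> cmod (H \<omega> t) \<le> B"
    and conv: "\<And>t. fourier_conv (\<lambda>n \<omega>. Hn n \<omega> t) (\<lambda>\<omega>. H \<omega> t)"
  shows "fourier_conv (\<lambda>n \<omega>. CLINT t|\<tau>. Hn n \<omega> t) (\<lambda>\<omega>. CLINT t|\<tau>. H \<omega> t)"
proof -
  interpret T: finite_measure \<tau> by fact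
  note m1[measurable] m2[measurable]
  have fM: "finite_measure M" "finite_measure N" by unfold_locales
  show ?thesis unfolding fourier_conv_def
  proof (intro conjI allI)
    fix u :: "'j => real"
    have e1: "(CLINT \<omega>|M. (CLINT t|\<tau>. Hn n \<omega> t) * iexp (\<Sum>j\<in>J. u j * Yn n j \<omega>))
      = (CLINT t|\<tau>. (CLINT \<omega>|M. Hn n \<omega> t * iexp (\<Sum>j\<in>J. u j * Yn n j \<omega>)))" for n
      by (rule mixed_integral_swap[OF fM(1) fin m1, where B=B]) (measurable, auto simp: b1 simp del: of_real_sum of_real_mult)
    have e2: "(CLINT \<omega>|N. (CLINT t|\<tau>. H \<omega> t) * iexp (\<Sum>j\<in>J. u j * Y j \<omega>))
      = (CLINT t|\<tau>. (CLINT \<omega>|N. H \<omega> t * iexp (\<Sum>j\<in>J. u j * Y j \<omega>)))"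
      by (rule mixed_integral_swap[OF fM(2) fin m2, where B=B]) (measurable, auto simp: b2 simp del: of_real_sum of_real_mult)
    show "(\<lambda>n. CLINT \<omega>|M. (CLINT t|\<tau>. Hn n \<omega> t) * iexp (\<Sum>j\<in>J. u j * Yn n j \<omega>))
       \<longlonglongrightarrow> (CLINT \<omega>|N. (CLINT t|\<tau>. H \<omega> t) * iexp (\<Sum>j\<in>J. u j * Y j \<omega>))"
      unfolding e1 e2
    proof (rule integral_dominated_convergence[where w="\<lambda>_. B"])
      show "AE t in \<tau>. (\<lambda>n. CLINT \<omega>|M. Hn n \<omega> t * iexp (\<Sum>j\<in>J. u j * Yn n j \<omega>))
          \<longlonglongrightarrow> (CLINT \<omega>|N. H \<omega> t * iexp (\<Sum>j\<in>J. u j * Y j \<omega>))"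
        using conv unfolding fourier_conv_def by blast
      show "AE t in \<tau>. cmod (CLINT \<omega>|M. Hn n \<omega> t * iexp (\<Sum>j\<in>J. u j * Yn n j \<omega>)) \<le> B" for n
      proof (rule AE_I2)
        fix t
        have [measurable]: "(\<lambda>\<omega>. Hn n \<omega> t) \<in> borel_measurable M"
          using conv[of t] unfolding fourier_conv_def by blast
        obtain \<omega>0 where "\<omega>0 \<in> space M" using M.not_empty by blast
        with b1[OF this, of n t] have B0: "B \<ge> 0" by (meson norm_ge_zero order_trans)
        have "cmod (CLINT \<omega>|M. Hn n \<omega> t * iexp (\<Sum>j\<in>J. u j * Yn n j \<omega>))
          \<le> (LINT \<omega>|M. cmod (Hn n \<omega> t * iexp (\<Sum>j\<in>J. u j * Yn n j \<omega>)))"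
          by (rule integral_norm_bound)
        also have "\<dots> \<le> (LINT \<omega>|M. B)"
        proof (rule integral_mono)
          show "integrable M (\<lambda>\<omega>. cmod (Hn n \<omega> t * iexp (\<Sum>j\<in>J. u j * Yn n j \<omega>)))"
            by (rule M.integrable_const_bound[where B=B])
               (auto simp: norm_mult b1 simp del: of_real_sum of_real_mult)
        qed (auto simp: norm_mult b1 simp del: of_real_sum of_real_mult)
        finally show "cmod (CLINT \<omega>|M. Hn n \<omega> t * iexp (\<Sum>j\<in>J. u j * Yn n j \<omega>)) \<le> B"
          by (simp add: M.prob_space)
      qed
      show "(\<lambda>t. CLINT \<omega>|M. Hn n \<omega> t * iexp (\<Sum>j\<in>J. u j * Yn n j \<omega>)) \<in> borel_measurable \<tau>" for n
        by measurable
      show "(\<lambda>t. CLINT \<omega>|N. H \<omega> t * iexp (\<Sum>j\<in>J. u j * Y j \<omega>)) \<in> borel_measurable \<tau>"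
        by measurable
    qed auto
  qed measurable
qed

lemma fourier_conv_soft:
  assumes conv: "fourier_conv (\<lambda>n \<omega>. complex_of_real (hn n \<omega>)) (\<lambda>\<omega>. complex_of_real (h \<omega>))"
    and j: "j \<in> J" and \<sigma>: "\<sigma> > 0"
    and b1: "\<And>n \<omega>. \<bar>hn n \<omega>\<bar> \<le> 1" and b2: "\<And>\<omega>. \<bar>h \<omega>\<bar> \<le> 1"
  shows "fourier_conv (\<lambda>n \<omega>. complex_of_real (hn n \<omega> * soft_indicator a b \<sigma> (Yn n j \<omega>)))
     (\<lambda>\<omega>. complex_of_real (h \<omega> * soft_indicator a b \<sigma> (Y j \<omega>)))"
proof -
  define c where "c = 1 / sqrt (2 * pi * \<sigma>\<^sup>2)"
  have c0: "c \<ge> 0" by (simp add: c_def)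
  have dens_le: "normal_density y \<sigma> z \<le> c" for y z
    unfolding normal_density_def c_def by (rule mult_left_le) auto
  have mh1: "(\<lambda>\<omega>. complex_of_real (hn n \<omega>)) \<in> borel_measurable M" for n
    using conv unfolding fourier_conv_def by blast
  have mh2: "(\<lambda>\<omega>. complex_of_real (h \<omega>)) \<in> borel_measurable N"
    using conv unfolding fourier_conv_def by blast
  have [measurable]: "hn n \<in> borel_measurable M" "h \<in> borel_measurable N" for n
    using measurable_compose[OF mh1 borel_measurable_Re] measurable_compose[OF mh2 borel_measurable_Re] by simp_all
  have [measurable]: "Yn n j \<in> borel_measurable M" "Y j \<in> borel_measurable N" for n
    using j by auto
  have step1: "fourier_conv (\<lambda>n \<omega>. complex_of_real (hn n \<omega>) * complex_of_real (normal_density (Yn n j \<omega>) \<sigma> z))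
     (\<lambda>\<omega>. complex_of_real (h \<omega>) * complex_of_real (normal_density (Y j \<omega>) \<sigma> z))" for z
  proof -
    have "fourier_conv 
       (\<lambda>n \<omega>. CLINT t|std_normal_distribution. complex_of_real (hn n \<omega>) * (complex_of_real c * iexp (t * ((Yn n j \<omega> - z) / \<sigma>))))
       (\<lambda>\<omega>. CLINT t|std_normal_distribution. complex_of_real (h \<omega>) * (complex_of_real c * iexp (t * ((Y j \<omega> - z) / \<sigma>))))"
    proof (rule fourier_conv_mix[where B=c])
      show "finite_measure std_normal_distribution"
        using prob_space_normal_density[of 1 0] prob_space.finite_measure by auto
      show "cmod (complex_of_real (hn n \<omega>) * (complex_of_real c * iexp (t * ((Yn n j \<omega> - z) / \<sigma>)))) \<le> c" for n \<omega> t
        using c0 b1[of n \<omega>] by (simp add: norm_mult mult_le_cancel_right1 del: of_real_mult of_real_divide of_real_diff) (meson mult_left_le_one_le abs_ge_zero)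
      show "cmod (complex_of_real (h \<omega>) * (complex_of_real c * iexp (t * ((Y j \<omega> - z) / \<sigma>)))) \<le> c" for \<omega> t
        using c0 b2[of \<omega>] by (simp add: norm_mult mult_le_cancel_right1 del: of_real_mult of_real_divide of_real_diff) (meson mult_left_le_one_le abs_ge_zero)
      show "fourier_conv (\<lambda>n \<omega>. complex_of_real (hn n \<omega>) * (complex_of_real c * iexp (t * ((Yn n j \<omega> - z) / \<sigma>))))
        (\<lambda>\<omega>. complex_of_real (h \<omega>) * (complex_of_real c * iexp (t * ((Y j \<omega> - z) / \<sigma>))))" for t
        by (rule fourier_conv_modulate[OF conv j])
    qed measurable
    then show ?thesis
      unfolding normal_density_eq_char[OF \<sigma>] c_def by (subst (asm) (1 2) integral_mult_right_zero)
  qed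
  have "fourier_conv 
      (\<lambda>n \<omega>. CLINT z|density lborel (\<lambda>z. ennreal (indicator {a..b} z)). complex_of_real (hn n \<omega>) * complex_of_real (normal_density (Yn n j \<omega>) \<sigma> z))
      (\<lambda>\<omega>. CLINT z|density lborel (\<lambda>z. ennreal (indicator {a..b} z)). complex_of_real (h \<omega>) * complex_of_real (normal_density (Y j \<omega>) \<sigma> z))"
  proof (rule fourier_conv_mix[where B=c])
    show "finite_measure (density lborel (\<lambda>z. ennreal (indicator {a..b} z)))"
      by standard (auto simp: emeasure_density ennreal_indicator emeasure_lborel_Icc_eq)
    have *: "cmod (complex_of_real x * complex_of_real (normal_density y \<sigma> z)) \<le> c" if "\<bar>x\<bar> \<le> 1" for x y z
      using that dens_le[of y z] by (simp add: norm_mult) (meson mult_left_le_one_le abs_ge_zero normal_density_nonneg order_trans)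
    show "cmod (complex_of_real (hn n \<omega>) * complex_of_real (normal_density (Yn n j \<omega>) \<sigma> z)) \<le> c" for n \<omega> z
      by (rule *[OF b1])
    show "cmod (complex_of_real (h \<omega>) * complex_of_real (normal_density (Y j \<omega>) \<sigma> z)) \<le> c" for \<omega> z
      by (rule *[OF b2])
    show "fourier_conv (\<lambda>n \<omega>. complex_of_real (hn n \<omega>) * complex_of_real (normal_density (Yn n j \<omega>) \<sigma> z))
      (\<lambda>\<omega>. complex_of_real (h \<omega>) * complex_of_real (normal_density (Y j \<omega>) \<sigma> z))" for z by (rule step1)
  qed (unfold normal_density_def, measurable)
  then show ?thesis
    by (simp add: soft_indicator_def)
qed

lemma soft_product_conv:
  assumes char: "\<And>u. (\<lambda>n. CLINT \<omega>|M. iexp (\<Sum>j\<in>J. u j * Yn n j \<omega>)) \<longlonglongrightarrow> (CLINT \<omega>|N. iexp (\<Sum>j\<in>J. u j * Y j \<omega>))"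
    and \<sigma>: "\<sigma> > 0"
  shows "(\<lambda>n. LINT \<omega>|M. (\<Prod>j\<in>J. soft_indicator a b \<sigma> (Yn n j \<omega>))) \<longlonglongrightarrow> (LINT \<omega>|N. (\<Prod>j\<in>J. soft_indicator a b \<sigma> (Y j \<omega>)))"
proof -
  have p1: "\<bar>\<Prod>j\<in>I. soft_indicator a b \<sigma> (f j)\<bar> \<le> 1" for I :: "'j set" and f
    unfolding abs_prod by (intro prod_le_1) (auto simp: soft_indicator_bounds[OF \<sigma>])
  have "finite I ==> I \<subseteq> J ==> fourier_conv (\<lambda>n \<omega>. complex_of_real (\<Prod>j\<in>I. soft_indicator a b \<sigma> (Yn n j \<omega>)))
     (\<lambda>\<omega>. complex_of_real (\<Prod>j\<in>I. soft_indicator a b \<sigma> (Y j \<omega>)))" for I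
  proof (induction I rule: finite_induct)
    case empty
    show ?case unfolding fourier_conv_def using char by auto
  next
    case (insert j I)
    then have "j \<in> J" "I \<subseteq> J" by auto
    from fourier_conv_soft[OF insert(3)[OF this(2)] this(1) \<sigma> p1 p1, of a b] insert(1,2)
    show ?case by (simp add: mult.commute)
  qed
  from this[OF finJ order_refl]
  have "(\<lambda>n. CLINT \<omega>|M. complex_of_real (\<Prod>j\<in>J. soft_indicator a b \<sigma> (Yn n j \<omega>)) * iexp (\<Sum>j\<in>J. 0 * Yn n j \<omega>))
     \<longlonglongrightarrow> (CLINT \<omega>|N. complex_of_real (\<Prod>j\<in>J. soft_indicator a b \<sigma> (Y j \<omega>)) * iexp (\<Sum>j\<in>J. 0 * Y j \<omega>))"
    unfolding fourier_conv_def by (elim conjE allE[of _ "\<lambda>_. 0"])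
  then have "(\<lambda>n. complex_of_real (LINT \<omega>|M. (\<Prod>j\<in>J. soft_indicator a b \<sigma> (Yn n j \<omega>))))
     \<longlonglongrightarrow> complex_of_real (LINT \<omega>|N. (\<Prod>j\<in>J. soft_indicator a b \<sigma> (Y j \<omega>)))"
    by (simp del: of_real_prod)
  then show ?thesis by (simp only: tendsto_of_real_iff)
qed

end

lemma (in prob_space) orthant_le_soft_product:
  fixes U :: "'j => 'a => real"
  assumes fin: "finite J" and U[measurable]: "\<And>j. j \<in> J ==> U j \<in> borel_measurable M"
    and mom: "\<And>j. j \<in> J ==> integrable M (\<lambda>\<omega>. (U j \<omega>)\<^sup>2)" "\<And>j. j \<in> J ==> expectation (\<lambda>\<omega>. (U j \<omega>)\<^sup>2) \<le> V"
    and pos: "\<sigma> > 0" "\<delta> > 0" "T > 0" "\<sigma>\<^sup>2 / \<delta>\<^sup>2 \<le> 1"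
  shows "prob {\<omega> \<in> space M. \<forall>j\<in>J. U j \<omega> \<le> a} \<le>
     expectation (\<lambda>\<omega>. \<Prod>j\<in>J. soft_indicator (- T - \<delta>) (a + \<delta>) \<sigma> (U j \<omega>)) + card J * (\<sigma>\<^sup>2 / \<delta>\<^sup>2) + card J * (V / T\<^sup>2)"
proof -
  define \<kappa> where "\<kappa> = \<sigma>\<^sup>2 / \<delta>\<^sup>2"
  define g where "g = (\<lambda>\<omega>. \<Prod>j\<in>J. soft_indicator (- T - \<delta>) (a + \<delta>) \<sigma> (U j \<omega>))"
  have g01: "0 \<le> g \<omega>" "g \<omega> \<le> 1" for \<omega>
    unfolding g_def by (auto intro!: prod_nonneg prod_le_1 simp: soft_indicator_bounds[OF pos(1)])
  have gm[measurable]: "g \<in> borel_measurable M"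
    unfolding g_def by measurable
  have gi: "integrable M g" by (rule integrable_const_bound[where B=1]) (use g01 in auto)
  have \<kappa>: "0 \<le> \<kappa>" "\<kappa> \<le> 1" using pos by (auto simp: \<kappa>_def)
  let ?E = "{\<omega> \<in> space M. (\<forall>j\<in>J. - T \<le> U j \<omega>) \<and> (\<forall>j\<in>J. U j \<omega> \<le> a)}"
  let ?B = "\<lambda>j. {\<omega> \<in> space M. (U j \<omega>)\<^sup>2 \<ge> T\<^sup>2}"
  have Em[measurable]: "?E \<in> events" using fin by measurable
  have Ei: "integrable M (indicator ?E :: _ => real)"
    using Em by (intro integrable_real_indicator) (auto simp: emeasure_finite less_top[symmetric])
  have Bm: "?B j \<in> events" if "j \<in> J" for j
    using U[OF that] by measurable
  have low: "indicator ?E \<omega> * (1 - card J * \<kappa>) \<le> g \<omega>" for \<omega>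
  proof (cases "\<omega> \<in> ?E")
    case True
    have "1 + real (card J) * (- \<kappa>) \<le> (1 + (- \<kappa>)) ^ card J"
      by (rule Bernoulli_inequality) (use \<kappa> in auto)
    also have "\<dots> = (\<Prod>j\<in>J. 1 - \<kappa>)" by simp
    also have "\<dots> \<le> g \<omega>"
      unfolding g_def
    proof (rule prod_mono, intro conjI)
      fix j assume "j \<in> J"
      then show "1 - \<kappa> \<le> soft_indicator (- T - \<delta>) (a + \<delta>) \<sigma> (U j \<omega>)"
        unfolding \<kappa>_def using True pos by (intro soft_indicator_inside) auto
    qed (use \<kappa> in auto)
    finally show ?thesis using True by simp
  next
    case False
    then show ?thesis using g01 by simp
  qed
  have "prob ?E * (1 - card J * \<kappa>) = expectation (\<lambda>\<omega>. indicator ?E \<omega> * (1 - card J * \<kappa>))"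
    using Em sets.sets_into_space[OF Em] by (simp add: Int_absorb2)
  also have "\<dots> \<le> expectation g"
    by (rule integral_mono[OF _ gi]) (use low Ei in auto)
  finally have 1: "prob ?E * (1 - card J * \<kappa>) \<le> expectation g" .
  have "prob ?E * (card J * \<kappa>) \<le> card J * \<kappa>"
    using \<kappa> by (intro mult_left_le_one_le) auto
  with 1 have 2: "prob ?E \<le> expectation g + card J * \<kappa>" by (simp add: algebra_simps)
  have "prob {\<omega> \<in> space M. \<forall>j\<in>J. U j \<omega> \<le> a} \<le> prob (?E \<union> (\<Union>j\<in>J. ?B j))"
  proof (rule finite_measure_mono)
    show "?E \<union> (\<Union>j\<in>J. ?B j) \<in> events" using fin Em Bm by (intro sets.Un sets.finite_UN) auto
    show "{\<omega> \<in> space M. \<forall>j\<in>J. U j \<omega> \<le> a} \<subseteq> ?E \<union> (\<Union>j\<in>J. ?B j)"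
    proof
      fix \<omega> assume w: "\<omega> \<in> {\<omega> \<in> space M. \<forall>j\<in>J. U j \<omega> \<le> a}"
      show "\<omega> \<in> ?E \<union> (\<Union>j\<in>J. ?B j)"
      proof (cases "\<forall>j\<in>J. - T \<le> U j \<omega>")
        case False
        then obtain j where j: "j \<in> J" "U j \<omega> < - T" by force
        then have "T\<^sup>2 \<le> (U j \<omega>)\<^sup>2" using pos by (intro abs_le_square_iff[THEN iffD1]) auto
        with j w show ?thesis by auto
      qed (use w in auto)
    qed
  qed
  also have "\<dots> \<le> prob ?E + prob (\<Union>j\<in>J. ?B j)"
    using fin Em Bm by (intro measure_Un_le sets.finite_UN) auto
  also have "prob (\<Union>j\<in>J. ?B j) \<le> (\<Sum>j\<in>J. prob (?B j))"
    using fin by (intro finite_measure_subadditive_finite) auto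
  also have "\<dots> \<le> (\<Sum>j\<in>J. V / T\<^sup>2)"
  proof (rule sum_mono)
    fix j assume j: "j \<in> J"
    have "prob (?B j) \<le> expectation (\<lambda>\<omega>. (U j \<omega>)\<^sup>2) / T\<^sup>2"
      using pos by (intro integral_Markov_inequality_measure[where A="{}"] mom j) auto
    also have "\<dots> \<le> V / T\<^sup>2" using mom(2)[OF j] by (intro divide_right_mono) auto
    finally show "prob (?B j) \<le> V / T\<^sup>2" .
  qed
  finally show ?thesis using 2 by (simp add: g_def \<kappa>_def)
qed

lemma (in prob_space) soft_product_le_orthant:
  fixes U :: "'j => 'a => real"
  assumes fin: "finite J" and U[measurable]: "\<And>j. j \<in> J ==> U j \<in> borel_measurable M"
    and pos: "\<sigma> > 0" "\<delta> > 0"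
  shows "expectation (\<lambda>\<omega>. \<Prod>j\<in>J. soft_indicator c (a + \<delta>) \<sigma> (U j \<omega>)) \<le>
     prob {\<omega> \<in> space M. \<forall>j\<in>J. U j \<omega> \<le> a + 2 * \<delta>} + \<sigma>\<^sup>2 / \<delta>\<^sup>2"
proof -
  define g where "g = (\<lambda>\<omega>. \<Prod>j\<in>J. soft_indicator c (a + \<delta>) \<sigma> (U j \<omega>))"
  let ?E = "{\<omega> \<in> space M. \<forall>j\<in>J. U j \<omega> \<le> a + 2 * \<delta>}"
  have Em[measurable]: "?E \<in> events" using fin by measurable
  have g01: "0 \<le> g \<omega>" "g \<omega> \<le> 1" for \<omega>
    unfolding g_def by (auto intro!: prod_nonneg prod_le_1 simp: soft_indicator_bounds[OF pos(1)])
  have gm[measurable]: "g \<in> borel_measurable M"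
    unfolding g_def by measurable
  have gi: "integrable M g" by (rule integrable_const_bound[where B=1]) (use g01 in auto)
  have Ei: "integrable M (indicator ?E :: _ => real)"
    using Em by (intro integrable_real_indicator) (auto simp: emeasure_finite less_top[symmetric])
  have "expectation g \<le> expectation (\<lambda>\<omega>. indicator ?E \<omega> + \<sigma>\<^sup>2 / \<delta>\<^sup>2)"
  proof (rule integral_mono[OF gi])
    fix \<omega> assume w: "\<omega> \<in> space M"
    show "g \<omega> \<le> indicator ?E \<omega> + \<sigma>\<^sup>2 / \<delta>\<^sup>2"
    proof (cases "\<omega> \<in> ?E")
      case True then show ?thesis using g01(2)[of \<omega>] by (simp add: add_increasing2)
    next
      case False
      then obtain j where j: "j \<in> J" "U j \<omega> > a + 2 * \<delta>" using w by force
      have "g \<omega> = soft_indicator c (a + \<delta>) \<sigma> (U j \<omega>) * (\<Prod>i\<in>J - {j}. soft_indicator c (a + \<delta>) \<sigma> (U i \<omega>))"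
        unfolding g_def using fin j by (simp add: prod.remove)
      also have "\<dots> \<le> soft_indicator c (a + \<delta>) \<sigma> (U j \<omega>) * 1"
        by (intro mult_left_mono prod_le_1) (auto simp: soft_indicator_bounds[OF pos(1)])
      also have "\<dots> \<le> \<sigma>\<^sup>2 / \<delta>\<^sup>2"
        using soft_indicator_outside[OF pos, of "a + \<delta>" "U j \<omega>" c] j by simp
      finally show ?thesis using False by simp
    qed
  qed (use Ei in auto)
  also have "\<dots> = prob ?E + \<sigma>\<^sup>2 / \<delta>\<^sup>2"
    using Ei Em sets.sets_into_space[OF Em] by (simp add: prob_space Int_absorb2)
  finally show ?thesis unfolding g_def .
qed

context two_systems
begin

text \<open>
  A direct substitute for the multivariate continuity theorem.  The indicator of an orthant is
  squeezed between products of smoothed indicators of the intervals from \<open>- T\<close> to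
  \<open>a\<close>; their expectations converge by the characteristic functions, and the bound on
  the second moments controls what lies below \<open>- T\<close>.
\<close>

lemma orthant_transfer:
  assumes char: "\<And>u. (\<lambda>n. CLINT \<omega>|M. iexp (\<Sum>j\<in>J. u j * Yn n j \<omega>)) \<longlonglongrightarrow> (CLINT \<omega>|N. iexp (\<Sum>j\<in>J. u j * Y j \<omega>))"
    and momn: "\<And>n j. j \<in> J ==> integrable M (\<lambda>\<omega>. (Yn n j \<omega>)\<^sup>2)" "\<And>n j. j \<in> J ==> M.expectation (\<lambda>\<omega>. (Yn n j \<omega>)\<^sup>2) \<le> V"
    and mom: "\<And>j. j \<in> J ==> integrable N (\<lambda>\<omega>. (Y j \<omega>)\<^sup>2)" "\<And>j. j \<in> J ==> N.expectation (\<lambda>\<omega>. (Y j \<omega>)\<^sup>2) \<le> V"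
    and \<delta>: "\<delta> > 0" and \<kappa>: "\<kappa> > 0"
  shows "\<forall>\<^sub>F n in sequentially. M.prob {\<omega> \<in> space M. \<forall>j\<in>J. Yn n j \<omega> \<le> a} \<le> N.prob {\<omega> \<in> space N. \<forall>j\<in>J. Y j \<omega> \<le> a + \<delta>} + \<kappa>"
    and "\<forall>\<^sub>F n in sequentially. N.prob {\<omega> \<in> space N. \<forall>j\<in>J. Y j \<omega> \<le> a} \<le> M.prob {\<omega> \<in> space M. \<forall>j\<in>J. Yn n j \<omega> \<le> a + \<delta>} + \<kappa>"
proof -
  define k where "k = min 1 (\<kappa> / (4 * (card J + 1)))"
  have k: "0 < k" "k \<le> 1" "k * (card J + 1) \<le> \<kappa> / 4"
  proof -
    have "k \<le> \<kappa> / (4 * (card J + 1))" unfolding k_def by (rule min.cobounded2)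
    then show "k * (card J + 1) \<le> \<kappa> / 4" by (simp add: field_simps)
  qed (use \<kappa> in \<open>auto simp: k_def\<close>)
  define d where "d = \<delta> / 2"
  have d: "d > 0" using \<delta> by (simp add: d_def)
  (* the kernel is narrow compared with the margin d: its mass beyond d is at most k *)
  define s where "s = sqrt k * d"
  have s: "s > 0" "s\<^sup>2 / d\<^sup>2 = k" using k d by (auto simp: s_def power_mult_distrib)
  (* beyond T the second moments leave a probability of at most k *)
  define T where "T = sqrt (max V 1 / k)"
  have T: "T > 0" "V / T\<^sup>2 \<le> k"
  proof -
    show "T > 0" unfolding T_def using k by simp
    have "T\<^sup>2 = max V 1 / k" unfolding T_def using k by simp
    then have "V / T\<^sup>2 = (V / max V 1) * k" by simp
    also have "\<dots> \<le> 1 * k" using k by (intro mult_right_mono) (auto simp: divide_le_eq)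
    finally show "V / T\<^sup>2 \<le> k" by simp
  qed
  have ck: "card J * k + card J * (V / T\<^sup>2) + k \<le> \<kappa> / 2"
  proof -
    have "card J * (V / T\<^sup>2) \<le> card J * k" using T by (intro mult_left_mono) auto
    moreover have "k * card J + k \<le> \<kappa> / 4" using k(3) by (simp add: algebra_simps)
    moreover have "k * card J = card J * k" by simp
    ultimately show ?thesis using k by linarith
  qed
  note lim = soft_product_conv[OF char s(1), of "- T - d" "a + d"]
  let ?en = "\<lambda>n. LINT \<omega>|M. (\<Prod>j\<in>J. soft_indicator (- T - d) (a + d) s (Yn n j \<omega>))"
  let ?e = "LINT \<omega>|N. (\<Prod>j\<in>J. soft_indicator (- T - d) (a + d) s (Y j \<omega>))"
  have ev: "\<forall>\<^sub>F n in sequentially. dist (?en n) ?e < \<kappa> / 2"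
    using tendstoD[OF lim, of "\<kappa> / 2"] \<kappa> by simp
  have d2: "a + \<delta> = a + 2 * d" by (simp add: d_def)
  show "\<forall>\<^sub>F n in sequentially. M.prob {\<omega> \<in> space M. \<forall>j\<in>J. Yn n j \<omega> \<le> a} \<le> N.prob {\<omega> \<in> space N. \<forall>j\<in>J. Y j \<omega> \<le> a + \<delta>} + \<kappa>"
    using ev
  proof eventually_elim
    case (elim n)
    have "M.prob {\<omega> \<in> space M. \<forall>j\<in>J. Yn n j \<omega> \<le> a} \<le> ?en n + card J * k + card J * (V / T\<^sup>2)"
      using M.orthant_le_soft_product[OF finJ Yn_meas momn s(1) d T(1)] s k by simp
    moreover have "?e \<le> N.prob {\<omega> \<in> space N. \<forall>j\<in>J. Y j \<omega> \<le> a + \<delta>} + k"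
      using N.soft_product_le_orthant[OF finJ Y_meas s(1) d] s d2 by simp
    ultimately show ?case using elim ck unfolding dist_real_def by linarith
  qed
  show "\<forall>\<^sub>F n in sequentially. N.prob {\<omega> \<in> space N. \<forall>j\<in>J. Y j \<omega> \<le> a} \<le> M.prob {\<omega> \<in> space M. \<forall>j\<in>J. Yn n j \<omega> \<le> a + \<delta>} + \<kappa>"
    using ev
  proof eventually_elim
    case (elim n)
    have "N.prob {\<omega> \<in> space N. \<forall>j\<in>J. Y j \<omega> \<le> a} \<le> ?e + card J * k + card J * (V / T\<^sup>2)"
      using N.orthant_le_soft_product[OF finJ Y_meas mom s(1) d T(1)] s k by simp
    moreover have "?en n \<le> M.prob {\<omega> \<in> space M. \<forall>j\<in>J. Yn n j \<omega> \<le> a + \<delta>} + k"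
      using M.soft_product_le_orthant[OF finJ Yn_meas s(1) d] s d2 by simp
    ultimately show ?case using elim ck unfolding dist_real_def by linarith
  qed
qed

end

section \<open>The empirical process of an i.i.d. sample\<close>

lemma (in prob_space) indep_vars_Suc_shift:
  assumes "indep_vars (\<lambda>_. N) X {1..}"
  shows "indep_vars (\<lambda>_. N) (\<lambda>i. X (Suc i)) UNIV"
  unfolding indep_vars_def2 indep_sets_def
proof (intro conjI ballI allI impI)
  from assms show "random_variable N (X (Suc i))" for i
    by (auto simp: indep_vars_def2)
  then show "{X (Suc i) -` A \<inter> space M |A. A \<in> sets N} \<subseteq> events" for i
    by auto
  fix J :: "nat set" and A
  assume J: "J \<noteq> {}" "finite J" and A: "A \<in> Pi J (\<lambda>i. {X (Suc i) -` A \<inter> space M |A. A \<in> sets N})"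
  have "prob (\<Inter>j\<in>Suc ` J. A (j - 1)) = (\<Prod>j\<in>Suc ` J. prob (A (j - 1)))"
  proof (rule indep_setsD)
    show "indep_sets (\<lambda>i. {X i -` A \<inter> space M |A. A \<in> sets N}) {1..}"
      using assms by (simp add: indep_vars_def2)
  qed (use J A in auto)
  then show "prob (\<Inter>j\<in>J. A j) = (\<Prod>j\<in>J. prob (A j))"
    by (simp add: prod.reindex)
qed

text \<open>
  Statements that hold up to a set of probability \<open>\<eta>\<close>, for all large \<open>n\<close>.  The exceptional
  sets are only required to be covered by events, because the statements involve suprema over
  uncountable families.
\<close>

definition (in prob_space) mostly :: "real => (nat => 'a => bool) => bool" where
  "mostly \<eta> Q \<longleftrightarrow> (\<forall>\<^sub>F n in sequentially. \<exists>B\<in>events. prob B \<le> \<eta> \<and> (\<forall>\<omega>\<in>space M - B. Q n \<omega>))"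

lemma (in prob_space) mostly_mono:
  assumes "mostly \<eta> Q" "\<forall>\<^sub>F n in sequentially. \<forall>\<omega>\<in>space M. Q n \<omega> \<longrightarrow> R n \<omega>"
  shows "mostly \<eta> R"
  using assms unfolding mostly_def by eventually_elim blast

lemma (in prob_space) mostly_conj:
  assumes "mostly \<eta> Q" "mostly \<zeta> R"
  shows "mostly (\<eta> + \<zeta>) (\<lambda>n \<omega>. Q n \<omega> \<and> R n \<omega>)"
  using assms unfolding mostly_def
proof eventually_elim
  case (elim n)
  then obtain B C where BC: "B \<in> events" "prob B \<le> \<eta>" "\<forall>\<omega>\<in>space M - B. Q n \<omega>"
    "C \<in> events" "prob C \<le> \<zeta>" "\<forall>\<omega>\<in>space M - C. R n \<omega>" by blast
  then have "prob (B \<union> C) \<le> \<eta> + \<zeta>"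
    using measure_Un_le[of B M C] by linarith
  with BC show ?case by (intro bexI[of _ "B \<union> C"]) auto
qed

lemma (in prob_space) mostly_finite_ball:
  assumes "finite F" "\<And>s. s \<in> F ==> mostly \<eta> (Q s)"
  shows "mostly (real (card F) * \<eta>) (\<lambda>n \<omega>. \<forall>s\<in>F. Q s n \<omega>)"
  using assms
proof (induction F)
  case empty
  then show ?case unfolding mostly_def by (auto intro!: always_eventually bexI[of _ "{}"])
next
  case (insert s F)
  have "mostly (\<eta> + real (card F) * \<eta>) (\<lambda>n \<omega>. Q s n \<omega> \<and> (\<forall>s\<in>F. Q s n \<omega>))"
    using insert by (intro mostly_conj) auto
  then show ?case using insert(1,2) by (simp add: algebra_simps)
qed

lemma (in prob_space) mostly_Markov:
  assumes [measurable]: "\<And>n. Y n \<in> borel_measurable M"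
    and "\<And>n \<omega>. \<omega> \<in> space M ==> 0 \<le> Y n \<omega>"
    and "\<And>n. integrable M (Y n)" "\<forall>\<^sub>F n in sequentially. expectation (Y n) \<le> c"
    and t: "t > 0"
  shows "mostly (c / t) (\<lambda>n \<omega>. Y n \<omega> < t)"
  unfolding mostly_def using assms(4)
proof eventually_elim
  case (elim n)
  have "prob {\<omega>\<in>space M. Y n \<omega> \<ge> t} \<le> expectation (Y n) / t"
    using assms by (intro integral_Markov_inequality_measure[where A="{}"]) (auto intro!: AE_I2)
  also have "\<dots> \<le> c / t" using elim t by (intro divide_right_mono) auto
  finally show ?case
    by (intro bexI[of _ "{\<omega>\<in>space M. Y n \<omega> \<ge> t}"]) (auto simp: not_le)
qed

lemma abs_less_of_square:
  fixes x K :: real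
  assumes "x\<^sup>2 < K\<^sup>2" "K > 0"
  shows "\<bar>x\<bar> < K"
  using power2_less_imp_less[of "\<bar>x\<bar>" K] assms by simp

locale iid_sample = prob_space M for M :: "'w measure" +
  fixes P :: "'x measure" and X :: "nat => 'w => 'x"
  assumes indep: "indep_vars (\<lambda>_. P) X {1..}"
    and distr_X: "\<And>i. i \<ge> 1 ==> distr M P (X i) = P"
begin

lemma X_measurable: "i \<ge> 1 ==> X i \<in> measurable M P"
  using indep by (auto simp: indep_vars_def2)

lemma X_space: "i \<ge> 1 ==> \<omega> \<in> space M ==> X i \<omega> \<in> space P"
  using X_measurable by (auto simp: measurable_def)

sublocale P: prob_space P
  using prob_space_distr[OF X_measurable[of 1]] distr_X[of 1] by simp

lemma X_compose: "i \<ge> 1 ==> f \<in> borel_measurable P ==> (\<lambda>\<omega>. f (X i \<omega>)) \<in> borel_measurable M"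
  by (rule measurable_compose[OF X_measurable])

lemma X_integrable:
  fixes f :: "'x => real"
  assumes "i \<ge> 1" "integrable P f"
  shows "integrable M (\<lambda>\<omega>. f (X i \<omega>))"
  using integrable_distr_eq[OF X_measurable[OF assms(1)], of f] assms distr_X[OF assms(1)]
  by (auto simp: borel_measurable_integrable)

lemma X_expectation:
  fixes f :: "'x => real"
  assumes "i \<ge> 1" "f \<in> borel_measurable P"
  shows "expectation (\<lambda>\<omega>. f (X i \<omega>)) = (LINT x|P. f x)"
  using integral_distr[OF X_measurable[OF assms(1)], of f] assms distr_X[OF assms(1)] by simp

definition avg :: "nat => ('x => real) => 'w => real" where
  "avg n f \<omega> = (\<Sum>i=1..n. f (X i \<omega>)) / n"

definition emp :: "nat => ('x => real) => 'w => real" where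
  "emp n f \<omega> = (\<Sum>i=1..n. f (X i \<omega>) - (LINT x|P. f x)) / sqrt n"

lemma avg_measurable[measurable]: "f \<in> borel_measurable P ==> avg n f \<in> borel_measurable M"
  unfolding avg_def[abs_def] by (intro borel_measurable_divide borel_measurable_sum X_compose borel_measurable_const) auto

lemma emp_measurable[measurable]: "f \<in> borel_measurable P ==> emp n f \<in> borel_measurable M"
  unfolding emp_def[abs_def] by (intro borel_measurable_divide borel_measurable_sum borel_measurable_diff X_compose borel_measurable_const) auto

lemma avg_integrable: "integrable P f ==> integrable M (avg n f)"
  unfolding avg_def[abs_def] by (intro integrable_divide_zero Bochner_Integration.integrable_sum impI X_integrable) auto

lemma avg_expectation:
  assumes "integrable P f" "n \<ge> 1"
  shows "expectation (avg n f) = (LINT x|P. f x)"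
  unfolding avg_def[abs_def] using assms
  by (simp add: X_integrable X_expectation borel_measurable_integrable)

lemma square_integrable_centered:
  fixes f :: "'x => real"
  assumes [measurable]: "f \<in> borel_measurable P" and f2: "integrable P (\<lambda>x. (f x)\<^sup>2)"
  shows "integrable P f" "integrable P (\<lambda>x. (f x - (LINT x|P. f x))\<^sup>2)"
    "(LINT x|P. (f x - (LINT x|P. f x))\<^sup>2) \<le> (LINT x|P. (f x)\<^sup>2)"
proof -
  show fi: "integrable P f" by (rule P.square_integrable_imp_integrable) (use f2 in auto)
  show "integrable P (\<lambda>x. (f x - (LINT x|P. f x))\<^sup>2)"
    unfolding power2_diff using fi f2 by auto
  show "(LINT x|P. (f x - (LINT x|P. f x))\<^sup>2) \<le> (LINT x|P. (f x)\<^sup>2)"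
    using P.variance_eq[OF fi f2] by simp
qed

lemma sum_square_expectation:
  fixes g :: "'x => real"
  assumes [measurable]: "g \<in> borel_measurable P" and g2: "integrable P (\<lambda>x. (g x)\<^sup>2)"
    and g0: "(LINT x|P. g x) = 0"
  shows "integrable M (\<lambda>\<omega>. (\<Sum>i=1..n. g (X i \<omega>))\<^sup>2)
    \<and> expectation (\<lambda>\<omega>. (\<Sum>i=1..n. g (X i \<omega>))\<^sup>2) = n * (LINT x|P. (g x)\<^sup>2)"
proof (induction n)
  case (Suc n)
  have gi: "integrable P g" by (rule P.square_integrable_imp_integrable) (use g2 in auto)
  let ?S = "\<lambda>\<omega>. \<Sum>i=1..n. g (X i \<omega>)" and ?Y = "\<lambda>\<omega>. g (X (Suc n) \<omega>)"
  have ind0: "indep_vars (\<lambda>_. borel) (\<lambda>i \<omega>. g (X i \<omega>)) {1..}"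
    by (rule indep_vars_compose2[OF indep]) simp
  have ind: "indep_var borel ?Y borel ?S"
    by (rule indep_vars_sum) (auto intro: indep_vars_subset[OF ind0])
  have Yi: "integrable M ?Y" and Si: "integrable M ?S"
    by (auto intro!: X_integrable gi)
  have Y2: "integrable M (\<lambda>\<omega>. (?Y \<omega>)\<^sup>2)" using X_integrable[OF _ g2, of "Suc n"] by simp
  have YS: "integrable M (\<lambda>\<omega>. ?Y \<omega> * ?S \<omega>)"
    by (rule indep_var_integrable[OF ind Yi Si])
  have YS0: "expectation (\<lambda>\<omega>. ?Y \<omega> * ?S \<omega>) = 0"
    using indep_var_lebesgue_integral[OF ind Yi Si] X_expectation[of "Suc n" g] g0 by simp
  have eq: "(\<Sum>i=1..Suc n. g (X i \<omega>))\<^sup>2 = (?S \<omega>)\<^sup>2 + 2 * (?Y \<omega> * ?S \<omega>) + (?Y \<omega>)\<^sup>2" for \<omega>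
    by (simp add: power2_eq_square algebra_simps)
  have "expectation (\<lambda>\<omega>. (?Y \<omega>)\<^sup>2) = (LINT x|P. (g x)\<^sup>2)"
    using X_expectation[of "Suc n" "\<lambda>x. (g x)\<^sup>2"] by simp
  then show ?case unfolding eq using Suc YS YS0 Y2
    by (simp add: algebra_simps)
qed simp

lemma emp_square:
  fixes f :: "'x => real"
  assumes f[measurable]: "f \<in> borel_measurable P" and f2: "integrable P (\<lambda>x. (f x)\<^sup>2)"
  shows "integrable M (\<lambda>\<omega>. (emp n f \<omega>)\<^sup>2)"
    and "expectation (\<lambda>\<omega>. (emp n f \<omega>)\<^sup>2) \<le> (LINT x|P. (f x)\<^sup>2)"
proof -
  let ?g = "\<lambda>x. f x - (LINT x|P. f x)"
  note c = square_integrable_centered[OF f f2]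
  have g0: "(LINT x|P. ?g x) = 0" using c by (simp add: P.prob_space)
  note s = sum_square_expectation[OF _ c(2) g0, of n]
  have eq: "(emp n f \<omega>)\<^sup>2 = (\<Sum>i=1..n. ?g (X i \<omega>))\<^sup>2 / n" for \<omega>
    unfolding emp_def by (simp add: power_divide)
  show "integrable M (\<lambda>\<omega>. (emp n f \<omega>)\<^sup>2)" unfolding eq using s by simp
  have "expectation (\<lambda>\<omega>. (emp n f \<omega>)\<^sup>2) = n * (LINT x|P. (?g x)\<^sup>2) / n"
    unfolding eq using s by simp
  also have "\<dots> \<le> (LINT x|P. (?g x)\<^sup>2)" by (cases "n = 0") auto
  finally show "expectation (\<lambda>\<omega>. (emp n f \<omega>)\<^sup>2) \<le> (LINT x|P. (f x)\<^sup>2)" using c(3) by simp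
qed

lemma emp_abs:
  fixes f :: "'x => real"
  assumes f[measurable]: "f \<in> borel_measurable P" and f2: "integrable P (\<lambda>x. (f x)\<^sup>2)"
  shows "integrable M (\<lambda>\<omega>. \<bar>emp n f \<omega>\<bar>)"
    and "expectation (\<lambda>\<omega>. \<bar>emp n f \<omega>\<bar>) \<le> sqrt (LINT x|P. (f x)\<^sup>2)"
proof -
  note s = emp_square[OF f f2, of n]
  show i: "integrable M (\<lambda>\<omega>. \<bar>emp n f \<omega>\<bar>)"
    by (rule square_integrable_imp_integrable) (use s in auto)
  have "(expectation (\<lambda>\<omega>. \<bar>emp n f \<omega>\<bar>))\<^sup>2 \<le> expectation (\<lambda>\<omega>. (emp n f \<omega>)\<^sup>2)"
    using variance_eq[OF i] variance_positive[of "\<lambda>\<omega>. \<bar>emp n f \<omega>\<bar>"] s by simp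
  also have "\<dots> \<le> (LINT x|P. (f x)\<^sup>2)" by (rule s)
  finally show "expectation (\<lambda>\<omega>. \<bar>emp n f \<omega>\<bar>) \<le> sqrt (LINT x|P. (f x)\<^sup>2)"
    by (rule real_le_rsqrt)
qed

lemma mostly_emp_le:
  fixes f :: "'x => real"
  assumes f[measurable]: "f \<in> borel_measurable P" and f2: "integrable P (\<lambda>x. (f x)\<^sup>2)" and \<eta>: "\<eta> > 0"
  shows "\<exists>K>0. mostly \<eta> (\<lambda>n \<omega>. \<bar>emp n f \<omega>\<bar> < K)"
proof -
  let ?V = "LINT x|P. (f x)\<^sup>2"
  have V0: "?V \<ge> 0" by simp
  define K where "K = sqrt ((?V + 1) / \<eta>)"
  have K: "K > 0" "K\<^sup>2 = (?V + 1) / \<eta>" using \<eta> V0 by (auto simp: K_def add_nonneg_pos)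
  have "mostly (?V / K\<^sup>2) (\<lambda>n \<omega>. (emp n f \<omega>)\<^sup>2 < K\<^sup>2)"
  proof (rule mostly_Markov)
    show "0 < K\<^sup>2" using K(1) by simp
  qed (use emp_square[OF f f2] in auto)
  moreover have "?V / K\<^sup>2 \<le> \<eta>"
  proof -
    have "?V / K\<^sup>2 = \<eta> * (?V / (?V + 1))" by (simp add: K)
    also have "\<dots> \<le> \<eta> * 1" using \<eta> V0 by (intro mult_left_mono) (simp_all add: add_nonneg_pos)
    finally show ?thesis by simp
  qed
  ultimately have "mostly \<eta> (\<lambda>n \<omega>. (emp n f \<omega>)\<^sup>2 < K\<^sup>2)"
    unfolding mostly_def by (elim eventually_mono) (meson order_trans)
  then have "mostly \<eta> (\<lambda>n \<omega>. \<bar>emp n f \<omega>\<bar> < K)"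
    by (rule mostly_mono) (use K in \<open>auto intro!: always_eventually abs_less_of_square\<close>)
  with K show ?thesis by blast
qed

lemma mostly_avg_le:
  assumes "integrable P f" "\<And>x. x \<in> space P ==> 0 \<le> f x" and \<eta>: "\<eta> > 0"
  shows "\<exists>K>0. mostly \<eta> (\<lambda>n \<omega>. avg n f \<omega> < K)"
proof -
  let ?V = "LINT x|P. f x"
  have V0: "?V \<ge> 0" using assms by (intro integral_nonneg_AE) (auto intro!: AE_I2)
  define K where "K = (?V + 1) / \<eta>"
  have K: "K > 0" using \<eta> V0 by (auto simp: K_def)
  have "mostly (?V / K) (\<lambda>n \<omega>. avg n f \<omega> < K)"
  proof (rule mostly_Markov)
    show "\<forall>\<^sub>F n in sequentially. expectation (avg n f) \<le> ?V"
      using eventually_ge_at_top[of 1] by eventually_elim (use avg_expectation[OF assms(1)] in auto)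
    show "0 \<le> avg n f \<omega>" if "\<omega> \<in> space M" for n \<omega>
      unfolding avg_def using that assms(2) X_space by (intro divide_nonneg_nonneg sum_nonneg) auto
  qed (use avg_integrable assms K in auto)
  moreover have "?V / K \<le> \<eta>"
  proof -
    have "?V / K = \<eta> * (?V / (?V + 1))" by (simp add: K_def)
    also have "\<dots> \<le> \<eta> * 1" using \<eta> V0 by (intro mult_left_mono) (simp_all add: add_nonneg_pos)
    finally show ?thesis by simp
  qed
  ultimately have "mostly \<eta> (\<lambda>n \<omega>. avg n f \<omega> < K)"
    unfolding mostly_def by (elim eventually_mono) (meson order_trans)
  with K show ?thesis by blast
qed

lemma mostly_avg_close:
  fixes f :: "'x => real"
  assumes f[measurable]: "f \<in> borel_measurable P" and f2: "integrable P (\<lambda>x. (f x)\<^sup>2)" and \<eta>: "\<eta> > 0" "\<tau> > 0"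
  shows "mostly \<eta> (\<lambda>n \<omega>. \<bar>avg n f \<omega> - (LINT x|P. f x)\<bar> < \<tau>)"
proof -
  obtain K where K: "K > 0" "mostly \<eta> (\<lambda>n \<omega>. \<bar>emp n f \<omega>\<bar> < K)" using mostly_emp_le[OF f f2 \<eta>(1)] by blast
  have "filterlim (\<lambda>n. sqrt (real n)) at_top sequentially"
    by (intro filterlim_compose[OF sqrt_at_top] filterlim_real_sequentially)
  then have ev: "\<forall>\<^sub>F n in sequentially. sqrt (real n) \<ge> K / \<tau>"
    by (simp add: filterlim_at_top)
  show ?thesis
  proof (rule mostly_mono[OF K(2)])
    show "\<forall>\<^sub>F n in sequentially. \<forall>\<omega>\<in>space M. \<bar>emp n f \<omega>\<bar> < K \<longrightarrow> \<bar>avg n f \<omega> - (LINT x|P. f x)\<bar> < \<tau>"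
      using ev eventually_ge_at_top[of 1]
    proof (eventually_elim, intro ballI impI)
      fix n \<omega> assume n: "K / \<tau> \<le> sqrt (real n)" "1 \<le> n" and w: "\<bar>emp n f \<omega>\<bar> < K"
      have s: "sqrt n > 0" "sqrt n * sqrt n = n" using n by auto
      have "emp n f \<omega> = sqrt n * (avg n f \<omega> - (LINT x|P. f x))"
      proof -
        define r where "r = sqrt n"
        have r: "r > 0" "real n = r * r" using s by (auto simp: r_def)
        have "(S - n * c) / r = r * (S / n - c)" for S c :: real
          unfolding r(2) using r(1) by (simp add: field_simps)
        then show ?thesis unfolding emp_def avg_def sum_subtractf r_def[symmetric] by simp
      qed
      then have "sqrt n * \<bar>avg n f \<omega> - (LINT x|P. f x)\<bar> < K" using w by (simp add: abs_mult)
      also have "K \<le> sqrt n * \<tau>" using n \<eta> by (simp add: field_simps)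
      finally show "\<bar>avg n f \<omega> - (LINT x|P. f x)\<bar> < \<tau>" using s by simp
    qed
  qed
qed

text \<open>
  The central limit theorem for a single function; joint convergence follows from it through
  linear combinations.
\<close>

lemma emp_char_limit:
  fixes f :: "'x => real"
  assumes f[measurable]: "f \<in> borel_measurable P" and f2: "integrable P (\<lambda>x. (f x)\<^sup>2)"
    and f0: "(LINT x|P. f x) = 0"
  shows "(\<lambda>n. CLINT \<omega>|M. iexp (emp n f \<omega>)) \<longlonglongrightarrow> complex_of_real (exp (- (LINT x|P. (f x)\<^sup>2) / 2))"
proof (cases "(LINT x|P. (f x)\<^sup>2) = 0")
  case True
  have "(CLINT \<omega>|M. iexp (emp n f \<omega>)) = 1" for n
  proof -
    have "expectation (\<lambda>\<omega>. (emp n f \<omega>)\<^sup>2) = 0"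
      using emp_square(2)[OF f f2, of n] True by (intro antisym) auto
    then have "AE \<omega> in M. (emp n f \<omega>)\<^sup>2 = 0"
      using integral_nonneg_eq_0_iff_AE[OF emp_square(1)[OF f f2, of n]] by simp
    then have "AE \<omega> in M. iexp (emp n f \<omega>) = 1" by eventually_elim simp
    then have "(CLINT \<omega>|M. iexp (emp n f \<omega>)) = (CLINT \<omega>|M. 1)"
      by (intro integral_cong_AE) auto
    then show ?thesis by (simp add: prob_space)
  qed
  with True show ?thesis by simp
next
  case False
  define \<sigma> where "\<sigma> = sqrt (LINT x|P. (f x)\<^sup>2)"
  have \<sigma>: "\<sigma> > 0" "\<sigma>\<^sup>2 = (LINT x|P. (f x)\<^sup>2)"
    using False by (auto simp: \<sigma>_def integral_nonneg less_le)
  let ?Z = "\<lambda>i \<omega>. f (X (Suc i) \<omega>)"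
  have fi: "integrable P f" by (rule P.square_integrable_imp_integrable) (use f2 in auto)
  have "weak_conv_m (\<lambda>n. distr M borel (\<lambda>\<omega>. (\<Sum>i<n. ?Z i \<omega>) / sqrt (n * \<sigma>\<^sup>2))) std_normal_distribution"
  proof (rule central_limit_theorem_zero_mean[where \<mu>="distr P borel f"])
    show "indep_vars (\<lambda>i. borel) ?Z UNIV"
      by (rule indep_vars_compose2[OF indep_vars_Suc_shift[OF indep]]) simp
    show mean: "expectation (?Z n) = 0" for n using X_expectation[of "Suc n" f] f0 by simp
    show "integrable M (\<lambda>x. (?Z n x)\<^sup>2)" for n using X_integrable[OF _ f2, of "Suc n"] by simp
    show "variance (?Z n) = \<sigma>\<^sup>2" for n
      unfolding mean \<sigma> using X_expectation[of "Suc n" "\<lambda>x. (f x)\<^sup>2"] by simp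
    show "distr M borel (?Z n) = distr P borel f" for n
      using distr_distr[OF f X_measurable[of "Suc n"]] distr_X[of "Suc n"] by (simp add: comp_def)
  qed (rule \<sigma>)
  then have "(\<lambda>n. char (distr M borel (\<lambda>\<omega>. (\<Sum>i<n. ?Z i \<omega>) / sqrt (n * \<sigma>\<^sup>2))) \<sigma>) \<longlonglongrightarrow> char std_normal_distribution \<sigma>"
    by (intro levy_continuity1 real_dist_normal_dist)
       (auto intro!: real_distribution_distr borel_measurable_divide borel_measurable_sum X_compose)
  moreover have "char (distr M borel (\<lambda>\<omega>. (\<Sum>i<n. ?Z i \<omega>) / sqrt (n * \<sigma>\<^sup>2))) \<sigma> = (CLINT \<omega>|M. iexp (emp n f \<omega>))" for n
  proof -
    have "\<sigma> * ((\<Sum>i<n. ?Z i \<omega>) / sqrt (n * \<sigma>\<^sup>2)) = emp n f \<omega>" for \<omega>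
      unfolding emp_def f0 using \<sigma>(1) by (simp add: real_sqrt_mult sum.atLeast1_atMost_eq)
    moreover have "(\<lambda>\<omega>. (\<Sum>i<n. ?Z i \<omega>) / sqrt (n * \<sigma>\<^sup>2)) \<in> borel_measurable M"
      by (auto intro!: borel_measurable_divide borel_measurable_sum X_compose)
    ultimately show ?thesis unfolding char_def
      by (subst integral_distr) (simp_all del: of_real_mult times_divide_eq_right)
  qed
  ultimately show ?thesis by (simp add: char_std_normal_distribution \<sigma>(2))
qed

lemma emp_sum:
  assumes "finite J" "\<And>j. j \<in> J ==> integrable P (f j)"
  shows "(\<Sum>j\<in>J. u j * emp n (f j) \<omega>) = emp n (\<lambda>x. \<Sum>j\<in>J. u j * f j x) \<omega>"
proof -
  have "(LINT x|P. (\<Sum>j\<in>J. u j * f j x)) = (\<Sum>j\<in>J. u j * (LINT x|P. f j x))"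
    using assms by (subst Bochner_Integration.integral_sum) auto
  then have "emp n (\<lambda>x. \<Sum>j\<in>J. u j * f j x) \<omega> = (\<Sum>i=1..n. \<Sum>j\<in>J. u j * (f j (X i \<omega>) - (LINT x|P. f j x))) / sqrt n"
    unfolding emp_def by (simp add: sum_subtractf right_diff_distrib)
  also have "\<dots> = (\<Sum>j\<in>J. u j * emp n (f j) \<omega>)"
    unfolding emp_def by (subst sum.swap) (simp add: sum_distrib_left sum_divide_distrib)
  finally show ?thesis ..
qed

end

lemma L2_inner_integrable:
  fixes f g :: "'a => real"
  assumes [measurable]: "f \<in> borel_measurable P" "g \<in> borel_measurable P"
    and "integrable P (\<lambda>x. (f x)\<^sup>2)" "integrable P (\<lambda>x. (g x)\<^sup>2)"
  shows "integrable P (\<lambda>x. f x * g x)"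
proof (rule Bochner_Integration.integrable_bound)
  show "integrable P (\<lambda>x. (f x)\<^sup>2 + (g x)\<^sup>2)" using assms by simp
  have "\<bar>a * b\<bar> \<le> a\<^sup>2 + b\<^sup>2" for a b :: real
  proof -
    have "2 * (\<bar>a\<bar> * \<bar>b\<bar>) \<le> a\<^sup>2 + b\<^sup>2" using sum_squares_bound[of "\<bar>a\<bar>" "\<bar>b\<bar>"] by simp
    moreover have "0 \<le> \<bar>a\<bar> * \<bar>b\<bar>" by simp
    ultimately show ?thesis unfolding abs_mult by linarith
  qed
  then show "AE x in P. norm (f x * g x) \<le> norm ((f x)\<^sup>2 + (g x)\<^sup>2)" by simp
qed measurable

lemma L2_sum:
  fixes f :: "'j => 'a => real"
  assumes "finite J" and m: "\<And>j. j \<in> J ==> f j \<in> borel_measurable P"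
    and i: "\<And>j. j \<in> J ==> integrable P (\<lambda>x. (f j x)\<^sup>2)"
  shows "integrable P (\<lambda>x. (\<Sum>j\<in>J. u j * f j x)\<^sup>2)"
    and "(LINT x|P. (\<Sum>j\<in>J. u j * f j x)\<^sup>2) = (\<Sum>j\<in>J. \<Sum>k\<in>J. u j * u k * (LINT x|P. f j x * f k x))"
proof -
  have eq: "(\<Sum>j\<in>J. u j * f j x)\<^sup>2 = (\<Sum>j\<in>J. \<Sum>k\<in>J. u j * u k * (f j x * f k x))" for x
    unfolding power2_eq_square sum_product by (intro sum.cong refl) (simp add: mult_ac)
  have ii: "integrable P (\<lambda>x. f j x * f k x)" if "j \<in> J" "k \<in> J" for j k
    using that by (intro L2_inner_integrable m i)
  show "integrable P (\<lambda>x. (\<Sum>j\<in>J. u j * f j x)\<^sup>2)"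
    unfolding eq by (intro Bochner_Integration.integrable_sum integrable_mult_right ii)
  show "(LINT x|P. (\<Sum>j\<in>J. u j * f j x)\<^sup>2) = (\<Sum>j\<in>J. \<Sum>k\<in>J. u j * u k * (LINT x|P. f j x * f k x))"
  proof -
    have 1: "(LINT x|P. (\<Sum>j\<in>J. u j * f j x)\<^sup>2) = (\<Sum>j\<in>J. LINT x|P. (\<Sum>k\<in>J. u j * u k * (f j x * f k x)))"
      unfolding eq
      by (rule Bochner_Integration.integral_sum) (intro Bochner_Integration.integrable_sum integrable_mult_right ii)
    have 2: "(LINT x|P. (\<Sum>k\<in>J. u j * u k * (f j x * f k x))) = (\<Sum>k\<in>J. LINT x|P. u j * u k * (f j x * f k x))"
      if "j \<in> J" for j
      by (rule Bochner_Integration.integral_sum) (intro integrable_mult_right ii that)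
    show ?thesis unfolding 1
      by (rule sum.cong[OF refl]) (simp only: 2 integral_mult_right_zero)
  qed
qed

section \<open>Two-sided quadratic bounds for log-likelihood ratios\<close>

text \<open>
  The difference of the two sides has derivative \<open>y ^ 3 / (1 + y)\<close>, hence its minimum
  at \<open>0\<close>.
\<close>

lemma ln_one_plus_le_cubic:
  fixes x :: real
  assumes "x > -1"
  shows "ln (1 + x) \<le> x - x\<^sup>2 / 2 + x ^ 3 / 3"
proof -
  define f where "f = (\<lambda>x::real. x - x\<^sup>2 / 2 + x ^ 3 / 3 - ln (1 + x))"
  have d: "(f has_real_derivative y ^ 3 / (1 + y)) (at y)" if "y > -1" for y
  proof -
    have "(f has_real_derivative (1 - y + y\<^sup>2 - 1 / (1 + y))) (at y)"
      unfolding f_def using that by (auto intro!: derivative_eq_intros)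
    moreover have "1 - y + y\<^sup>2 - 1 / (1 + y) = y ^ 3 / (1 + y)"
      using that by (simp add: field_simps power2_eq_square power3_eq_cube)
    ultimately show ?thesis by simp
  qed
  have "f 0 \<le> f x"
  proof (cases "x \<ge> 0")
    case True
    show ?thesis
    proof (rule DERIV_nonneg_imp_nondecreasing[OF True])
      fix y assume "0 \<le> y" "y \<le> x"
      then show "\<exists>z. (f has_real_derivative z) (at y) \<and> 0 \<le> z"
        by (intro exI[of _ "y ^ 3 / (1 + y)"] conjI d) auto
    qed
  next
    case False
    then have "x \<le> 0" by simp
    then show ?thesis
    proof (rule DERIV_nonpos_imp_nonincreasing)
      fix y assume "x \<le> y" "y \<le> 0"
      then show "\<exists>z. (f has_real_derivative z) (at y) \<and> z \<le> 0"
        using assms by (intro exI[of _ "y ^ 3 / (1 + y)"] conjI d) (auto simp: divide_nonpos_pos)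
    qed
  qed
  then show ?thesis by (simp add: f_def)
qed

lemma ln_one_plus_ge_cubic:
  fixes x :: real
  assumes "\<bar>x\<bar> \<le> 1 / 2"
  shows "x - x\<^sup>2 / 2 - 2 / 3 * \<bar>x\<bar> ^ 3 \<le> ln (1 + x)"
proof (cases "x \<ge> 0")
  case True
  define f where "f = (\<lambda>x::real. ln (1 + x) - x + x\<^sup>2 / 2)"
  have "f 0 \<le> f x"
  proof (rule DERIV_nonneg_imp_nondecreasing[OF True])
    fix y assume y: "0 \<le> y" "y \<le> x"
    have "(f has_real_derivative (1 / (1 + y) - 1 + y)) (at y)"
      unfolding f_def using y by (auto intro!: derivative_eq_intros)
    moreover have "1 / (1 + y) - 1 + y = y\<^sup>2 / (1 + y)"
      using y by (simp add: field_simps power2_eq_square)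
    ultimately show "\<exists>z. (f has_real_derivative z) (at y) \<and> 0 \<le> z" using y by auto
  qed
  moreover have "0 \<le> 2 / 3 * \<bar>x\<bar> ^ 3" by simp
  moreover have "f 0 = 0" "f x = ln (1 + x) - x + x\<^sup>2 / 2" by (simp_all add: f_def)
  ultimately have "x - x\<^sup>2 / 2 - 2 / 3 * \<bar>x\<bar> ^ 3 \<le> ln (1 + x)" by linarith
  then show ?thesis .
next
  case False
  define f where "f = (\<lambda>x::real. ln (1 + x) - x + x\<^sup>2 / 2 - 2 / 3 * x ^ 3)"
  have "f x \<ge> f 0"
  proof (rule DERIV_nonpos_imp_nonincreasing[where f=f and a=x and b=0])
    show "x \<le> 0" using False by simp
    fix y assume y: "x \<le> y" "y \<le> 0"
    then have y2: "1 + y \<ge> 1 / 2" using assms by linarith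
    have "(f has_real_derivative (1 / (1 + y) - 1 + y - 2 * y\<^sup>2)) (at y)"
      unfolding f_def using y2 by (auto intro!: derivative_eq_intros)
    moreover have "1 / (1 + y) - 1 + y - 2 * y\<^sup>2 = y\<^sup>2 * (1 / (1 + y) - 2)"
      using y2 by (simp add: field_simps power2_eq_square)
    moreover have "1 / (1 + y) \<le> 2" using y2 by (simp add: divide_le_eq)
    ultimately show "\<exists>z. (f has_real_derivative z) (at y) \<and> z \<le> 0"
      by (metis diff_le_0_iff_le mult_nonneg_nonpos zero_le_power2)
  qed
  then show ?thesis using False by (simp add: f_def)
qed

text \<open>
  The hypotheses say that the second moment matches the first, which is the case at the maximiser
  of the quadratic approximation; the cubic error is absorbed by \<open>\<tau>\<close>.
\<close>

lemma sum_ln_lower: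
  fixes x :: "'i => real"
  assumes "finite I" "\<And>i. i \<in> I ==> \<bar>x i\<bar> \<le> \<tau>" "0 \<le> \<tau>" "\<tau> \<le> 1 / 2"
    and s1: "(\<Sum>i\<in>I. x i) = q" and s2: "(\<Sum>i\<in>I. (x i)\<^sup>2) \<le> q * (1 + \<tau>)" and q: "q \<ge> 0"
  shows "q * (1 - 4 * \<tau>) \<le> 2 * (\<Sum>i\<in>I. ln (1 + x i))"
proof -
  have "x i - (1 / 2 + 2 / 3 * \<tau>) * (x i)\<^sup>2 \<le> ln (1 + x i)" if "i \<in> I" for i
  proof -
    have b: "\<bar>x i\<bar> \<le> \<tau>" using assms that by blast
    have "\<bar>x i\<bar> ^ 3 = \<bar>x i\<bar> * (x i)\<^sup>2" by (simp add: power3_eq_cube power2_eq_square abs_mult)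
    also have "\<dots> \<le> \<tau> * (x i)\<^sup>2" using b by (intro mult_right_mono) auto
    finally have "2 / 3 * \<bar>x i\<bar> ^ 3 \<le> 2 / 3 * \<tau> * (x i)\<^sup>2" by simp
    moreover have "x i - (x i)\<^sup>2 / 2 - 2 / 3 * \<bar>x i\<bar> ^ 3 \<le> ln (1 + x i)"
      using b assms by (intro ln_one_plus_ge_cubic) auto
    ultimately show ?thesis by (simp add: algebra_simps)
  qed
  then have "(\<Sum>i\<in>I. x i - (1 / 2 + 2 / 3 * \<tau>) * (x i)\<^sup>2) \<le> (\<Sum>i\<in>I. ln (1 + x i))"
    by (rule sum_mono)
  then have "q - (1 / 2 + 2 / 3 * \<tau>) * (\<Sum>i\<in>I. (x i)\<^sup>2) \<le> (\<Sum>i\<in>I. ln (1 + x i))"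
    by (simp add: sum_subtractf sum_distrib_left s1)
  moreover have "(1 / 2 + 2 / 3 * \<tau>) * (\<Sum>i\<in>I. (x i)\<^sup>2) \<le> (1 / 2 + 2 / 3 * \<tau>) * (q * (1 + \<tau>))"
    using s2 assms by (intro mult_left_mono) auto
  moreover have "q * (1 - 4 * \<tau>) \<le> 2 * (q - (1 / 2 + 2 / 3 * \<tau>) * (q * (1 + \<tau>)))"
  proof -
    have "2 * (q - (1 / 2 + 2 / 3 * \<tau>) * (q * (1 + \<tau>))) - q * (1 - 4 * \<tau>) = q * (\<tau> * (5 / 3 - 4 / 3 * \<tau>))"
      by (simp add: field_simps)
    also have "\<dots> \<ge> 0" using assms by (intro mult_nonneg_nonneg) auto
    finally show ?thesis by simp
  qed
  ultimately show ?thesis by argo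
qed

text \<open>
  The step is chosen as the positive part of the empirical process divided by
  \<open>sqrt n\<close>, the maximiser of the quadratic approximation.  The fourth moment makes
  the largest term negligible.
\<close>

lemma (in iid_sample) likelihood_lower_bound:
  fixes s :: "'x => real"
  assumes s[measurable]: "s \<in> borel_measurable P" and s0: "(LINT x|P. s x) = 0" and s1: "(LINT x|P. (s x)\<^sup>2) = 1"
    and s4: "integrable P (\<lambda>x. (s x) ^ 4)" and pos: "\<eta> > 0" "\<kappa> > 0" "\<epsilon>0 > 0"
  shows "mostly \<kappa> (\<lambda>n \<omega>. \<exists>\<epsilon>. 0 \<le> \<epsilon> \<and> \<epsilon> \<le> \<epsilon>0 \<and>
     (max (emp n s \<omega>) 0)\<^sup>2 - \<eta> \<le> 2 * (\<Sum>i=1..n. ln (1 + \<epsilon> * s (X i \<omega>))))"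
proof -
  have s2: "integrable P (\<lambda>x. (s x)\<^sup>2)" using s1 not_integrable_integral_eq by fastforce
  have s22: "integrable P (\<lambda>x. ((s x)\<^sup>2)\<^sup>2)" using s4 by (simp flip: power_mult)
  have k3: "\<kappa> / 3 > 0" using pos by simp
  obtain K where K: "K > 0" "mostly (\<kappa> / 3) (\<lambda>n \<omega>. \<bar>emp n s \<omega>\<bar> < K)"
    using mostly_emp_le[OF s s2 k3] by blast
  obtain C where C: "C > 0" "mostly (\<kappa> / 3) (\<lambda>n \<omega>. avg n (\<lambda>x. s x ^ 4) \<omega> < C)"
    using mostly_avg_le[OF s4 _ k3] by auto
  define \<tau> where "\<tau> = min (1 / 2) (\<eta> / (4 * K\<^sup>2))"
  have \<tau>: "\<tau> > 0" "\<tau> \<le> 1 / 2" "4 * K\<^sup>2 * \<tau> \<le> \<eta>"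
  proof -
    show "\<tau> > 0" "\<tau> \<le> 1 / 2" using pos K by (auto simp: \<tau>_def)
    have "\<tau> \<le> \<eta> / (4 * K\<^sup>2)" unfolding \<tau>_def by (rule min.cobounded2)
    then show "4 * K\<^sup>2 * \<tau> \<le> \<eta>" using K by (simp add: field_simps)
  qed
  have A: "mostly (\<kappa> / 3) (\<lambda>n \<omega>. \<bar>avg n (\<lambda>x. (s x)\<^sup>2) \<omega> - 1\<bar> < \<tau>)"
    using mostly_avg_close[OF _ s22 k3 \<tau>(1)] s1 by simp
  have ev1: "\<forall>\<^sub>F n in sequentially. real n \<ge> K ^ 4 * C / \<tau> ^ 4" and ev2: "\<forall>\<^sub>F n in sequentially. real n \<ge> (K / \<epsilon>0)\<^sup>2"
    using filterlim_real_sequentially by (simp_all only: filterlim_at_top)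
  have "mostly (\<kappa> / 3 + \<kappa> / 3 + \<kappa> / 3) (\<lambda>n \<omega>. (\<bar>emp n s \<omega>\<bar> < K \<and> avg n (\<lambda>x. s x ^ 4) \<omega> < C) \<and> \<bar>avg n (\<lambda>x. (s x)\<^sup>2) \<omega> - 1\<bar> < \<tau>)"
    by (intro mostly_conj K C A)
  then have "mostly \<kappa> (\<lambda>n \<omega>. (\<bar>emp n s \<omega>\<bar> < K \<and> avg n (\<lambda>x. s x ^ 4) \<omega> < C) \<and> \<bar>avg n (\<lambda>x. (s x)\<^sup>2) \<omega> - 1\<bar> < \<tau>)"
    by simp
  then show ?thesis
  proof (rule mostly_mono)
    show "\<forall>\<^sub>F n in sequentially. \<forall>\<omega>\<in>space M. (\<bar>emp n s \<omega>\<bar> < K \<and> avg n (\<lambda>x. s x ^ 4) \<omega> < C) \<and> \<bar>avg n (\<lambda>x. (s x)\<^sup>2) \<omega> - 1\<bar> < \<tau> \<longrightarrow>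
        (\<exists>\<epsilon>. 0 \<le> \<epsilon> \<and> \<epsilon> \<le> \<epsilon>0 \<and> (max (emp n s \<omega>) 0)\<^sup>2 - \<eta> \<le> 2 * (\<Sum>i=1..n. ln (1 + \<epsilon> * s (X i \<omega>))))"
      using ev1 ev2 eventually_ge_at_top[of 1]
    proof (eventually_elim, intro ballI impI)
      fix n \<omega> assume n1: "K ^ 4 * C / \<tau> ^ 4 \<le> real n" and n2: "(K / \<epsilon>0)\<^sup>2 \<le> real n" and n3: "1 \<le> n"
        and w: "(\<bar>emp n s \<omega>\<bar> < K \<and> avg n (\<lambda>x. s x ^ 4) \<omega> < C) \<and> \<bar>avg n (\<lambda>x. (s x)\<^sup>2) \<omega> - 1\<bar> < \<tau>"
      define m where "m = max (emp n s \<omega>) 0"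
      (* the maximiser of the quadratic approximation over nonnegative steps *)
      define \<epsilon> where "\<epsilon> = m / sqrt n"
      define x where "x = (\<lambda>i. \<epsilon> * s (X i \<omega>))"
      have m: "0 \<le> m" "m \<le> K" "m * emp n s \<omega> = m\<^sup>2" using w K by (auto simp: m_def max_def power2_eq_square)
      have sn: "sqrt n > 0" using n3 by simp
      have "sqrt n \<ge> K / \<epsilon>0" using n2 K pos by (simp add: real_le_rsqrt)
      then have "\<epsilon> \<le> \<epsilon>0" unfolding \<epsilon>_def using m sn pos by (simp add: field_simps)
      have \<epsilon>2: "\<epsilon>\<^sup>2 = m\<^sup>2 / n" "\<epsilon> ^ 4 = m ^ 4 / (real n)\<^sup>2"
      proof -
        have "sqrt n ^ 4 = (sqrt n ^ 2) ^ 2" unfolding power_mult[symmetric] by simp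
        also have "\<dots> = (real n)\<^sup>2" by (subst real_sqrt_pow2) auto
        finally have "sqrt n ^ 4 = (real n)\<^sup>2" .
        then show "\<epsilon>\<^sup>2 = m\<^sup>2 / n" "\<epsilon> ^ 4 = m ^ 4 / (real n)\<^sup>2"
          unfolding \<epsilon>_def power_divide by simp_all
      qed
      have sx: "(\<Sum>i=1..n. x i) = m\<^sup>2"
      proof -
        have "(\<Sum>i=1..n. x i) = m * ((\<Sum>i=1..n. s (X i \<omega>)) / sqrt n)"
          unfolding x_def \<epsilon>_def by (simp add: sum_distrib_left sum_divide_distrib)
        then show ?thesis using m(3) by (simp add: emp_def s0)
      qed
      have sx2: "(\<Sum>i=1..n. (x i)\<^sup>2) \<le> m\<^sup>2 * (1 + \<tau>)"
      proof -
        have "(\<Sum>i=1..n. (x i)\<^sup>2) = m\<^sup>2 * avg n (\<lambda>x. (s x)\<^sup>2) \<omega>"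
          unfolding x_def avg_def by (simp add: power_mult_distrib \<epsilon>2 sum_distrib_left sum_divide_distrib)
        also have "\<dots> \<le> m\<^sup>2 * (1 + \<tau>)" using w by (intro mult_left_mono) auto
        finally show ?thesis .
      qed
      have xb: "\<bar>x i\<bar> \<le> \<tau>" if "i \<in> {1..n}" for i
      proof -
        have "x i ^ 4 = \<epsilon> ^ 4 * s (X i \<omega>) ^ 4" by (simp add: x_def power_mult_distrib)
        also have "\<dots> \<le> \<epsilon> ^ 4 * (\<Sum>i=1..n. s (X i \<omega>) ^ 4)"
          using that by (intro mult_left_mono member_le_sum) auto
        also have "\<dots> = m ^ 4 * avg n (\<lambda>x. s x ^ 4) \<omega> / n"
          unfolding \<epsilon>2 avg_def by (simp add: power2_eq_square)
        also have "\<dots> \<le> K ^ 4 * C / n"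
        proof (intro divide_right_mono mult_mono)
          show "m ^ 4 \<le> K ^ 4" using m by (intro power_mono) auto
          show "0 \<le> avg n (\<lambda>x. s x ^ 4) \<omega>" unfolding avg_def by (intro divide_nonneg_nonneg sum_nonneg) auto
          show "avg n (\<lambda>x. s x ^ 4) \<omega> \<le> C" using w by simp
        qed (use K in auto)
        also have "\<dots> \<le> \<tau> ^ 4"
        proof -
          have "\<tau> ^ 4 > 0" using \<tau> by simp
          then have "K ^ 4 * C \<le> real n * \<tau> ^ 4" using n1 by (simp add: pos_divide_le_eq)
          then show ?thesis using n3 by (simp add: pos_divide_le_eq mult.commute)
        qed
        finally have "\<bar>x i\<bar> ^ 4 \<le> \<tau> ^ 4" by (simp add: power_even_abs)
        then show ?thesis using power_mono_iff[of "\<bar>x i\<bar>" \<tau> 4] \<tau> by simp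
      qed
      have "m\<^sup>2 * (1 - 4 * \<tau>) \<le> 2 * (\<Sum>i=1..n. ln (1 + x i))"
        by (rule sum_ln_lower[OF _ xb _ _ sx sx2]) (use \<tau> in auto)
      moreover have "m\<^sup>2 - \<eta> \<le> m\<^sup>2 * (1 - 4 * \<tau>)"
      proof -
        have "m\<^sup>2 * (4 * \<tau>) \<le> K\<^sup>2 * (4 * \<tau>)" using m \<tau> by (intro mult_right_mono power_mono) auto
        then show ?thesis using \<tau>(3) by (simp add: algebra_simps)
      qed
      ultimately have "m\<^sup>2 - \<eta> \<le> 2 * (\<Sum>i=1..n. ln (1 + \<epsilon> * s (X i \<omega>)))" by (simp add: x_def)
      moreover have "0 \<le> \<epsilon>" using m by (simp add: \<epsilon>_def)
      ultimately show "\<exists>\<epsilon>. 0 \<le> \<epsilon> \<and> \<epsilon> \<le> \<epsilon>0 \<and> (max (emp n s \<omega>) 0)\<^sup>2 - \<eta> \<le> 2 * (\<Sum>i=1..n. ln (1 + \<epsilon> * s (X i \<omega>)))"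
        using \<open>\<epsilon> \<le> \<epsilon>0\<close> unfolding m_def by blast
    qed
  qed
qed

section \<open>Finite nets of coefficient sequences\<close>

text \<open>
  A box with summable side lengths is totally bounded in \<open>\<ell>\<^sub>1\<close>: finitely
  many coordinates are rounded to a grid and the others contribute a small tail.  The bound
  \<open>d\<close> on the coefficient differences is the same for the whole class, so it can be
  used before the random functions are drawn.
\<close>

lemma finite_coefficient_net:
  fixes c :: "'s => nat => real"
  assumes w: "summable w" "\<And>k. 0 \<le> w k" and c: "\<And>s k. s \<in> S ==> \<bar>c s k\<bar> \<le> w k" and \<delta>: "\<delta> > 0"
  shows "\<exists>F d. finite F \<and> F \<subseteq> S \<and> summable d \<and> (\<forall>k. 0 \<le> d k) \<and> suminf d \<le> \<delta> \<and>
     (\<forall>s\<in>S. \<exists>t\<in>F. \<forall>k. \<bar>c s k - c t k\<bar> \<le> d k)"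
proof -
  obtain K where K: "\<bar>\<Sum>k. w (k + K)\<bar> < \<delta> / 4"
    using suminf_exist_split[of "\<delta> / 4" w] w(1) \<delta> by force
  define h where "h = \<delta> / (2 * (real K + 1))"
  have h: "h > 0" using \<delta> by (simp add: h_def)
  define d where "d = (\<lambda>k. if k < K then h else 2 * w k)"
  (* the leading coefficients, rounded to a grid of mesh h *)
  define cell where "cell = (\<lambda>s. map (\<lambda>k. \<lfloor>c s k / h\<rfloor>) [0..<K])"
  obtain m where m: "\<And>k. k < K ==> w k / h \<le> real_of_int m"
  proof
    fix k assume k: "k < K"
    have "w k \<le> (\<Sum>k<K. w k)" using k w by (intro member_le_sum) auto
    then have "w k / h \<le> (\<Sum>k<K. w k) / h" using h by (intro divide_right_mono) auto
    also have "\<dots> \<le> real_of_int \<lceil>(\<Sum>k<K. w k) / h\<rceil>" by simp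
    finally show "w k / h \<le> real_of_int \<lceil>(\<Sum>k<K. w k) / h\<rceil>" .
  qed
  have "cell ` S \<subseteq> {xs. set xs \<subseteq> {- m - 1..m} \<and> length xs = K}"
  proof clarify
    fix s assume s: "s \<in> S"
    have "\<lfloor>c s k / h\<rfloor> \<in> {- m - 1..m}" if "k < K" for k
    proof -
      have "\<bar>c s k / h\<bar> \<le> w k / h" using c[OF s, of k] h by (simp add: divide_right_mono)
      then have "\<bar>c s k / h\<bar> \<le> real_of_int m" using m[OF that] by linarith
      then have "\<lfloor>c s k / h\<rfloor> \<le> m" "- m - 1 \<le> \<lfloor>c s k / h\<rfloor>" by linarith+
      then show ?thesis by simp
    qed
    then show "set (cell s) \<subseteq> {- m - 1..m} \<and> length (cell s) = K" by (auto simp: cell_def)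
  qed
  then have fin: "finite (cell ` S)"
    by (rule finite_subset) (rule finite_lists_length_eq, simp)
  define rep where "rep = (\<lambda>y. SOME s. s \<in> S \<and> cell s = y)"
  have rep: "rep (cell s) \<in> S \<and> cell (rep (cell s)) = cell s" if "s \<in> S" for s
    unfolding rep_def by (rule someI[of _ s]) (use that in auto)
  have dsum: "summable d"
  proof (rule summable_comparison_test)
    show "\<exists>N. \<forall>n\<ge>N. norm (d n) \<le> 2 * w n" using w by (intro exI[of _ K]) (auto simp: d_def)
  qed (use w in simp)
  have "suminf d = (\<Sum>k. d (k + K)) + (\<Sum>k<K. d k)" by (rule suminf_split_initial_segment[OF dsum])
  also have "(\<Sum>k. d (k + K)) = 2 * (\<Sum>k. w (k + K))"
    using w by (subst suminf_mult[symmetric]) (auto simp: d_def summable_iff_shift)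
  also have "(\<Sum>k<K. d k) = K * h" by (simp add: d_def)
  also have "2 * (\<Sum>k. w (k + K)) + K * h \<le> \<delta> / 2 + \<delta> / 2"
  proof (rule add_mono)
    show "2 * (\<Sum>k. w (k + K)) \<le> \<delta> / 2" using K by linarith
    show "real K * h \<le> \<delta> / 2" using \<delta> by (simp add: h_def field_simps)
  qed
  finally have "suminf d \<le> \<delta>" by simp
  moreover have "\<bar>c s k - c (rep (cell s)) k\<bar> \<le> d k" if s: "s \<in> S" for s k
  proof (cases "k < K")
    case True
    let ?t = "rep (cell s)"
    have "cell ?t ! k = cell s ! k" using rep[OF s] by simp
    then have "\<lfloor>c ?t k / h\<rfloor> = \<lfloor>c s k / h\<rfloor>" using True by (simp add: cell_def)
    then have "\<bar>c s k / h - c ?t k / h\<bar> \<le> 1" by linarith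
    then show ?thesis using True h by (simp add: d_def divide_le_eq flip: diff_divide_distrib)
  next
    case False
    then show ?thesis using c[OF s, of k] c[of "rep (cell s)" k] rep[OF s] by (simp add: d_def)
  qed
  moreover have "0 \<le> d k" for k using w h by (simp add: d_def)
  moreover have "rep ` cell ` S \<subseteq> S" using rep by auto
  ultimately show ?thesis
    using fin dsum by (intro exI[of _ "rep ` cell ` S"] exI[of _ d]) blast
qed

section \<open>Likelihood ratios over a class with an absolutely summable expansion\<close>

text \<open>
  Functions with coefficients in a box of \<open>\<ell>\<^sub>1\<close> along a sequence dominated
  by one function with four moments.  This is all that the limit theorem needs to know about the
  scores.
\<close>

locale series_class = P: prob_space P for P :: "'x measure" +
  fixes S :: "('x => real) set" and c :: "('x => real) => nat => real"
    and w :: "nat => real" and e :: "nat => 'x => real" and A :: "'x => real"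
  assumes w_summable: "summable w" and w_nonneg: "\<And>k. 0 \<le> w k"
    and c_bound: "\<And>s k. s \<in> S ==> \<bar>c s k\<bar> \<le> w k"
    and e_measurable[measurable]: "\<And>k. e k \<in> borel_measurable P"
    and e_bound: "\<And>k x. x \<in> space P ==> \<bar>e k x\<bar> \<le> A x"
    and A_measurable[measurable]: "A \<in> borel_measurable P"
    and A4: "integrable P (\<lambda>x. A x ^ 4)"
    and expansion: "\<And>s x. s \<in> S ==> x \<in> space P ==> s x = (\<Sum>k. c s k * e k x)"
begin

lemma A_nonneg: "x \<in> space P ==> 0 \<le> A x"
  using e_bound[of x 0] by linarith

lemma A_power_integrable:
  assumes "j \<le> 4" shows "integrable P (\<lambda>x. A x ^ j)"
proof (rule Bochner_Integration.integrable_bound)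
  show "integrable P (\<lambda>x. 1 + A x ^ 4)" using A4 by simp
  have "A x ^ j \<le> 1 + A x ^ 4" if "x \<in> space P" for x
  proof (cases "A x \<le> 1")
    case True
    then show ?thesis using power_le_one[of "A x" j] A_nonneg[OF that] by (simp add: add_increasing2)
  next
    case False
    then have "A x ^ j \<le> A x ^ 4" using power_increasing[of j 4 "A x"] assms by simp
    then show ?thesis by linarith
  qed
  then show "AE x in P. norm (A x ^ j) \<le> norm (1 + A x ^ 4)"
    by (intro AE_I2) (simp add: A_nonneg)
qed measurable

lemma A_integrable: "integrable P A" "integrable P (\<lambda>x. (A x)\<^sup>2)" "integrable P (\<lambda>x. A x ^ 3)"
  using A_power_integrable[of 1] A_power_integrable[of 2] A_power_integrable[of 3] by simp_all

lemma series_abs_summable: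
  assumes "summable v" "\<And>k. \<bar>b k\<bar> \<le> v k" "x \<in> space P"
  shows "summable (\<lambda>k. \<bar>b k * e k x\<bar>)" "\<bar>\<Sum>k. b k * e k x\<bar> \<le> suminf v * A x" "\<And>n. \<bar>\<Sum>k<n. b k * e k x\<bar> \<le> suminf v * A x"
proof -
  have le: "\<bar>b k * e k x\<bar> \<le> v k * A x" for k
    unfolding abs_mult using assms(2)[of k] e_bound[OF assms(3), of k] by (intro mult_mono) auto
  have vs: "summable (\<lambda>k. v k * A x)" using assms(1) by (rule summable_mult2)
  show s: "summable (\<lambda>k. \<bar>b k * e k x\<bar>)"
    by (rule summable_comparison_test[OF _ vs]) (use le in auto)
  have "\<bar>\<Sum>k. b k * e k x\<bar> \<le> (\<Sum>k. \<bar>b k * e k x\<bar>)" by (rule summable_rabs[OF s])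
  also have "\<dots> \<le> (\<Sum>k. v k * A x)" by (rule suminf_le[OF le s vs])
  also have "\<dots> = suminf v * A x" by (rule suminf_mult2[symmetric, OF assms(1)])
  finally show "\<bar>\<Sum>k. b k * e k x\<bar> \<le> suminf v * A x" .
  show "\<bar>\<Sum>k<n. b k * e k x\<bar> \<le> suminf v * A x" for n
  proof -
    have "\<bar>\<Sum>k<n. b k * e k x\<bar> \<le> (\<Sum>k<n. \<bar>b k * e k x\<bar>)" by (rule sum_abs)
    also have "\<dots> \<le> (\<Sum>k<n. v k * A x)" by (intro sum_mono le)
    also have "\<dots> \<le> (\<Sum>k. v k * A x)"
    proof -
      have "0 \<le> v k * A x" for k using le[of k] by linarith
      then show ?thesis by (intro sum_le_suminf vs) auto
    qed
    also have "\<dots> = suminf v * A x" by (rule suminf_mult2[symmetric, OF assms(1)])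
    finally show ?thesis .
  qed
qed

lemmas series_summable = summable_rabs_cancel[OF series_abs_summable(1)]

lemma series_measurable: "(\<lambda>x. \<Sum>k. b k * e k x) \<in> borel_measurable P"
  by measurable

lemma S_measurable: "s \<in> S ==> s \<in> borel_measurable P"
  using series_measurable[of "c s"] by (subst measurable_cong[OF expansion]) auto

lemma S_bound: "s \<in> S ==> x \<in> space P ==> \<bar>s x\<bar> \<le> suminf w * A x"
  using series_abs_summable(2)[OF w_summable c_bound] by (simp add: expansion)

lemma W_nonneg: "0 \<le> suminf w"
  using w_summable w_nonneg by (simp add: suminf_nonneg)

lemma S_diff:
  assumes "s \<in> S" "t \<in> S" "summable d" "\<And>k. \<bar>c s k - c t k\<bar> \<le> d k" "x \<in> space P"
  shows "\<bar>s x - t x\<bar> \<le> suminf d * A x"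
proof -
  have "s x - t x = (\<Sum>k. c s k * e k x - c t k * e k x)"
    unfolding expansion[OF assms(1,5)] expansion[OF assms(2,5)]
    by (rule suminf_diff)
       (rule series_summable[OF w_summable c_bound assms(5)], rule assms)+
  then show ?thesis
    using series_abs_summable(2)[OF assms(3,4,5)] by (simp add: left_diff_distrib)
qed

lemma bounded_by_A_integrable:
  assumes [measurable]: "f \<in> borel_measurable P" and "\<And>x. x \<in> space P ==> \<bar>f x\<bar> \<le> C * A x" and j: "j \<le> 4"
  shows "integrable P (\<lambda>x. f x ^ j)"
proof (rule Bochner_Integration.integrable_bound)
  show "integrable P (\<lambda>x. C ^ j * A x ^ j)" using A_power_integrable[OF j] by simp
  show "AE x in P. norm (f x ^ j) \<le> norm (C ^ j * A x ^ j)"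
  proof (rule AE_I2)
    fix x assume "x \<in> space P"
    then have "\<bar>f x\<bar> ^ j \<le> \<bar>C * A x\<bar> ^ j" using assms(2)[of x] by (intro power_mono) auto
    then show "norm (f x ^ j) \<le> norm (C ^ j * A x ^ j)" unfolding real_norm_def power_abs power_mult_distrib[symmetric] .
  qed
qed measurable

lemma S_power_integrable: "s \<in> S ==> j \<le> 4 ==> integrable P (\<lambda>x. s x ^ j)"
  by (rule bounded_by_A_integrable[OF S_measurable S_bound])

lemma e_power_integrable: "j \<le> 4 ==> integrable P (\<lambda>x. e k x ^ j)"
  by (rule bounded_by_A_integrable[of _ 1]) (use e_bound in auto)

lemma S_square_diff:
  assumes "s \<in> S" "t \<in> S" "summable d" "\<And>k. \<bar>c s k - c t k\<bar> \<le> d k" "x \<in> space P"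
  shows "\<bar>(s x)\<^sup>2 - (t x)\<^sup>2\<bar> \<le> 2 * suminf w * suminf d * (A x)\<^sup>2"
proof -
  have "\<bar>(s x)\<^sup>2 - (t x)\<^sup>2\<bar> = \<bar>s x - t x\<bar> * \<bar>s x + t x\<bar>"
    unfolding abs_mult[symmetric] by (rule arg_cong[of _ _ abs]) (simp add: power2_eq_square algebra_simps)
  also have "\<dots> \<le> (suminf d * A x) * (2 * suminf w * A x)"
  proof (rule mult_mono)
    show 1: "\<bar>s x - t x\<bar> \<le> suminf d * A x" by (rule S_diff[OF assms])
    show "0 \<le> suminf d * A x" using 1 by linarith
    show "\<bar>s x + t x\<bar> \<le> 2 * suminf w * A x"
      using S_bound[OF assms(1,5)] S_bound[OF assms(2,5)] abs_triangle_ineq[of "s x" "t x"] by linarith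
  qed simp
  also have "\<dots> = 2 * suminf w * suminf d * (A x)\<^sup>2" by (simp only: power2_eq_square mult_ac)
  finally show ?thesis .
qed

end

locale sampled_series_class = iid_sample M P X + series_class P S c w e A
  for M :: "'w measure" and P :: "'x measure" and X S c w e A
begin

lemma emp_series:
  assumes "summable v" "\<And>k. \<bar>b k\<bar> \<le> v k" "\<And>x. x \<in> space P ==> f x = (\<Sum>k. b k * e k x)" "\<omega> \<in> space M"
  shows "(\<lambda>k. b k * emp n (e k) \<omega>) sums emp n f \<omega>"
proof -
  have ei: "integrable P (\<lambda>x. b k * e k x)" for k using e_power_integrable[of 1 k] by simp
  have 1: "(\<lambda>k. b k * e k (X i \<omega>)) sums f (X i \<omega>)" if "i \<in> {1..n}" for i
    using summable_sums[OF series_summable[OF assms(1,2)], of "X i \<omega>"] assms(3) X_space[of i \<omega>] that assms(4)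
    by simp
  have 2: "(\<lambda>k. b k * (LINT x|P. e k x)) sums (LINT x|P. f x)"
  proof -
    have m: "(\<lambda>k. LINT x|P. (\<Sum>j<k. b j * e j x)) \<longlonglongrightarrow> (LINT x|P. (\<Sum>k. b k * e k x))"
    proof (rule integral_dominated_convergence[where w="\<lambda>x. suminf v * A x"])
      show "AE x in P. (\<lambda>i. \<Sum>j<i. b j * e j x) \<longlonglongrightarrow> (\<Sum>k. b k * e k x)"
        by (intro AE_I2 summable_LIMSEQ series_summable[OF assms(1,2)])
      show "AE x in P. norm (\<Sum>j<i. b j * e j x) \<le> suminf v * A x" for i
        using series_abs_summable(3)[OF assms(1,2)] by (intro AE_I2) auto
    qed (use A_integrable in auto)
    have "(LINT x|P. (\<Sum>k. b k * e k x)) = (LINT x|P. f x)"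
      by (rule Bochner_Integration.integral_cong) (auto simp: assms(3))
    moreover have "(LINT x|P. (\<Sum>j<k. b j * e j x)) = (\<Sum>j<k. b j * (LINT x|P. e j x))" for k
      using ei by (simp add: Bochner_Integration.integral_sum)
    ultimately show ?thesis using m by (simp add: sums_def)
  qed
  have "(\<lambda>k. (\<Sum>i=1..n. b k * e k (X i \<omega>) - b k * (LINT x|P. e k x)) / sqrt n) sums
      ((\<Sum>i=1..n. f (X i \<omega>) - (LINT x|P. f x)) / sqrt n)"
    by (intro sums_divide sums_sum sums_diff 1 2)
  then show ?thesis unfolding emp_def by (simp add: sum_distrib_left right_diff_distrib)
qed

text \<open>
  Bounds the oscillation of the empirical process between any two functions whose coefficients
  differ by at most \<open>d\<close>.
\<close>

definition fluctuation :: "(nat => real) => nat => 'w => real" where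
  "fluctuation d n \<omega> = (\<Sum>k. d k * \<bar>emp n (e k) \<omega>\<bar>)"

lemma emp_e_bound:
  assumes "\<omega> \<in> space M"
  shows "\<bar>emp n (e k) \<omega>\<bar> \<le> (\<Sum>i=1..n. A (X i \<omega>) + (LINT x|P. A x)) / sqrt n"
proof -
  have "\<bar>LINT x|P. e k x\<bar> \<le> (LINT x|P. A x)"
    using e_power_integrable[of 1 k] A_integrable
    by (intro order_trans[OF integral_abs_bound] integral_mono) (auto simp: e_bound)
  then have "\<bar>\<Sum>i=1..n. e k (X i \<omega>) - (LINT x|P. e k x)\<bar> \<le> (\<Sum>i=1..n. A (X i \<omega>) + (LINT x|P. A x))"
    using e_bound[OF X_space[OF _ assms], of _ k]
    by (intro order_trans[OF sum_abs] sum_mono order_trans[OF abs_triangle_ineq4] add_mono) auto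
  then show ?thesis unfolding emp_def by (simp add: abs_divide divide_right_mono)
qed

lemma fluctuation_summable:
  assumes "summable d" "\<And>k. 0 \<le> d k" "\<omega> \<in> space M"
  shows "summable (\<lambda>k. d k * \<bar>emp n (e k) \<omega>\<bar>)"
proof (rule summable_comparison_test)
  show "summable (\<lambda>k. d k * ((\<Sum>i=1..n. A (X i \<omega>) + (LINT x|P. A x)) / sqrt n))"
    using assms(1) by (rule summable_mult2)
  show "\<exists>N. \<forall>k\<ge>N. norm (d k * \<bar>emp n (e k) \<omega>\<bar>) \<le> d k * ((\<Sum>i=1..n. A (X i \<omega>) + (LINT x|P. A x)) / sqrt n)"
  proof (intro exI[of _ 0] allI impI)
    fix k
    have "norm (d k * \<bar>emp n (e k) \<omega>\<bar>) = d k * \<bar>emp n (e k) \<omega>\<bar>" using assms(2)[of k] by (simp add: abs_mult)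
    also have "\<dots> \<le> d k * ((\<Sum>i=1..n. A (X i \<omega>) + (LINT x|P. A x)) / sqrt n)"
      by (intro mult_left_mono emp_e_bound assms)
    finally show "norm (d k * \<bar>emp n (e k) \<omega>\<bar>) \<le> d k * ((\<Sum>i=1..n. A (X i \<omega>) + (LINT x|P. A x)) / sqrt n)" .
  qed
qed

lemma emp_diff_le_fluctuation:
  assumes "s \<in> S" "t \<in> S" "summable d" "\<And>k. \<bar>c s k - c t k\<bar> \<le> d k" "\<omega> \<in> space M"
  shows "\<bar>emp n s \<omega> - emp n t \<omega>\<bar> \<le> fluctuation d n \<omega>"
proof -
  have d0: "0 \<le> d k" for k using assms(4)[of k] by linarith
  note sm = fluctuation_summable[OF assms(3) d0 assms(5), of n]
  have "(\<lambda>k. c s k * emp n (e k) \<omega> - c t k * emp n (e k) \<omega>) sums (emp n s \<omega> - emp n t \<omega>)"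
    by (intro sums_diff emp_series[OF w_summable c_bound] expansion assms)
  then have eq: "emp n s \<omega> - emp n t \<omega> = (\<Sum>k. (c s k - c t k) * emp n (e k) \<omega>)"
    by (simp add: left_diff_distrib sums_iff)
  have le: "\<bar>(c s k - c t k) * emp n (e k) \<omega>\<bar> \<le> d k * \<bar>emp n (e k) \<omega>\<bar>" for k
    unfolding abs_mult using assms(4)[of k] by (intro mult_right_mono) auto
  have sa: "summable (\<lambda>k. \<bar>(c s k - c t k) * emp n (e k) \<omega>\<bar>)"
    by (rule summable_comparison_test[OF _ sm]) (use le in auto)
  have "\<bar>\<Sum>k. (c s k - c t k) * emp n (e k) \<omega>\<bar> \<le> (\<Sum>k. \<bar>(c s k - c t k) * emp n (e k) \<omega>\<bar>)"
    by (rule summable_rabs[OF sa])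
  also have "\<dots> \<le> (\<Sum>k. d k * \<bar>emp n (e k) \<omega>\<bar>)" by (rule suminf_le[OF le sa sm])
  finally show ?thesis unfolding eq fluctuation_def .
qed

lemma fluctuation_mean:
  assumes "summable d" "\<And>k. 0 \<le> d k"
  shows "integrable M (fluctuation d n)" "expectation (fluctuation d n) \<le> suminf d * sqrt (LINT x|P. (A x)\<^sup>2)"
proof -
  let ?a = "sqrt (LINT x|P. (A x)\<^sup>2)"
  have e2: "integrable P (\<lambda>x. (e k x)\<^sup>2)" for k by (rule e_power_integrable) simp
  have "(LINT x|P. (e k x)\<^sup>2) \<le> (LINT x|P. (A x)\<^sup>2)" for k
    using e2 A_integrable e_bound by (intro integral_mono) (auto simp: abs_le_square_iff[symmetric] A_nonneg)
  then have E: "expectation (\<lambda>\<omega>. \<bar>emp n (e k) \<omega>\<bar>) \<le> ?a" for k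
    using emp_abs(2)[OF e_measurable e2, of n k] by (meson order_trans real_sqrt_le_mono)
  have I: "integrable M (\<lambda>\<omega>. d k * \<bar>emp n (e k) \<omega>\<bar>)" for k
    using emp_abs(1)[OF e_measurable e2] by simp
  have le: "expectation (\<lambda>\<omega>. norm (d k * \<bar>emp n (e k) \<omega>\<bar>)) \<le> d k * ?a" for k
    using E[of k] assms(2)[of k] by (simp add: abs_mult mult_left_mono)
  have ds: "summable (\<lambda>k. d k * ?a)" using assms(1) by (rule summable_mult2)
  have s: "summable (\<lambda>k. expectation (\<lambda>\<omega>. norm (d k * \<bar>emp n (e k) \<omega>\<bar>)))"
    by (rule summable_comparison_test[OF _ ds]) (use le in auto)
  have ae: "AE \<omega> in M. summable (\<lambda>k. norm (d k * \<bar>emp n (e k) \<omega>\<bar>))"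
    using fluctuation_summable[OF assms] assms(2) by (intro AE_I2) (simp add: abs_mult)
  show "integrable M (fluctuation d n)"
    unfolding fluctuation_def[abs_def] by (rule integrable_suminf[OF I ae s])
  have "expectation (fluctuation d n) = (\<Sum>k. expectation (\<lambda>\<omega>. d k * \<bar>emp n (e k) \<omega>\<bar>))"
    unfolding fluctuation_def[abs_def] by (rule integral_suminf[OF I ae s])
  also have "\<dots> \<le> (\<Sum>k. d k * ?a)"
  proof (rule suminf_le[OF _ _ ds])
    show "expectation (\<lambda>\<omega>. d k * \<bar>emp n (e k) \<omega>\<bar>) \<le> d k * ?a" for k
      using le[of k] assms(2)[of k] by (simp add: abs_mult)
    show "summable (\<lambda>k. expectation (\<lambda>\<omega>. d k * \<bar>emp n (e k) \<omega>\<bar>))"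
      using s assms(2) by (simp add: abs_mult)
  qed
  also have "\<dots> = suminf d * ?a" by (rule suminf_mult2[symmetric, OF assms(1)])
  finally show "expectation (fluctuation d n) \<le> suminf d * ?a" .
qed

lemma mostly_fluctuation:
  assumes "summable d" "\<And>k. 0 \<le> d k" "suminf d * sqrt (LINT x|P. (A x)\<^sup>2) \<le> \<kappa> * \<eta>" "\<eta> > 0"
  shows "mostly \<kappa> (\<lambda>n \<omega>. fluctuation d n \<omega> < \<eta>)"
proof -
  have "mostly (\<kappa> * \<eta> / \<eta>) (\<lambda>n \<omega>. fluctuation d n \<omega> < \<eta>)"
  proof (rule mostly_Markov)
    show "0 \<le> fluctuation d n \<omega>" if "\<omega> \<in> space M" for n \<omega>
      unfolding fluctuation_def using fluctuation_summable[OF assms(1,2) that] assms(2) by (intro suminf_nonneg) auto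
    show "integrable M (fluctuation d n)" for n by (rule fluctuation_mean[OF assms(1,2)])
    then show "fluctuation d n \<in> borel_measurable M" for n by auto
    show "\<forall>\<^sub>F n in sequentially. expectation (fluctuation d n) \<le> \<kappa> * \<eta>"
      using fluctuation_mean(2)[OF assms(1,2)] assms(3) by (intro always_eventually allI) (meson order_trans)
  qed (rule assms)
  then show ?thesis using assms(4) by simp
qed

end

lemma (in prob_space) mostly_weaken: "mostly \<eta> Q ==> \<eta> \<le> \<zeta> ==> mostly \<zeta> Q"
  unfolding mostly_def by (elim eventually_mono) (meson order_trans)

text \<open>
  Concavity of the logarithm.  It reduces steps that are too large for a Taylor expansion to steps
  of a fixed small size.
\<close>

lemma ln_one_plus_scaled:
  fixes y t :: real
  assumes "0 \<le> t" "t \<le> 1" "1 + y > 0"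
  shows "t * ln (1 + y) \<le> ln (1 + t * y)"
proof -
  have "(1 - t) * ln 1 + t * ln (1 + y) \<le> ln ((1 - t) *\<^sub>R 1 + t *\<^sub>R (1 + y))"
    using assms by (intro concave_onD[OF ln_concave]) auto
  moreover have "(1 - t) *\<^sub>R 1 + t *\<^sub>R (1 + y) = 1 + t * y" by (simp add: algebra_simps)
  ultimately show ?thesis by (simp only: ln_one mult_zero_right add_0)
qed

text \<open>
  For small steps the cubic bound applies and the resulting quadratic is maximised explicitly.  At
  the critical step size \<open>\<epsilon>0\<close> that quadratic is already nonpositive, because
  of \<open>big\<close>; by concavity the sum stays nonpositive for every larger step.
\<close>

lemma sum_ln_upper:
  fixes x :: "'i => real"
  assumes I: "finite I" "\<And>i. i \<in> I ==> 1 + \<epsilon> * x i > 0" and \<epsilon>: "\<epsilon> > 0" "\<epsilon>0 > 0" and n: "n > 0" and m: "m \<ge> 0"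
    and s1: "(\<Sum>i\<in>I. x i) \<le> sqrt n * m"
    and s2: "(\<Sum>i\<in>I. (x i)\<^sup>2) \<ge> n * (1 - 3 * \<tau>)"
    and s3: "\<epsilon>0 * (\<Sum>i\<in>I. \<bar>x i\<bar> ^ 3) \<le> n * \<tau>"
    and \<tau>: "4 * \<tau> < 1" and big: "sqrt n * \<epsilon>0 * (1 - 4 * \<tau>) \<ge> 2 * m"
  shows "2 * (\<Sum>i\<in>I. ln (1 + \<epsilon> * x i)) \<le> m\<^sup>2 / (1 - 4 * \<tau>)"
proof -
  define B where "B = 1 - 4 * \<tau>"
  have B: "B > 0" using \<tau> by (simp add: B_def)
  have core: "2 * (\<Sum>i\<in>I. ln (1 + \<delta> * x i)) \<le> 2 * (\<delta> * (sqrt n * m)) - n * \<delta>\<^sup>2 * B"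
    if d: "0 < \<delta>" "\<delta> \<le> \<epsilon>0" and pos: "\<And>i. i \<in> I ==> 1 + \<delta> * x i > 0" for \<delta>
  proof -
    have "ln (1 + \<delta> * x i) \<le> \<delta> * x i - \<delta>\<^sup>2 / 2 * (x i)\<^sup>2 + \<delta> ^ 3 / 3 * \<bar>x i\<bar> ^ 3" if "i \<in> I" for i
    proof -
      have "ln (1 + \<delta> * x i) \<le> \<delta> * x i - (\<delta> * x i)\<^sup>2 / 2 + (\<delta> * x i) ^ 3 / 3"
        using pos[OF that] by (intro ln_one_plus_le_cubic) simp
      moreover have "(\<delta> * x i) ^ 3 \<le> \<delta> ^ 3 * \<bar>x i\<bar> ^ 3"
      proof -
        have "(\<delta> * x i) ^ 3 \<le> \<bar>\<delta> * x i\<bar> ^ 3" by (metis abs_ge_self power_abs)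
        then show ?thesis using d by (simp add: abs_mult power_mult_distrib)
      qed
      ultimately show ?thesis by (simp add: power_mult_distrib)
    qed
    then have "(\<Sum>i\<in>I. ln (1 + \<delta> * x i)) \<le> (\<Sum>i\<in>I. \<delta> * x i - \<delta>\<^sup>2 / 2 * (x i)\<^sup>2 + \<delta> ^ 3 / 3 * \<bar>x i\<bar> ^ 3)"
      by (rule sum_mono)
    also have "\<dots> = \<delta> * (\<Sum>i\<in>I. x i) - \<delta>\<^sup>2 / 2 * (\<Sum>i\<in>I. (x i)\<^sup>2) + \<delta> ^ 3 / 3 * (\<Sum>i\<in>I. \<bar>x i\<bar> ^ 3)"
      by (simp add: sum.distrib sum_subtractf sum_distrib_left)
    also have "\<dots> \<le> \<delta> * (sqrt n * m) - \<delta>\<^sup>2 / 2 * (n * (1 - 3 * \<tau>)) + \<delta>\<^sup>2 / 2 * (n * \<tau>)"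
    proof (intro add_mono diff_mono)
      show "\<delta> * (\<Sum>i\<in>I. x i) \<le> \<delta> * (sqrt n * m)" using s1 d by (intro mult_left_mono) auto
      show "\<delta>\<^sup>2 / 2 * (n * (1 - 3 * \<tau>)) \<le> \<delta>\<^sup>2 / 2 * (\<Sum>i\<in>I. (x i)\<^sup>2)" using s2 by (intro mult_left_mono) auto
      have nn: "0 \<le> (\<Sum>i\<in>I. \<bar>x i\<bar> ^ 3)" by (intro sum_nonneg) auto
      have "\<delta> ^ 3 / 3 * (\<Sum>i\<in>I. \<bar>x i\<bar> ^ 3) = \<delta>\<^sup>2 / 3 * (\<delta> * (\<Sum>i\<in>I. \<bar>x i\<bar> ^ 3))"
        by (simp add: power3_eq_cube power2_eq_square)
      also have "\<dots> \<le> \<delta>\<^sup>2 / 3 * (\<epsilon>0 * (\<Sum>i\<in>I. \<bar>x i\<bar> ^ 3))"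
        using d nn by (intro mult_left_mono mult_right_mono) auto
      also have "\<dots> \<le> \<delta>\<^sup>2 / 2 * (\<epsilon>0 * (\<Sum>i\<in>I. \<bar>x i\<bar> ^ 3))"
        using \<epsilon> nn by (intro mult_right_mono mult_nonneg_nonneg) auto
      also have "\<dots> \<le> \<delta>\<^sup>2 / 2 * (n * \<tau>)" using s3 by (intro mult_left_mono) auto
      finally show "\<delta> ^ 3 / 3 * (\<Sum>i\<in>I. \<bar>x i\<bar> ^ 3) \<le> \<delta>\<^sup>2 / 2 * (n * \<tau>)" .
    qed
    finally have le: "(\<Sum>i\<in>I. ln (1 + \<delta> * x i)) \<le> \<delta> * (sqrt n * m) - \<delta>\<^sup>2 / 2 * (n * (1 - 3 * \<tau>)) + \<delta>\<^sup>2 / 2 * (n * \<tau>)" .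
    have "2 * (\<delta> * (sqrt n * m) - \<delta>\<^sup>2 / 2 * (n * (1 - 3 * \<tau>)) + \<delta>\<^sup>2 / 2 * (n * \<tau>)) = 2 * (\<delta> * (sqrt n * m)) - n * \<delta>\<^sup>2 * B"
      unfolding B_def by (simp add: field_simps)
    with le show ?thesis by argo
  qed
  show ?thesis
  proof (cases "\<epsilon> \<le> \<epsilon>0")
    case True
    have "(2 * (\<epsilon> * (sqrt n * m)) - n * \<epsilon>\<^sup>2 * B) * B \<le> m\<^sup>2"
    proof -
      have "0 \<le> (m - sqrt n * \<epsilon> * B)\<^sup>2" by simp
      also have "\<dots> = m\<^sup>2 - 2 * m * (sqrt n * \<epsilon> * B) + (sqrt n)\<^sup>2 * \<epsilon>\<^sup>2 * B\<^sup>2"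
        by (simp add: power2_diff power_mult_distrib)
      also have "(sqrt n)\<^sup>2 = n" using n by simp
      finally show ?thesis by (simp add: algebra_simps power2_eq_square)
    qed
    then have "2 * (\<epsilon> * (sqrt n * m)) - n * \<epsilon>\<^sup>2 * B \<le> m\<^sup>2 / B" using B by (simp add: pos_le_divide_eq)
    with core[OF \<epsilon>(1) True I(2)] show ?thesis by (simp add: B_def)
  next
    case False
    define t where "t = \<epsilon>0 / \<epsilon>"
    have t: "0 < t" "t \<le> 1" "t * \<epsilon> = \<epsilon>0" using False \<epsilon> by (auto simp: t_def)
    have le: "t * ln (1 + \<epsilon> * x i) \<le> ln (1 + \<epsilon>0 * x i)" if "i \<in> I" for i
      using ln_one_plus_scaled[of t "\<epsilon> * x i"] t I(2)[OF that] by (simp flip: mult.assoc)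
    have pos0: "1 + \<epsilon>0 * x i > 0" if "i \<in> I" for i
    proof -
      have "1 + \<epsilon>0 * x i = (1 - t) + t * (1 + \<epsilon> * x i)" using t(3) by (simp add: algebra_simps flip: mult.assoc)
      also have "\<dots> > 0" using mult_pos_pos[OF t(1) I(2)[OF that]] t by linarith
      finally show ?thesis .
    qed
    have "t * (2 * (\<Sum>i\<in>I. ln (1 + \<epsilon> * x i))) \<le> 2 * (\<Sum>i\<in>I. ln (1 + \<epsilon>0 * x i))"
    proof -
      have "(\<Sum>i\<in>I. t * ln (1 + \<epsilon> * x i)) \<le> (\<Sum>i\<in>I. ln (1 + \<epsilon>0 * x i))"
        by (rule sum_mono) (rule le)
      then have "t * (\<Sum>i\<in>I. ln (1 + \<epsilon> * x i)) \<le> (\<Sum>i\<in>I. ln (1 + \<epsilon>0 * x i))"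
        by (simp only: sum_distrib_left)
      then show ?thesis by argo
    qed
    also have "\<dots> \<le> 2 * (\<epsilon>0 * (sqrt n * m)) - n * \<epsilon>0\<^sup>2 * B"
      by (rule core) (use \<epsilon> pos0 in auto)
    also have "\<dots> = \<epsilon>0 * sqrt n * (2 * m - sqrt n * \<epsilon>0 * B)"
    proof -
      have "n = sqrt n * sqrt n" using n by simp
      then have "n * \<epsilon>0\<^sup>2 * B = \<epsilon>0 * sqrt n * (sqrt n * \<epsilon>0 * B)" by (metis (no_types) mult.assoc mult.commute power2_eq_square)
      then show ?thesis by (simp add: right_diff_distrib)
    qed
    also have "\<dots> \<le> 0" using big \<epsilon> n by (intro mult_nonneg_nonpos) (auto simp: B_def)
    finally have "2 * (\<Sum>i\<in>I. ln (1 + \<epsilon> * x i)) \<le> 0" using t by (simp add: mult_le_0_iff)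
    also have "0 \<le> m\<^sup>2 / (1 - 4 * \<tau>)" using \<tau> by simp
    finally show ?thesis .
  qed
qed

text \<open>
  The relation \<open>R\<close> collects the pairs of a direction and a step that are realised by
  the model.  A score may vanish identically, because the quotient by a zero distance is zero.
\<close>

locale lr_model = sampled_series_class M P X S c w e A
  for M :: "'w measure" and P :: "'x measure" and X S c w e A +
  fixes R :: "(('x => real) \<times> real) set" and L :: "nat => 'w => real"
  assumes S_mean: "\<And>s. s \<in> S ==> (LINT x|P. s x) = 0"
    and S_norm: "\<And>s. s \<in> S ==> (LINT x|P. (s x)\<^sup>2) = 1 \<or> (\<forall>x\<in>space P. s x = 0)"
    and R_S: "\<And>s \<epsilon>. (s, \<epsilon>) \<in> R ==> s \<in> S \<and> 0 \<le> \<epsilon> \<and> (\<forall>x\<in>space P. 1 + \<epsilon> * s x > 0)"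
    and R_ex: "\<And>s. s \<in> S ==> \<exists>\<epsilon>0>0. \<forall>\<epsilon>. 0 \<le> \<epsilon> \<and> \<epsilon> \<le> \<epsilon>0 \<longrightarrow> (s, \<epsilon>) \<in> R"
    and L_nonneg: "\<And>n \<omega>. n \<ge> 1 ==> \<omega> \<in> space M ==> 0 \<le> L n \<omega>"
    and L_lower: "\<And>n \<omega> s \<epsilon>. n \<ge> 1 ==> \<omega> \<in> space M ==> (s, \<epsilon>) \<in> R ==>
        2 * (\<Sum>i=1..n. ln (1 + \<epsilon> * s (X i \<omega>))) \<le> L n \<omega>"
    and L_upper: "\<And>n \<omega>. n \<ge> 1 ==> \<omega> \<in> space M ==> L n \<omega> = 0 \<or>
        (\<exists>s \<epsilon>. (s, \<epsilon>) \<in> R \<and> L n \<omega> = 2 * (\<Sum>i=1..n. ln (1 + \<epsilon> * s (X i \<omega>))))"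
    and L_measurable: "\<And>n. n \<ge> 1 ==> L n \<in> borel_measurable M"
begin

lemma S_square_integrable: "s \<in> S ==> integrable P (\<lambda>x. (s x)\<^sup>2)"
  by (rule S_power_integrable) auto

lemma mostly_L_ge:
  assumes s: "s \<in> S" and pos: "\<eta> > 0" "\<kappa> > 0"
  shows "mostly \<kappa> (\<lambda>n \<omega>. (max (emp n s \<omega>) 0)\<^sup>2 - \<eta> \<le> L n \<omega>)"
proof (cases "\<forall>x\<in>space P. s x = 0")
  case True
  have "(LINT x|P. s x) = 0" by (rule S_mean[OF s])
  then have "emp n s \<omega> = 0" if "\<omega> \<in> space M" for n \<omega>
    unfolding emp_def using True X_space[OF _ that] by (simp add: sum.neutral)
  then have "mostly 0 (\<lambda>n \<omega>. (max (emp n s \<omega>) 0)\<^sup>2 - \<eta> \<le> L n \<omega>)"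
    unfolding mostly_def
    by (intro eventually_mono[OF eventually_ge_at_top[of 1]] bexI[of _ "{}"])
       (use L_nonneg pos in \<open>auto intro: order_trans[of _ 0]\<close>)
  then show ?thesis by (rule mostly_weaken) (use pos in simp)
next
  case False
  then have norm: "(LINT x|P. (s x)\<^sup>2) = 1" using S_norm[OF s] by blast
  obtain \<epsilon>0 where e0: "\<epsilon>0 > 0" "\<And>\<epsilon>. 0 \<le> \<epsilon> ==> \<epsilon> \<le> \<epsilon>0 ==> (s, \<epsilon>) \<in> R" using R_ex[OF s] by blast
  have i4: "integrable P (\<lambda>x. s x ^ 4)" by (rule S_power_integrable[OF s]) simp
  show ?thesis
  proof (rule mostly_mono[OF likelihood_lower_bound[OF S_measurable[OF s] S_mean[OF s] norm i4 pos e0(1)]])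
    show "\<forall>\<^sub>F n in sequentially. \<forall>\<omega>\<in>space M.
       (\<exists>\<epsilon>. 0 \<le> \<epsilon> \<and> \<epsilon> \<le> \<epsilon>0 \<and> (max (emp n s \<omega>) 0)\<^sup>2 - \<eta> \<le> 2 * (\<Sum>i=1..n. ln (1 + \<epsilon> * s (X i \<omega>)))) \<longrightarrow>
       (max (emp n s \<omega>) 0)\<^sup>2 - \<eta> \<le> L n \<omega>"
      using eventually_ge_at_top[of 1]
    proof (eventually_elim, intro ballI impI, elim exE conjE)
      fix n \<omega> \<epsilon> assume "(1::nat) \<le> n" "\<omega> \<in> space M" "0 \<le> \<epsilon>" "\<epsilon> \<le> \<epsilon>0"
        "(max (emp n s \<omega>) 0)\<^sup>2 - \<eta> \<le> 2 * (\<Sum>i=1..n. ln (1 + \<epsilon> * s (X i \<omega>)))"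
      then show "(max (emp n s \<omega>) 0)\<^sup>2 - \<eta> \<le> L n \<omega>"
        using L_lower[of n \<omega> s \<epsilon>] e0(2) by force
    qed
  qed
qed

text \<open>
  Every direction is replaced by a neighbour in a finite net, at the price of one fluctuation
  term; the remaining estimates are laws of large numbers for the net and for the dominating
  function.
\<close>

lemma L_upper_bound:
  assumes \<eta>: "0 < \<eta>" "\<eta> \<le> 1" and \<kappa>: "\<kappa> > 0"
  shows "\<exists>F. finite F \<and> F \<subseteq> S \<and>
    mostly \<kappa> (\<lambda>n \<omega>. \<forall>a\<ge>0. (\<forall>t\<in>F. emp n t \<omega> \<le> a) \<longrightarrow> L n \<omega> \<le> (1 + \<eta>) * (a + \<eta>)\<^sup>2)"
proof -
  define \<tau> where "\<tau> = \<eta> / 8"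
  have \<tau>: "0 < \<tau>" "4 * \<tau> < 1" using \<eta> by (auto simp: \<tau>_def)
  define k where "k = \<kappa> / 5"
  have k: "k > 0" using \<kappa> by (simp add: k_def)
  define W where "W = suminf w"
  have W: "W \<ge> 0" using W_nonneg by (simp add: W_def)
  define I2 where "I2 = (LINT x|P. (A x)\<^sup>2)"
  have I2: "I2 \<ge> 0" by (simp add: I2_def)
  obtain C2 where C2: "C2 > 0" "mostly k (\<lambda>n \<omega>. avg n (\<lambda>x. (A x)\<^sup>2) \<omega> < C2)"
    using mostly_avg_le[OF A_integrable(2) _ k] by auto
  obtain C3 where C3: "C3 > 0" "mostly k (\<lambda>n \<omega>. avg n (\<lambda>x. A x ^ 3) \<omega> < C3)"
    using mostly_avg_le[OF A_integrable(3) _ k] A_nonneg by auto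
  define Q where "Q = (2 * W + 1) * (C2 + I2 + 1)"
  have Q: "Q > 0" unfolding Q_def using W C2 I2 by (intro mult_pos_pos) auto
  (* mesh of the net: small enough for the fluctuation term and for the change of squares *)
  define D where "D = min (k * \<eta> / (sqrt I2 + 1)) (\<tau> / Q)"
  have D0: "D > 0"
    unfolding D_def using k \<eta> I2 Q \<tau> by (auto simp: add_nonneg_pos intro!: divide_pos_pos mult_pos_pos)
  have D1: "D * sqrt I2 \<le> k * \<eta>"
  proof -
    have "D * sqrt I2 \<le> D * (sqrt I2 + 1)" using D0 by (intro mult_left_mono) auto
    also have "\<dots> \<le> k * \<eta> / (sqrt I2 + 1) * (sqrt I2 + 1)"
      unfolding D_def using I2 by (intro mult_right_mono) auto
    also have "\<dots> = k * \<eta>"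
    proof -
      have "sqrt I2 + 1 \<noteq> 0" using real_sqrt_ge_zero[OF I2] by linarith
      then show ?thesis by simp
    qed
    finally show ?thesis .
  qed
  have D2: "2 * W * D * z \<le> \<tau>" if z: "0 \<le> z" "z \<le> C2 + I2 + 1" for z
  proof -
    have "2 * W * D * z = D * ((2 * W) * z)" by simp
    also have "\<dots> \<le> D * Q"
      unfolding Q_def using D0 W z by (intro mult_left_mono mult_mono) auto
    also have "\<dots> \<le> \<tau> / Q * Q"
      using Q unfolding D_def by (intro mult_right_mono) auto
    also have "\<dots> = \<tau>" using Q by simp
    finally show ?thesis .
  qed
  obtain F d where F: "finite F" "F \<subseteq> S" and d: "summable d" "\<And>k. 0 \<le> d k" "suminf d \<le> D"
    and net: "\<And>s. s \<in> S ==> \<exists>t\<in>F. \<forall>k. \<bar>c s k - c t k\<bar> \<le> d k"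
    using finite_coefficient_net[where S=S and c=c and w=w and \<delta>=D, OF w_summable w_nonneg c_bound D0] by metis
  define k' where "k' = k / (card F + 1)"
  have k': "k' > 0" "card F * k' \<le> k" using k by (auto simp: k'_def field_simps)
  have sd: "suminf d \<ge> 0" using d by (simp add: suminf_nonneg)
  have fl: "mostly k (\<lambda>n \<omega>. fluctuation d n \<omega> < \<eta>)"
  proof (rule mostly_fluctuation[OF d(1,2) _ \<eta>(1)])
    have "suminf d * sqrt I2 \<le> D * sqrt I2" using d(3) I2 by (intro mult_right_mono) auto
    then show "suminf d * sqrt (LINT x|P. (A x)\<^sup>2) \<le> k * \<eta>" using D1 by (simp add: I2_def)
  qed
  have mono: "mostly k Q" if "mostly (card F * k') Q" for Q
    by (rule mostly_weaken[OF that k'(2)])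
  have norms: "mostly k (\<lambda>n \<omega>. \<forall>t\<in>F. \<bar>avg n (\<lambda>x. (t x)\<^sup>2) \<omega> - (LINT x|P. (t x)\<^sup>2)\<bar> < \<tau>)"
  proof (rule mono, rule mostly_finite_ball[OF F(1)])
    fix t assume "t \<in> F"
    then have t: "t \<in> S" using F by auto
    have "integrable P (\<lambda>x. ((t x)\<^sup>2)\<^sup>2)" using S_power_integrable[OF t, of 4] by (simp flip: power_mult)
    then show "mostly k' (\<lambda>n \<omega>. \<bar>avg n (\<lambda>x. (t x)\<^sup>2) \<omega> - (LINT x|P. (t x)\<^sup>2)\<bar> < \<tau>)"
      using S_measurable[OF t] by (intro mostly_avg_close k' \<tau>) auto
  qed
  have "\<forall>t\<in>F. \<exists>K>0. mostly k' (\<lambda>n \<omega>. \<bar>emp n t \<omega>\<bar> < K)"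
    using F S_measurable S_square_integrable k' by (intro ballI mostly_emp_le) auto
  then obtain Kf where Kf: "\<And>t. t \<in> F ==> Kf t > 0 \<and> mostly k' (\<lambda>n \<omega>. \<bar>emp n t \<omega>\<bar> < Kf t)" by metis
  define K where "K = (\<Sum>t\<in>F. Kf t)"
  have K: "K \<ge> 0" "\<And>t. t \<in> F ==> Kf t \<le> K"
    unfolding K_def using Kf F by (auto intro!: sum_nonneg member_le_sum simp: less_imp_le)
  have bd: "mostly k (\<lambda>n \<omega>. \<forall>t\<in>F. \<bar>emp n t \<omega>\<bar> < Kf t)"
    by (rule mono, rule mostly_finite_ball[OF F(1)]) (use Kf in auto)
  define \<epsilon>0 where "\<epsilon>0 = \<tau> / (W ^ 3 * C3 + 1)"
  have e0: "\<epsilon>0 > 0" "\<epsilon>0 * (W ^ 3 * C3) \<le> \<tau>"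
  proof -
    have p: "W ^ 3 * C3 \<ge> 0" using W C3 by (intro mult_nonneg_nonneg) auto
    then show "\<epsilon>0 > 0" using \<tau> unfolding \<epsilon>0_def by (intro divide_pos_pos) auto
    have "\<epsilon>0 * (W ^ 3 * C3) = \<tau> * (W ^ 3 * C3 / (W ^ 3 * C3 + 1))" by (simp add: \<epsilon>0_def)
    also have "\<dots> \<le> \<tau> * 1" using p \<tau> by (intro mult_left_mono) (auto simp: divide_le_eq)
    finally show "\<epsilon>0 * (W ^ 3 * C3) \<le> \<tau>" by simp
  qed
  have ev: "\<forall>\<^sub>F n in sequentially. sqrt (real n) \<ge> 2 * (K + \<eta>) / (\<epsilon>0 * (1 - 4 * \<tau>))"
    using filterlim_compose[OF sqrt_at_top filterlim_real_sequentially] by (simp only: filterlim_at_top)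
  have "mostly (k + (k + (k + (k + k)))) (\<lambda>n \<omega>. avg n (\<lambda>x. (A x)\<^sup>2) \<omega> < C2 \<and> avg n (\<lambda>x. A x ^ 3) \<omega> < C3 \<and>
     fluctuation d n \<omega> < \<eta> \<and> (\<forall>t\<in>F. \<bar>avg n (\<lambda>x. (t x)\<^sup>2) \<omega> - (LINT x|P. (t x)\<^sup>2)\<bar> < \<tau>) \<and> (\<forall>t\<in>F. \<bar>emp n t \<omega>\<bar> < Kf t))"
    by (intro mostly_conj C2 C3 fl norms bd)
  then have "mostly \<kappa> (\<lambda>n \<omega>. \<forall>a\<ge>0. (\<forall>t\<in>F. emp n t \<omega> \<le> a) \<longrightarrow> L n \<omega> \<le> (1 + \<eta>) * (a + \<eta>)\<^sup>2)"
    unfolding k_def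
  proof (simp, elim mostly_mono)
    show "\<forall>\<^sub>F n in sequentially. \<forall>\<omega>\<in>space M. avg n (\<lambda>x. (A x)\<^sup>2) \<omega> < C2 \<and> avg n (\<lambda>x. A x ^ 3) \<omega> < C3 \<and>
     fluctuation d n \<omega> < \<eta> \<and> (\<forall>t\<in>F. \<bar>avg n (\<lambda>x. (t x)\<^sup>2) \<omega> - (LINT x|P. (t x)\<^sup>2)\<bar> < \<tau>) \<and> (\<forall>t\<in>F. \<bar>emp n t \<omega>\<bar> < Kf t)
     \<longrightarrow> (\<forall>a\<ge>0. (\<forall>t\<in>F. emp n t \<omega> \<le> a) \<longrightarrow> L n \<omega> \<le> (1 + \<eta>) * (a + \<eta>)\<^sup>2)"
      using ev eventually_ge_at_top[of 1]
    proof (eventually_elim, intro ballI allI impI, elim conjE)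
      fix n \<omega> and a :: real
      assume big: "2 * (K + \<eta>) / (\<epsilon>0 * (1 - 4 * \<tau>)) \<le> sqrt (real n)" and n: "1 \<le> n" and w: "\<omega> \<in> space M"
        and a: "0 \<le> a" "\<forall>t\<in>F. emp n t \<omega> \<le> a"
        and c2: "avg n (\<lambda>x. (A x)\<^sup>2) \<omega> < C2" and c3: "avg n (\<lambda>x. A x ^ 3) \<omega> < C3" and fl: "fluctuation d n \<omega> < \<eta>"
        and nm: "\<forall>t\<in>F. \<bar>avg n (\<lambda>x. (t x)\<^sup>2) \<omega> - (LINT x|P. (t x)\<^sup>2)\<bar> < \<tau>" and bd: "\<forall>t\<in>F. \<bar>emp n t \<omega>\<bar> < Kf t"
      have Xs: "X i \<omega> \<in> space P" if "i \<in> {1..n}" for i using X_space[OF _ w] that by auto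
      have rhs0: "0 \<le> (1 + \<eta>) * (a + \<eta>)\<^sup>2" using \<eta> by simp
      consider "L n \<omega> = 0" | s \<epsilon> where "(s, \<epsilon>) \<in> R" "L n \<omega> = 2 * (\<Sum>i=1..n. ln (1 + \<epsilon> * s (X i \<omega>)))"
        using L_upper[OF n w] by blast
      then show "L n \<omega> \<le> (1 + \<eta>) * (a + \<eta>)\<^sup>2"
      proof cases
        case 1
        then show ?thesis using rhs0 by simp
      next
        case (2 s \<epsilon>)
        note R = R_S[OF 2(1)]
        then have s: "s \<in> S" by simp
        show ?thesis
        proof (cases "\<epsilon> = 0 \<or> (\<forall>x\<in>space P. s x = 0)")
          case True
          then have "L n \<omega> = 0" unfolding 2(2) using Xs by (auto intro!: sum.neutral)
          then show ?thesis using rhs0 by simp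
        next
          case False
          then have norm: "(LINT x|P. (s x)\<^sup>2) = 1" and \<epsilon>: "\<epsilon> > 0" using S_norm[OF s] R by auto
          obtain t where t: "t \<in> F" "\<And>k. \<bar>c s k - c t k\<bar> \<le> d k" using net[OF s] by blast
          then have tS: "t \<in> S" using F by auto
          (* capping a at K keeps the required sample size independent of a *)
          define m where "m = min a K + \<eta>"
          have m: "0 \<le> m" "m \<le> K + \<eta>" "m \<le> a + \<eta>" using a K \<eta> by (auto simp: m_def)
          have emps: "emp n s \<omega> \<le> m"
          proof -
            have "\<bar>emp n s \<omega> - emp n t \<omega>\<bar> < \<eta>"
              using emp_diff_le_fluctuation[OF s tS d(1) t(2) w, of n] fl by linarith
            moreover have "emp n t \<omega> \<le> a" "emp n t \<omega> \<le> K" using a t bd K(2)[OF t(1)] by force+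
            ultimately show ?thesis unfolding m_def by linarith
          qed
          have sn: "sqrt n > 0" "real n > 0" using n by auto
          have q1: "(\<Sum>i=1..n. s (X i \<omega>)) \<le> sqrt n * m"
            using emps sn unfolding emp_def S_mean[OF s] by (simp add: pos_divide_le_eq mult.commute)
          have sqd: "\<bar>(s x)\<^sup>2 - (t x)\<^sup>2\<bar> \<le> 2 * W * suminf d * (A x)\<^sup>2" if "x \<in> space P" for x
            using S_square_diff[OF s tS d(1) t(2) that] by (simp add: W_def)
          have shrink: "2 * W * suminf d * z \<le> \<tau>" if "0 \<le> z" "z \<le> C2 + I2 + 1" for z
          proof -
            have "2 * W * suminf d * z \<le> 2 * W * D * z" using W d(3) that by (intro mult_right_mono mult_left_mono) auto
            with D2[OF that] show ?thesis by simp
          qed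
          have q2: "real n * (1 - 3 * \<tau>) \<le> (\<Sum>i=1..n. (s (X i \<omega>))\<^sup>2)"
          proof -
            have "avg n (\<lambda>x. (t x)\<^sup>2) \<omega> - avg n (\<lambda>x. (s x)\<^sup>2) \<omega> \<le> \<tau>"
            proof -
              have "avg n (\<lambda>x. (t x)\<^sup>2) \<omega> - avg n (\<lambda>x. (s x)\<^sup>2) \<omega> = (\<Sum>i=1..n. (t (X i \<omega>))\<^sup>2 - (s (X i \<omega>))\<^sup>2) / n"
                unfolding avg_def by (simp add: sum_subtractf diff_divide_distrib)
              also have "\<dots> \<le> (\<Sum>i=1..n. 2 * W * suminf d * (A (X i \<omega>))\<^sup>2) / n"
                using sqd[OF Xs] by (intro divide_right_mono sum_mono) (force simp: abs_le_iff)+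
              also have "\<dots> = 2 * W * suminf d * avg n (\<lambda>x. (A x)\<^sup>2) \<omega>"
                unfolding avg_def by (simp add: sum_distrib_left)
              also have "\<dots> \<le> \<tau>"
              proof (rule shrink)
                show "0 \<le> avg n (\<lambda>x. (A x)\<^sup>2) \<omega>" unfolding avg_def by (intro divide_nonneg_nonneg sum_nonneg) auto
                show "avg n (\<lambda>x. (A x)\<^sup>2) \<omega> \<le> C2 + I2 + 1" using c2 I2 by linarith
              qed
              finally show ?thesis .
            qed
            moreover have "(LINT x|P. (s x)\<^sup>2) - (LINT x|P. (t x)\<^sup>2) \<le> \<tau>"
            proof -
              note sis = S_square_integrable[OF s] S_square_integrable[OF tS]
              have "(LINT x|P. (s x)\<^sup>2) - (LINT x|P. (t x)\<^sup>2) = (LINT x|P. (s x)\<^sup>2 - (t x)\<^sup>2)"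
                using sis by simp
              also have "\<dots> \<le> (LINT x|P. 2 * W * suminf d * (A x)\<^sup>2)"
                using sis A_integrable sqd by (intro integral_mono) (force simp: abs_le_iff)+
              also have "\<dots> = 2 * W * suminf d * I2" by (simp add: I2_def)
              also have "\<dots> \<le> \<tau>" using I2 C2 by (intro shrink) auto
              finally show ?thesis .
            qed
            moreover have "\<bar>avg n (\<lambda>x. (t x)\<^sup>2) \<omega> - (LINT x|P. (t x)\<^sup>2)\<bar> < \<tau>" using nm t by blast
            ultimately have "1 - 3 * \<tau> \<le> avg n (\<lambda>x. (s x)\<^sup>2) \<omega>" using norm by linarith
            then show ?thesis using sn unfolding avg_def by (simp add: pos_le_divide_eq mult.commute)
          qed
          have q3: "\<epsilon>0 * (\<Sum>i=1..n. \<bar>s (X i \<omega>)\<bar> ^ 3) \<le> real n * \<tau>"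
          proof -
            have "(\<Sum>i=1..n. \<bar>s (X i \<omega>)\<bar> ^ 3) \<le> (\<Sum>i=1..n. (W * A (X i \<omega>)) ^ 3)"
              using S_bound[OF s Xs] by (intro sum_mono power_mono) (auto simp: W_def)
            also have "\<dots> = real n * (W ^ 3 * avg n (\<lambda>x. A x ^ 3) \<omega>)"
              unfolding avg_def power_mult_distrib sum_distrib_left[symmetric] using sn by simp
            also have "\<dots> \<le> real n * (W ^ 3 * C3)" using c3 W by (intro mult_left_mono) auto
            finally have "\<epsilon>0 * (\<Sum>i=1..n. \<bar>s (X i \<omega>)\<bar> ^ 3) \<le> \<epsilon>0 * (real n * (W ^ 3 * C3))"
              using e0 by (intro mult_left_mono) auto
            also have "\<dots> = real n * (\<epsilon>0 * (W ^ 3 * C3))" by simp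
            also have "\<dots> \<le> real n * \<tau>" using e0 by (intro mult_left_mono) auto
            finally show ?thesis .
          qed
          have q4: "2 * m \<le> sqrt (real n) * \<epsilon>0 * (1 - 4 * \<tau>)"
          proof -
            have "\<epsilon>0 * (1 - 4 * \<tau>) > 0" using e0 \<tau> by (intro mult_pos_pos) auto
            then have "2 * (K + \<eta>) \<le> sqrt n * (\<epsilon>0 * (1 - 4 * \<tau>))" using big by (simp add: pos_divide_le_eq)
            then show ?thesis using m by (simp add: mult.assoc)
          qed
          have "L n \<omega> \<le> m\<^sup>2 / (1 - 4 * \<tau>)"
            unfolding 2(2)
            by (rule sum_ln_upper[OF _ _ \<epsilon> e0(1) sn(2) m(1) q1 q2 q3 \<tau>(2) q4]) (use R Xs in auto)
          also have "\<dots> \<le> (1 + \<eta>) * m\<^sup>2"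
          proof -
            have "1 \<le> (1 + \<eta>) * (1 - 4 * \<tau>)"
            proof -
              have "(1 + \<eta>) * (1 - 4 * \<tau>) - 1 = \<eta> * (1 - \<eta>) / 2" by (simp add: \<tau>_def field_simps)
              also have "\<dots> \<ge> 0" using \<eta> by simp
              finally show ?thesis by simp
            qed
            then have "m\<^sup>2 * 1 \<le> m\<^sup>2 * ((1 + \<eta>) * (1 - 4 * \<tau>))" by (intro mult_left_mono) auto
            then show ?thesis using \<tau> by (simp add: pos_divide_le_eq mult_ac)
          qed
          also have "\<dots> \<le> (1 + \<eta>) * (a + \<eta>)\<^sup>2" using m \<eta> by (intro mult_left_mono power_mono) auto
          finally show ?thesis .
        qed
      qed
    qed
  qed
  then show ?thesis using F by blast
qed

end

section \<open>Gaussian processes\<close>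

lemma gaussian_measure_eq_distr:
  assumes "\<sigma> \<ge> 0"
  shows "gaussian_measure m \<sigma> = distr std_normal_distribution borel (\<lambda>z. m + \<sigma> * z)"
proof -
  interpret Z: prob_space std_normal_distribution
    using prob_space_normal_density[of 1 0] by simp
  show ?thesis
  proof (cases "\<sigma> = 0")
    case True
    then show ?thesis by (simp add: gaussian_measure_def Z.distr_const)
  next
    case False
    have "distributed std_normal_distribution lborel (\<lambda>x. x) std_normal_density"
      by (simp add: distributed_def distr_id2)
    from Z.normal_density_affine[OF this, of \<sigma> m] False assms
    have "distributed std_normal_distribution lborel (\<lambda>z. m + \<sigma> * z) (normal_density m \<sigma>)" by simp
    then have "distr std_normal_distribution lborel (\<lambda>z. m + \<sigma> * z) = density lborel (normal_density m \<sigma>)"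
      by (simp add: distributed_def)
    moreover have "distr std_normal_distribution lborel (\<lambda>z. m + \<sigma> * z) = distr std_normal_distribution borel (\<lambda>z. m + \<sigma> * z)"
      by (rule distr_cong) auto
    ultimately show ?thesis using False by (simp add: gaussian_measure_def)
  qed
qed

lemma affine_image_moments:
  fixes Z :: "real measure" and m \<sigma> t :: real
  assumes "prob_space Z" and sZ: "sets Z = sets borel"
    and i1: "integrable Z (\<lambda>x. x)" "integrable Z (\<lambda>x. x\<^sup>2)"
    and z: "(LINT x|Z. x) = 0" "(LINT x|Z. x\<^sup>2) = 1"
  defines "D \<equiv> distr Z borel (\<lambda>z. m + \<sigma> * z)"
  shows "integrable D (\<lambda>x. x)" "(LINT x|D. x) = m" "integrable D (\<lambda>x. x\<^sup>2)" "(LINT x|D. x\<^sup>2) = m\<^sup>2 + \<sigma>\<^sup>2"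
    "(CLINT x|D. iexp (t * x)) = iexp (t * m) * char Z (t * \<sigma>)"
proof -
  interpret prob_space Z by fact
  note [measurable_cong] = sZ
  have m: "(\<lambda>z. m + \<sigma> * z) \<in> measurable Z borel" by measurable
  have eq: "(m + \<sigma> * x)\<^sup>2 = m\<^sup>2 + 2 * m * \<sigma> * x + \<sigma>\<^sup>2 * x\<^sup>2" for x
    by (simp add: power2_eq_square algebra_simps)
  have i: "integrable Z (\<lambda>z. \<sigma> * z)" "integrable Z (\<lambda>z. 2 * m * \<sigma> * z)" "integrable Z (\<lambda>z. \<sigma>\<^sup>2 * z\<^sup>2)"
      "integrable Z (\<lambda>z. m\<^sup>2)" "integrable Z (\<lambda>z. m)"
    by (intro integrable_mult_right i1 integrable_const)+
  show "integrable D (\<lambda>x. x)"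
    unfolding D_def by (subst integrable_distr_eq[OF m]) (simp, intro Bochner_Integration.integrable_add i)
  have "(LINT x|D. x) = (LINT z|Z. m + \<sigma> * z)"
    unfolding D_def by (rule integral_distr[OF m]) simp
  also have "\<dots> = (LINT z|Z. m) + (LINT z|Z. \<sigma> * z)"
    by (intro Bochner_Integration.integral_add i)
  also have "(LINT z|Z. \<sigma> * z) = \<sigma> * (LINT z|Z. z)" by (rule integral_mult_right_zero)
  finally show "(LINT x|D. x) = m" using z by (simp add: prob_space)
  show "integrable D (\<lambda>x. x\<^sup>2)"
    unfolding D_def by (subst integrable_distr_eq[OF m]) (simp, unfold eq, intro Bochner_Integration.integrable_add i)
  have "(LINT x|D. x\<^sup>2) = (LINT z|Z. m\<^sup>2 + 2 * m * \<sigma> * z + \<sigma>\<^sup>2 * z\<^sup>2)"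
    unfolding D_def eq[symmetric] by (rule integral_distr[OF m]) simp
  also have "\<dots> = (LINT z|Z. m\<^sup>2 + 2 * m * \<sigma> * z) + (LINT z|Z. \<sigma>\<^sup>2 * z\<^sup>2)"
    by (intro Bochner_Integration.integral_add Bochner_Integration.integrable_add i)
  also have "(LINT z|Z. m\<^sup>2 + 2 * m * \<sigma> * z) = (LINT z|Z. m\<^sup>2) + (LINT z|Z. 2 * m * \<sigma> * z)"
    by (intro Bochner_Integration.integral_add i)
  also have "(LINT z|Z. 2 * m * \<sigma> * z) = 2 * m * \<sigma> * (LINT z|Z. z)" by (rule integral_mult_right_zero)
  also have "(LINT z|Z. \<sigma>\<^sup>2 * z\<^sup>2) = \<sigma>\<^sup>2 * (LINT z|Z. z\<^sup>2)" by (rule integral_mult_right_zero)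
  finally show "(LINT x|D. x\<^sup>2) = m\<^sup>2 + \<sigma>\<^sup>2" unfolding z by (simp add: prob_space)
  have ie: "iexp (t * (m + \<sigma> * z)) = iexp (t * m) * iexp ((t * \<sigma>) * z)" for z
    unfolding exp_add[symmetric] by (rule arg_cong[of _ _ exp]) (simp add: algebra_simps)
  have "(CLINT x|D. iexp (t * x)) = (CLINT z|Z. iexp (t * (m + \<sigma> * z)))"
    unfolding D_def by (rule integral_distr[OF m]) measurable
  also have "\<dots> = iexp (t * m) * char Z (t * \<sigma>)"
    unfolding ie char_def by (rule integral_mult_right_zero)
  finally show "(CLINT x|D. iexp (t * x)) = iexp (t * m) * char Z (t * \<sigma>)" .
qed

lemma gaussian_measure_moments:
  assumes "\<sigma> \<ge> 0"
  shows "integrable (gaussian_measure m \<sigma>) (\<lambda>x. x)" "(LINT x|gaussian_measure m \<sigma>. x) = m"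
    "integrable (gaussian_measure m \<sigma>) (\<lambda>x. x\<^sup>2)" "(LINT x|gaussian_measure m \<sigma>. x\<^sup>2) = m\<^sup>2 + \<sigma>\<^sup>2"
    "(CLINT x|gaussian_measure m \<sigma>. iexp (t * x)) = iexp (t * m) * complex_of_real (exp (- (t\<^sup>2 * \<sigma>\<^sup>2) / 2))"
proof -
  have p: "prob_space std_normal_distribution"
    using prob_space_normal_density[of 1 0] by simp
  have s: "sets std_normal_distribution = sets borel" by simp
  have i1: "integrable std_normal_distribution (\<lambda>x. x)" "integrable std_normal_distribution (\<lambda>x. x\<^sup>2)"
    using integrable_std_normal_distribution_moment[of 1] integrable_std_normal_distribution_moment[of 2] by (simp_all only: power_one_right)
  have z: "(LINT x|std_normal_distribution. x) = 0" "(LINT x|std_normal_distribution. x\<^sup>2) = 1"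
    using integral_std_normal_distribution_moment_odd[of 1] std_normal_distribution_even_moments(1)[of 1] by (auto simp: fact_numeral)
  note g = gaussian_measure_eq_distr[OF assms] and A = affine_image_moments[OF p s i1 z]
  show "integrable (gaussian_measure m \<sigma>) (\<lambda>x. x)" unfolding g by (rule A)
  show "(LINT x|gaussian_measure m \<sigma>. x) = m" unfolding g by (rule A)
  show "integrable (gaussian_measure m \<sigma>) (\<lambda>x. x\<^sup>2)" unfolding g by (rule A)
  show "(LINT x|gaussian_measure m \<sigma>. x\<^sup>2) = m\<^sup>2 + \<sigma>\<^sup>2" unfolding g by (rule A)
  show "(CLINT x|gaussian_measure m \<sigma>. iexp (t * x)) = iexp (t * m) * complex_of_real (exp (- (t\<^sup>2 * \<sigma>\<^sup>2) / 2))"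
    unfolding g A(5) by (simp only: char_std_normal_distribution power_mult_distrib)
qed

lemma centered_gaussian_moments:
  assumes C: "centered_gaussian_process N S K G" and s: "s \<in> S"
  shows "G s \<in> borel_measurable N" "integrable N (G s)" "integrable N (\<lambda>\<omega>. (G s \<omega>)\<^sup>2)" "(LINT \<omega>|N. (G s \<omega>)\<^sup>2) = K s s"
proof -
  show m: "G s \<in> borel_measurable N" using C s by (auto simp: centered_gaussian_process_def)
  have "\<forall>F c. finite F \<and> F \<subseteq> S \<longrightarrow> (\<exists>m \<sigma>. \<sigma> \<ge> 0 \<and> distr N borel (\<lambda>\<omega>. \<Sum>s\<in>F. c s * G s \<omega>) = gaussian_measure m \<sigma>)"
    using C by (auto simp: centered_gaussian_process_def)
  from this[rule_format, of "{s}" "\<lambda>_. 1"] s obtain m \<sigma> where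
    g: "\<sigma> \<ge> 0" "distr N borel (G s) = gaussian_measure m \<sigma>" by auto
  show "integrable N (G s)" "integrable N (\<lambda>\<omega>. (G s \<omega>)\<^sup>2)"
    using gaussian_measure_moments(1,3)[OF g(1), of m] unfolding g(2)[symmetric]
    by (simp_all add: integrable_distr_eq[OF m])
  show "(LINT \<omega>|N. (G s \<omega>)\<^sup>2) = K s s"
    using C s by (simp add: centered_gaussian_process_def power2_eq_square)
qed

lemma centered_gaussian_char:
  fixes S :: "('x => real) set"
  assumes C: "centered_gaussian_process N S (L2_inner P) G"
    and meas: "\<And>s. s \<in> S ==> s \<in> borel_measurable P" and sq: "\<And>s. s \<in> S ==> integrable P (\<lambda>x. (s x)\<^sup>2)"
    and F: "finite F" "F \<subseteq> S"
  shows "(CLINT \<omega>|N. iexp (\<Sum>s\<in>F. u s * G s \<omega>)) = complex_of_real (exp (- (LINT x|P. (\<Sum>s\<in>F. u s * s x)\<^sup>2) / 2))"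
proof -
  note mom = centered_gaussian_moments[OF C]
  have FS: "s \<in> F ==> s \<in> S" for s using F by auto
  have [measurable]: "s \<in> F ==> G s \<in> borel_measurable N" for s using mom(1) FS by blast
  obtain m \<sigma> where g: "\<sigma> \<ge> 0" "distr N borel (\<lambda>\<omega>. \<Sum>s\<in>F. u s * G s \<omega>) = gaussian_measure m \<sigma>"
    using C F unfolding centered_gaussian_process_def by metis
  let ?Z = "\<lambda>\<omega>. \<Sum>s\<in>F. u s * G s \<omega>"
  have Z[measurable]: "?Z \<in> borel_measurable N" by measurable
  have "m = (LINT \<omega>|N. ?Z \<omega>)"
    using gaussian_measure_moments(2)[OF g(1), of m] unfolding g(2)[symmetric] by (simp add: integral_distr[OF Z])
  also have "\<dots> = (\<Sum>s\<in>F. u s * (LINT \<omega>|N. G s \<omega>))"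
    using mom(2)[OF FS] by (subst Bochner_Integration.integral_sum) auto
  also have "\<dots> = 0"
    using C FS by (intro sum.neutral ballI) (simp add: centered_gaussian_process_def)
  finally have m0: "m = 0" .
  have "\<sigma>\<^sup>2 = (LINT \<omega>|N. (?Z \<omega>)\<^sup>2)"
    using gaussian_measure_moments(4)[OF g(1), of m] unfolding g(2)[symmetric] by (simp add: integral_distr[OF Z] m0)
  also have "\<dots> = (\<Sum>s\<in>F. \<Sum>t\<in>F. u s * u t * (LINT \<omega>|N. G s \<omega> * G t \<omega>))"
    by (rule L2_sum(2)[OF F(1)]) (use mom FS in auto)
  also have "\<dots> = (\<Sum>s\<in>F. \<Sum>t\<in>F. u s * u t * (LINT x|P. s x * t x))"
    using C FS by (intro sum.cong refl) (simp add: centered_gaussian_process_def L2_inner_def)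
  also have "\<dots> = (LINT x|P. (\<Sum>s\<in>F. u s * s x)\<^sup>2)"
    by (rule L2_sum(2)[OF F(1), symmetric]) (use meas sq FS in auto)
  finally have \<sigma>: "\<sigma>\<^sup>2 = (LINT x|P. (\<Sum>s\<in>F. u s * s x)\<^sup>2)" .
  have "(CLINT \<omega>|N. iexp (?Z \<omega>)) = (CLINT x|distr N borel ?Z. iexp (1 * x))"
    unfolding mult_1 by (rule integral_distr[OF Z, symmetric]) measurable
  also have "\<dots> = complex_of_real (exp (- (\<sigma>\<^sup>2) / 2))"
    unfolding g(2) gaussian_measure_moments(5)[OF g(1)] m0 by simp
  finally show ?thesis unfolding \<sigma> .
qed

context series_class
begin

lemma L2_dist_le:
  assumes "s \<in> S" "t \<in> S" "summable d" "\<And>k. \<bar>c s k - c t k\<bar> \<le> d k"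
  shows "L2_dist P s t \<le> suminf d * sqrt (LINT x|P. (A x)\<^sup>2)"
proof -
  have d0: "0 \<le> d k" for k using assms(4)[of k] by linarith
  have sd: "0 \<le> suminf d" using assms(3) d0 by (simp add: suminf_nonneg)
  have [measurable]: "s \<in> borel_measurable P" "t \<in> borel_measurable P" using S_measurable assms by auto
  have b: "\<bar>s x - t x\<bar> \<le> suminf d * A x" if "x \<in> space P" for x by (rule S_diff[OF assms that])
  have "(LINT x|P. (s x - t x)\<^sup>2) \<le> (LINT x|P. (suminf d)\<^sup>2 * (A x)\<^sup>2)"
  proof (rule integral_mono)
    show "integrable P (\<lambda>x. (s x - t x)\<^sup>2)" by (rule bounded_by_A_integrable[OF _ b]) auto
    show "(s x - t x)\<^sup>2 \<le> (suminf d)\<^sup>2 * (A x)\<^sup>2" if "x \<in> space P" for x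
      using power_mono[OF b[OF that], of 2] by (simp add: power_mult_distrib)
  qed (use A_integrable in auto)
  also have "\<dots> = (suminf d)\<^sup>2 * (LINT x|P. (A x)\<^sup>2)" by simp
  finally have "L2_dist P s t \<le> sqrt ((suminf d)\<^sup>2 * (LINT x|P. (A x)\<^sup>2))"
    unfolding L2_dist_def by (rule real_sqrt_le_mono)
  also have "\<dots> = suminf d * sqrt (LINT x|P. (A x)\<^sup>2)" using sd by (simp add: real_sqrt_mult)
  finally show ?thesis .
qed

text \<open>
  Nearby coefficients give nearby functions in \<open>L\<^sub>2\<close>, so the union of the
  finite nets is dense and the uniform continuity of the paths extends inequalities from it to the
  whole class.
\<close>

lemma dense_finite_sets:
  fixes G :: "('x => real) => 'v => real"
  assumes uc: "bounded_uc_paths N S (L2_dist P) G"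
  shows "\<exists>F :: nat => ('x => real) set. (\<forall>k. finite (F k) \<and> F k \<subseteq> S) \<and> incseq F \<and>
    (\<forall>\<omega>\<in>space N. \<forall>y. (\<forall>s\<in>\<Union>(range F). G s \<omega> \<le> y) \<longrightarrow> (\<forall>s\<in>S. G s \<omega> \<le> y))"
proof -
  have "\<exists>F d. finite F \<and> F \<subseteq> S \<and> summable d \<and> (\<forall>i. 0 \<le> d i) \<and> suminf d \<le> inverse (Suc k) \<and>
     (\<forall>s\<in>S. \<exists>t\<in>F. \<forall>i. \<bar>c s i - c t i\<bar> \<le> d i)" for k
    by (rule finite_coefficient_net[OF w_summable w_nonneg c_bound]) auto
  then obtain F d where F: "\<And>k. finite (F k) \<and> F k \<subseteq> S \<and> summable (d k) \<and> (\<forall>i. 0 \<le> d k i) \<and> suminf (d k) \<le> inverse (Suc k) \<and>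
     (\<forall>s\<in>S. \<exists>t\<in>F k. \<forall>i. \<bar>c s i - c t i\<bar> \<le> d k i)" by metis
  define H where "H k = (\<Union>j\<le>k. F j)" for k
  let ?a = "sqrt (LINT x|P. (A x)\<^sup>2)"
  have "G s \<omega> \<le> y" if w: "\<omega> \<in> space N" and y: "\<forall>s\<in>\<Union>(range H). G s \<omega> \<le> y" and s: "s \<in> S" for \<omega> y s
  proof (rule ccontr)
    assume "\<not> G s \<omega> \<le> y"
    then have "G s \<omega> - y > 0" by simp
    then obtain \<delta> where \<delta>: "\<delta> > 0" "\<And>t. t \<in> S ==> L2_dist P s t < \<delta> ==> \<bar>G s \<omega> - G t \<omega>\<bar> < G s \<omega> - y"
      using uc w s unfolding bounded_uc_paths_def by blast
    have "(\<lambda>k. inverse (real (Suc k)) * ?a) \<longlonglongrightarrow> 0 * ?a"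
      by (intro tendsto_mult LIMSEQ_inverse_real_of_nat tendsto_const)
    then have "\<forall>\<^sub>F k in sequentially. inverse (real (Suc k)) * ?a < \<delta>"
      using \<delta>(1) by (simp add: order_tendstoD(2))
    then obtain k where k: "inverse (real (Suc k)) * ?a < \<delta>" by (auto simp: eventually_sequentially)
    obtain t where t: "t \<in> F k" "\<And>i. \<bar>c s i - c t i\<bar> \<le> d k i" using F[of k] s by blast
    then have tS: "t \<in> S" using F by blast
    have "L2_dist P s t \<le> suminf (d k) * ?a" using F[of k] t by (intro L2_dist_le s tS) auto
    also have "\<dots> \<le> inverse (real (Suc k)) * ?a" using F[of k] by (intro mult_right_mono) auto
    also note k
    finally have "\<bar>G s \<omega> - G t \<omega>\<bar> < G s \<omega> - y" by (rule \<delta>(2)[OF tS])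
    then have "G t \<omega> > y" by linarith
    moreover have "t \<in> H k" using t by (auto simp: H_def)
    ultimately show False using y by (meson UN_I not_le rangeI UnionI)
  qed
  moreover have "incseq H" unfolding incseq_def H_def by (intro allI impI UN_mono) auto
  moreover have "finite (H k) \<and> H k \<subseteq> S" for k
  proof -
    have "finite (F j)" "F j \<subseteq> S" for j using F[of j] by blast+
    then show ?thesis unfolding H_def by (simp add: UN_least)
  qed
  ultimately show ?thesis by (intro exI[of _ H]) blast
qed

end

lemma sup_sq_pos_le_iff:
  assumes "bounded_uc_paths N S \<rho> G" "\<omega> \<in> space N" "x \<ge> 0"
  shows "sup_sq_pos S G \<omega> \<le> x \<longleftrightarrow> (\<forall>s\<in>S. G s \<omega> \<le> sqrt x)"
proof -
  let ?sup = "SUP s\<in>S. ennreal ((max (G s \<omega>) 0)\<^sup>2)"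
  obtain b where b: "\<And>s. s \<in> S ==> \<bar>G s \<omega>\<bar> \<le> b"
  proof -
    have "bounded ((\<lambda>s. G s \<omega>) ` S)" using assms(1,2) by (simp add: bounded_uc_paths_def)
    then obtain b where "\<forall>y\<in>(\<lambda>s. G s \<omega>) ` S. norm y \<le> b" unfolding bounded_iff by blast
    then show ?thesis by (intro that[of b]) auto
  qed
  have "?sup \<le> ennreal (b\<^sup>2)"
  proof (rule SUP_least)
    fix s assume "s \<in> S"
    then have "(max (G s \<omega>) 0)\<^sup>2 \<le> b\<^sup>2" using b[of s] by (intro power_mono) auto
    then show "ennreal ((max (G s \<omega>) 0)\<^sup>2) \<le> ennreal (b\<^sup>2)" by (rule ennreal_leI)
  qed
  then have "?sup < top" by (rule le_less_trans) simp
  then have eq: "ennreal (sup_sq_pos S G \<omega>) = ?sup" unfolding sup_sq_pos_def by simp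
  have "sup_sq_pos S G \<omega> \<le> x \<longleftrightarrow> ennreal (sup_sq_pos S G \<omega>) \<le> ennreal x"
    using assms(3) by (simp add: ennreal_le_iff)
  also have "\<dots> \<longleftrightarrow> (\<forall>s\<in>S. ennreal ((max (G s \<omega>) 0)\<^sup>2) \<le> ennreal x)"
    unfolding eq by (rule SUP_le_iff)
  also have "\<dots> \<longleftrightarrow> (\<forall>s\<in>S. G s \<omega> \<le> sqrt x)"
  proof -
    have "(max g 0)\<^sup>2 \<le> x \<longleftrightarrow> g \<le> sqrt x" for g :: real
    proof
      assume "(max g 0)\<^sup>2 \<le> x"
      then have "max g 0 \<le> sqrt x" by (rule real_le_rsqrt)
      then show "g \<le> sqrt x" by simp
    next
      assume "g \<le> sqrt x"
      then have "max g 0 \<le> sqrt x" using assms(3) by simp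
      then have "(max g 0)\<^sup>2 \<le> (sqrt x)\<^sup>2" by (intro power_mono) auto
      then show "(max g 0)\<^sup>2 \<le> x" using assms(3) by simp
    qed
    then show ?thesis using assms(3) by (simp add: ennreal_le_iff)
  qed
  finally show ?thesis .
qed

context lr_model
begin

lemma emp_orthant_transfer:
  fixes N :: "'v measure"
  assumes C: "centered_gaussian_process N S (L2_inner P) G" and F: "finite F" "F \<subseteq> S" and \<delta>: "\<delta> > 0" and \<kappa>: "\<kappa> > 0"
  shows "\<forall>\<^sub>F n in sequentially. prob {\<omega> \<in> space M. \<forall>s\<in>F. emp n s \<omega> \<le> a} \<le> measure N {\<omega> \<in> space N. \<forall>s\<in>F. G s \<omega> \<le> a + \<delta>} + \<kappa>"
    and "\<forall>\<^sub>F n in sequentially. measure N {\<omega> \<in> space N. \<forall>s\<in>F. G s \<omega> \<le> a} \<le> prob {\<omega> \<in> space M. \<forall>s\<in>F. emp n s \<omega> \<le> a + \<delta>} + \<kappa>"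
proof -
  interpret N: prob_space N using C by (auto simp: centered_gaussian_process_def)
  note mom = centered_gaussian_moments[OF C]
  have FS: "s \<in> F ==> s \<in> S" for s using F by auto
  have norm1: "(LINT x|P. (s x)\<^sup>2) \<le> 1" if "s \<in> F" for s
  proof (cases "\<forall>x\<in>space P. s x = 0")
    case True
    then have "(LINT x|P. (s x)\<^sup>2) = (LINT x|P. 0)" by (intro Bochner_Integration.integral_cong) auto
    then show ?thesis by simp
  next
    case False
    then have "(LINT x|P. (s x)\<^sup>2) = 1" using S_norm[OF FS[OF that]] by blast
    then show ?thesis by simp
  qed
  interpret two_systems M N F emp G
    by unfold_locales (use F S_measurable mom FS in auto)
  have char: "(\<lambda>n. CLINT \<omega>|M. iexp (\<Sum>s\<in>F. u s * emp n s \<omega>)) \<longlonglongrightarrow> (CLINT \<omega>|N. iexp (\<Sum>s\<in>F. u s * G s \<omega>))" for u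
  proof -
    have i1: "integrable P s" if "s \<in> F" for s using S_power_integrable[OF FS[OF that], of 1] by simp
    have m: "(\<lambda>x. \<Sum>s\<in>F. u s * s x) \<in> borel_measurable P" using S_measurable FS by (intro borel_measurable_sum) auto
    have i2: "integrable P (\<lambda>x. (\<Sum>s\<in>F. u s * s x)\<^sup>2)"
      by (rule L2_sum(1)[OF F(1)]) (use S_measurable S_square_integrable FS in auto)
    have 0: "(LINT x|P. (\<Sum>s\<in>F. u s * s x)) = 0"
      using i1 S_mean[OF FS] by (subst Bochner_Integration.integral_sum) auto
    have eq: "(\<Sum>s\<in>F. u s * emp n s \<omega>) = emp n (\<lambda>x. \<Sum>s\<in>F. u s * s x) \<omega>" for n \<omega>
      by (rule emp_sum[OF F(1)]) (rule i1)
    have r: "(CLINT \<omega>|N. iexp (\<Sum>s\<in>F. u s * G s \<omega>)) = complex_of_real (exp (- (LINT x|P. (\<Sum>s\<in>F. u s * s x)\<^sup>2) / 2))"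
      by (rule centered_gaussian_char[OF C _ _ F]) (use S_measurable S_square_integrable in auto)
    show ?thesis unfolding eq r by (rule emp_char_limit[OF m i2 0])
  qed
  have e2: "expectation (\<lambda>\<omega>. (emp n s \<omega>)\<^sup>2) \<le> 1" if "s \<in> F" for n s
    using emp_square(2)[OF S_measurable S_square_integrable, OF FS FS, OF that that, of n] norm1[OF that] by simp
  have g2: "N.expectation (\<lambda>\<omega>. (G s \<omega>)\<^sup>2) \<le> 1" if "s \<in> F" for s
    using mom(4)[OF FS[OF that]] norm1[OF that] by (simp add: L2_inner_def power2_eq_square)
  note t = orthant_transfer[OF char _ e2 _ g2 \<delta> \<kappa>]
  show "\<forall>\<^sub>F n in sequentially. prob {\<omega> \<in> space M. \<forall>s\<in>F. emp n s \<omega> \<le> a} \<le> measure N {\<omega> \<in> space N. \<forall>s\<in>F. G s \<omega> \<le> a + \<delta>} + \<kappa>"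
    by (rule t) (use emp_square(1) S_measurable S_square_integrable mom FS in auto)
  show "\<forall>\<^sub>F n in sequentially. measure N {\<omega> \<in> space N. \<forall>s\<in>F. G s \<omega> \<le> a} \<le> prob {\<omega> \<in> space M. \<forall>s\<in>F. emp n s \<omega> \<le> a + \<delta>} + \<kappa>"
    by (rule t) (use emp_square(1) S_measurable S_square_integrable mom FS in auto)
qed

lemma emp_event: "finite F ==> F \<subseteq> S ==> {\<omega> \<in> space M. \<forall>s\<in>F. emp n s \<omega> \<le> a} \<in> events"
  using S_measurable by (intro sets.sets_Collect_finite_All) (auto intro!: borel_measurable_le)

lemma L_event: "n \<ge> 1 ==> {\<omega> \<in> space M. L n \<omega> \<le> x} \<in> events"
  using L_measurable[of n] by measurable

text \<open>
  The statistic dominates the value in each of finitely many directions.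
\<close>

lemma L_prob_upper:
  fixes N :: "'v measure"
  assumes C: "centered_gaussian_process N S (L2_inner P) G" and F: "finite F" "F \<subseteq> S"
    and x: "x \<ge> 0" and \<delta>: "\<delta> > 0" and \<kappa>: "\<kappa> > 0"
  shows "\<forall>\<^sub>F n in sequentially. prob {\<omega> \<in> space M. L n \<omega> \<le> x} \<le> measure N {\<omega> \<in> space N. \<forall>s\<in>F. G s \<omega> \<le> sqrt (x + \<delta>)} + \<kappa>"
proof -
  define k where "k = \<kappa> / 2 / (card F + 1)"
  have k: "k > 0" "card F * k \<le> \<kappa> / 2" using \<kappa> by (auto simp: k_def field_simps)
  define y where "y = sqrt (x + \<delta> / 2)"
  have y: "y < sqrt (x + \<delta>)" using x \<delta> by (simp add: y_def)
  have "mostly (\<kappa> / 2) (\<lambda>n \<omega>. \<forall>s\<in>F. (max (emp n s \<omega>) 0)\<^sup>2 - \<delta> / 2 \<le> L n \<omega>)"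
    by (rule mostly_weaken[OF mostly_finite_ball[OF F(1)] k(2)], rule mostly_L_ge) (use F \<delta> k in auto)
  then have 1: "\<forall>\<^sub>F n in sequentially. \<exists>B\<in>events. prob B \<le> \<kappa> / 2 \<and> (\<forall>\<omega>\<in>space M - B. \<forall>s\<in>F. (max (emp n s \<omega>) 0)\<^sup>2 - \<delta> / 2 \<le> L n \<omega>)"
    by (simp only: mostly_def)
  have 2: "\<forall>\<^sub>F n in sequentially. prob {\<omega> \<in> space M. \<forall>s\<in>F. emp n s \<omega> \<le> y} \<le> measure N {\<omega> \<in> space N. \<forall>s\<in>F. G s \<omega> \<le> y + (sqrt (x + \<delta>) - y)} + \<kappa> / 2"
    by (rule emp_orthant_transfer(1)[OF C F]) (use y \<kappa> in auto)
  show ?thesis using 1 2 eventually_ge_at_top[of 1]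
  proof eventually_elim
    case (elim n)
    then obtain B where B: "B \<in> events" "prob B \<le> \<kappa> / 2"
      "\<And>\<omega> s. \<omega> \<in> space M - B ==> s \<in> F ==> (max (emp n s \<omega>) 0)\<^sup>2 - \<delta> / 2 \<le> L n \<omega>" by blast
    have "prob {\<omega> \<in> space M. L n \<omega> \<le> x} \<le> prob ({\<omega> \<in> space M. \<forall>s\<in>F. emp n s \<omega> \<le> y} \<union> B)"
    proof (rule finite_measure_mono)
      show "{\<omega> \<in> space M. \<forall>s\<in>F. emp n s \<omega> \<le> y} \<union> B \<in> events" using emp_event[OF F] B by (intro sets.Un) auto
      show "{\<omega> \<in> space M. L n \<omega> \<le> x} \<subseteq> {\<omega> \<in> space M. \<forall>s\<in>F. emp n s \<omega> \<le> y} \<union> B"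
      proof clarify
        fix \<omega> s assume w: "\<omega> \<in> space M" "L n \<omega> \<le> x" "\<omega> \<notin> B" "s \<in> F"
        then have "(max (emp n s \<omega>) 0)\<^sup>2 - \<delta> / 2 \<le> L n \<omega>" by (intro B(3)) auto
        then have "(max (emp n s \<omega>) 0)\<^sup>2 \<le> x + \<delta> / 2" using w by linarith
        then have "max (emp n s \<omega>) 0 \<le> y" unfolding y_def by (rule real_le_rsqrt)
        then show "emp n s \<omega> \<le> y" by simp
      qed
    qed
    also have "\<dots> \<le> prob {\<omega> \<in> space M. \<forall>s\<in>F. emp n s \<omega> \<le> y} + prob B"
      using emp_event[OF F] B by (intro measure_Un_le) auto
    finally show ?case using elim(2) B(2) by simp
  qed
qed

text \<open>
  The statistic is dominated by its values on a finite net that depends on the required accuracy.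
\<close>

lemma L_prob_lower:
  fixes N :: "'v measure"
  assumes C: "centered_gaussian_process N S (L2_inner P) G"
    and x: "x \<ge> 0" and \<delta>: "\<delta> > 0" and \<kappa>: "\<kappa> > 0"
  shows "\<exists>F. finite F \<and> F \<subseteq> S \<and> (\<forall>\<^sub>F n in sequentially.
    measure N {\<omega> \<in> space N. \<forall>s\<in>F. G s \<omega> \<le> sqrt x} \<le> prob {\<omega> \<in> space M. L n \<omega> \<le> x + \<delta>} + \<kappa>)"
proof -
  define y where "y = sqrt (x + \<delta> / 2)"
  have y: "sqrt x < y" "0 \<le> y" "y\<^sup>2 < x + \<delta>" using x \<delta> by (auto simp: y_def)
  have "((\<lambda>\<eta>. (1 + \<eta>) * (y + \<eta>)\<^sup>2) \<longlongrightarrow> (1 + 0) * (y + 0)\<^sup>2) (at_right 0)"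
    by (intro tendsto_intros)
  then have "\<forall>\<^sub>F \<eta> in at_right 0. (1 + \<eta>) * (y + \<eta>)\<^sup>2 < x + \<delta>"
    using y(3) by (intro order_tendstoD(2)) auto
  moreover have "\<forall>\<^sub>F \<eta>::real in at_right 0. 0 < \<eta> \<and> \<eta> < 1"
    by (rule eventually_at_rightI[of 0 1]) auto
  ultimately have "\<forall>\<^sub>F \<eta>::real in at_right 0. (0 < \<eta> \<and> \<eta> < 1) \<and> (1 + \<eta>) * (y + \<eta>)\<^sup>2 < x + \<delta>"
    by eventually_elim auto
  then obtain \<eta> where \<eta>: "0 < \<eta>" "\<eta> < 1" "(1 + \<eta>) * (y + \<eta>)\<^sup>2 < x + \<delta>"
    using eventually_happens by (metis (no_types, lifting) trivial_limit_at_right_real)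
  obtain F where F: "finite F" "F \<subseteq> S" and m: "mostly (\<kappa> / 2) (\<lambda>n \<omega>. \<forall>a\<ge>0. (\<forall>t\<in>F. emp n t \<omega> \<le> a) \<longrightarrow> L n \<omega> \<le> (1 + \<eta>) * (a + \<eta>)\<^sup>2)"
    using L_upper_bound[of \<eta> "\<kappa> / 2"] \<eta> \<kappa> by auto
  from m have 1: "\<forall>\<^sub>F n in sequentially. \<exists>B\<in>events. prob B \<le> \<kappa> / 2 \<and>
      (\<forall>\<omega>\<in>space M - B. \<forall>a\<ge>0. (\<forall>t\<in>F. emp n t \<omega> \<le> a) \<longrightarrow> L n \<omega> \<le> (1 + \<eta>) * (a + \<eta>)\<^sup>2)"
    by (simp only: mostly_def)
  have 2: "\<forall>\<^sub>F n in sequentially. measure N {\<omega> \<in> space N. \<forall>s\<in>F. G s \<omega> \<le> sqrt x} \<le> prob {\<omega> \<in> space M. \<forall>s\<in>F. emp n s \<omega> \<le> sqrt x + (y - sqrt x)} + \<kappa> / 2"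
    by (rule emp_orthant_transfer(2)[OF C F]) (use y \<kappa> in auto)
  have "\<forall>\<^sub>F n in sequentially. measure N {\<omega> \<in> space N. \<forall>s\<in>F. G s \<omega> \<le> sqrt x} \<le> prob {\<omega> \<in> space M. L n \<omega> \<le> x + \<delta>} + \<kappa>"
    using 1 2 eventually_ge_at_top[of 1]
  proof eventually_elim
    case (elim n)
    then obtain B where B: "B \<in> events" "prob B \<le> \<kappa> / 2"
      "\<And>\<omega> a. \<omega> \<in> space M - B ==> 0 \<le> a ==> (\<forall>t\<in>F. emp n t \<omega> \<le> a) ==> L n \<omega> \<le> (1 + \<eta>) * (a + \<eta>)\<^sup>2" by blast
    have "prob {\<omega> \<in> space M. \<forall>s\<in>F. emp n s \<omega> \<le> y} \<le> prob ({\<omega> \<in> space M. L n \<omega> \<le> x + \<delta>} \<union> B)"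
    proof (rule finite_measure_mono)
      show "{\<omega> \<in> space M. L n \<omega> \<le> x + \<delta>} \<union> B \<in> events" using L_event[OF elim(3)] B by (intro sets.Un) auto
      show "{\<omega> \<in> space M. \<forall>s\<in>F. emp n s \<omega> \<le> y} \<subseteq> {\<omega> \<in> space M. L n \<omega> \<le> x + \<delta>} \<union> B"
      proof clarify
        fix \<omega> assume w: "\<omega> \<in> space M" "\<forall>s\<in>F. emp n s \<omega> \<le> y" "\<omega> \<notin> B"
        then have "L n \<omega> \<le> (1 + \<eta>) * (y + \<eta>)\<^sup>2" using y by (intro B(3)) auto
        then show "L n \<omega> \<le> x + \<delta>" using \<eta> by linarith
      qed
    qed
    also have "\<dots> \<le> prob {\<omega> \<in> space M. L n \<omega> \<le> x + \<delta>} + prob B"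
      using L_event[OF elim(3)] B by (intro measure_Un_le) auto
    finally show ?case using elim(2) B(2) by simp
  qed
  with F show ?thesis by blast
qed

text \<open>
  The distribution function of the limit at \<open>x\<close> is the decreasing limit, along the
  dense finite sets, of the probabilities that the Gaussian process stays below
  \<open>sqrt x\<close>; the two preceding bounds enclose the distribution function of the
  statistic between such values at neighbouring points.
\<close>

theorem likelihood_ratio_limit:
  fixes N :: "'v measure"
  assumes tight: "tight_gaussian_process N P S G"
  shows "weak_conv_m (\<lambda>n. distr M borel (L n)) (distr N borel (sup_sq_pos S G))"
proof -
  have C: "centered_gaussian_process N S (L2_inner P) G" and uc: "bounded_uc_paths N S (L2_dist P) G"
    using tight by (auto simp: tight_gaussian_process_def)
  interpret N: prob_space N using C by (auto simp: centered_gaussian_process_def)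
  have Gm: "s \<in> S ==> G s \<in> borel_measurable N" for s using C by (auto simp: centered_gaussian_process_def)
  obtain F :: "nat => ('x => real) set" where F: "\<And>k. finite (F k) \<and> F k \<subseteq> S" "incseq F"
    and dense: "\<And>\<omega> y s. \<omega> \<in> space N ==> (\<forall>s\<in>\<Union>(range F). G s \<omega> \<le> y) ==> s \<in> S ==> G s \<omega> \<le> y"
    using dense_finite_sets[OF uc] by blast
  define E where "E H y = {\<omega> \<in> space N. \<forall>s\<in>H. G s \<omega> \<le> y}" for H y
  have Em: "E H y \<in> N.events" if "finite H" "H \<subseteq> S" for H y
    unfolding E_def using that Gm by (intro sets.sets_Collect_finite_All) (auto intro!: borel_measurable_le)
  have ES: "E S y = (\<Inter>k. E (F k) y)" for y
  proof (intro equalityI subsetI INT_I)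
    fix \<omega> k assume "\<omega> \<in> E S y"
    then show "\<omega> \<in> E (F k) y" using F(1)[of k] by (auto simp: E_def)
  next
    fix \<omega> assume "\<omega> \<in> (\<Inter>k. E (F k) y)"
    then have w: "\<omega> \<in> E (F k) y" for k by blast
    from w[of 0] have sp: "\<omega> \<in> space N" by (simp add: E_def)
    have "\<forall>s\<in>\<Union>(range F). G s \<omega> \<le> y" using w by (auto simp: E_def)
    with sp show "\<omega> \<in> E S y" unfolding E_def by (auto intro: dense)
  qed
  have ESm: "E S y \<in> N.events" for y unfolding ES using Em F by (intro sets.countable_INT) auto
  let ?T = "sup_sq_pos S G"
  have T0: "0 \<le> ?T \<omega>" for \<omega> by (simp add: sup_sq_pos_def)
  have TE: "{\<omega> \<in> space N. ?T \<omega> \<le> x} = E S (sqrt x)" if "x \<ge> 0" for x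
    unfolding E_def using sup_sq_pos_le_iff[OF uc _ that] by auto
  have Tneg: "{\<omega> \<in> space N. ?T \<omega> \<le> x} = {}" if "x < 0" for x
    using T0 that by (auto simp: not_le intro: less_le_trans)
  have Tm: "?T \<in> borel_measurable N"
    unfolding borel_measurable_iff_le
  proof
    fix x show "{\<omega> \<in> space N. ?T \<omega> \<le> x} \<in> N.events"
    proof (cases "x \<ge> 0")
      case True
      show ?thesis unfolding TE[OF True] by (rule ESm)
    next
      case False
      then have "x < 0" by simp
      show ?thesis unfolding Tneg[OF \<open>x < 0\<close>] by simp
    qed
  qed
  define f where "f = cdf (distr N borel ?T)"
  have f: "f x = N.prob {\<omega> \<in> space N. ?T \<omega> \<le> x}" for x
    unfolding f_def cdf_def using Tm by (subst measure_distr) (auto intro!: arg_cong[of _ _ N.prob])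
  have fneg: "f x = 0" if "x < 0" for x unfolding f Tneg[OF that] by simp
  have Lf: "cdf (distr M borel (L n)) x = prob {\<omega> \<in> space M. L n \<omega> \<le> x}" if "n \<ge> 1" for n x
    unfolding cdf_def using L_measurable[OF that] by (subst measure_distr) (auto intro!: arg_cong[of _ _ prob])
  have up: "\<forall>\<^sub>F n in sequentially. prob {\<omega> \<in> space M. L n \<omega> \<le> x} \<le> f (x + \<delta>) + \<kappa>"
    if x: "x \<ge> 0" and \<delta>: "\<delta> > 0" and \<kappa>: "\<kappa> > 0" for x \<delta> \<kappa>
  proof -
    have "(\<lambda>k. N.prob (E (F k) (sqrt (x + \<delta>)))) \<longlonglongrightarrow> N.prob (\<Inter>k. E (F k) (sqrt (x + \<delta>)))"
    proof (rule N.finite_Lim_measure_decseq)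
      show "range (\<lambda>k. E (F k) (sqrt (x + \<delta>))) \<subseteq> N.events" using Em F by auto
      show "decseq (\<lambda>k. E (F k) (sqrt (x + \<delta>)))"
        using F(2) unfolding decseq_def incseq_def E_def by blast
    qed
    then have "\<forall>\<^sub>F k in sequentially. N.prob (E (F k) (sqrt (x + \<delta>))) < f (x + \<delta>) + \<kappa> / 2"
      using \<kappa> f[of "x + \<delta>"] TE[of "x + \<delta>"] x \<delta> by (intro order_tendstoD(2)) (auto simp: ES[symmetric])
    then obtain k where k: "N.prob (E (F k) (sqrt (x + \<delta>))) < f (x + \<delta>) + \<kappa> / 2" by (auto simp: eventually_sequentially)
    have "\<forall>\<^sub>F n in sequentially. prob {\<omega> \<in> space M. L n \<omega> \<le> x} \<le> N.prob (E (F k) (sqrt (x + \<delta>))) + \<kappa> / 2"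
      unfolding E_def by (rule L_prob_upper[OF C _ _ x \<delta>]) (use F \<kappa> in auto)
    then show ?thesis by eventually_elim (use k in linarith)
  qed
  have low: "\<forall>\<^sub>F n in sequentially. f x \<le> prob {\<omega> \<in> space M. L n \<omega> \<le> x + \<delta>} + \<kappa>"
    if x: "x \<ge> 0" and \<delta>: "\<delta> > 0" and \<kappa>: "\<kappa> > 0" for x \<delta> \<kappa>
  proof -
    obtain H where H: "finite H" "H \<subseteq> S" and ev: "\<forall>\<^sub>F n in sequentially.
      N.prob {\<omega> \<in> space N. \<forall>s\<in>H. G s \<omega> \<le> sqrt x} \<le> prob {\<omega> \<in> space M. L n \<omega> \<le> x + \<delta>} + \<kappa>"
      using L_prob_lower[OF C x \<delta> \<kappa>] by blast
    have "f x \<le> N.prob (E H (sqrt x))"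
      unfolding f TE[OF x] using Em[OF H] H by (intro N.finite_measure_mono) (auto simp: E_def)
    with ev show ?thesis unfolding E_def by (elim eventually_mono) linarith
  qed
  show ?thesis
    unfolding weak_conv_m_def weak_conv_def
  proof (intro allI impI)
    fix x assume "isCont (cdf (distr N borel ?T)) x"
    then have cont: "isCont f x" by (simp add: f_def)
    show "(\<lambda>n. cdf (distr M borel (L n)) x) \<longlonglongrightarrow> cdf (distr N borel ?T) x"
      unfolding f_def[symmetric]
    proof (rule tendstoI)
      fix \<kappa> :: real assume \<kappa>: "\<kappa> > 0"
      obtain \<delta> where \<delta>: "\<delta> > 0" "\<And>y. \<bar>y - x\<bar> < \<delta> ==> \<bar>f y - f x\<bar> < \<kappa> / 2"
        using cont \<kappa> unfolding continuous_at_eps_delta dist_real_def by (meson half_gt_zero)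
      show "\<forall>\<^sub>F n in sequentially. dist (cdf (distr M borel (L n)) x) (f x) < \<kappa>"
      proof (cases "x < 0")
        case True
        show ?thesis using eventually_ge_at_top[of 1]
        proof eventually_elim
          case (elim n)
          have empty: "{\<omega> \<in> space M. L n \<omega> \<le> x} = {}" using L_nonneg[OF elim] True by (auto simp: not_le intro: less_le_trans)
          have "cdf (distr M borel (L n)) x = 0" unfolding Lf[OF elim] empty by simp
          then show ?case using fneg[OF True] \<kappa> by simp
        qed
      next
        case False
        then have x: "x \<ge> 0" by simp
        have 1: "\<forall>\<^sub>F n in sequentially. prob {\<omega> \<in> space M. L n \<omega> \<le> x} \<le> f (x + \<delta> / 2) + \<kappa> / 4"
          using x \<delta> \<kappa> by (intro up) auto
        have f1: "\<bar>f (x + \<delta> / 2) - f x\<bar> < \<kappa> / 2" using \<delta> by (intro \<delta>(2)) auto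
        have 2: "\<forall>\<^sub>F n in sequentially. f x - \<kappa> * 3 / 4 \<le> prob {\<omega> \<in> space M. L n \<omega> \<le> x}"
        proof (cases "x = 0")
          case True
          have "\<bar>f (- (\<delta> / 2)) - f 0\<bar> < \<kappa> / 2" using \<delta>(2)[of "- (\<delta> / 2)"] \<delta>(1) True by auto
          then have le: "f x - \<kappa> * 3 / 4 \<le> 0" using fneg[of "- (\<delta> / 2)"] \<delta>(1) True \<kappa> by (simp add: abs_less_iff)
          have "f x - \<kappa> * 3 / 4 \<le> prob {\<omega> \<in> space M. L n \<omega> \<le> x}" for n
            using le measure_nonneg[of M "{\<omega> \<in> space M. L n \<omega> \<le> x}"] by linarith
          then show ?thesis by simp
        next
          case False
          define h where "h = min \<delta> x / 2"
          have h: "h > 0" "h < \<delta>" "x - h \<ge> 0" using x False \<delta>(1) by (auto simp: h_def min_def)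
          have ev: "\<forall>\<^sub>F n in sequentially. f (x - h) \<le> prob {\<omega> \<in> space M. L n \<omega> \<le> x} + \<kappa> / 4"
            using low[of "x - h" h "\<kappa> / 4"] h \<kappa> by simp
          have "\<bar>f (x - h) - f x\<bar> < \<kappa> / 2" using h by (intro \<delta>(2)) auto
          then have "f x - \<kappa> / 2 < f (x - h)" by linarith
          then show ?thesis by (intro eventually_mono[OF ev]) linarith
        qed
        show ?thesis using 1 2 eventually_ge_at_top[of 1]
        proof eventually_elim
          case (elim n)
          then show ?case using f1 \<kappa> Lf[OF elim(3), of x] unfolding dist_real_def by linarith
        qed
      qed
    qed
  qed
qed

end

section \<open>Gram--Schmidt orthonormalisation in a space of square integrable functions\<close>

definition L2_fun :: "'x measure => ('x => real) => bool" where
  "L2_fun P f \<longleftrightarrow> f \<in> borel_measurable P \<and> integrable P (\<lambda>x. (f x)\<^sup>2)"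

lemma L2_fun_inner_integrable: "L2_fun P f ==> L2_fun P g ==> integrable P (\<lambda>x. f x * g x)"
  unfolding L2_fun_def by (intro L2_inner_integrable) auto

lemma L2_fun_scale: "L2_fun P f ==> L2_fun P (\<lambda>x. a * f x)"
  unfolding L2_fun_def by (auto simp: power_mult_distrib)

lemma L2_fun_sum:
  assumes "finite J" "\<And>j. j \<in> J ==> L2_fun P (f j)"
  shows "L2_fun P (\<lambda>x. \<Sum>j\<in>J. a j * f j x)"
  unfolding L2_fun_def using assms L2_sum(1)[OF assms(1), of f P a]
  by (auto simp: L2_fun_def intro!: borel_measurable_sum borel_measurable_times)

lemma L2_fun_add:
  assumes "L2_fun P f" "L2_fun P g" shows "L2_fun P (\<lambda>x. f x + a * g x)"
proof -
  have "L2_fun P (\<lambda>x. \<Sum>j\<in>{True, False}. (if j then 1 else a) * (if j then f else g) x)"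
    by (rule L2_fun_sum) (use assms in auto)
  then show ?thesis by simp
qed

lemma L2_inner_commute: "L2_inner P f g = L2_inner P g f"
  by (simp add: L2_inner_def mult.commute)

lemma L2_inner_scale: "L2_inner P (\<lambda>x. a * f x) g = a * L2_inner P f g"
  by (simp add: L2_inner_def mult.assoc)

lemma L2_inner_sum:
  assumes "finite J" "\<And>j. j \<in> J ==> L2_fun P (f j)" "L2_fun P g"
  shows "L2_inner P (\<lambda>x. \<Sum>j\<in>J. a j * f j x) g = (\<Sum>j\<in>J. a j * L2_inner P (f j) g)"
proof -
  have "L2_inner P (\<lambda>x. \<Sum>j\<in>J. a j * f j x) g = (LINT x|P. (\<Sum>j\<in>J. a j * (f j x * g x)))"
    unfolding L2_inner_def by (simp add: sum_distrib_right mult.assoc)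
  also have "\<dots> = (\<Sum>j\<in>J. LINT x|P. a j * (f j x * g x))"
    by (rule Bochner_Integration.integral_sum) (intro integrable_mult_right L2_fun_inner_integrable assms)
  finally show ?thesis by (simp add: L2_inner_def)
qed

lemma L2_inner_add:
  assumes "L2_fun P f" "L2_fun P h" "L2_fun P g"
  shows "L2_inner P (\<lambda>x. f x + a * h x) g = L2_inner P f g + a * L2_inner P h g"
proof -
  have "L2_inner P (\<lambda>x. \<Sum>j\<in>{True, False}. (if j then 1 else a) * (if j then f else h) x) g
    = (\<Sum>j\<in>{True, False}. (if j then 1 else a) * L2_inner P (if j then f else h) g)"
    by (rule L2_inner_sum) (use assms in auto)
  then show ?thesis by simp
qed

lemma L2_inner_null:
  assumes f: "L2_fun P f" and "L2_inner P f f = 0"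
  shows "L2_inner P f g = 0"
proof -
  have "AE x in P. f x * f x = 0"
    using integral_nonneg_eq_0_iff_AE[OF L2_fun_inner_integrable[OF f f]] assms(2) by (simp add: L2_inner_def)
  then have "AE x in P. f x * g x = 0" by eventually_elim simp
  then show ?thesis unfolding L2_inner_def by (rule integral_eq_zero_AE)
qed

lemma L2_inner_nonneg: "0 \<le> L2_inner P f f"
  by (simp add: L2_inner_def)

lemma L2_Cauchy_Schwarz:
  assumes f: "L2_fun P f" and g: "L2_fun P g"
  shows "\<bar>LINT x|P. f x * g x\<bar> \<le> sqrt (LINT x|P. (f x)\<^sup>2) * sqrt (LINT x|P. (g x)\<^sup>2)"
proof -
  have sq: "L2_inner P h h = (LINT x|P. (h x)\<^sup>2)" for h by (simp add: L2_inner_def power2_eq_square)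
  let ?a = "L2_inner P f f" and ?b = "L2_inner P f g" and ?c = "L2_inner P g g"
  have "?b\<^sup>2 \<le> ?a * ?c"
  proof (cases "?c = 0")
    case True
    have "?b = 0" by (subst L2_inner_commute) (rule L2_inner_null[OF g True])
    then show ?thesis by (simp add: L2_inner_nonneg True)
  next
    case False
    then have c: "?c > 0" using L2_inner_nonneg[of P g] by simp
    let ?t = "- ?b / ?c"
    have h: "L2_fun P (\<lambda>x. f x + ?t * g x)" by (rule L2_fun_add[OF f g])
    have "0 \<le> L2_inner P (\<lambda>x. f x + ?t * g x) (\<lambda>x. f x + ?t * g x)" by (rule L2_inner_nonneg)
    also have "\<dots> = L2_inner P f (\<lambda>x. f x + ?t * g x) + ?t * L2_inner P g (\<lambda>x. f x + ?t * g x)"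
      by (rule L2_inner_add[OF f g h])
    also have "L2_inner P f (\<lambda>x. f x + ?t * g x) = ?a + ?t * L2_inner P g f"
      by (subst L2_inner_commute) (rule L2_inner_add[OF f g f])
    also have "L2_inner P g f = ?b" by (rule L2_inner_commute)
    also have "L2_inner P g (\<lambda>x. f x + ?t * g x) = ?b + ?t * ?c"
      by (subst L2_inner_commute) (rule L2_inner_add[OF f g g])
    finally have "0 \<le> ?a + ?t * ?b + ?t * (?b + ?t * ?c)" .
    also have "\<dots> = ?a - ?b\<^sup>2 / ?c" using c by (simp add: field_simps power2_eq_square)
    finally show ?thesis using c by (simp add: pos_divide_le_eq)
  qed
  then have "sqrt (?b\<^sup>2) \<le> sqrt (?a * ?c)" by (rule real_sqrt_le_mono)
  then show ?thesis by (simp add: sq real_sqrt_mult) (simp add: L2_inner_def)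
qed

text \<open>
  Division by zero is zero, so a vector depending linearly on its predecessors is sent to the zero
  function and the remaining ones stay orthonormal.
\<close>

fun gram_schmidt :: "'x measure => (nat => 'x => real) => nat => 'x => real" where
  "gram_schmidt P v n =
    (let r = (\<lambda>x. v n x + (-1) * (\<Sum>k<n. L2_inner P (v n) (gram_schmidt P v k) * gram_schmidt P v k x)) in
      (\<lambda>x. (1 / sqrt (L2_inner P r r)) * r x))"

declare gram_schmidt.simps[simp del]

definition gs_residual :: "'x measure => (nat => 'x => real) => nat => 'x => real" where
  "gs_residual P v n x = v n x + (-1) * (\<Sum>k<n. L2_inner P (v n) (gram_schmidt P v k) * gram_schmidt P v k x)"

lemma gram_schmidt_eq:
  "gram_schmidt P v n = (\<lambda>x. (1 / sqrt (L2_inner P (gs_residual P v n) (gs_residual P v n))) * gs_residual P v n x)"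
  by (subst gram_schmidt.simps) (simp add: Let_def gs_residual_def[abs_def])

locale L2_sequence =
  fixes P :: "'x measure" and v :: "nat => 'x => real"
  assumes L2_v: "\<And>n. L2_fun P (v n)"
begin

abbreviation "gs \<equiv> gram_schmidt P v"
abbreviation "res \<equiv> gs_residual P v"

lemma gs_props:
  "L2_fun P (gs n) \<and> (\<forall>k<n. L2_inner P (gs n) (gs k) = 0) \<and> (L2_inner P (gs n) (gs n) = 1 \<or> gs n = (\<lambda>_. 0))"
proof (induction n rule: less_induct)
  case (less n)
  have sL2: "L2_fun P (\<lambda>x. \<Sum>k<n. L2_inner P (v n) (gs k) * gs k x)"
    by (rule L2_fun_sum) (use less in auto)
  have rL2: "L2_fun P (res n)"
    unfolding gs_residual_def[abs_def] by (rule L2_fun_add[OF L2_v sL2])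
  have orth: "L2_inner P (res n) (gs j) = 0" if j: "j < n" for j
  proof -
    have "L2_inner P (res n) (gs j) = L2_inner P (v n) (gs j) + (-1) * L2_inner P (\<lambda>x. \<Sum>k<n. L2_inner P (v n) (gs k) * gs k x) (gs j)"
      unfolding gs_residual_def[abs_def] by (rule L2_inner_add[OF L2_v sL2]) (use less j in auto)
    also have "L2_inner P (\<lambda>x. \<Sum>k<n. L2_inner P (v n) (gs k) * gs k x) (gs j) = (\<Sum>k<n. L2_inner P (v n) (gs k) * L2_inner P (gs k) (gs j))"
      by (rule L2_inner_sum) (use less j in auto)
    also have "\<dots> = (\<Sum>k<n. if k = j then L2_inner P (v n) (gs j) * L2_inner P (gs j) (gs j) else 0)"
    proof (rule sum.cong[OF refl])
      fix k assume "k \<in> {..<n}"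
      then have "L2_inner P (gs k) (gs j) = 0" if "k \<noteq> j"
        using less[of k] less[of j] j that L2_inner_commute[of P "gs k" "gs j"] by (cases "k < j") auto
      then show "L2_inner P (v n) (gs k) * L2_inner P (gs k) (gs j) = (if k = j then L2_inner P (v n) (gs j) * L2_inner P (gs j) (gs j) else 0)"
        by auto
    qed
    also have "\<dots> = L2_inner P (v n) (gs j) * L2_inner P (gs j) (gs j)" using j by simp
    also have "\<dots> = L2_inner P (v n) (gs j)"
    proof (cases "gs j = (\<lambda>_. 0)")
      case True
      then show ?thesis by (simp add: L2_inner_def)
    next
      case False
      then show ?thesis using less[OF j] by simp
    qed
    finally show ?thesis by simp
  qed
  let ?\<rho> = "L2_inner P (res n) (res n)"
  have "L2_inner P (gs n) (gs n) = (1 / sqrt ?\<rho>) * ((1 / sqrt ?\<rho>) * ?\<rho>)"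
    unfolding gram_schmidt_eq[of P v n] L2_inner_scale
    by (subst L2_inner_commute) (simp only: L2_inner_scale)
  moreover have "(1 / sqrt ?\<rho>) * ((1 / sqrt ?\<rho>) * ?\<rho>) = 1" if "?\<rho> \<noteq> 0"
  proof -
    have "?\<rho> > 0" using that L2_inner_nonneg[of P "res n"] by simp
    then have "sqrt ?\<rho> * sqrt ?\<rho> = ?\<rho>" "sqrt ?\<rho> \<noteq> 0" by auto
    moreover have "(1 / s) * ((1 / s) * r) = 1" if "s * s = r" "s \<noteq> 0" for s r :: real
      using that by (auto simp: field_simps)
    ultimately show ?thesis by blast
  qed
  moreover have "gs n = (\<lambda>_. 0)" if "?\<rho> = 0" unfolding gram_schmidt_eq[of P v n] that by simp
  moreover have "L2_fun P (gs n)" unfolding gram_schmidt_eq[of P v n] by (rule L2_fun_scale[OF rL2])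
  moreover have "\<forall>k<n. L2_inner P (gs n) (gs k) = 0"
    unfolding gram_schmidt_eq[of P v n] L2_inner_scale using orth by simp
  ultimately show ?case by fastforce
qed

lemma gs_L2: "L2_fun P (gs n)"
  and gs_orthogonal: "j \<noteq> k ==> L2_inner P (gs j) (gs k) = 0"
  and gs_normal: "L2_inner P (gs n) (gs n) = 1 \<or> gs n = (\<lambda>_. 0)"
proof -
  show "L2_fun P (gs n)" "L2_inner P (gs n) (gs n) = 1 \<or> gs n = (\<lambda>_. 0)" using gs_props by auto
  show "j \<noteq> k ==> L2_inner P (gs j) (gs k) = 0"
    using gs_props[of j] gs_props[of k] L2_inner_commute[of P "gs j" "gs k"] by (cases "k < j") auto
qed

lemma res_L2: "L2_fun P (res n)"
  unfolding gs_residual_def[abs_def] by (intro L2_fun_add L2_v L2_fun_sum gs_L2 finite_lessThan)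

text \<open>
  Each vector lies in the span of the orthonormalised ones up to its own index.
\<close>

lemma v_inner_step:
  assumes g: "L2_fun P g"
  shows "L2_inner P (v n) g = (\<Sum>k<Suc n. L2_inner P (v n) (gs k) * L2_inner P (gs k) g)"
proof -
  have split: "L2_inner P (v n) h = L2_inner P (res n) h + (\<Sum>k<n. L2_inner P (v n) (gs k) * L2_inner P (gs k) h)" if h: "L2_fun P h" for h
  proof -
    have "L2_inner P (res n) h = L2_inner P (v n) h + (-1) * L2_inner P (\<lambda>x. \<Sum>k<n. L2_inner P (v n) (gs k) * gs k x) h"
      unfolding gs_residual_def[abs_def] by (rule L2_inner_add[OF L2_v _ h]) (rule L2_fun_sum, auto intro: gs_L2)
    also have "L2_inner P (\<lambda>x. \<Sum>k<n. L2_inner P (v n) (gs k) * gs k x) h = (\<Sum>k<n. L2_inner P (v n) (gs k) * L2_inner P (gs k) h)"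
      by (rule L2_inner_sum) (auto intro: gs_L2 h)
    finally show ?thesis by simp
  qed
  let ?\<rho> = "L2_inner P (res n) (res n)"
  have "L2_inner P (res n) g = L2_inner P (v n) (gs n) * L2_inner P (gs n) g"
  proof (cases "?\<rho> = 0")
    case True
    have "gs n = (\<lambda>_. 0)" unfolding gram_schmidt_eq[of P v n] True by simp
    then show ?thesis using L2_inner_null[OF res_L2 True] by (simp add: L2_inner_def)
  next
    case False
    then have p: "?\<rho> > 0" using L2_inner_nonneg[of P "res n"] by simp
    then have s: "sqrt ?\<rho> * sqrt ?\<rho> = ?\<rho>" "sqrt ?\<rho> > 0" by auto
    have "(\<Sum>k<n. L2_inner P (v n) (gs k) * L2_inner P (gs k) (gs n)) = 0"
      using gs_orthogonal by (intro sum.neutral) auto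
    then have "L2_inner P (v n) (gs n) = L2_inner P (res n) (gs n)" using split[OF gs_L2[of n]] by simp
    also have "\<dots> = (1 / sqrt ?\<rho>) * ?\<rho>"
      by (subst L2_inner_commute, subst gram_schmidt_eq[of P v n]) (rule L2_inner_scale)
    also have "\<dots> = sqrt ?\<rho>" using s by (simp add: divide_eq_eq)
    finally have "L2_inner P (v n) (gs n) = sqrt ?\<rho>" .
    moreover have "L2_inner P (gs n) g = (1 / sqrt ?\<rho>) * L2_inner P (res n) g"
      by (subst gram_schmidt_eq[of P v n]) (rule L2_inner_scale)
    ultimately show ?thesis using s(2) by simp
  qed
  with split[OF g] show ?thesis by simp
qed

lemma v_gs_zero: "n < k ==> L2_inner P (v n) (gs k) = 0"
  by (subst v_inner_step[OF gs_L2]) (auto simp: gs_orthogonal intro!: sum.neutral)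

lemma v_inner_expansion:
  assumes "L2_fun P g" "n < N"
  shows "L2_inner P (v n) g = (\<Sum>k<N. L2_inner P (v n) (gs k) * L2_inner P (gs k) g)"
proof -
  have "(\<Sum>k<N. L2_inner P (v n) (gs k) * L2_inner P (gs k) g) = (\<Sum>k<Suc n. L2_inner P (v n) (gs k) * L2_inner P (gs k) g)"
    using assms(2) v_gs_zero by (intro sum.mono_neutral_right) auto
  then show ?thesis using v_inner_step[OF assms(1)] by simp
qed

end

section \<open>Construction of the tight Gaussian process\<close>

lemma gaussian_measure_unique:
  assumes "prob_space N" and [measurable]: "Y \<in> borel_measurable N" and \<sigma>: "\<sigma> \<ge> 0"
    and char: "\<And>t. (CLINT \<omega>|N. iexp (t * Y \<omega>)) = complex_of_real (exp (- (t\<^sup>2 * \<sigma>\<^sup>2) / 2))"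
  shows "distr N borel Y = gaussian_measure 0 \<sigma>"
proof (rule Levy_uniqueness)
  interpret N: prob_space N by fact
  show "real_distribution (distr N borel Y)" by (rule N.real_distribution_distr) simp
  interpret Z: prob_space std_normal_distribution
    using prob_space_normal_density[of 1 0] by simp
  show "real_distribution (gaussian_measure 0 \<sigma>)"
    unfolding gaussian_measure_eq_distr[OF \<sigma>] by (rule Z.real_distribution_distr) simp
  show "char (distr N borel Y) = char (gaussian_measure 0 \<sigma>)"
  proof
    fix t
    have "char (distr N borel Y) t = (CLINT \<omega>|N. iexp (t * Y \<omega>))"
      unfolding char_def by (rule integral_distr) measurable
    also have "\<dots> = char (gaussian_measure 0 \<sigma>) t"
      unfolding char char_def gaussian_measure_moments(5)[OF \<sigma>] by simp
    finally show "char (distr N borel Y) t = char (gaussian_measure 0 \<sigma>) t" .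
  qed
qed

text \<open>
  The index set is the range of an injection, so that the process can be realised on a product
  space of prescribed type.
\<close>

lemma std_normal_sequence:
  fixes \<iota> :: "nat => 'i"
  assumes inj: "inj \<iota>"
  defines "N \<equiv> \<Pi>\<^sub>M i\<in>range \<iota>. std_normal_distribution"
  shows "prob_space N" and "\<And>k. (\<lambda>\<omega>. \<omega> (\<iota> k)) \<in> borel_measurable N"
    and "\<And>K b. (CLINT \<omega>|N. iexp (\<Sum>k<K. b k * \<omega> (\<iota> k))) = complex_of_real (exp (- (\<Sum>k<(K::nat). (b k)\<^sup>2) / 2))"
proof -
  let ?Z = "std_normal_distribution"
  have pZ: "prob_space ?Z" using prob_space_normal_density[of 1 0] by simp
  show pN: "prob_space N" unfolding N_def by (rule prob_space_PiM) (rule pZ)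
  interpret N: prob_space N by (rule pN)
  have comp: "(\<lambda>\<omega>. \<omega> i) \<in> measurable N ?Z" if "i \<in> range \<iota>" for i
    unfolding N_def using that by (rule measurable_component_singleton)
  have compb: "(\<lambda>\<omega>. \<omega> i) \<in> borel_measurable N" if "i \<in> range \<iota>" for i
    using comp[OF that] by (simp cong: measurable_cong_sets)
  then show cm: "(\<lambda>\<omega>. \<omega> (\<iota> k)) \<in> borel_measurable N" for k by blast
  have dist: "distr N borel (\<lambda>\<omega>. \<omega> i) = ?Z" if "i \<in> range \<iota>" for i
  proof -
    have "distr N borel (\<lambda>\<omega>. \<omega> i) = distr N ?Z (\<lambda>\<omega>. \<omega> i)" by (rule distr_cong) auto
    also have "\<dots> = ?Z" unfolding N_def by (rule distr_PiM_component) (use pZ that in auto)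
    finally show ?thesis .
  qed
  have ind: "N.indep_vars (\<lambda>_. borel) (\<lambda>i \<omega>. \<omega> i) (range \<iota>)"
  proof (subst N.indep_vars_iff_distr_eq_PiM')
    show "range \<iota> \<noteq> {}" by simp
    show "i \<in> range \<iota> ==> (\<lambda>\<omega>. \<omega> i) \<in> borel_measurable N" for i by (rule compb)
    have sp: "space N = (\<Pi>\<^sub>E i\<in>range \<iota>. UNIV)" by (simp add: N_def space_PiM)
    have "distr N (\<Pi>\<^sub>M i\<in>range \<iota>. borel) (\<lambda>x. restrict x (range \<iota>)) = distr N N (\<lambda>x. x)"
    proof (rule distr_cong)
      show "sets (\<Pi>\<^sub>M i\<in>range \<iota>. borel :: real measure) = sets N" unfolding N_def by (rule sets_PiM_cong) auto
      show "restrict x (range \<iota>) = x" if "x \<in> space N" for x using that sp by (auto simp: PiE_def extensional_restrict)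
    qed simp
    also have "\<dots> = N" by (rule distr_id2) simp
    also have "\<dots> = (\<Pi>\<^sub>M i\<in>range \<iota>. distr N borel (\<lambda>\<omega>. \<omega> i))"
      unfolding N_def by (rule PiM_cong) (use dist in \<open>auto simp: N_def\<close>)
    finally show "distr N (\<Pi>\<^sub>M i\<in>range \<iota>. borel) (\<lambda>x. restrict x (range \<iota>)) = (\<Pi>\<^sub>M i\<in>range \<iota>. distr N borel (\<lambda>\<omega>. \<omega> i))" .
  qed
  show "(CLINT \<omega>|N. iexp (\<Sum>k<K. b k * \<omega> (\<iota> k))) = complex_of_real (exp (- (\<Sum>k<K. (b k)\<^sup>2) / 2))" for K :: nat and b
  proof -
    define J where "J = \<iota> ` {..<K}"
    define \<beta> where "\<beta> i = b (inv \<iota> i)" for i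
    have re: "(\<Sum>i\<in>J. g i) = (\<Sum>k<K. g (\<iota> k))" for g :: "'i => real"
      unfolding J_def by (rule sum.reindex_cong[of \<iota> "{..<K}"]) (use inj in \<open>auto simp: inj_on_def inj_def\<close>)
    have \<beta>: "\<beta> (\<iota> k) = b k" for k using inj by (simp add: \<beta>_def)
    have indJ: "N.indep_vars (\<lambda>_. borel) (\<lambda>i \<omega>. \<beta> i * \<omega> i) J"
      by (rule N.indep_vars_compose2[OF N.indep_vars_subset[OF ind]]) (auto simp: J_def)
    have m: "(\<lambda>\<omega>. \<Sum>i\<in>J. \<beta> i * \<omega> i) \<in> borel_measurable N"
      using compb by (intro borel_measurable_sum borel_measurable_times) (auto simp: J_def)
    have 1: "char (distr N borel (\<lambda>\<omega>. \<beta> i * \<omega> i)) 1 = complex_of_real (exp (- ((\<beta> i)\<^sup>2) / 2))" if "i \<in> J" for i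
    proof -
      have i: "i \<in> range \<iota>" using that by (auto simp: J_def)
      have "char (distr N borel (\<lambda>\<omega>. \<beta> i * \<omega> i)) 1 = (CLINT \<omega>|N. iexp (1 * (\<beta> i * \<omega> i)))"
        unfolding char_def by (rule integral_distr) (use compb[OF i] in measurable)
      also have "\<dots> = (CLINT x|distr N borel (\<lambda>\<omega>. \<omega> i). iexp (\<beta> i * x))"
        unfolding mult_1 by (rule integral_distr[symmetric, OF compb[OF i]]) measurable
      also have "\<dots> = char ?Z (\<beta> i)" unfolding dist[OF i] char_def ..
      finally show ?thesis by (simp add: char_std_normal_distribution)
    qed
    have "(CLINT \<omega>|N. iexp (\<Sum>k<K. b k * \<omega> (\<iota> k))) = (CLINT \<omega>|N. iexp (1 * (\<Sum>i\<in>J. \<beta> i * \<omega> i)))"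
      unfolding re \<beta> by simp
    also have "\<dots> = char (distr N borel (\<lambda>\<omega>. \<Sum>i\<in>J. \<beta> i * \<omega> i)) 1"
      unfolding char_def by (rule integral_distr[symmetric, OF m]) measurable
    also have "\<dots> = (\<Prod>i\<in>J. char (distr N borel (\<lambda>\<omega>. \<beta> i * \<omega> i)) 1)"
      by (rule N.char_distr_sum[OF indJ])
    also have "\<dots> = (\<Prod>i\<in>J. complex_of_real (exp (- ((\<beta> i)\<^sup>2) / 2)))" by (rule prod.cong[OF refl 1])
    also have "\<dots> = complex_of_real (exp (\<Sum>i\<in>J. - ((\<beta> i)\<^sup>2) / 2))"
      unfolding J_def by (simp add: exp_sum)
    also have "(\<Sum>i\<in>J. - ((\<beta> i)\<^sup>2) / 2) = - (\<Sum>k<K. (b k)\<^sup>2) / 2"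
      unfolding re \<beta> by (simp add: sum_negf sum_divide_distrib)
    finally show ?thesis .
  qed
qed

locale gaussian_coordinates = L2_sequence P e + N: prob_space N
  for P :: "'x measure" and e :: "nat => 'x => real" and N :: "'v measure" +
  fixes \<xi> :: "nat => 'v => real"
  assumes \<xi>_measurable[measurable]: "\<And>k. \<xi> k \<in> borel_measurable N"
    and \<xi>_char: "\<And>K b. (CLINT \<omega>|N. iexp (\<Sum>k<K. b k * \<xi> k \<omega>)) = complex_of_real (exp (- (\<Sum>k<(K::nat). (b k)\<^sup>2) / 2))"
begin

text \<open>
  Jointly Gaussian variables with the same covariances as the functions \<open>e k\<close>.
\<close>

definition Z :: "nat => 'v => real" where
  "Z k \<omega> = (\<Sum>j<Suc k. L2_inner P (e k) (gs j) * \<xi> j \<omega>)"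

lemma Z_measurable[measurable]: "Z k \<in> borel_measurable N"
  unfolding Z_def[abs_def] by measurable

lemma Z_char:
  "(CLINT \<omega>|N. iexp (\<Sum>k<K. \<gamma> k * Z k \<omega>)) = complex_of_real (exp (- (LINT x|P. (\<Sum>k<K. \<gamma> k * e k x)\<^sup>2) / 2))"
proof -
  let ?a = "\<lambda>k j. L2_inner P (e k) (gs j)"
  define \<beta> where "\<beta> j = (\<Sum>k<K. \<gamma> k * ?a k j)" for j
  have Zx: "Z k \<omega> = (\<Sum>j<K. ?a k j * \<xi> j \<omega>)" if "k < K" for k \<omega>
    unfolding Z_def using that v_gs_zero[of k] by (intro sum.mono_neutral_left) auto
  have "(\<Sum>k<K. \<gamma> k * Z k \<omega>) = (\<Sum>j<K. \<beta> j * \<xi> j \<omega>)" for \<omega>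
  proof -
    have "(\<Sum>k<K. \<gamma> k * Z k \<omega>) = (\<Sum>k<K. \<Sum>j<K. \<gamma> k * ?a k j * \<xi> j \<omega>)"
      by (simp add: Zx sum_distrib_left mult.assoc)
    also have "\<dots> = (\<Sum>j<K. \<Sum>k<K. \<gamma> k * ?a k j * \<xi> j \<omega>)" by (rule sum.swap)
    finally show ?thesis by (simp add: \<beta>_def sum_distrib_right)
  qed
  then have 1: "(CLINT \<omega>|N. iexp (\<Sum>k<K. \<gamma> k * Z k \<omega>)) = complex_of_real (exp (- (\<Sum>j<K. (\<beta> j)\<^sup>2) / 2))"
    by (simp only: \<xi>_char)
  have "(\<Sum>j<K. (\<beta> j)\<^sup>2) = (\<Sum>j<K. \<Sum>k<K. \<Sum>l<K. \<gamma> k * \<gamma> l * (?a k j * ?a l j))"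
    unfolding \<beta>_def power2_eq_square sum_product by (simp add: mult_ac)
  also have "\<dots> = (\<Sum>k<K. \<Sum>l<K. \<Sum>j<K. \<gamma> k * \<gamma> l * (?a k j * ?a l j))"
    by (subst sum.swap) (intro sum.cong refl sum.swap)
  also have "\<dots> = (\<Sum>k<K. \<Sum>l<K. \<gamma> k * \<gamma> l * L2_inner P (e k) (e l))"
  proof (intro sum.cong refl)
    fix k l assume "k \<in> {..<K}" "l \<in> {..<K}"
    then have "L2_inner P (e k) (e l) = (\<Sum>j<K. ?a k j * ?a l j)"
      using v_inner_expansion[OF L2_v[of l], of k K] by (simp add: L2_inner_commute[of P _ "e l"])
    then show "(\<Sum>j<K. \<gamma> k * \<gamma> l * (?a k j * ?a l j)) = \<gamma> k * \<gamma> l * L2_inner P (e k) (e l)"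
      by (simp add: sum_distrib_left)
  qed
  also have "\<dots> = (LINT x|P. (\<Sum>k<K. \<gamma> k * e k x)\<^sup>2)"
    unfolding L2_inner_def by (rule L2_sum(2)[symmetric]) (use L2_v in \<open>auto simp: L2_fun_def\<close>)
  finally show ?thesis using 1 by simp
qed

lemma Z_moment: "integrable N (\<lambda>\<omega>. \<bar>Z k \<omega>\<bar>)" "N.expectation (\<lambda>\<omega>. \<bar>Z k \<omega>\<bar>) \<le> sqrt (LINT x|P. (e k x)\<^sup>2)"
proof -
  let ?V = "LINT x|P. (e k x)\<^sup>2"
  have d: "distr N borel (Z k) = gaussian_measure 0 (sqrt ?V)"
  proof (rule gaussian_measure_unique)
    fix t
    have "(CLINT \<omega>|N. iexp (\<Sum>j<Suc k. (if j = k then t else 0) * Z j \<omega>))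
      = complex_of_real (exp (- (LINT x|P. (\<Sum>j<Suc k. (if j = k then t else 0) * e j x)\<^sup>2) / 2))" by (rule Z_char)
    moreover have "(\<Sum>j<Suc k. (if j = k then t else 0) * g j) = t * g k" for g :: "nat => real"
      by (simp add: sum.neutral)
    ultimately show "(CLINT \<omega>|N. iexp (t * Z k \<omega>)) = complex_of_real (exp (- (t\<^sup>2 * (sqrt ?V)\<^sup>2) / 2))"
      by (simp add: power_mult_distrib)
  qed (auto simp: N.prob_space_axioms)
  have s0: "sqrt ?V \<ge> 0" by simp
  have i2: "integrable N (\<lambda>\<omega>. (Z k \<omega>)\<^sup>2)" and E2: "N.expectation (\<lambda>\<omega>. (Z k \<omega>)\<^sup>2) = ?V"
    using gaussian_measure_moments(3,4)[OF s0, of 0] unfolding d[symmetric]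
    by (simp_all add: integrable_distr_eq integral_distr)
  show i: "integrable N (\<lambda>\<omega>. \<bar>Z k \<omega>\<bar>)"
    by (rule N.square_integrable_imp_integrable) (use i2 in auto)
  have "(N.expectation (\<lambda>\<omega>. \<bar>Z k \<omega>\<bar>))\<^sup>2 \<le> ?V"
    using N.variance_eq[OF i] N.variance_positive[of "\<lambda>\<omega>. \<bar>Z k \<omega>\<bar>"] i2 E2 by simp
  then show "N.expectation (\<lambda>\<omega>. \<bar>Z k \<omega>\<bar>) \<le> sqrt ?V" by (rule real_le_rsqrt)
qed

end

text \<open>
  Coefficients depending continuously on the function make the paths of the random series
  continuous.
\<close>

locale lipschitz_series = series_class P S c w e A
  for P :: "'x measure" and S c w e A +
  fixes C :: "nat => real"
  assumes c_lipschitz: "\<And>s t k. s \<in> S ==> t \<in> S ==> \<bar>c s k - c t k\<bar> \<le> C k * L2_dist P s t"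

locale gaussian_series = lipschitz_series P S c w e A C + gaussian_coordinates P e N \<xi>
  for P :: "'x measure" and S c w e A C and N :: "'v measure" and \<xi>
begin

definition good :: "'v => bool" where
  "good \<omega> \<longleftrightarrow> (\<Sum>k. ennreal (w k * \<bar>Z k \<omega>\<bar>)) < top"

lemma good_measurable[measurable]: "Measurable.pred N good"
  unfolding good_def[abs_def] by measurable

lemma good_summable: "good \<omega> ==> summable (\<lambda>k. w k * \<bar>Z k \<omega>\<bar>)"
  unfolding good_def by (rule summable_suminf_not_top) (auto simp: w_nonneg)

text \<open>
  The first moments of \<open>Z k\<close> are bounded and the weights are summable.
\<close>

lemma AE_good: "AE \<omega> in N. good \<omega>"
proof -
  let ?a = "sqrt (LINT x|P. (A x)\<^sup>2)"
  have E: "N.expectation (\<lambda>\<omega>. \<bar>Z k \<omega>\<bar>) \<le> ?a" for k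
  proof -
    have "(LINT x|P. (e k x)\<^sup>2) \<le> (LINT x|P. (A x)\<^sup>2)"
      using e_power_integrable[of 2 k] A_integrable e_bound
      by (intro integral_mono) (auto simp: abs_le_square_iff[symmetric] A_nonneg)
    then show ?thesis using Z_moment(2)[of k] by (meson order_trans real_sqrt_le_mono)
  qed
  have "(\<integral>\<^sup>+ \<omega>. (\<Sum>k. ennreal (w k * \<bar>Z k \<omega>\<bar>)) \<partial>N) = (\<Sum>k. \<integral>\<^sup>+ \<omega>. ennreal (w k * \<bar>Z k \<omega>\<bar>) \<partial>N)"
    by (rule nn_integral_suminf) measurable
  also have "\<dots> \<le> (\<Sum>k. ennreal (w k * ?a))"
  proof (rule suminf_le)
    fix k
    have "(\<integral>\<^sup>+ \<omega>. ennreal (w k * \<bar>Z k \<omega>\<bar>) \<partial>N) = ennreal (N.expectation (\<lambda>\<omega>. w k * \<bar>Z k \<omega>\<bar>))"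
      using Z_moment(1)[of k] by (intro nn_integral_eq_integral) (auto simp: w_nonneg)
    also have "\<dots> \<le> ennreal (w k * ?a)" using E[of k] w_nonneg[of k] by (intro ennreal_leI) (simp add: mult_left_mono)
    finally show "(\<integral>\<^sup>+ \<omega>. ennreal (w k * \<bar>Z k \<omega>\<bar>) \<partial>N) \<le> ennreal (w k * ?a)" .
  qed auto
  also have "\<dots> = ennreal (\<Sum>k. w k * ?a)"
    using summable_mult2[OF w_summable, of ?a] by (intro suminf_ennreal2) (auto simp: w_nonneg)
  finally have "(\<integral>\<^sup>+ \<omega>. (\<Sum>k. ennreal (w k * \<bar>Z k \<omega>\<bar>)) \<partial>N) \<noteq> \<infinity>"
    by (metis ennreal_less_top infinity_ennreal_def leD)
  then have "AE \<omega> in N. (\<Sum>k. ennreal (w k * \<bar>Z k \<omega>\<bar>)) \<noteq> \<infinity>"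
    by (intro nn_integral_PInf_AE) measurable
  then show ?thesis by eventually_elim (simp add: good_def less_top)
qed

definition Y :: "(nat => real) => 'v => real" where
  "Y \<gamma> \<omega> = (if good \<omega> then \<Sum>k. \<gamma> k * Z k \<omega> else 0)"

lemma Y_measurable[measurable]: "Y \<gamma> \<in> borel_measurable N"
  unfolding Y_def[abs_def] by measurable

lemma Y_summable:
  assumes "\<And>k. \<bar>\<gamma> k\<bar> \<le> B * w k" "good \<omega>"
  shows "summable (\<lambda>k. \<bar>\<gamma> k * Z k \<omega>\<bar>)" "summable (\<lambda>k. \<gamma> k * Z k \<omega>)"
proof -
  show "summable (\<lambda>k. \<bar>\<gamma> k * Z k \<omega>\<bar>)"
  proof (rule summable_comparison_test)
    show "summable (\<lambda>k. B * (w k * \<bar>Z k \<omega>\<bar>))" using good_summable[OF assms(2)] by (rule summable_mult)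
    have "\<bar>\<gamma> k\<bar> * \<bar>Z k \<omega>\<bar> \<le> B * w k * \<bar>Z k \<omega>\<bar>" for k using assms(1) by (rule mult_right_mono) simp
    then show "\<exists>M. \<forall>k\<ge>M. norm \<bar>\<gamma> k * Z k \<omega>\<bar> \<le> B * (w k * \<bar>Z k \<omega>\<bar>)" by (simp add: abs_mult mult.assoc)
  qed
  then show "summable (\<lambda>k. \<gamma> k * Z k \<omega>)" by (rule summable_rabs_cancel)
qed

text \<open>
  Partial sums have the Gaussian characteristic function; both sides converge.
\<close>

lemma Y_char:
  assumes \<gamma>: "\<And>k. \<bar>\<gamma> k\<bar> \<le> B * w k"
  shows "(CLINT \<omega>|N. iexp (t * Y \<gamma> \<omega>)) = complex_of_real (exp (- (t\<^sup>2 * (LINT x|P. (\<Sum>k. \<gamma> k * e k x)\<^sup>2)) / 2))"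
proof (rule LIMSEQ_unique)
  show "(\<lambda>K. CLINT \<omega>|N. iexp (\<Sum>k<K. (t * \<gamma> k) * Z k \<omega>)) \<longlonglongrightarrow> (CLINT \<omega>|N. iexp (t * Y \<gamma> \<omega>))"
  proof (rule integral_dominated_convergence[where w="\<lambda>_. 1"])
    show "AE \<omega> in N. (\<lambda>K. iexp (\<Sum>k<K. (t * \<gamma> k) * Z k \<omega>)) \<longlonglongrightarrow> iexp (t * Y \<gamma> \<omega>)"
      using AE_good
    proof eventually_elim
      case (elim \<omega>)
      have "(\<lambda>K. t * (\<Sum>k<K. \<gamma> k * Z k \<omega>)) \<longlonglongrightarrow> t * (\<Sum>k. \<gamma> k * Z k \<omega>)"
        by (intro tendsto_mult tendsto_const summable_LIMSEQ Y_summable(2)[OF \<gamma> elim])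
      then have "(\<lambda>K. iexp (t * (\<Sum>k<K. \<gamma> k * Z k \<omega>))) \<longlonglongrightarrow> iexp (t * (\<Sum>k. \<gamma> k * Z k \<omega>))"
        by (rule tendsto_exp[OF tendsto_mult[OF tendsto_const tendsto_of_real]])
      then show ?case using elim by (simp add: Y_def sum_distrib_left mult.assoc)
    qed
    show "AE \<omega> in N. norm (iexp (\<Sum>k<K. (t * \<gamma> k) * Z k \<omega>)) \<le> 1" for K
      by (intro AE_I2) (simp del: of_real_sum of_real_mult)
  qed (auto intro!: borel_measurable_integrable)
  let ?v = "\<lambda>k. B * w k"
  have v: "summable ?v" using w_summable by (rule summable_mult)
  have "(\<lambda>K. LINT x|P. (\<Sum>k<K. \<gamma> k * e k x)\<^sup>2) \<longlonglongrightarrow> (LINT x|P. (\<Sum>k. \<gamma> k * e k x)\<^sup>2)"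
  proof (rule integral_dominated_convergence[where w="\<lambda>x. (suminf ?v)\<^sup>2 * (A x)\<^sup>2"])
    show "AE x in P. (\<lambda>K. (\<Sum>k<K. \<gamma> k * e k x)\<^sup>2) \<longlonglongrightarrow> (\<Sum>k. \<gamma> k * e k x)\<^sup>2"
      by (intro AE_I2 tendsto_power summable_LIMSEQ series_summable[OF v \<gamma>])
    show "AE x in P. norm ((\<Sum>k<K. \<gamma> k * e k x)\<^sup>2) \<le> (suminf ?v)\<^sup>2 * (A x)\<^sup>2" for K
    proof (rule AE_I2)
      fix x assume "x \<in> space P"
      from power_mono[OF series_abs_summable(3)[OF v \<gamma> this, of K], of 2]
      show "norm ((\<Sum>k<K. \<gamma> k * e k x)\<^sup>2) \<le> (suminf ?v)\<^sup>2 * (A x)\<^sup>2" by (simp add: power_mult_distrib)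
    qed
  qed (use A_integrable in auto)
  then have "(\<lambda>K. complex_of_real (exp (- (t\<^sup>2 * (LINT x|P. (\<Sum>k<K. \<gamma> k * e k x)\<^sup>2)) / 2)))
      \<longlonglongrightarrow> complex_of_real (exp (- (t\<^sup>2 * (LINT x|P. (\<Sum>k. \<gamma> k * e k x)\<^sup>2)) / 2))"
    by (intro tendsto_of_real tendsto_exp tendsto_divide tendsto_minus tendsto_mult tendsto_const) auto
  moreover have "(CLINT \<omega>|N. iexp (\<Sum>k<K. (t * \<gamma> k) * Z k \<omega>)) = complex_of_real (exp (- (t\<^sup>2 * (LINT x|P. (\<Sum>k<K. \<gamma> k * e k x)\<^sup>2)) / 2))" for K
  proof -
    have "(\<Sum>k<K. (t * \<gamma> k) * e k x)\<^sup>2 = t\<^sup>2 * (\<Sum>k<K. \<gamma> k * e k x)\<^sup>2" for x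
      by (simp add: sum_distrib_left mult.assoc flip: power_mult_distrib)
    then show ?thesis unfolding Z_char by simp
  qed
  ultimately show "(\<lambda>K. CLINT \<omega>|N. iexp (\<Sum>k<K. (t * \<gamma> k) * Z k \<omega>))
      \<longlonglongrightarrow> complex_of_real (exp (- (t\<^sup>2 * (LINT x|P. (\<Sum>k. \<gamma> k * e k x)\<^sup>2)) / 2))" by simp
qed

lemma combination_law:
  assumes F: "finite F" "F \<subseteq> S"
  shows "distr N borel (\<lambda>\<omega>. \<Sum>s\<in>F. b s * Y (c s) \<omega>) = gaussian_measure 0 (sqrt (LINT x|P. (\<Sum>s\<in>F. b s * s x)\<^sup>2))"
proof -
  define \<gamma> where "\<gamma> k = (\<Sum>s\<in>F. b s * c s k)" for k
  define B where "B = (\<Sum>s\<in>F. \<bar>b s\<bar>)"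
  have \<gamma>: "\<bar>\<gamma> k\<bar> \<le> B * w k" for k
  proof -
    have "\<bar>\<gamma> k\<bar> \<le> (\<Sum>s\<in>F. \<bar>b s * c s k\<bar>)" unfolding \<gamma>_def by (rule sum_abs)
    also have "\<dots> \<le> (\<Sum>s\<in>F. \<bar>b s\<bar> * w k)"
      unfolding abs_mult using c_bound F by (intro sum_mono mult_left_mono) auto
    finally show ?thesis by (simp add: B_def sum_distrib_right)
  qed
  have cw: "\<bar>c s k\<bar> \<le> 1 * w k" if "s \<in> F" for s k using c_bound F that by auto
  have lin: "(\<Sum>s\<in>F. b s * Y (c s) \<omega>) = Y \<gamma> \<omega>" for \<omega>
  proof (cases "good \<omega>")
    case True
    have "Y \<gamma> \<omega> = (\<Sum>k. \<Sum>s\<in>F. b s * (c s k * Z k \<omega>))"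
      using True by (simp add: Y_def \<gamma>_def sum_distrib_right mult.assoc)
    also have "\<dots> = (\<Sum>s\<in>F. \<Sum>k. b s * (c s k * Z k \<omega>))"
      using Y_summable(2)[OF cw True] by (intro suminf_sum summable_mult)
    also have "\<dots> = (\<Sum>s\<in>F. b s * Y (c s) \<omega>)"
      using Y_summable(2)[OF cw True] True by (intro sum.cong refl) (simp add: Y_def suminf_mult)
    finally show ?thesis ..
  qed (simp add: Y_def)
  have ser: "(\<Sum>k. \<gamma> k * e k x) = (\<Sum>s\<in>F. b s * s x)" if x: "x \<in> space P" for x
  proof -
    have sm: "summable (\<lambda>k. c s k * e k x)" if "s \<in> F" for s
      by (rule series_summable[OF w_summable c_bound x]) (use that F in auto)
    have "(\<Sum>k. \<gamma> k * e k x) = (\<Sum>k. \<Sum>s\<in>F. b s * (c s k * e k x))"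
      by (simp add: \<gamma>_def sum_distrib_right mult.assoc)
    also have "\<dots> = (\<Sum>s\<in>F. \<Sum>k. b s * (c s k * e k x))"
      using sm by (intro suminf_sum summable_mult)
    also have "\<dots> = (\<Sum>s\<in>F. b s * s x)"
      using sm F by (intro sum.cong refl) (auto simp: suminf_mult expansion x subset_iff)
    finally show ?thesis .
  qed
  let ?V = "LINT x|P. (\<Sum>s\<in>F. b s * s x)\<^sup>2"
  have V: "(LINT x|P. (\<Sum>k. \<gamma> k * e k x)\<^sup>2) = ?V" by (rule Bochner_Integration.integral_cong) (auto simp: ser)
  show ?thesis unfolding lin
  proof (rule gaussian_measure_unique)
    show "(CLINT \<omega>|N. iexp (t * Y \<gamma> \<omega>)) = complex_of_real (exp (- (t\<^sup>2 * (sqrt ?V)\<^sup>2) / 2))" for t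
      unfolding Y_char[OF \<gamma>] V by simp
  qed (auto simp: N.prob_space_axioms)
qed

text \<open>
  The Weierstrass test, with the summable bounds \<open>w k * \<bar>Z k \<omega>\<bar>\<close>,
  gives bounded and uniformly continuous paths: finitely many terms are Lipschitz in
  \<open>L\<^sub>2\<close> and the tail is uniformly small.
\<close>

lemma Y_process: "tight_gaussian_process N P S (\<lambda>s. Y (c s))"
  unfolding tight_gaussian_process_def
proof
  have sq: "integrable P (\<lambda>x. (s x)\<^sup>2)" if "s \<in> S" for s by (rule S_power_integrable[OF that]) simp
  have law1: "distr N borel (Y (c s)) = gaussian_measure 0 (sqrt (LINT x|P. (s x)\<^sup>2))" if "s \<in> S" for s
    using combination_law[of "{s}" "\<lambda>_. 1"] that by simp
  have m1: "integrable N (Y (c s))" "N.expectation (Y (c s)) = 0" "integrable N (\<lambda>\<omega>. (Y (c s) \<omega>)\<^sup>2)"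
    "N.expectation (\<lambda>\<omega>. (Y (c s) \<omega>)\<^sup>2) = (LINT x|P. (s x)\<^sup>2)" if "s \<in> S" for s
    using gaussian_measure_moments(1-4)[of "sqrt (LINT x|P. (s x)\<^sup>2)" 0] unfolding law1[OF that, symmetric]
    by (simp_all add: integrable_distr_eq integral_distr)
  show "centered_gaussian_process N S (L2_inner P) (\<lambda>s. Y (c s))"
    unfolding centered_gaussian_process_def
  proof (intro conjI ballI allI impI)
    show "prob_space N" by unfold_locales
    show "Y (c s) \<in> borel_measurable N" for s by measurable
    show "\<exists>m \<sigma>. 0 \<le> \<sigma> \<and> distr N borel (\<lambda>\<omega>. \<Sum>s\<in>F. b s * Y (c s) \<omega>) = gaussian_measure m \<sigma>"
      if "finite F \<and> F \<subseteq> S" for F b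
      using combination_law[of F b] that by (intro exI[of _ 0] exI[of _ "sqrt (LINT x|P. (\<Sum>s\<in>F. b s * s x)\<^sup>2)"]) simp
    show "N.expectation (Y (c s)) = 0" if "s \<in> S" for s by (rule m1[OF that])
    show "(LINT \<omega>|N. Y (c s) \<omega> * Y (c t) \<omega>) = L2_inner P s t" if st: "s \<in> S" "t \<in> S" for s t
    proof (cases "s = t")
      case True
      then show ?thesis using m1(4)[OF st(1)] by (simp add: L2_inner_def power2_eq_square)
    next
      case False
      have law: "distr N borel (\<lambda>\<omega>. Y (c s) \<omega> + Y (c t) \<omega>) = gaussian_measure 0 (sqrt (LINT x|P. (s x + t x)\<^sup>2))"
        using combination_law[of "{s, t}" "\<lambda>_. 1"] st False by simp
      have "N.expectation (\<lambda>\<omega>. (Y (c s) \<omega> + Y (c t) \<omega>)\<^sup>2) = (LINT x|P. (s x + t x)\<^sup>2)"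
        using gaussian_measure_moments(4)[of "sqrt (LINT x|P. (s x + t x)\<^sup>2)" 0] unfolding law[symmetric]
        by (simp add: integral_distr)
      moreover have iY: "integrable N (\<lambda>\<omega>. Y (c s) \<omega> * Y (c t) \<omega>)"
        by (rule L2_inner_integrable) (use m1 st in auto)
      moreover have iP: "integrable P (\<lambda>x. s x * t x)"
        by (rule L2_inner_integrable) (use S_measurable sq st in auto)
      moreover have "N.expectation (\<lambda>\<omega>. (Y (c s) \<omega> + Y (c t) \<omega>)\<^sup>2) =
          N.expectation (\<lambda>\<omega>. (Y (c s) \<omega>)\<^sup>2) + N.expectation (\<lambda>\<omega>. (Y (c t) \<omega>)\<^sup>2) + 2 * (LINT \<omega>|N. Y (c s) \<omega> * Y (c t) \<omega>)"
        unfolding power2_sum using iY m1 st by (simp add: mult.assoc)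
      moreover have "(LINT x|P. (s x + t x)\<^sup>2) = (LINT x|P. (s x)\<^sup>2) + (LINT x|P. (t x)\<^sup>2) + 2 * (LINT x|P. s x * t x)"
        unfolding power2_sum using iP sq st by (simp add: mult.assoc)
      ultimately show ?thesis using m1(4) st by (simp add: L2_inner_def)
    qed
  qed
  show "bounded_uc_paths N S (L2_dist P) (\<lambda>s. Y (c s))"
    unfolding bounded_uc_paths_def
  proof (intro ballI conjI allI impI)
    fix \<omega>
    have cw: "\<bar>c s k\<bar> \<le> 1 * w k" if "s \<in> S" for s k using c_bound[OF that, of k] by simp
    show "bounded ((\<lambda>s. Y (c s) \<omega>) ` S)"
    proof (cases "good \<omega>")
      case True
      have "\<bar>Y (c s) \<omega>\<bar> \<le> (\<Sum>k. w k * \<bar>Z k \<omega>\<bar>)" if s: "s \<in> S" for s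
      proof -
        have "\<bar>Y (c s) \<omega>\<bar> \<le> (\<Sum>k. \<bar>c s k * Z k \<omega>\<bar>)"
          using True Y_summable(1)[OF cw[OF s] True] by (simp add: Y_def summable_rabs)
        also have "\<dots> \<le> (\<Sum>k. w k * \<bar>Z k \<omega>\<bar>)"
          using Y_summable(1)[OF cw[OF s] True] good_summable[OF True] c_bound[OF s]
          by (intro suminf_le) (auto simp: abs_mult mult_right_mono)
        finally show ?thesis .
      qed
      then show ?thesis unfolding bounded_iff by auto
    qed (auto simp: Y_def bounded_iff)
    fix \<epsilon> :: real assume \<epsilon>: "\<epsilon> > 0"
    show "\<exists>\<delta>>0. \<forall>s\<in>S. \<forall>t\<in>S. L2_dist P s t < \<delta> \<longrightarrow> \<bar>Y (c s) \<omega> - Y (c t) \<omega>\<bar> < \<epsilon>"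
    proof (cases "good \<omega>")
      case False
      then show ?thesis using \<epsilon> by (intro exI[of _ 1]) (simp add: Y_def)
    next
      case True
      note gs = good_summable[OF True]
      obtain K where K: "\<bar>\<Sum>k. w (k + K) * \<bar>Z (k + K) \<omega>\<bar>\<bar> < \<epsilon> / 4"
        using suminf_exist_split[of "\<epsilon> / 4" "\<lambda>k. w k * \<bar>Z k \<omega>\<bar>"] gs \<epsilon> by force
      define D where "D = (\<Sum>k<K. \<bar>C k\<bar> * \<bar>Z k \<omega>\<bar>) + 1"
      have D: "D > 0" unfolding D_def by (intro add_nonneg_pos sum_nonneg) auto
      show ?thesis
      proof (intro exI[of _ "\<epsilon> / (2 * D)"] conjI ballI impI)
        show "\<epsilon> / (2 * D) > 0" using \<epsilon> D by simp
        fix s t assume s: "s \<in> S" and t: "t \<in> S" and d: "L2_dist P s t < \<epsilon> / (2 * D)"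
        let ?h = "\<lambda>k. (c s k - c t k) * Z k \<omega>"
        have d0: "0 \<le> L2_dist P s t" by (simp add: L2_dist_def)
        have h2: "\<bar>c s k - c t k\<bar> \<le> 2 * w k" for k using c_bound[OF s, of k] c_bound[OF t, of k] by linarith
        note hs = Y_summable[OF h2 True]
        have "Y (c s) \<omega> - Y (c t) \<omega> = (\<Sum>k. ?h k)"
          using True suminf_diff[OF Y_summable(2)[OF cw[OF s] True] Y_summable(2)[OF cw[OF t] True]]
          by (simp add: Y_def left_diff_distrib)
        also have "\<dots> = (\<Sum>k. ?h (k + K)) + (\<Sum>k<K. ?h k)" by (rule suminf_split_initial_segment[OF hs(2)])
        finally have eq: "Y (c s) \<omega> - Y (c t) \<omega> = (\<Sum>k. ?h (k + K)) + (\<Sum>k<K. ?h k)" .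
        have "\<bar>\<Sum>k. ?h (k + K)\<bar> \<le> (\<Sum>k. \<bar>?h (k + K)\<bar>)"
          using hs(1) by (intro summable_rabs) (subst summable_iff_shift)
        also have "\<dots> \<le> (\<Sum>k. 2 * (w (k + K) * \<bar>Z (k + K) \<omega>\<bar>))"
        proof (rule suminf_le)
          show "\<bar>?h (k + K)\<bar> \<le> 2 * (w (k + K) * \<bar>Z (k + K) \<omega>\<bar>)" for k
            using mult_right_mono[OF h2[of "k + K"], of "\<bar>Z (k + K) \<omega>\<bar>"] by (simp add: abs_mult mult.assoc)
          show "summable (\<lambda>k. \<bar>?h (k + K)\<bar>)" using hs(1) by (subst summable_iff_shift)
          show "summable (\<lambda>k. 2 * (w (k + K) * \<bar>Z (k + K) \<omega>\<bar>))"
            using gs by (intro summable_mult) (subst summable_iff_shift[of "\<lambda>k. w k * \<bar>Z k \<omega>\<bar>"])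
        qed
        also have "\<dots> = 2 * (\<Sum>k. w (k + K) * \<bar>Z (k + K) \<omega>\<bar>)"
          using gs by (intro suminf_mult) (subst summable_iff_shift[of "\<lambda>k. w k * \<bar>Z k \<omega>\<bar>"])
        also have "\<dots> < \<epsilon> / 2" using K by linarith
        finally have 1: "\<bar>\<Sum>k. ?h (k + K)\<bar> < \<epsilon> / 2" .
        have "\<bar>\<Sum>k<K. ?h k\<bar> \<le> (\<Sum>k<K. \<bar>?h k\<bar>)" by (rule sum_abs)
        also have "\<dots> \<le> (\<Sum>k<K. L2_dist P s t * (\<bar>C k\<bar> * \<bar>Z k \<omega>\<bar>))"
        proof (rule sum_mono)
          fix k
          have "\<bar>c s k - c t k\<bar> \<le> C k * L2_dist P s t" by (rule c_lipschitz[OF s t])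
          also have "\<dots> \<le> \<bar>C k\<bar> * L2_dist P s t" using d0 by (intro mult_right_mono) auto
          finally have "\<bar>c s k - c t k\<bar> * \<bar>Z k \<omega>\<bar> \<le> \<bar>C k\<bar> * L2_dist P s t * \<bar>Z k \<omega>\<bar>" by (rule mult_right_mono) simp
          then show "\<bar>?h k\<bar> \<le> L2_dist P s t * (\<bar>C k\<bar> * \<bar>Z k \<omega>\<bar>)" by (simp add: abs_mult mult_ac)
        qed
        also have "\<dots> = L2_dist P s t * (\<Sum>k<K. \<bar>C k\<bar> * \<bar>Z k \<omega>\<bar>)" by (simp add: sum_distrib_left)
        also have "\<dots> \<le> L2_dist P s t * D" unfolding D_def using d0 by (intro mult_left_mono) auto
        also have "\<dots> \<le> \<epsilon> / (2 * D) * D" using d D by (intro mult_right_mono) auto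
        also have "\<dots> = \<epsilon> / 2" using D by simp
        finally show "\<bar>Y (c s) \<omega> - Y (c t) \<omega>\<bar> < \<epsilon>" unfolding eq using 1 by linarith
      qed
    qed
  qed
qed

end

theorem (in lipschitz_series) tight_gaussian_process_exists:
  fixes \<iota> :: "nat => 'i"
  assumes inj: "inj \<iota>"
  shows "\<exists>(N :: ('i => real) measure) G. tight_gaussian_process N P S G"
proof -
  define N where "N = (\<Pi>\<^sub>M i\<in>range \<iota>. std_normal_distribution)"
  note s = std_normal_sequence[OF inj, folded N_def]
  interpret N: prob_space N by (rule s)
  interpret gaussian_series P S c w e A C N "\<lambda>k \<omega>. \<omega> (\<iota> k)"
  proof unfold_locales
    show "L2_fun P (e n)" for n unfolding L2_fun_def using e_power_integrable[of 2 n] by simp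
  qed (use s in auto)
  show ?thesis using Y_process by blast
qed

section \<open>Power series of likelihood ratios in one coordinate\<close>

text \<open>
  The function \<open>M\<close> bounds the sums of absolute values.  Carrying it along yields
  majorants of all coefficients at once.
\<close>

definition entire_series :: "(real => real) => (nat => real) => (real => real) => bool" where
  "entire_series f a M \<longleftrightarrow> (\<forall>h. (\<lambda>n. a n * h ^ n) sums f h) \<and>
    (\<forall>h. summable (\<lambda>n. \<bar>a n\<bar> * \<bar>h\<bar> ^ n) \<and> (\<Sum>n. \<bar>a n\<bar> * \<bar>h\<bar> ^ n) \<le> M \<bar>h\<bar>)"

lemma entire_series_mult:
  assumes f: "entire_series f a M" and g: "entire_series g b M'"
  shows "entire_series (\<lambda>h. f h * g h) (\<lambda>n. \<Sum>i\<le>n. a i * b (n - i)) (\<lambda>r. M r * M' r)"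
  unfolding entire_series_def
proof (intro conjI allI)
  fix h :: real
  have sa: "summable (\<lambda>n. norm (a n * h ^ n))" and sb: "summable (\<lambda>n. norm (b n * h ^ n))"
    using f g by (simp_all add: entire_series_def abs_mult power_abs)
  have conv: "(\<Sum>i\<le>n. u i * x ^ i * (v (n - i) * x ^ (n - i))) = (\<Sum>i\<le>n. u i * v (n - i)) * x ^ n" for u v n and x :: real
    unfolding sum_distrib_right
    by (intro sum.cong refl) (simp add: mult_ac power_add[symmetric])
  have "(\<lambda>n. (\<Sum>i\<le>n. a i * b (n - i)) * h ^ n) sums ((\<Sum>n. a n * h ^ n) * (\<Sum>n. b n * h ^ n))"
    using Cauchy_product_sums[OF sa sb] unfolding conv .
  then show "(\<lambda>n. (\<Sum>i\<le>n. a i * b (n - i)) * h ^ n) sums (f h * g h)"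
    using f g by (simp add: entire_series_def sums_iff)
  have sa': "summable (\<lambda>n. norm (\<bar>a n\<bar> * \<bar>h\<bar> ^ n))" and sb': "summable (\<lambda>n. norm (\<bar>b n\<bar> * \<bar>h\<bar> ^ n))"
    using f g by (simp_all add: entire_series_def abs_mult power_abs)
  have S: "(\<lambda>n. (\<Sum>i\<le>n. \<bar>a i\<bar> * \<bar>b (n - i)\<bar>) * \<bar>h\<bar> ^ n) sums ((\<Sum>n. \<bar>a n\<bar> * \<bar>h\<bar> ^ n) * (\<Sum>n. \<bar>b n\<bar> * \<bar>h\<bar> ^ n))"
    using Cauchy_product_sums[OF sa' sb'] unfolding conv[of "\<lambda>i. \<bar>a i\<bar>" "\<bar>h\<bar>" "\<lambda>i. \<bar>b i\<bar>"] .
  have le: "\<bar>\<Sum>i\<le>n. a i * b (n - i)\<bar> * \<bar>h\<bar> ^ n \<le> (\<Sum>i\<le>n. \<bar>a i\<bar> * \<bar>b (n - i)\<bar>) * \<bar>h\<bar> ^ n" for n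
    unfolding abs_mult[symmetric] by (intro mult_right_mono sum_abs) auto
  show sm: "summable (\<lambda>n. \<bar>\<Sum>i\<le>n. a i * b (n - i)\<bar> * \<bar>h\<bar> ^ n)"
    by (rule summable_comparison_test[OF _ sums_summable[OF S]]) (use le in auto)
  have "(\<Sum>n. \<bar>\<Sum>i\<le>n. a i * b (n - i)\<bar> * \<bar>h\<bar> ^ n) \<le> (\<Sum>n. \<bar>a n\<bar> * \<bar>h\<bar> ^ n) * (\<Sum>n. \<bar>b n\<bar> * \<bar>h\<bar> ^ n)"
    using suminf_le[OF le sm sums_summable[OF S]] S by (simp add: sums_iff)
  also have "\<dots> \<le> M \<bar>h\<bar> * M' \<bar>h\<bar>"
  proof (rule mult_mono)
    show "0 \<le> (\<Sum>n. \<bar>b n\<bar> * \<bar>h\<bar> ^ n)" using g by (intro suminf_nonneg) (auto simp: entire_series_def)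
    have "0 \<le> (\<Sum>n. \<bar>a n\<bar> * \<bar>h\<bar> ^ n)" using f by (intro suminf_nonneg) (auto simp: entire_series_def)
    also show "(\<Sum>n. \<bar>a n\<bar> * \<bar>h\<bar> ^ n) \<le> M \<bar>h\<bar>" using f by (simp add: entire_series_def)
    finally show "0 \<le> M \<bar>h\<bar>" .
    show "(\<Sum>n. \<bar>b n\<bar> * \<bar>h\<bar> ^ n) \<le> M' \<bar>h\<bar>" using g by (simp add: entire_series_def)
  qed
  finally show "(\<Sum>n. \<bar>\<Sum>i\<le>n. a i * b (n - i)\<bar> * \<bar>h\<bar> ^ n) \<le> M \<bar>h\<bar> * M' \<bar>h\<bar>" .
qed

lemma entire_series_coeff_bound:
  assumes "entire_series f a M" "r \<ge> 0"
  shows "\<bar>a n\<bar> * r ^ n \<le> M r"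
proof -
  have s: "summable (\<lambda>n. \<bar>a n\<bar> * r ^ n)" "(\<Sum>n. \<bar>a n\<bar> * r ^ n) \<le> M r"
    using assms unfolding entire_series_def by (metis abs_of_nonneg)+
  have "\<bar>a n\<bar> * r ^ n = (\<Sum>k\<in>{n}. \<bar>a k\<bar> * r ^ k)" by simp
  also have "\<dots> \<le> (\<Sum>n. \<bar>a n\<bar> * r ^ n)" using assms(2) by (intro sum_le_suminf s) auto
  finally show ?thesis using s(2) by simp
qed

lemma entire_series_bound:
  assumes "entire_series f a M" "\<bar>h\<bar> \<le> r"
  shows "\<bar>f h\<bar> \<le> M r"
proof -
  have r: "r \<ge> 0" using assms by linarith
  have s: "summable (\<lambda>n. \<bar>a n\<bar> * \<bar>h\<bar> ^ n)" "(\<lambda>n. a n * h ^ n) sums f h" using assms by (auto simp: entire_series_def)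
  have s2: "summable (\<lambda>n. \<bar>a n\<bar> * r ^ n)" "(\<Sum>n. \<bar>a n\<bar> * r ^ n) \<le> M r"
    using assms(1) r unfolding entire_series_def by (metis abs_of_nonneg)+
  have "\<bar>f h\<bar> \<le> (\<Sum>n. \<bar>a n\<bar> * \<bar>h\<bar> ^ n)"
    using summable_rabs[of "\<lambda>n. a n * h ^ n"] s by (simp add: abs_mult power_abs sums_iff)
  also have "\<dots> \<le> (\<Sum>n. \<bar>a n\<bar> * r ^ n)"
    using assms(2) by (intro suminf_le s s2) (auto intro!: mult_left_mono power_mono)
  finally show ?thesis using s2 by simp
qed

lemma entire_series_exp: "entire_series (\<lambda>h. exp (z * h)) (\<lambda>n. z ^ n / fact n) (\<lambda>r. exp (\<bar>z\<bar> * r))"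
proof -
  have e: "(\<lambda>n. z ^ n / fact n * h ^ n) sums exp (z * h)" for z h :: real
    using exp_converges[of "z * h"] by (simp add: power_mult_distrib divide_inverse mult_ac)
  show ?thesis
    unfolding entire_series_def using e[of z] e[of "\<bar>z\<bar>"] by (simp add: sums_iff power_abs)
qed

definition half_square_coeff :: "nat => real" where
  "half_square_coeff n = (if even n then (- 1 / 2) ^ (n div 2) / fact (n div 2) else 0)"

lemma entire_series_half_square:
  "entire_series (\<lambda>h. exp (- h\<^sup>2 / 2)) half_square_coeff (\<lambda>r. exp (r\<^sup>2 / 2))"
proof -
  have e: "(\<lambda>n. if even n then c ^ (n div 2) / fact (n div 2) * h ^ n else 0) sums exp (c * h\<^sup>2)" for c h :: real
  proof -
    have pw: "(if even (2 * k) then c ^ (2 * k div 2) / fact (2 * k div 2) * h ^ (2 * k) else 0) = (c * h\<^sup>2) ^ k /\<^sub>R fact k" for k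
      unfolding power_mult power_mult_distrib by (simp add: divide_inverse)
    have "(\<lambda>k. (\<lambda>n. if even n then c ^ (n div 2) / fact (n div 2) * h ^ n else 0) (2 * k)) sums exp (c * h\<^sup>2)"
      unfolding pw by (rule exp_converges)
    then show ?thesis
      by (subst (asm) sums_mono_reindex) (auto simp: strict_mono_def elim: evenE)
  qed
  have 1: "half_square_coeff n * h ^ n = (if even n then (- 1 / 2) ^ (n div 2) / fact (n div 2) * h ^ n else 0)" for h n
    by (simp add: half_square_coeff_def)
  have 2: "\<bar>half_square_coeff n\<bar> * \<bar>h\<bar> ^ n = (if even n then (1 / 2) ^ (n div 2) / fact (n div 2) * h ^ n else 0)" for h n
    by (auto simp: half_square_coeff_def power_abs abs_mult power_even_abs)
  show ?thesis unfolding entire_series_def 1 2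
    using e[of "- 1 / 2"] e[of "1 / 2"] by (simp add: sums_iff)
qed

lemma entire_series_binomial:
  assumes "c \<ge> 0"
  shows "entire_series (\<lambda>h. (1 + c * h) ^ N) (\<lambda>n. real (N choose n) * c ^ n) (\<lambda>r. (1 + c * r) ^ N)"
proof -
  have e: "(\<lambda>n. real (N choose n) * c ^ n * h ^ n) sums ((1 + c * h) ^ N)" for h :: real
  proof -
    have "(\<lambda>n. real (N choose n) * c ^ n * h ^ n) sums (\<Sum>n\<le>N. real (N choose n) * c ^ n * h ^ n)"
      by (rule sums_finite) (auto simp: not_le)
    moreover have "(1 + c * h) ^ N = (\<Sum>n\<le>N. real (N choose n) * c ^ n * h ^ n)"
      using binomial_ring[of "c * h" 1 N] by (simp add: add.commute power_mult_distrib mult.assoc)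
    ultimately show ?thesis by simp
  qed
  show ?thesis unfolding entire_series_def using e assms by (simp add: abs_mult sums_iff)
qed

lemma higher_diffs: "(diffs ^^ n) a k = fact (k + n) / fact k * (a (k + n) :: real)"
proof (induction n arbitrary: k)
  case (Suc n)
  have "(diffs ^^ Suc n) a k = real (Suc k) * (fact (Suc k + n) / fact (Suc k) * a (Suc k + n))"
    unfolding Suc.IH[of "Suc k", symmetric] by (simp add: diffs_def)
  also have "\<dots> = real (Suc k) * (fact (Suc k + n) / (real (Suc k) * fact k) * a (Suc k + n))" by (simp only: fact_Suc of_nat_mult)
  also have "\<dots> = fact (k + Suc n) / fact k * a (k + Suc n)" by (simp del: fact_Suc)
  finally show ?case .
qed simp

text \<open>
  A sequence \<open>D\<close> of successive derivatives is what the iteration of partial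
  derivatives consumes.
\<close>

lemma entire_series_derivatives:
  assumes "entire_series f a M"
  shows "\<exists>D. D 0 = (\<lambda>t. f (t - t0)) \<and> (\<forall>n t. (D n has_real_derivative D (Suc n) t) (at t)) \<and> (\<forall>n. D n t0 = fact n * a n)"
proof -
  have s: "summable (\<lambda>k. (diffs ^^ n) a k * x ^ k)" for n x
  proof (induction n arbitrary: x)
    case 0
    then show ?case using assms by (auto simp: entire_series_def sums_iff)
  next
    case (Suc n)
    then show ?case using termdiff_converges_all[of "(diffs ^^ n) a"] by simp
  qed
  define E where "E n x = (\<Sum>k. (diffs ^^ n) a k * x ^ k)" for n x
  have d: "(E n has_real_derivative E (Suc n) x) (at x)" for n x
    unfolding E_def using termdiffs_strong_converges_everywhere[OF s, of n x] by simp
  define D where "D n t = E n (t - t0)" for n t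
  have "(D n has_real_derivative D (Suc n) t) (at t)" for n t
  proof -
    have "((\<lambda>t. E n (t - t0)) has_real_derivative E (Suc n) (t - t0) * 1) (at t)"
      by (rule DERIV_chain2[OF d]) (auto intro!: derivative_eq_intros)
    then show ?thesis unfolding D_def by simp
  qed
  moreover have "D n t0 = fact n * a n" for n
    unfolding D_def E_def using powser_zero[of "(diffs ^^ n) a"] by (simp add: higher_diffs)
  moreover have "D 0 = (\<lambda>t. f (t - t0))"
    unfolding D_def E_def using assms by (auto simp: entire_series_def sums_iff)
  ultimately show ?thesis by blast
qed

lemma power_series_unique:
  assumes "\<And>h::real. (\<lambda>n. a n * h ^ n) sums f h" "\<And>h. (\<lambda>n. b n * h ^ n) sums f h"
  shows "a n = b n"
proof -
  define c where "c n = a n - b n" for n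
  have c: "(\<lambda>n. c n * h ^ n) sums 0" for h
    using sums_diff[OF assms(1)[of h] assms(2)[of h]] by (simp add: c_def left_diff_distrib)
  have s: "summable (\<lambda>k. (diffs ^^ n) c k * x ^ k)" for n x
  proof (induction n arbitrary: x)
    case 0
    then show ?case using c by (auto simp: sums_iff)
  next
    case (Suc n)
    then show ?case using termdiff_converges_all[of "(diffs ^^ n) c"] by simp
  qed
  have "(\<Sum>k. (diffs ^^ n) c k * x ^ k) = 0" for n x
  proof (induction n arbitrary: x)
    case 0
    then show ?case using c by (auto simp: sums_iff)
  next
    case (Suc n)
    have "((\<lambda>x. \<Sum>k. (diffs ^^ n) c k * x ^ k) has_real_derivative (\<Sum>k. (diffs ^^ Suc n) c k * x ^ k)) (at x)"
      using termdiffs_strong_converges_everywhere[OF s, of n x] by simp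
    then show ?case unfolding Suc by (metis DERIV_const DERIV_unique)
  qed
  from this[of n 0] have "fact n * c n = 0"
    using powser_zero[of "(diffs ^^ n) c"] by (simp add: higher_diffs)
  then show ?thesis by (simp add: c_def)
qed

text \<open>
  Exchange of sum and integral turns the generating identity \<open>gen\<close> into an identity
  of power series in \<open>h\<close>, whose coefficients agree.  In the applications it states
  that Hermite and Charlier polynomials are unbiased estimators of powers of the parameter.
\<close>

lemma coefficient_unbiased:
  fixes r :: "real => 'a => real"
  assumes ser: "\<And>x. entire_series (\<lambda>h. r h x) (\<lambda>n. a n x) (\<lambda>\<rho>. m \<rho> x)"
    and [measurable]: "\<And>n. a n \<in> borel_measurable \<nu>" "p \<in> borel_measurable \<nu>" and p: "\<And>x. p x \<ge> 0"
    and int: "\<And>\<rho>. \<rho> \<ge> 0 ==> integrable \<nu> (\<lambda>x. m \<rho> x * p x)"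
    and gen: "\<And>h. (LINT x|\<nu>. r h x * p x) = exp (h * y)"
  shows "integrable \<nu> (\<lambda>x. a n x * p x)" "(LINT x|\<nu>. a n x * p x) = y ^ n / fact n"
proof -
  have ia: "integrable \<nu> (\<lambda>x. a n x * h ^ n * p x)" for n h
  proof (rule Bochner_Integration.integrable_bound)
    show "integrable \<nu> (\<lambda>x. m \<bar>h\<bar> x * p x)" by (rule int) simp
    have "\<bar>a n x\<bar> * \<bar>h\<bar> ^ n \<le> m \<bar>h\<bar> x" for x using entire_series_coeff_bound[OF ser, of "\<bar>h\<bar>" n x] by simp
    then show "AE x in \<nu>. norm (a n x * h ^ n * p x) \<le> norm (m \<bar>h\<bar> x * p x)"
      using p by (intro AE_I2) (auto simp: abs_mult power_abs intro!: mult_right_mono order_trans[OF _ abs_ge_self])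
  qed measurable
  show "integrable \<nu> (\<lambda>x. a n x * p x)" using ia[of n 1] by simp
  have "(\<lambda>n. (LINT x|\<nu>. a n x * p x) * h ^ n) sums exp (h * y)" for h
  proof -
    have sm: "summable (\<lambda>n. \<bar>a n x\<bar> * \<bar>h\<bar> ^ n)" "(\<Sum>n. \<bar>a n x\<bar> * \<bar>h\<bar> ^ n) \<le> m \<bar>h\<bar> x" for x
      using ser[of x] by (auto simp: entire_series_def)
    have nrm: "norm (a n x * h ^ n * p x) = \<bar>a n x\<bar> * \<bar>h\<bar> ^ n * p x" for n x
      using p[of x] by (simp add: abs_mult power_abs)
    have AEs: "AE x in \<nu>. summable (\<lambda>n. norm (a n x * h ^ n * p x))"
      unfolding nrm by (intro AE_I2 summable_mult2 sm)
    have S: "summable (\<lambda>n. LINT x|\<nu>. norm (a n x * h ^ n * p x))"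
    proof (rule summableI_nonneg_bounded)
      show "0 \<le> (LINT x|\<nu>. norm (a n x * h ^ n * p x))" for n by simp
      show "(\<Sum>k<n. LINT x|\<nu>. norm (a k x * h ^ k * p x)) \<le> (LINT x|\<nu>. m \<bar>h\<bar> x * p x)" for n
      proof -
        have "(\<Sum>k<n. LINT x|\<nu>. norm (a k x * h ^ k * p x)) = (LINT x|\<nu>. (\<Sum>k<n. norm (a k x * h ^ k * p x)))"
          using ia by (subst Bochner_Integration.integral_sum) auto
        also have "\<dots> \<le> (LINT x|\<nu>. m \<bar>h\<bar> x * p x)"
        proof (rule integral_mono)
          show "integrable \<nu> (\<lambda>x. \<Sum>k<n. norm (a k x * h ^ k * p x))" using ia by auto
          show "integrable \<nu> (\<lambda>x. m \<bar>h\<bar> x * p x)" by (rule int) simp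
          fix x
          have "(\<Sum>k<n. norm (a k x * h ^ k * p x)) = (\<Sum>k<n. \<bar>a k x\<bar> * \<bar>h\<bar> ^ k) * p x"
            unfolding nrm by (simp add: sum_distrib_right)
          also have "\<dots> \<le> m \<bar>h\<bar> x * p x"
            using sum_le_suminf[OF sm(1)[of x], of "{..<n}"] sm(2)[of x] by (intro mult_right_mono p) auto
          finally show "(\<Sum>k<n. norm (a k x * h ^ k * p x)) \<le> m \<bar>h\<bar> x * p x" .
        qed
        finally show "(\<Sum>k<n. LINT x|\<nu>. norm (a k x * h ^ k * p x)) \<le> (LINT x|\<nu>. m \<bar>h\<bar> x * p x)" .
      qed
    qed
    have "(\<lambda>n. LINT x|\<nu>. a n x * h ^ n * p x) sums (LINT x|\<nu>. (\<Sum>n. a n x * h ^ n * p x))"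
      by (rule sums_integral[OF ia AEs S])
    moreover have "(\<Sum>n. a n x * h ^ n * p x) = r h x * p x" for x
      using sums_mult2[of "\<lambda>n. a n x * h ^ n" "r h x" "p x"] ser[of x] by (auto simp: entire_series_def sums_iff)
    moreover have "(LINT x|\<nu>. a n x * h ^ n * p x) = (LINT x|\<nu>. a n x * p x) * h ^ n" for n
      by (subst integral_mult_left_zero[symmetric]) (simp add: mult_ac)
    ultimately show ?thesis by (simp add: gen)
  qed
  moreover have "(\<lambda>n. y ^ n / fact n * h ^ n) sums exp (h * y)" for h
    using exp_converges[of "h * y"] by (simp add: power_mult_distrib divide_inverse mult_ac)
  ultimately show "(LINT x|\<nu>. a n x * p x) = y ^ n / fact n" by (rule power_series_unique)
qed

subsection \<open>Gaussian coordinate\<close>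

definition gauss_coeff :: "nat => real => real" where
  "gauss_coeff n z = (\<Sum>i\<le>n. z ^ i / fact i * half_square_coeff (n - i))"

definition gauss_maj :: "real => real => real" where
  "gauss_maj r z = exp (\<bar>z\<bar> * r) * exp (r\<^sup>2 / 2)"

lemma gauss_series: "entire_series (\<lambda>h. exp (z * h) * exp (- h\<^sup>2 / 2)) (\<lambda>n. gauss_coeff n z) (\<lambda>r. gauss_maj r z)"
  unfolding gauss_coeff_def gauss_maj_def by (rule entire_series_mult[OF entire_series_exp entire_series_half_square])

lemma gauss_coeff_measurable[measurable]: "gauss_coeff n \<in> borel_measurable borel"
  unfolding gauss_coeff_def[abs_def] by measurable

lemma gauss_maj_measurable[measurable]: "gauss_maj r \<in> borel_measurable borel"
  unfolding gauss_maj_def[abs_def] by measurable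

lemma gauss_tilt:
  "exp ((x - t0) * h) * exp (- h\<^sup>2 / 2) * std_normal_density (x - t) = exp (h * (t - t0)) * normal_density (t + h) 1 x"
  unfolding normal_density_def
  by (simp add: exp_add[symmetric] power2_eq_square field_simps)

lemma gauss_generating:
  "integrable lborel (\<lambda>x. exp ((x - t0) * h) * exp (- h\<^sup>2 / 2) * std_normal_density (x - t))"
  "(LINT x|lborel. exp ((x - t0) * h) * exp (- h\<^sup>2 / 2) * std_normal_density (x - t)) = exp (h * (t - t0))"
  unfolding gauss_tilt by simp_all

lemma gauss_abs_exp:
  assumes "r \<ge> 0"
  shows "integrable lborel (\<lambda>x. exp (\<bar>x - t0\<bar> * r) * std_normal_density (x - t))"
    "(LINT x|lborel. exp (\<bar>x - t0\<bar> * r) * std_normal_density (x - t)) \<le> 2 * exp (r\<^sup>2 / 2 + r * \<bar>t - t0\<bar>)"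
proof -
  let ?g = "\<lambda>h x. exp ((x - t0) * h) * exp (- h\<^sup>2 / 2) * std_normal_density (x - t)"
  have le: "exp (\<bar>x - t0\<bar> * r) * std_normal_density (x - t) \<le> exp (r\<^sup>2 / 2) * (?g r x + ?g (- r) x)" for x
  proof -
    have "exp (\<bar>x - t0\<bar> * r) \<le> exp ((x - t0) * r) + exp ((x - t0) * (- r))"
    proof -
      have "\<bar>x - t0\<bar> * r = (x - t0) * r \<or> \<bar>x - t0\<bar> * r = (x - t0) * (- r)" by (auto simp: abs_if algebra_simps)
      then show ?thesis by (elim disjE) (simp_all only: le_add_same_cancel1 le_add_same_cancel2 exp_ge_zero)
    qed
    then have "exp (\<bar>x - t0\<bar> * r) * std_normal_density (x - t) \<le> (exp ((x - t0) * r) + exp ((x - t0) * (- r))) * std_normal_density (x - t)"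
      by (intro mult_right_mono) auto
    also have "\<dots> = exp (r\<^sup>2 / 2) * (?g r x + ?g (- r) x)"
    proof -
      have "exp (r\<^sup>2 / 2) * exp (- r\<^sup>2 / 2) = (1::real)" by (simp add: exp_add[symmetric])
      then have c: "exp (r\<^sup>2 / 2) * (u * exp (- s\<^sup>2 / 2) * v) = u * v" if "s\<^sup>2 = r\<^sup>2" for u v s :: real
        unfolding that by (metis (no_types, opaque_lifting) mult.assoc mult.commute mult.right_neutral)
      show ?thesis by (subst distrib_left) (simp only: c[OF refl] c[OF power2_minus] distrib_right)
    qed
    finally show ?thesis .
  qed
  have gi: "integrable lborel (\<lambda>x. exp (r\<^sup>2 / 2) * (?g r x + ?g (- r) x))"
    by (intro integrable_mult_right Bochner_Integration.integrable_add gauss_generating)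
  show i: "integrable lborel (\<lambda>x. exp (\<bar>x - t0\<bar> * r) * std_normal_density (x - t))"
    by (rule Bochner_Integration.integrable_bound[OF gi]) (use le in \<open>auto intro!: order_trans[OF _ abs_ge_self]\<close>)
  have "(LINT x|lborel. exp (\<bar>x - t0\<bar> * r) * std_normal_density (x - t)) \<le> (LINT x|lborel. exp (r\<^sup>2 / 2) * (?g r x + ?g (- r) x))"
    by (rule integral_mono[OF i gi le])
  also have "\<dots> = exp (r\<^sup>2 / 2) * ((LINT x|lborel. ?g r x) + (LINT x|lborel. ?g (- r) x))"
    by (subst integral_mult_right_zero, subst Bochner_Integration.integral_add) (rule gauss_generating refl)+
  also have "\<dots> = exp (r\<^sup>2 / 2) * (exp (r * (t - t0)) + exp (- r * (t - t0)))" by (simp only: gauss_generating)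
  also have "\<dots> \<le> exp (r\<^sup>2 / 2) * (exp (r * \<bar>t - t0\<bar>) + exp (r * \<bar>t - t0\<bar>))"
  proof (intro mult_left_mono add_mono)
    show "exp (r * (t - t0)) \<le> exp (r * \<bar>t - t0\<bar>)" using assms by (simp add: mult_left_mono)
    show "exp (- r * (t - t0)) \<le> exp (r * \<bar>t - t0\<bar>)"
      using mult_left_mono[OF abs_ge_minus_self[of "t - t0"] assms] by (simp add: algebra_simps)
  qed auto
  finally show "(LINT x|lborel. exp (\<bar>x - t0\<bar> * r) * std_normal_density (x - t)) \<le> 2 * exp (r\<^sup>2 / 2 + r * \<bar>t - t0\<bar>)"
    by (simp add: exp_add)
qed

lemma gauss_maj_moment:
  assumes "r \<ge> 0"
  shows "integrable lborel (\<lambda>x. gauss_maj r (x - t0) ^ j * std_normal_density (x - t))"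
    "(LINT x|lborel. gauss_maj r (x - t0) ^ j * std_normal_density (x - t)) \<le> exp (r\<^sup>2 / 2) ^ j * (2 * exp ((j * r)\<^sup>2 / 2 + (j * r) * \<bar>t - t0\<bar>))"
proof -
  have eq: "gauss_maj r z ^ j * v = exp (r\<^sup>2 / 2) ^ j * (exp (\<bar>z\<bar> * (j * r)) * v)" for z v
    unfolding gauss_maj_def power_mult_distrib by (simp add: exp_of_nat_mult[symmetric] mult_ac)
  have r: "real j * r \<ge> 0" using assms by simp
  show "integrable lborel (\<lambda>x. gauss_maj r (x - t0) ^ j * std_normal_density (x - t))"
    unfolding eq by (intro integrable_mult_right gauss_abs_exp r)
  show "(LINT x|lborel. gauss_maj r (x - t0) ^ j * std_normal_density (x - t)) \<le> exp (r\<^sup>2 / 2) ^ j * (2 * exp ((j * r)\<^sup>2 / 2 + (j * r) * \<bar>t - t0\<bar>))"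
    unfolding eq integral_mult_right_zero by (intro mult_left_mono gauss_abs_exp r) auto
qed

lemma gauss_unbiased:
  "integrable lborel (\<lambda>x. gauss_coeff n (x - t0) * std_normal_density (x - t))"
  "(LINT x|lborel. gauss_coeff n (x - t0) * std_normal_density (x - t)) = (t - t0) ^ n / fact n"
proof -
  note * = coefficient_unbiased[where r="\<lambda>h x. exp ((x - t0) * h) * exp (- h\<^sup>2 / 2)" and m="\<lambda>r x. gauss_maj r (x - t0)"
      and y="t - t0" and \<nu>=lborel and a="\<lambda>n x. gauss_coeff n (x - t0)" and p="\<lambda>x. std_normal_density (x - t)",
      OF gauss_series _ _ _ _ gauss_generating(2)]
  show "integrable lborel (\<lambda>x. gauss_coeff n (x - t0) * std_normal_density (x - t))"
    by (rule *(1)) (use gauss_maj_moment(1)[where j=1] in \<open>auto simp: normal_density_nonneg\<close>)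
  show "(LINT x|lborel. gauss_coeff n (x - t0) * std_normal_density (x - t)) = (t - t0) ^ n / fact n"
    by (rule *(2)) (use gauss_maj_moment(1)[where j=1] in \<open>auto simp: normal_density_nonneg\<close>)
qed

subsection \<open>Poisson coordinate\<close>

definition poisson_coeff :: "real => nat => nat => real" where
  "poisson_coeff t0 n N = (\<Sum>i\<le>n. real (N choose i) * inverse t0 ^ i * ((-1) ^ (n - i) / fact (n - i)))"

definition poisson_maj :: "real => real => nat => real" where
  "poisson_maj t0 r N = (1 + inverse t0 * r) ^ N * exp r"

lemma poisson_series:
  assumes "t0 > 0"
  shows "entire_series (\<lambda>h. (1 + inverse t0 * h) ^ N * exp (- h)) (\<lambda>n. poisson_coeff t0 n N) (\<lambda>r. poisson_maj t0 r N)"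
  unfolding poisson_coeff_def poisson_maj_def
  using entire_series_mult[OF entire_series_binomial entire_series_exp[of "-1"], of "inverse t0" N] assms by simp

lemma poisson_sum:
  fixes t y :: real
  assumes "t \<ge> 0"
  shows "integrable (count_space UNIV) (\<lambda>N. y ^ N * (t ^ N / fact N * exp (- t)))"
    "(LINT N|count_space UNIV. y ^ N * (t ^ N / fact N * exp (- t))) = exp (t * (y - 1))"
proof -
  have e: "(\<lambda>N. y ^ N * (t ^ N / fact N * exp (- t))) sums exp (t * (y - 1))" for y
  proof -
    have "(\<lambda>N. (y * t) ^ N /\<^sub>R fact N * exp (- t)) sums (exp (y * t) * exp (- t))"
      by (intro sums_mult2 exp_converges)
    moreover have "(\<lambda>N. y ^ N * (t ^ N / fact N * exp (- t))) = (\<lambda>N. (y * t) ^ N /\<^sub>R fact N * exp (- t))"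
      by (rule ext) (simp add: power_mult_distrib divide_inverse)
    moreover have "exp (y * t) * exp (- t) = exp (t * (y - 1))" by (simp add: exp_add[symmetric] algebra_simps)
    ultimately show ?thesis by simp
  qed
  have "summable (\<lambda>N. norm (y ^ N * (t ^ N / fact N * exp (- t))))"
    using e[of "\<bar>y\<bar>"] assms by (simp add: sums_iff abs_mult power_abs)
  then show i: "integrable (count_space UNIV) (\<lambda>N. y ^ N * (t ^ N / fact N * exp (- t)))"
    by (simp only: integrable_count_space_nat_iff)
  show "(LINT N|count_space UNIV. y ^ N * (t ^ N / fact N * exp (- t))) = exp (t * (y - 1))"
    using sums_unique2[OF sums_integral_count_space_nat[OF i] e[of y]] .
qed

lemma poisson_generating:
  fixes t t0 h :: real
  assumes "t \<ge> 0" "t0 > 0"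
  shows "(LINT N|count_space UNIV. (1 + inverse t0 * h) ^ N * exp (- h) * (t ^ N / fact N * exp (- t))) = exp (h * ((t - t0) / t0))"
proof -
  have "(LINT N|count_space UNIV. (1 + inverse t0 * h) ^ N * exp (- h) * (t ^ N / fact N * exp (- t)))
    = (LINT N|count_space UNIV. exp (- h) * ((1 + inverse t0 * h) ^ N * (t ^ N / fact N * exp (- t))))"
    by (simp add: mult_ac)
  also have "\<dots> = exp (- h) * exp (t * (1 + inverse t0 * h - 1))"
    by (simp only: integral_mult_right_zero poisson_sum[OF assms(1)])
  also have "\<dots> = exp (h * ((t - t0) / t0))"
    unfolding exp_add[symmetric] using assms by (intro arg_cong[of _ _ exp]) (simp add: field_simps)
  finally show ?thesis .
qed

lemma poisson_maj_moment:
  assumes "t \<ge> 0"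
  shows "integrable (count_space UNIV) (\<lambda>N. poisson_maj t0 r N ^ j * (t ^ N / fact N * exp (- t)))"
    "(LINT N|count_space UNIV. poisson_maj t0 r N ^ j * (t ^ N / fact N * exp (- t))) = exp r ^ j * exp (t * ((1 + inverse t0 * r) ^ j - 1))"
proof -
  have eq: "poisson_maj t0 r N ^ j * v = exp r ^ j * (((1 + inverse t0 * r) ^ j) ^ N * v)" for N v
    unfolding poisson_maj_def by (simp add: power_mult_distrib power_mult[symmetric] mult_ac)
  show "integrable (count_space UNIV) (\<lambda>N. poisson_maj t0 r N ^ j * (t ^ N / fact N * exp (- t)))"
    unfolding eq by (intro integrable_mult_right poisson_sum assms)
  show "(LINT N|count_space UNIV. poisson_maj t0 r N ^ j * (t ^ N / fact N * exp (- t))) = exp r ^ j * exp (t * ((1 + inverse t0 * r) ^ j - 1))"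
    unfolding eq integral_mult_right_zero poisson_sum[OF assms] ..
qed

lemma poisson_unbiased:
  assumes "t \<ge> 0" "t0 > 0"
  shows "integrable (count_space UNIV) (\<lambda>N. poisson_coeff t0 n N * (t ^ N / fact N * exp (- t)))"
  "(LINT N|count_space UNIV. poisson_coeff t0 n N * (t ^ N / fact N * exp (- t))) = ((t - t0) / t0) ^ n / fact n"
proof -
  note * = coefficient_unbiased[where r="\<lambda>h N. (1 + inverse t0 * h) ^ N * exp (- h)" and m="\<lambda>r N. poisson_maj t0 r N"
      and y="(t - t0) / t0" and \<nu>="count_space UNIV" and a="\<lambda>n N. poisson_coeff t0 n N" and p="\<lambda>N. t ^ N / fact N * exp (- t)",
      OF poisson_series[OF assms(2)] _ _ _ _ poisson_generating[OF assms]]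
  have m: "integrable (count_space UNIV) (\<lambda>N. poisson_maj t0 r N * (t ^ N / fact N * exp (- t)))" for r
    using poisson_maj_moment(1)[OF assms(1), where j=1] by (simp only: power_one_right)
  show "integrable (count_space UNIV) (\<lambda>N. poisson_coeff t0 n N * (t ^ N / fact N * exp (- t)))"
    by (rule *(1)) (use m assms in simp_all)
  show "(LINT N|count_space UNIV. poisson_coeff t0 n N * (t ^ N / fact N * exp (- t))) = ((t - t0) / t0) ^ n / fact n"
    by (rule *(2)) (use m assms in simp_all)
qed

section \<open>Products of coordinates and multi-indices\<close>

abbreviation MI :: "nat => (nat => nat) set" where
  "MI d \<equiv> {1..d} \<rightarrow>\<^sub>E UNIV"

definition deg :: "nat => (nat => nat) => nat" where
  "deg d \<alpha> = (\<Sum>l=1..d. \<alpha> l)"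

definition enum_MI :: "nat => nat => nat => nat" where
  "enum_MI d = from_nat_into (MI d)"

lemma finite_multi_indices: "finite (multi_indices d k)"
proof (rule finite_subset)
  show "multi_indices d k \<subseteq> {1..d} \<rightarrow>\<^sub>E {..k}"
  proof
    fix \<alpha> assume a: "\<alpha> \<in> multi_indices d k"
    have "\<alpha> l \<le> k" if "l \<in> {1..d}" for l
      using a member_le_sum[of l "{1..d}" \<alpha>] that by (auto simp: multi_indices_def)
    with a show "\<alpha> \<in> {1..d} \<rightarrow>\<^sub>E {..k}" by (auto simp: multi_indices_def PiE_iff)
  qed
qed (intro finite_PiE, auto)

lemma bij_enum_MI:
  assumes "d \<ge> 1"
  shows "bij_betw (enum_MI d) UNIV (MI d)"
  unfolding enum_MI_def
proof (rule bij_betw_from_nat_into)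
  show "countable (MI d)" by (rule countable_PiE) auto
  have "inj (\<lambda>n. \<lambda>l\<in>{1..d}. n :: nat)"
  proof (rule injI)
    fix n m :: nat assume "(\<lambda>l\<in>{1..d}. n) = (\<lambda>l\<in>{1..d}. m)"
    from fun_cong[OF this, of 1] assms show "n = m" by simp
  qed
  moreover have "range (\<lambda>n. \<lambda>l\<in>{1..d}. n :: nat) \<subseteq> MI d" by auto
  ultimately show "infinite (MI d)" by (metis finite_imageD finite_subset infinite_UNIV_nat)
qed

lemma product_series_summable:
  assumes "\<And>l. l \<in> {1..d} ==> summable (\<lambda>n. \<bar>f l n :: real\<bar>)"
  shows "(\<lambda>\<alpha>. \<bar>\<Prod>l=1..d. f l (\<alpha> l)\<bar>) summable_on MI d"
proof (rule nonneg_bdd_above_summable_on)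
  show "bdd_above (sum (\<lambda>\<alpha>. \<bar>\<Prod>l=1..d. f l (\<alpha> l)\<bar>) ` {F. F \<subseteq> MI d \<and> finite F})"
  proof (rule bdd_aboveI2)
    fix F assume F: "F \<in> {F. F \<subseteq> MI d \<and> finite F}"
    define N where "N = (\<Sum>\<alpha>\<in>F. \<Sum>l=1..d. \<alpha> l)"
    have "F \<subseteq> {1..d} \<rightarrow>\<^sub>E {..N}"
    proof
      fix \<alpha> assume a: "\<alpha> \<in> F"
      have "\<alpha> l \<le> N" if "l \<in> {1..d}" for l
        unfolding N_def using member_le_sum[of l "{1..d}" \<alpha>] member_le_sum[of \<alpha> F "\<lambda>\<alpha>. \<Sum>l=1..d. \<alpha> l"] that a F
        by force
      then show "\<alpha> \<in> {1..d} \<rightarrow>\<^sub>E {..N}" using a F by (auto simp: PiE_iff)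
    qed
    then have "(\<Sum>\<alpha>\<in>F. \<bar>\<Prod>l=1..d. f l (\<alpha> l)\<bar>) \<le> (\<Sum>\<alpha>\<in>{1..d} \<rightarrow>\<^sub>E {..N}. \<bar>\<Prod>l=1..d. f l (\<alpha> l)\<bar>)"
      by (intro sum_mono2) (auto intro!: finite_PiE)
    also have "\<dots> = (\<Prod>l=1..d. \<Sum>n\<le>N. \<bar>f l n\<bar>)"
      by (simp add: abs_prod prod_sum_PiE)
    also have "\<dots> \<le> (\<Prod>l=1..d. \<Sum>n. \<bar>f l n\<bar>)"
      using assms by (intro prod_mono conjI sum_nonneg sum_le_suminf) auto
    finally show "(\<Sum>\<alpha>\<in>F. \<bar>\<Prod>l=1..d. f l (\<alpha> l)\<bar>) \<le> (\<Prod>l=1..d. \<Sum>n. \<bar>f l n\<bar>)" .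
  qed
qed simp

text \<open>
  The product of finitely many absolutely convergent series.
\<close>

lemma product_series_has_sum:
  assumes s: "\<And>l. l \<in> {1..d} ==> summable (\<lambda>n. \<bar>f l n :: real\<bar>)"
  shows "((\<lambda>\<alpha>. \<Prod>l=1..d. f l (\<alpha> l)) has_sum (\<Prod>l=1..d. suminf (f l))) (MI d)"
proof -
  have sm: "(\<lambda>\<alpha>. \<Prod>l=1..d. f l (\<alpha> l)) summable_on MI d"
    by (rule abs_summable_summable) (use product_series_summable[OF s] in auto)
  have ab: "(\<lambda>n. norm (f l n)) summable_on UNIV" if "l \<in> {1..d}" for l
    using s[OF that] by (subst summable_on_UNIV_nonneg_real_iff) auto
  have "infsum (\<lambda>\<alpha>. \<Prod>l=1..d. f l (\<alpha> l)) (MI d) = (\<Prod>l=1..d. infsum (f l) UNIV)"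
    by (rule infsum_prod_PiE_abs) (use ab in auto)
  also have "\<dots> = (\<Prod>l=1..d. suminf (f l))"
  proof (rule prod.cong[OF refl])
    fix l assume l: "l \<in> {1..d}"
    have "(f l has_sum infsum (f l) UNIV) UNIV" using abs_summable_summable[OF ab[OF l]] by simp
    then show "infsum (f l) UNIV = suminf (f l)" by (intro sums_unique has_sum_imp_sums)
  qed
  finally show ?thesis using sm by (metis has_sum_infsum)
qed

lemma has_sum_enum_MI:
  assumes "d \<ge> 1" "(g has_sum S) (MI d)"
  shows "(\<lambda>k. g (enum_MI d k)) sums S"
  by (rule has_sum_imp_sums) (use assms has_sum_reindex_bij_betw[OF bij_enum_MI[OF assms(1)], of g S] in auto)

lemma summable_enum_MI:
  assumes "d \<ge> 1" "(\<lambda>\<alpha>. \<bar>g \<alpha> :: real\<bar>) summable_on MI d"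
  shows "summable (\<lambda>k. \<bar>g (enum_MI d k)\<bar>)"
  using has_sum_enum_MI[OF assms(1), of "\<lambda>\<alpha>. \<bar>g \<alpha>\<bar>"] assms(2) by (auto simp: sums_iff summable_on_def)

lemma has_sum_by_degree:
  fixes g :: "(nat => nat) => real"
  assumes "(g has_sum S) (MI d)"
  shows "(\<lambda>k. \<Sum>\<alpha>\<in>multi_indices d k. g \<alpha>) sums S"
proof (rule has_sum_imp_sums, rule has_sum_SigmaD[where f="\<lambda>x. g (snd x)" and A=UNIV and B="multi_indices d"])
  define X where "X = MI d"
  have mi: "\<alpha> \<in> multi_indices d k \<longleftrightarrow> \<alpha> \<in> X \<and> deg d \<alpha> = k" for \<alpha> k
    unfolding multi_indices_def deg_def X_def by (rule mem_Collect_eq)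
  have "bij_betw snd (Sigma UNIV (multi_indices d)) X"
    by (rule bij_betwI[where g="\<lambda>\<alpha>. (deg d \<alpha>, \<alpha>)"]) (auto simp: mi)
  then have "bij_betw snd (Sigma UNIV (multi_indices d)) (MI d)" by (simp only: X_def)
  from has_sum_reindex_bij_betw[OF this, of g S] assms
  show "((\<lambda>x. g (snd x)) has_sum S) (Sigma UNIV (multi_indices d))" by simp
  show "((\<lambda>y. g (snd (k, y))) has_sum (\<Sum>\<alpha>\<in>multi_indices d k. g \<alpha>)) (multi_indices d k)" for k
    using has_sum_finite[OF finite_multi_indices, of "\<lambda>y. g (snd (k, y))"] by simp
qed

subsection \<open>Iterated partial derivatives of a product\<close>

text \<open>
  A partial derivative acts on one factor only.
\<close>

lemma multi_deriv_product:
  assumes D: "\<And>l n t. l \<in> {1..d} ==> (D l n has_real_derivative D l (Suc n) t) (at t)"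
  shows "multi_deriv d \<alpha> (\<lambda>\<theta>. \<Prod>l=1..d. D l 0 (\<theta> l)) = (\<lambda>\<theta>. \<Prod>l=1..d. D l (\<alpha> l) (\<theta> l))"
proof -
  define Q where "Q \<beta> = (\<lambda>\<theta>. \<Prod>l=1..d. D l (\<beta> l) (\<theta> l))" for \<beta> :: "nat => nat"
  have step: "partial_deriv l (Q \<beta>) = Q (\<beta>(l := Suc (\<beta> l)))" if l: "l \<in> {1..d}" for l \<beta>
  proof
    fix \<theta>
    let ?r = "\<Prod>m\<in>{1..d} - {l}. D m (\<beta> m) (\<theta> m)"
    have split: "Q \<gamma> (\<theta>(l := t)) = D l (\<gamma> l) t * ?r" if "\<And>m. m \<noteq> l ==> \<gamma> m = \<beta> m" for \<gamma> t
    proof -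
      have "Q \<gamma> (\<theta>(l := t)) = D l (\<gamma> l) t * (\<Prod>m\<in>{1..d} - {l}. D m (\<gamma> m) ((\<theta>(l := t)) m))"
        unfolding Q_def using l by (subst prod.remove[of _ l]) auto
      also have "(\<Prod>m\<in>{1..d} - {l}. D m (\<gamma> m) ((\<theta>(l := t)) m)) = ?r"
        using that by (intro prod.cong) auto
      finally show ?thesis .
    qed
    have "((\<lambda>t. Q \<beta> (\<theta>(l := t))) has_real_derivative D l (Suc (\<beta> l)) (\<theta> l) * ?r) (at (\<theta> l))"
      unfolding split[of \<beta>, OF refl] by (rule DERIV_cmult_right[OF D[OF l]])
    then have "partial_deriv l (Q \<beta>) \<theta> = D l (Suc (\<beta> l)) (\<theta> l) * ?r"
      unfolding partial_deriv_def by (rule DERIV_imp_deriv)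
    also have "\<dots> = Q (\<beta>(l := Suc (\<beta> l))) \<theta>"
      using split[of "\<beta>(l := Suc (\<beta> l))" "\<theta> l"] by simp
    finally show "partial_deriv l (Q \<beta>) \<theta> = Q (\<beta>(l := Suc (\<beta> l))) \<theta>" .
  qed
  have iter: "(partial_deriv l ^^ n) (Q \<beta>) = Q (\<beta>(l := \<beta> l + n))" if l: "l \<in> {1..d}" for l \<beta> n
  proof (induction n)
    case (Suc n)
    have "(partial_deriv l ^^ Suc n) (Q \<beta>) = partial_deriv l (Q (\<beta>(l := \<beta> l + n)))" by (simp only: funpow.simps comp_apply Suc)
    also have "\<dots> = Q ((\<beta>(l := \<beta> l + n))(l := Suc ((\<beta>(l := \<beta> l + n)) l)))" by (rule step[OF l])
    also have "\<dots> = Q (\<beta>(l := \<beta> l + Suc n))" by (rule arg_cong[of _ _ Q]) auto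
    finally show ?case .
  qed simp
  have "distinct ls ==> set ls \<subseteq> {1..d} ==> foldr (\<lambda>l. partial_deriv l ^^ \<alpha> l) ls (Q (\<lambda>_. 0)) = Q (\<lambda>m. if m \<in> set ls then \<alpha> m else 0)" for ls
  proof (induction ls)
    case (Cons l ls)
    then have "foldr (\<lambda>l. partial_deriv l ^^ \<alpha> l) (l # ls) (Q (\<lambda>_. 0)) = (partial_deriv l ^^ \<alpha> l) (Q (\<lambda>m. if m \<in> set ls then \<alpha> m else 0))" by simp
    also have "\<dots> = Q ((\<lambda>m. if m \<in> set ls then \<alpha> m else 0)(l := \<alpha> l))" using Cons by (subst iter) auto
    also have "(\<lambda>m. if m \<in> set ls then \<alpha> m else 0)(l := \<alpha> l) = (\<lambda>m. if m \<in> set (l # ls) then \<alpha> m else 0)" by auto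
    finally show ?case .
  qed simp
  note fold = this
  have "multi_deriv d \<alpha> (Q (\<lambda>_. 0)) = Q (\<lambda>m. if m \<in> set [1..<d+1] then \<alpha> m else 0)"
    unfolding multi_deriv_def by (rule fold) auto
  also have "\<dots> = Q \<alpha>" unfolding Q_def set_upt by (intro ext prod.cong) auto
  finally show ?thesis unfolding Q_def .
qed

subsection \<open>Integrals of products of coordinate functions\<close>

lemma prod_split_coordinates:
  fixes f :: "nat => real"
  assumes "b \<le> d"
  shows "(\<Prod>l=1..d. f l) = (\<Prod>l=1..b. f l) * (\<Prod>l=b+1..d. f l)"
proof -
  have "{1..d} = {1..b} \<union> {b+1..d}" using assms by auto
  then show ?thesis by (simp add: prod.union_disjoint)
qed

lemma base_measurable_fst: "l \<in> {1..b} ==> (\<lambda>x. fst x l) \<in> borel_measurable (base_measure d b)"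
proof -
  assume "l \<in> {1..b}"
  then have "(\<lambda>y. y l) \<in> measurable (\<Pi>\<^sub>M l\<in>{1..b}. lborel :: real measure) lborel" by (rule measurable_component_singleton)
  then have "(\<lambda>y. y l) \<in> borel_measurable (\<Pi>\<^sub>M l\<in>{1..b}. lborel :: real measure)" by (simp cong: measurable_cong_sets)
  then show ?thesis unfolding base_measure_def by (rule measurable_compose[OF measurable_fst])
qed

lemma base_measurable_snd: "l \<in> {b+1..d} ==> (\<lambda>x. snd x l) \<in> measurable (base_measure d b) (count_space UNIV)"
  unfolding base_measure_def
  by (rule measurable_compose[OF measurable_snd]) (rule measurable_component_singleton)

lemma sigma_finite_base: "sigma_finite_measure (base_measure d b)"
proof -
  interpret G: product_sigma_finite "\<lambda>_::nat. lborel :: real measure"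
    by (intro product_sigma_finite.intro) (rule lborel.sigma_finite_measure_axioms)
  interpret C: product_sigma_finite "\<lambda>_::nat. count_space UNIV :: nat measure"
    by (intro product_sigma_finite.intro sigma_finite_measure_count_space_countable) simp
  interpret G': sigma_finite_measure "\<Pi>\<^sub>M l\<in>{1..b}. lborel :: real measure" by (rule G.sigma_finite) simp
  interpret C': sigma_finite_measure "\<Pi>\<^sub>M l\<in>{b+1..d}. count_space UNIV :: nat measure" by (rule C.sigma_finite) simp
  interpret pair_sigma_finite "\<Pi>\<^sub>M l\<in>{1..b}. lborel :: real measure" "\<Pi>\<^sub>M l\<in>{b+1..d}. count_space UNIV :: nat measure" ..
  show ?thesis unfolding base_measure_def by (rule sigma_finite_measure_axioms)
qed

lemma base_product_integral:
  fixes u :: "nat => real => real" and v :: "nat => nat => real"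
  assumes bd: "b \<le> d" and u: "\<And>l. l \<in> {1..b} ==> integrable lborel (u l)"
    and v: "\<And>l. l \<in> {b+1..d} ==> integrable (count_space UNIV) (v l)"
  defines "F \<equiv> (\<lambda>x. \<Prod>l=1..d. if l \<le> b then u l (fst x l) else v l (snd x l))"
  shows "integrable (base_measure d b) F"
    and "(LINT x|base_measure d b. F x) = (\<Prod>l=1..d. if l \<le> b then (LINT z|lborel. u l z) else (LINT z|count_space UNIV. v l z))"
proof -
  interpret G: product_sigma_finite "\<lambda>_::nat. lborel :: real measure"
    by (intro product_sigma_finite.intro) (rule lborel.sigma_finite_measure_axioms)
  interpret C: product_sigma_finite "\<lambda>_::nat. count_space UNIV :: nat measure"
    by (intro product_sigma_finite.intro sigma_finite_measure_count_space_countable) simp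
  let ?M1 = "\<Pi>\<^sub>M l\<in>{1..b}. lborel :: real measure" and ?M2 = "\<Pi>\<^sub>M l\<in>{b+1..d}. count_space UNIV :: nat measure"
  interpret G': sigma_finite_measure ?M1 by (rule G.sigma_finite) simp
  interpret C': sigma_finite_measure ?M2 by (rule C.sigma_finite) simp
  interpret P: pair_sigma_finite ?M1 ?M2 ..
  let ?f = "\<lambda>y. \<Prod>l=1..b. u l (y l)" and ?g = "\<lambda>z. \<Prod>l=b+1..d. v l (z l)"
  have F: "F = (\<lambda>(y, z). ?f y * ?g z)"
    unfolding F_def prod_split_coordinates[OF bd] by (auto intro!: arg_cong2[of _ _ _ _ "(*)"] prod.cong)
  have f: "integrable ?M1 ?f" "(LINT y|?M1. ?f y) = (\<Prod>l=1..b. LINT z|lborel. u l z)"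
    by (rule G.product_integrable_prod, simp, rule u, simp) (rule G.product_integral_prod, simp, rule u, simp)
  have g: "integrable ?M2 ?g" "(LINT y|?M2. ?g y) = (\<Prod>l=b+1..d. LINT z|count_space UNIV. v l z)"
    by (rule C.product_integrable_prod, simp, rule v, simp) (rule C.product_integral_prod, simp, rule v, simp)
  have [measurable]: "?f \<in> borel_measurable ?M1" "?g \<in> borel_measurable ?M2" using f g by (simp_all only: borel_measurable_integrable)
  have i: "integrable (?M1 \<Otimes>\<^sub>M ?M2) (\<lambda>(y, z). ?f y * ?g z)"
  proof (rule P.Fubini_integrable)
    show "(\<lambda>(y, z). ?f y * ?g z) \<in> borel_measurable (?M1 \<Otimes>\<^sub>M ?M2)"
      unfolding split_beta' by (intro borel_measurable_times measurable_compose[OF measurable_fst] measurable_compose[OF measurable_snd]) fact+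
    show "integrable ?M1 (\<lambda>y. LINT z|?M2. norm (case (y, z) of (y, z) => ?f y * ?g z))"
      using f(1) by (simp add: abs_mult integrable_abs)
    show "AE y in ?M1. integrable ?M2 (\<lambda>z. case (y, z) of (y, z) => ?f y * ?g z)"
      using g(1) by simp
  qed
  show "integrable (base_measure d b) F" unfolding F base_measure_def by (rule i)
  have "(LINT x|base_measure d b. F x) = (LINT y|?M1. LINT z|?M2. ?f y * ?g z)"
    unfolding F base_measure_def using P.integral_fst'[OF i] by simp
  also have "\<dots> = (LINT y|?M1. ?f y) * (LINT z|?M2. ?g z)" by simp
  also have "\<dots> = (\<Prod>l=1..d. if l \<le> b then (LINT z|lborel. u l z) else (LINT z|count_space UNIV. v l z))"
    unfolding f g prod_split_coordinates[OF bd] by (intro arg_cong2[of _ _ _ _ "(*)"] prod.cong) auto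
  finally show "(LINT x|base_measure d b. F x) = (\<Prod>l=1..d. if l \<le> b then (LINT z|lborel. u l z) else (LINT z|count_space UNIV. v l z))" .
qed

section \<open>Expansion of the component densities around a reference point\<close>

lemma param_pos:
  assumes "\<theta> \<in> param_space d b" "l \<in> {1..d}" "b < l"
  shows "\<theta> l > 0"
  using PiE_mem[OF assms(1)[unfolded param_space_def] assms(2)] assms(3) by simp

locale reference_point =
  fixes d b :: nat and \<theta>0 :: param
  assumes d_pos: "d \<ge> 1" and b_le: "b \<le> d" and \<theta>0: "\<theta>0 \<in> param_space d b"
begin

definition dens :: "nat => real => obs => real" where
  "dens l t x = (if l \<le> b then std_normal_density (fst x l - t) else t ^ snd x l / fact (snd x l) * exp (- t))"

definition tay :: "nat => nat => obs => real" where
  "tay l n x = (if l \<le> b then gauss_coeff n (fst x l - \<theta>0 l) else poisson_coeff (\<theta>0 l) n (snd x l))"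

definition maj1 :: "real => nat => obs => real" where
  "maj1 r l x = (if l \<le> b then gauss_maj r (fst x l - \<theta>0 l) else poisson_maj (\<theta>0 l) r (snd x l))"

definition rat :: "nat => real => obs => real" where
  "rat l h x = (if l \<le> b then exp ((fst x l - \<theta>0 l) * h) * exp (- h\<^sup>2 / 2) else (1 + inverse (\<theta>0 l) * h) ^ snd x l * exp (- h))"

text \<open>
  The coefficient functions of the expansion of the likelihood ratio: products of Hermite and
  Charlier polynomials, each divided by a factorial.
\<close>

definition psi :: "(nat => nat) => obs => real" where
  "psi \<alpha> x = (\<Prod>l=1..d. tay l (\<alpha> l) x)"

definition maj :: "real => obs => real" where
  "maj r x = (\<Prod>l=1..d. maj1 r l x)"

definition mono :: "(nat => nat) => param => real" where
  "mono \<alpha> \<theta> = (\<Prod>l=1..d. (\<theta> l - \<theta>0 l) ^ \<alpha> l)"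

lemma \<theta>0_pos: "l \<in> {1..d} ==> b < l ==> \<theta>0 l > 0"
  by (rule param_pos[OF \<theta>0])

lemma coordinate_series: "l \<in> {1..d} ==> entire_series (\<lambda>h. rat l h x) (\<lambda>n. tay l n x) (\<lambda>r. maj1 r l x)"
  unfolding rat_def tay_def maj1_def using gauss_series poisson_series[OF \<theta>0_pos] by (cases "l \<le> b") auto

lemma comp_density_prod: "comp_density d b \<theta> x = (\<Prod>l=1..d. dens l (\<theta> l) x)"
  unfolding comp_density_def prod_split_coordinates[OF b_le]
  by (intro arg_cong2[of _ _ _ _ "(*)"] prod.cong) (auto simp: dens_def)

lemma dens_ratio:
  assumes "l \<in> {1..d}"
  shows "dens l t x = dens l (\<theta>0 l) x * rat l (t - \<theta>0 l) x"
proof (cases "l \<le> b")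
  case True
  have "std_normal_density (z - t) = std_normal_density (z - s) * (exp ((z - s) * (t - s)) * exp (- (t - s)\<^sup>2 / 2))" for z s :: real
    unfolding normal_density_def
    by (simp add: exp_add[symmetric] power2_eq_square field_simps)
  then show ?thesis using True by (simp add: dens_def rat_def)
next
  case False
  then have p: "\<theta>0 l > 0" using \<theta>0_pos[OF assms] by simp
  have "t ^ N = \<theta>0 l ^ N * (1 + inverse (\<theta>0 l) * (t - \<theta>0 l)) ^ N" for N
    unfolding power_mult_distrib[symmetric] using p by (simp add: field_simps)
  moreover have "exp (- t) = exp (- \<theta>0 l) * exp (- (t - \<theta>0 l))" by (simp add: exp_add[symmetric])
  ultimately show ?thesis using False by (simp add: dens_def rat_def)
qed

lemma dens_pos: "l \<in> {1..d} ==> (b < l ==> t > 0) ==> dens l t x > 0"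
  by (auto simp: dens_def normal_density_pos not_le)

lemma comp_density_pos: "\<theta> \<in> param_space d b ==> comp_density d b \<theta> x > 0"
  unfolding comp_density_prod
  by (intro prod_pos dens_pos) (auto intro: param_pos)

lemma comp_density_ratio: "comp_density d b \<theta> x / comp_density d b \<theta>0 x = (\<Prod>l=1..d. rat l (\<theta> l - \<theta>0 l) x)"
proof -
  have "comp_density d b \<theta> x = comp_density d b \<theta>0 x * (\<Prod>l=1..d. rat l (\<theta> l - \<theta>0 l) x)"
    unfolding comp_density_prod prod.distrib[symmetric] by (intro prod.cong refl dens_ratio)
  then show ?thesis using comp_density_pos[OF \<theta>0, of x] by simp
qed

lemma score_poly_eq: "score_poly d b \<theta>0 \<alpha> x = multi_fact d \<alpha> * psi \<alpha> x"
proof -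
  have "\<exists>D. D 0 = (\<lambda>t. rat l (t - \<theta>0 l) x) \<and> (\<forall>n t. (D n has_real_derivative D (Suc n) t) (at t)) \<and> (\<forall>n. D n (\<theta>0 l) = fact n * tay l n x)"
    if "l \<in> {1..d}" for l
    using entire_series_derivatives[OF coordinate_series[OF that]] by blast
  then have "\<forall>l. \<exists>D. l \<in> {1..d} \<longrightarrow> D 0 = (\<lambda>t. rat l (t - \<theta>0 l) x) \<and> (\<forall>n t. (D n has_real_derivative D (Suc n) t) (at t)) \<and> (\<forall>n. D n (\<theta>0 l) = fact n * tay l n x)"
    by blast
  from choice[OF this] obtain D where D: "\<And>l. l \<in> {1..d} ==> D l 0 = (\<lambda>t. rat l (t - \<theta>0 l) x)"
    "\<And>l n t. l \<in> {1..d} ==> (D l n has_real_derivative D l (Suc n) t) (at t)"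
    "\<And>l n. l \<in> {1..d} ==> D l n (\<theta>0 l) = fact n * tay l n x" by blast
  have "(\<lambda>\<theta>. comp_density d b \<theta> x / comp_density d b \<theta>0 x) = (\<lambda>\<theta>. \<Prod>l=1..d. D l 0 (\<theta> l))"
    unfolding comp_density_ratio using D(1) by (intro ext prod.cong) auto
  then have "score_poly d b \<theta>0 \<alpha> x = (\<Prod>l=1..d. D l (\<alpha> l) (\<theta>0 l))"
    unfolding score_poly_def using multi_deriv_product[of d D \<alpha>] D(2) by simp
  also have "\<dots> = (\<Prod>l=1..d. fact (\<alpha> l) * tay l (\<alpha> l) x)" by (intro prod.cong refl) (simp add: D(3))
  finally show ?thesis by (simp add: prod.distrib multi_fact_def psi_def)
qed

lemma density_expansion:
  "((\<lambda>\<alpha>. mono \<alpha> \<theta> * psi \<alpha> x) has_sum (comp_density d b \<theta> x / comp_density d b \<theta>0 x)) (MI d)"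
proof -
  let ?f = "\<lambda>l n. tay l n x * (\<theta> l - \<theta>0 l) ^ n"
  have s: "summable (\<lambda>n. \<bar>?f l n\<bar>)" "suminf (?f l) = rat l (\<theta> l - \<theta>0 l) x" if "l \<in> {1..d}" for l
    using coordinate_series[OF that, of x] by (auto simp: entire_series_def sums_iff abs_mult power_abs)
  have "((\<lambda>\<alpha>. \<Prod>l=1..d. ?f l (\<alpha> l)) has_sum (\<Prod>l=1..d. suminf (?f l))) (MI d)"
    by (rule product_series_has_sum) (rule s)
  moreover have "(\<Prod>l=1..d. suminf (?f l)) = comp_density d b \<theta> x / comp_density d b \<theta>0 x"
    unfolding comp_density_ratio by (intro prod.cong refl s)
  ultimately show ?thesis by (simp add: mono_def psi_def prod.distrib mult.commute)
qed

lemma maj1_nonneg: "r \<ge> 0 ==> l \<in> {1..d} ==> maj1 r l x \<ge> 0"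
  using \<theta>0_pos[of l] by (auto simp: maj1_def gauss_maj_def poisson_maj_def not_le intro!: mult_nonneg_nonneg zero_le_power add_nonneg_nonneg)

lemma maj_nonneg: "r \<ge> 0 ==> maj r x \<ge> 0"
  unfolding maj_def by (intro prod_nonneg) (simp add: maj1_nonneg)

text \<open>
  Holds for every radius \<open>r\<close>, which is why any geometric growth of the moments can be
  compensated.
\<close>

lemma psi_bound: "r \<ge> 0 ==> \<bar>psi \<alpha> x\<bar> * r ^ deg d \<alpha> \<le> maj r x"
proof -
  assume r: "r \<ge> 0"
  have "\<bar>psi \<alpha> x\<bar> * r ^ deg d \<alpha> = (\<Prod>l=1..d. \<bar>tay l (\<alpha> l) x\<bar> * r ^ \<alpha> l)"
    unfolding psi_def deg_def abs_prod power_sum prod.distrib ..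
  also have "\<dots> \<le> maj r x"
    unfolding maj_def using r by (intro prod_mono conjI entire_series_coeff_bound[OF coordinate_series]) auto
  finally show ?thesis .
qed

subsection \<open>Measurability and moments\<close>

lemma coordinate_measurable:
  assumes "l \<in> {1..d}"
  shows "tay l n \<in> borel_measurable (base_measure d b)" "maj1 r l \<in> borel_measurable (base_measure d b)"
proof -
  show "tay l n \<in> borel_measurable (base_measure d b)"
  proof (cases "l \<le> b")
    case True
    then have [measurable]: "(\<lambda>x. fst x l) \<in> borel_measurable (base_measure d b)" using assms by (intro base_measurable_fst) auto
    show ?thesis unfolding tay_def[abs_def] using True by simp
  next
    case False
    then have m: "(\<lambda>x. snd x l) \<in> measurable (base_measure d b) (count_space UNIV)" using assms by (intro base_measurable_snd) auto
    have "(\<lambda>x. poisson_coeff (\<theta>0 l) n (snd x l)) \<in> borel_measurable (base_measure d b)" by (rule measurable_compose[OF m]) simp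
    then show ?thesis unfolding tay_def[abs_def] using False by simp
  qed
  show "maj1 r l \<in> borel_measurable (base_measure d b)"
  proof (cases "l \<le> b")
    case True
    then have [measurable]: "(\<lambda>x. fst x l) \<in> borel_measurable (base_measure d b)" using assms by (intro base_measurable_fst) auto
    show ?thesis unfolding maj1_def[abs_def] using True by simp
  next
    case False
    then have m: "(\<lambda>x. snd x l) \<in> measurable (base_measure d b) (count_space UNIV)" using assms by (intro base_measurable_snd) auto
    have "(\<lambda>x. poisson_maj (\<theta>0 l) r (snd x l)) \<in> borel_measurable (base_measure d b)" by (rule measurable_compose[OF m]) simp
    then show ?thesis unfolding maj1_def[abs_def] using False by simp
  qed
qed

lemma psi_measurable[measurable]: "psi \<alpha> \<in> borel_measurable (base_measure d b)"
  unfolding psi_def[abs_def] by (intro borel_measurable_prod coordinate_measurable)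

lemma maj_measurable[measurable]: "maj r \<in> borel_measurable (base_measure d b)"
  unfolding maj_def[abs_def] by (intro borel_measurable_prod coordinate_measurable)

lemma comp_density_measurable_pair:
  "(\<lambda>(\<theta>, x). comp_density d b \<theta> x) \<in> borel_measurable ((\<Pi>\<^sub>M l\<in>{1..d}. borel) \<Otimes>\<^sub>M base_measure d b)"
  unfolding comp_density_prod split_beta'
proof (rule borel_measurable_prod)
  fix l assume l: "l \<in> {1..d}"
  let ?N = "(\<Pi>\<^sub>M l\<in>{1..d}. borel :: real measure) \<Otimes>\<^sub>M base_measure d b"
  have th[measurable]: "(\<lambda>p. fst p l) \<in> borel_measurable ?N"
    by (rule measurable_compose[OF measurable_fst measurable_component_singleton[OF l]])
  show "(\<lambda>p. dens l (fst p l) (snd p)) \<in> borel_measurable ?N"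
  proof (cases "l \<le> b")
    case True
    then have [measurable]: "(\<lambda>p. fst (snd p) l) \<in> borel_measurable ?N"
      using l by (intro measurable_compose[OF measurable_snd base_measurable_fst]) auto
    have "(\<lambda>p. std_normal_density (fst (snd p) l - fst p l)) \<in> borel_measurable ?N" by measurable
    then show ?thesis unfolding dens_def using True by simp
  next
    case False
    then have m: "(\<lambda>p. snd (snd p) l) \<in> measurable ?N (count_space UNIV)"
      using l by (intro measurable_compose[OF measurable_snd base_measurable_snd]) auto
    have mm: "(\<lambda>p. fst p l ^ N / fact N * exp (- fst p l)) \<in> borel_measurable ?N" for N by measurable
    have "(\<lambda>p. fst p l ^ snd (snd p) l / fact (snd (snd p) l) * exp (- fst p l)) \<in> borel_measurable ?N"
      by (rule measurable_compose_countable'[OF mm m]) simp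
    then show ?thesis unfolding dens_def using False by simp
  qed
qed

lemma comp_density_measurable:
  assumes "\<theta> \<in> extensional {1..d}"
  shows "comp_density d b \<theta> \<in> borel_measurable (base_measure d b)"
  using measurable_compose[OF measurable_Pair1' comp_density_measurable_pair, of \<theta>] assms
  by (simp add: space_PiM PiE_def)

definition \<kappa> :: "(nat => nat) => real" where
  "\<kappa> \<alpha> = (\<Prod>l=1..d. (if l \<le> b then 1 else inverse (\<theta>0 l) ^ \<alpha> l) / fact (\<alpha> l))"

lemma \<kappa>_pos: "\<kappa> \<alpha> > 0"
  unfolding \<kappa>_def using \<theta>0_pos by (intro prod_pos) (auto simp: not_le)

lemma param_nonneg: "\<theta> \<in> param_space d b ==> l \<in> {b+1..d} ==> \<theta> l \<ge> 0"
  using param_pos[of \<theta> d b l] by force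

text \<open>
  The coordinatewise identities multiply, since the components are product densities.
\<close>

lemma psi_unbiased:
  assumes \<theta>: "\<theta> \<in> param_space d b"
  shows "integrable (base_measure d b) (\<lambda>x. psi \<alpha> x * comp_density d b \<theta> x)"
    "(LINT x|base_measure d b. psi \<alpha> x * comp_density d b \<theta> x) = \<kappa> \<alpha> * mono \<alpha> \<theta>"
proof -
  let ?u = "\<lambda>l z. gauss_coeff (\<alpha> l) (z - \<theta>0 l) * std_normal_density (z - \<theta> l)"
    and ?v = "\<lambda>l N. poisson_coeff (\<theta>0 l) (\<alpha> l) N * (\<theta> l ^ N / fact N * exp (- \<theta> l))"
  have u: "integrable lborel (?u l)" for l by (rule gauss_unbiased)
  have v: "integrable (count_space UNIV) (?v l)" if "l \<in> {b+1..d}" for l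
    using param_nonneg[OF \<theta> that] \<theta>0_pos[of l] that by (intro poisson_unbiased) auto
  have eq: "psi \<alpha> x * comp_density d b \<theta> x = (\<Prod>l=1..d. if l \<le> b then ?u l (fst x l) else ?v l (snd x l))" for x
    unfolding psi_def comp_density_prod prod.distrib[symmetric] by (intro prod.cong refl) (simp add: tay_def dens_def)
  note i = base_product_integral[where u="?u" and v="?v", OF b_le u v]
  show "integrable (base_measure d b) (\<lambda>x. psi \<alpha> x * comp_density d b \<theta> x)" unfolding eq by (rule i(1))
  have "(LINT x|base_measure d b. psi \<alpha> x * comp_density d b \<theta> x) =
     (\<Prod>l=1..d. if l \<le> b then (LINT z|lborel. ?u l z) else (LINT z|count_space UNIV. ?v l z))" unfolding eq by (rule i(2))
  also have "\<dots> = (\<Prod>l=1..d. (if l \<le> b then 1 else inverse (\<theta>0 l) ^ \<alpha> l) / fact (\<alpha> l) * (\<theta> l - \<theta>0 l) ^ \<alpha> l)"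
  proof (rule prod.cong[OF refl])
    fix l assume l: "l \<in> {1..d}"
    show "(if l \<le> b then (LINT z|lborel. ?u l z) else (LINT z|count_space UNIV. ?v l z)) = (if l \<le> b then 1 else inverse (\<theta>0 l) ^ \<alpha> l) / fact (\<alpha> l) * (\<theta> l - \<theta>0 l) ^ \<alpha> l"
    proof (cases "l \<le> b")
      case True
      then show ?thesis by (simp add: gauss_unbiased)
    next
      case False
      then have "(LINT z|count_space UNIV. ?v l z) = ((\<theta> l - \<theta>0 l) / \<theta>0 l) ^ \<alpha> l / fact (\<alpha> l)"
        using param_nonneg[OF \<theta>, of l] \<theta>0_pos[of l] l by (intro poisson_unbiased) auto
      then show ?thesis using False by (simp add: divide_inverse power_inverse power_mult_distrib)
    qed
  qed
  also have "\<dots> = \<kappa> \<alpha> * mono \<alpha> \<theta>" unfolding \<kappa>_def mono_def prod.distrib ..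
  finally show "(LINT x|base_measure d b. psi \<alpha> x * comp_density d b \<theta> x) = \<kappa> \<alpha> * mono \<alpha> \<theta>" .
qed

lemma maj_moment_bounded:
  assumes "r \<ge> 0"
  shows "\<exists>B\<ge>0. \<forall>\<theta>\<in>param_space d b. (\<forall>l\<in>{1..d}. \<bar>\<theta> l\<bar> \<le> R) \<longrightarrow>
    integrable (base_measure d b) (\<lambda>x. maj r x ^ j * comp_density d b \<theta> x) \<and>
    (LINT x|base_measure d b. maj r x ^ j * comp_density d b \<theta> x) \<le> B"
proof -
  define B1 where "B1 l = (if l \<le> b then exp (r\<^sup>2 / 2) ^ j * (2 * exp ((j * r)\<^sup>2 / 2 + (j * r) * (R + \<bar>\<theta>0 l\<bar>)))
     else exp r ^ j * exp (R * ((1 + inverse (\<theta>0 l) * r) ^ j - 1)))" for l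
  have B0: "B1 l \<ge> 0" for l by (simp add: B1_def)
  have "integrable (base_measure d b) (\<lambda>x. maj r x ^ j * comp_density d b \<theta> x) \<and>
    (LINT x|base_measure d b. maj r x ^ j * comp_density d b \<theta> x) \<le> (\<Prod>l=1..d. B1 l)"
    if \<theta>: "\<theta> \<in> param_space d b" and R: "\<forall>l\<in>{1..d}. \<bar>\<theta> l\<bar> \<le> R" for \<theta>
  proof -
    let ?u = "\<lambda>l z. gauss_maj r (z - \<theta>0 l) ^ j * std_normal_density (z - \<theta> l)"
      and ?v = "\<lambda>l N. poisson_maj (\<theta>0 l) r N ^ j * (\<theta> l ^ N / fact N * exp (- \<theta> l))"
    have u: "integrable lborel (?u l)" for l by (rule gauss_maj_moment[OF assms])
    have v: "integrable (count_space UNIV) (?v l)" if "l \<in> {b+1..d}" for l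
      using param_nonneg[OF \<theta> that] by (intro poisson_maj_moment)
    have eq: "maj r x ^ j * comp_density d b \<theta> x = (\<Prod>l=1..d. if l \<le> b then ?u l (fst x l) else ?v l (snd x l))" for x
      unfolding maj_def comp_density_prod prod_power_distrib prod.distrib[symmetric] by (intro prod.cong refl) (simp add: maj1_def dens_def)
    note i = base_product_integral[where u="?u" and v="?v", OF b_le u v]
    have "(LINT x|base_measure d b. maj r x ^ j * comp_density d b \<theta> x) =
       (\<Prod>l=1..d. if l \<le> b then (LINT z|lborel. ?u l z) else (LINT z|count_space UNIV. ?v l z))" unfolding eq by (rule i(2))
    also have "\<dots> \<le> (\<Prod>l=1..d. B1 l)"
    proof (rule prod_mono, intro conjI)
      fix l assume l: "l \<in> {1..d}"
      show "(if l \<le> b then (LINT z|lborel. ?u l z) else (LINT z|count_space UNIV. ?v l z)) \<le> B1 l"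
      proof (cases "l \<le> b")
        case True
        have "(LINT z|lborel. ?u l z) \<le> exp (r\<^sup>2 / 2) ^ j * (2 * exp ((j * r)\<^sup>2 / 2 + (j * r) * \<bar>\<theta> l - \<theta>0 l\<bar>))"
          by (rule gauss_maj_moment[OF assms])
        also have "\<dots> \<le> B1 l"
        proof -
          have "\<bar>\<theta> l - \<theta>0 l\<bar> \<le> R + \<bar>\<theta>0 l\<bar>" using R l abs_triangle_ineq4[of "\<theta> l" "\<theta>0 l"] by force
          then show ?thesis unfolding B1_def using True assms by (auto intro!: mult_left_mono add_left_mono)
        qed
        finally show ?thesis using True by simp
      next
        case False
        then have lb: "l \<in> {b+1..d}" using l by auto
        have t: "0 \<le> \<theta> l" "\<theta> l \<le> R" using param_nonneg[OF \<theta> lb] R l by force+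
        have "inverse (\<theta>0 l) * r \<ge> 0" using \<theta>0_pos[OF l] False assms by simp
        then have "(1 + inverse (\<theta>0 l) * r) ^ j \<ge> 1" by (intro one_le_power) simp
        then have "\<theta> l * ((1 + inverse (\<theta>0 l) * r) ^ j - 1) \<le> R * ((1 + inverse (\<theta>0 l) * r) ^ j - 1)"
          using t by (intro mult_right_mono) auto
        then show ?thesis using False poisson_maj_moment(2)[OF t(1), of "\<theta>0 l" r j] by (simp add: B1_def)
      qed
      show "0 \<le> (if l \<le> b then (LINT z|lborel. ?u l z) else (LINT z|count_space UNIV. ?v l z))"
      proof (cases "l \<le> b")
        case False
        then have "l \<in> {b+1..d}" using l by auto
        then show ?thesis using poisson_maj_moment(2)[OF param_nonneg[OF \<theta>], of l "\<theta>0 l" r j] False by simp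
      qed (auto simp: gauss_maj_def intro!: integral_nonneg)
    qed
    finally show ?thesis using i(1) unfolding eq by blast
  qed
  moreover have "(\<Prod>l=1..d. B1 l) \<ge> 0" using B0 by (intro prod_nonneg) auto
  ultimately show ?thesis by blast
qed

lemma mono_zero: "mono (\<lambda>l\<in>{1..d}. 0) \<theta> = 1"
  by (simp add: mono_def)

lemma psi_zero: "psi (\<lambda>l\<in>{1..d}. 0) x = 1"
  unfolding psi_def by (intro prod.neutral) (auto simp: tay_def gauss_coeff_def half_square_coeff_def poisson_coeff_def)

lemma comp_density_integral:
  assumes "\<theta> \<in> param_space d b"
  shows "integrable (base_measure d b) (comp_density d b \<theta>)" "(LINT x|base_measure d b. comp_density d b \<theta> x) = 1"
proof -
  have "\<kappa> (\<lambda>l\<in>{1..d}. 0) = 1" unfolding \<kappa>_def by (intro prod.neutral) auto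
  then show "integrable (base_measure d b) (comp_density d b \<theta>)" "(LINT x|base_measure d b. comp_density d b \<theta> x) = 1"
    using psi_unbiased[OF assms, of "\<lambda>l\<in>{1..d}. 0", unfolded psi_zero mono_zero] by simp_all
qed

end

section \<open>Mixture densities\<close>

lemma space_mixing:
  assumes "\<Theta> \<subseteq> param_space d b" "g \<in> mixing_dists d \<Theta>"
  shows "space g = \<Theta>"
proof -
  have "space g = space (restrict_space (\<Pi>\<^sub>M l\<in>{1..d}. borel :: real measure) \<Theta>)"
    using assms(2) by (intro sets_eq_imp_space_eq) (simp add: mixing_dists_def)
  also have "\<dots> = \<Theta>" using assms(1) by (auto simp: space_restrict_space space_PiM param_space_def PiE_iff)
  finally show ?thesis .
qed

locale mixture_model = reference_point d b \<theta>0 for d b \<theta>0 +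
  fixes \<Theta> :: "param set" and R :: real and g0 :: "param measure"
  assumes \<Theta>_sub: "\<Theta> \<subseteq> param_space d b" and \<Theta>_bound: "\<And>\<theta> l. \<theta> \<in> \<Theta> ==> l \<in> {1..d} ==> \<bar>\<theta> l\<bar> \<le> R"
    and \<theta>0_in: "\<theta>0 \<in> \<Theta>" and g0_in: "g0 \<in> mixing_dists d \<Theta>"
begin

abbreviation G where "G \<equiv> mixing_dists d \<Theta>"
abbreviation f where "f \<equiv> mix_density d b"
abbreviation \<mu> where "\<mu> \<equiv> base_measure d b"
abbreviation mom where "mom \<equiv> mix_moment d \<theta>0"

text \<open>
  A radius that dominates the differences of parameters coordinatewise and is larger than
  \<open>1\<close>; the majorants are taken at twice this radius.
\<close>

definition \<rho>1 :: real where "\<rho>1 = 2 * R + 1 + d"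
definition \<rho> :: real where "\<rho> = 2 * \<rho>1"

lemma R_nonneg: "R \<ge> 0"
  using \<Theta>_bound[OF \<theta>0_in, of 1] d_pos by auto

lemma rho: "\<rho>1 \<ge> 1" "\<rho> > 0" "2 * R \<le> \<rho>1"
  using R_nonneg by (auto simp: \<rho>1_def \<rho>_def)

lemma \<Theta>_diff: "\<theta> \<in> \<Theta> ==> \<tau> \<in> \<Theta> ==> l \<in> {1..d} ==> \<bar>\<theta> l - \<tau> l\<bar> \<le> 2 * R"
  using \<Theta>_bound[of \<theta> l] \<Theta>_bound[of \<tau> l] by linarith

lemma G_prob: "g \<in> G ==> prob_space g" by (simp add: mixing_dists_def)

lemma G_space: "g \<in> G ==> space g = \<Theta>" by (rule space_mixing[OF \<Theta>_sub])

lemma G_id_measurable: "g \<in> G ==> (\<lambda>\<theta>. \<theta>) \<in> measurable g (\<Pi>\<^sub>M l\<in>{1..d}. borel)"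
proof -
  assume g: "g \<in> G"
  have "(\<lambda>\<theta>. \<theta>) \<in> measurable (restrict_space (\<Pi>\<^sub>M l\<in>{1..d}. borel :: real measure) \<Theta>) (\<Pi>\<^sub>M l\<in>{1..d}. borel)"
    by (rule measurable_restrict_space1) simp
  moreover have "sets g = sets (restrict_space (\<Pi>\<^sub>M l\<in>{1..d}. borel :: real measure) \<Theta>)" using g by (simp add: mixing_dists_def)
  ultimately show ?thesis using measurable_cong_sets by blast
qed

lemma G_measurable: "g \<in> G ==> h \<in> borel_measurable (\<Pi>\<^sub>M l\<in>{1..d}. borel) ==> h \<in> borel_measurable g"
  using measurable_compose[OF G_id_measurable] by simp

lemma G_integrable:
  fixes h :: "param => real"
  assumes g: "g \<in> G" and "h \<in> borel_measurable (\<Pi>\<^sub>M l\<in>{1..d}. borel)" "\<And>\<theta>. \<theta> \<in> \<Theta> ==> \<bar>h \<theta>\<bar> \<le> B"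
  shows "integrable g h"
proof -
  interpret prob_space g by (rule G_prob[OF g])
  show ?thesis
    using assms G_measurable[OF g] by (intro integrable_const_bound[where B=B]) (auto simp: G_space[OF g])
qed

lemma coordinate_param_measurable: "l \<in> {1..d} ==> (\<lambda>\<theta>. \<theta> l) \<in> borel_measurable (\<Pi>\<^sub>M l\<in>{1..d}. borel :: real measure)"
  by (rule measurable_component_singleton)

lemma mono_measurable: "mono \<alpha> \<in> borel_measurable (\<Pi>\<^sub>M l\<in>{1..d}. borel)"
  unfolding mono_def[abs_def] using coordinate_param_measurable
  by (intro borel_measurable_prod borel_measurable_power borel_measurable_diff) auto

lemma mono_bound:
  assumes "\<theta> \<in> \<Theta>" shows "\<bar>mono \<alpha> \<theta>\<bar> \<le> \<rho>1 ^ deg d \<alpha>"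
proof -
  have "\<bar>mono \<alpha> \<theta>\<bar> = (\<Prod>l=1..d. \<bar>\<theta> l - \<theta>0 l\<bar> ^ \<alpha> l)" by (simp add: mono_def abs_prod power_abs)
  also have "\<dots> \<le> (\<Prod>l=1..d. \<rho>1 ^ \<alpha> l)"
    using \<Theta>_diff[OF assms \<theta>0_in] rho(3) by (intro prod_mono conjI power_mono) (auto intro: order_trans)
  finally show ?thesis by (simp add: deg_def power_sum)
qed

lemma mom_eq: "mom \<alpha> g = (LINT \<theta>|g. mono \<alpha> \<theta>)"
  by (simp add: mix_moment_def mono_def)

lemma mono_integrable: "g \<in> G ==> integrable g (mono \<alpha>)"
  by (rule G_integrable[OF _ mono_measurable mono_bound])

lemma comp_measurable_param: "(\<lambda>\<theta>. comp_density d b \<theta> x) \<in> borel_measurable (\<Pi>\<^sub>M l\<in>{1..d}. borel)"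
  unfolding comp_density_prod
proof (rule borel_measurable_prod)
  fix l assume "l \<in> {1..d}"
  then have [measurable]: "(\<lambda>\<theta>. \<theta> l) \<in> borel_measurable (\<Pi>\<^sub>M l\<in>{1..d}. borel :: real measure)" by (rule coordinate_param_measurable)
  show "(\<lambda>\<theta>. dens l (\<theta> l) x) \<in> borel_measurable (\<Pi>\<^sub>M l\<in>{1..d}. borel)" unfolding dens_def by measurable
qed

lemma comp_pos: "\<theta> \<in> \<Theta> ==> comp_density d b \<theta> x > 0"
  by (rule comp_density_pos) (use \<Theta>_sub in auto)

lemma comp_bound: "\<theta> \<in> \<Theta> ==> comp_density d b \<theta> x \<le> comp_density d b \<theta>0 x * maj \<rho> x"
proof -
  assume \<theta>: "\<theta> \<in> \<Theta>"
  have "comp_density d b \<theta> x / comp_density d b \<theta>0 x \<le> (\<Prod>l=1..d. \<bar>rat l (\<theta> l - \<theta>0 l) x\<bar>)"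
    unfolding comp_density_ratio abs_prod[symmetric] by (rule abs_ge_self)
  also have "\<dots> \<le> maj \<rho> x" unfolding maj_def
  proof (rule prod_mono, intro conjI)
    fix l assume l: "l \<in> {1..d}"
    have "\<bar>\<theta> l - \<theta>0 l\<bar> \<le> \<rho>" using \<Theta>_diff[OF \<theta> \<theta>0_in l] rho by (simp add: \<rho>_def)
    then show "\<bar>rat l (\<theta> l - \<theta>0 l) x\<bar> \<le> maj1 \<rho> l x" by (rule entire_series_bound[OF coordinate_series[OF l]])
  qed simp
  finally show ?thesis using comp_pos[OF \<theta>0_in, of x] by (simp add: pos_divide_le_eq mult.commute)
qed

lemma comp_abs_bound: "\<theta> \<in> \<Theta> ==> \<bar>comp_density d b \<theta> x\<bar> \<le> comp_density d b \<theta>0 x * maj \<rho> x"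
  using comp_bound[of \<theta> x] comp_pos[of \<theta> x] by (simp only: abs_of_pos)

lemma comp_integrable: "g \<in> G ==> integrable g (\<lambda>\<theta>. comp_density d b \<theta> x)"
  by (rule G_integrable[OF _ comp_measurable_param comp_abs_bound])

lemma f_pos: assumes g: "g \<in> G" shows "f g x > 0"
proof -
  interpret prob_space g by (rule G_prob[OF g])
  have nn: "AE \<theta> in g. 0 \<le> comp_density d b \<theta> x" by (intro AE_I2 less_imp_le comp_pos) (simp add: G_space[OF g])
  have "f g x \<noteq> 0"
  proof
    assume "f g x = 0"
    then have "AE \<theta> in g. comp_density d b \<theta> x = 0"
      using integral_nonneg_eq_0_iff_AE[OF comp_integrable[OF g] nn] by (simp add: mix_density_def)
    then have "AE \<theta> in g. False" using AE_space     proof eventually_elim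
      case (elim \<theta>)
      then show False using comp_pos[of \<theta> x] by (simp add: G_space[OF g])
    qed
    then show False by simp
  qed
  moreover have "f g x \<ge> 0" unfolding mix_density_def by (rule integral_nonneg_AE[OF nn])
  ultimately show ?thesis by simp
qed

lemma pair_measurable:
  assumes g: "g \<in> G" shows "(\<lambda>(\<theta>, x). comp_density d b \<theta> x) \<in> borel_measurable (g \<Otimes>\<^sub>M \<mu>)"
proof -
  have "(\<lambda>p. (fst p, snd p)) \<in> measurable (g \<Otimes>\<^sub>M \<mu>) ((\<Pi>\<^sub>M l\<in>{1..d}. borel) \<Otimes>\<^sub>M \<mu>)"
    by (intro measurable_Pair measurable_snd measurable_compose[OF measurable_fst G_id_measurable[OF g]])
  from measurable_compose[OF this comp_density_measurable_pair] show ?thesis by (simp add: split_beta')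
qed

lemma f_measurable[measurable]: assumes g: "g \<in> G" shows "f g \<in> borel_measurable \<mu>"
proof -
  interpret prob_space g by (rule G_prob[OF g])
  have "(\<lambda>(x, \<theta>). comp_density d b \<theta> x) \<in> borel_measurable (\<mu> \<Otimes>\<^sub>M g)"
    using measurable_compose[OF measurable_pair_swap' pair_measurable[OF g]] by (simp add: split_beta' comp_def)
  then show ?thesis unfolding mix_density_def[abs_def] by (rule borel_measurable_lebesgue_integral)
qed

text \<open>
  Fubini, with the moments of the majorant bounded uniformly over the parameter set.
\<close>

lemma mix_integral:
  assumes g: "g \<in> G" and h[measurable]: "h \<in> borel_measurable \<mu>" and hb: "\<And>x. \<bar>h x :: real\<bar> \<le> c * maj \<rho> x ^ j"
  shows "integrable \<mu> (\<lambda>x. h x * f g x)"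
    "(LINT x|\<mu>. h x * f g x) = (LINT \<theta>|g. LINT x|\<mu>. h x * comp_density d b \<theta> x)"
proof -
  interpret g: prob_space g by (rule G_prob[OF g])
  interpret \<mu>: sigma_finite_measure \<mu> by (rule sigma_finite_base)
  interpret P: pair_sigma_finite g \<mu> ..
  obtain B where B: "B \<ge> 0" "\<And>\<theta>. \<theta> \<in> \<Theta> ==> integrable \<mu> (\<lambda>x. maj \<rho> x ^ j * comp_density d b \<theta> x) \<and>
      (LINT x|\<mu>. maj \<rho> x ^ j * comp_density d b \<theta> x) \<le> B"
    using maj_moment_bounded[OF less_imp_le[OF rho(2)], of R j] \<Theta>_sub \<Theta>_bound by (blast dest: subsetD)
  have c0: "c * maj \<rho> x ^ j \<ge> 0" for x using hb[of x] by linarith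
  have cm: "comp_density d b \<theta> \<in> borel_measurable \<mu>" if "\<theta> \<in> \<Theta>" for \<theta>
    using that \<Theta>_sub by (intro comp_density_measurable) (auto simp: param_space_def PiE_iff)
  have le: "norm (h x * comp_density d b \<theta> x) \<le> c * (maj \<rho> x ^ j * comp_density d b \<theta> x)" if "\<theta> \<in> \<Theta>" for \<theta> x
    using mult_right_mono[OF hb[of x], of "comp_density d b \<theta> x"] comp_pos[OF that, of x] by (simp add: abs_mult mult.assoc)
  have i1: "integrable \<mu> (\<lambda>x. h x * comp_density d b \<theta> x)" if \<theta>: "\<theta> \<in> \<Theta>" for \<theta>
  proof (rule Bochner_Integration.integrable_bound)
    show "integrable \<mu> (\<lambda>x. c * (maj \<rho> x ^ j * comp_density d b \<theta> x))" using B(2)[OF \<theta>] by simp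
    show "(\<lambda>x. h x * comp_density d b \<theta> x) \<in> borel_measurable \<mu>" using cm[OF \<theta>] by simp
    show "AE x in \<mu>. norm (h x * comp_density d b \<theta> x) \<le> norm (c * (maj \<rho> x ^ j * comp_density d b \<theta> x))"
      by (intro AE_I2 order_trans[OF le[OF \<theta>]]) simp
  qed
  have n1: "(LINT x|\<mu>. norm (h x * comp_density d b \<theta> x)) \<le> \<bar>c\<bar> * B" if \<theta>: "\<theta> \<in> \<Theta>" for \<theta>
  proof -
    have "(LINT x|\<mu>. norm (h x * comp_density d b \<theta> x)) \<le> (LINT x|\<mu>. c * (maj \<rho> x ^ j * comp_density d b \<theta> x))"
      using i1[OF \<theta>] B(2)[OF \<theta>] le[OF \<theta>] by (intro integral_mono) auto
    also have "\<dots> = c * (LINT x|\<mu>. maj \<rho> x ^ j * comp_density d b \<theta> x)" by simp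
    also have "\<dots> \<le> \<bar>c\<bar> * (LINT x|\<mu>. maj \<rho> x ^ j * comp_density d b \<theta> x)"
      using maj_nonneg[of \<rho>] rho comp_pos[OF \<theta>] by (intro mult_right_mono abs_ge_self integral_nonneg) (auto simp: less_imp_le)
    also have "\<dots> \<le> \<bar>c\<bar> * B" using B(2)[OF \<theta>] by (intro mult_left_mono) auto
    finally show ?thesis .
  qed
  have pm: "(\<lambda>(\<theta>, x). h x * comp_density d b \<theta> x) \<in> borel_measurable (g \<Otimes>\<^sub>M \<mu>)"
    using pair_measurable[OF g] unfolding split_beta'
    by (intro borel_measurable_times measurable_compose[OF measurable_snd h])
  have i: "integrable (g \<Otimes>\<^sub>M \<mu>) (\<lambda>(\<theta>, x). h x * comp_density d b \<theta> x)"
  proof (rule P.Fubini_integrable[OF pm])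
    show "integrable g (\<lambda>\<theta>. LINT x|\<mu>. norm (case (\<theta>, x) of (\<theta>, x) => h x * comp_density d b \<theta> x))"
    proof (rule g.integrable_const_bound[where B="\<bar>c\<bar> * B"])
      show "AE \<theta> in g. norm (LINT x|\<mu>. norm (case (\<theta>, x) of (\<theta>, x) => h x * comp_density d b \<theta> x)) \<le> \<bar>c\<bar> * B"
        using n1 by (intro AE_I2) (simp add: G_space[OF g])
      show "(\<lambda>\<theta>. LINT x|\<mu>. norm (case (\<theta>, x) of (\<theta>, x) => h x * comp_density d b \<theta> x)) \<in> borel_measurable g"
        by (rule \<mu>.borel_measurable_lebesgue_integral) (use measurable_compose[OF pm borel_measurable_norm] in \<open>simp add: split_beta'\<close>)
    qed
    show "AE \<theta> in g. integrable \<mu> (\<lambda>x. case (\<theta>, x) of (\<theta>, x) => h x * comp_density d b \<theta> x)"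
      using i1 by (intro AE_I2) (simp add: G_space[OF g])
  qed
  show "integrable \<mu> (\<lambda>x. h x * f g x)"
    using P.integrable_snd[OF i] by (simp add: mix_density_def)
  show "(LINT x|\<mu>. h x * f g x) = (LINT \<theta>|g. LINT x|\<mu>. h x * comp_density d b \<theta> x)"
    using P.Fubini_integral[OF i] by (simp add: mix_density_def)
qed

lemma f_integral: assumes g: "g \<in> G" shows "integrable \<mu> (f g)" "(LINT x|\<mu>. f g x) = 1"
proof -
  interpret prob_space g by (rule G_prob[OF g])
  have m: "\<bar>1::real\<bar> \<le> 1 * maj \<rho> x ^ 0" for x by simp
  note i = mix_integral[OF g _ m]
  show "integrable \<mu> (f g)" using i(1) by simp
  have "(LINT x|\<mu>. f g x) = (LINT \<theta>|g. LINT x|\<mu>. comp_density d b \<theta> x)" using i(2) by simp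
  also have "\<dots> = (LINT \<theta>|g. 1)"
    using comp_density_integral(2) \<Theta>_sub by (intro Bochner_Integration.integral_cong) (auto simp: G_space[OF g])
  finally show "(LINT x|\<mu>. f g x) = 1" by (simp add: prob_space)
qed

lemma psi_le_maj: "\<bar>psi \<alpha> x\<bar> \<le> inverse (\<rho> ^ deg d \<alpha>) * maj \<rho> x ^ 1"
  using psi_bound[of \<rho> \<alpha> x] rho(2) by (simp add: field_simps)

lemma psi_mix_integral:
  assumes g: "g \<in> G"
  shows "integrable \<mu> (\<lambda>x. psi \<alpha> x * f g x)" "(LINT x|\<mu>. psi \<alpha> x * f g x) = \<kappa> \<alpha> * mom \<alpha> g"
proof -
  note i = mix_integral[OF g psi_measurable psi_le_maj]
  show "integrable \<mu> (\<lambda>x. psi \<alpha> x * f g x)" by (rule i(1))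
  have "(LINT x|\<mu>. psi \<alpha> x * f g x) = (LINT \<theta>|g. \<kappa> \<alpha> * mono \<alpha> \<theta>)"
    unfolding i(2) using psi_unbiased(2) \<Theta>_sub by (intro Bochner_Integration.integral_cong) (auto simp: G_space[OF g])
  then show "(LINT x|\<mu>. psi \<alpha> x * f g x) = \<kappa> \<alpha> * mom \<alpha> g" by (simp add: mom_eq)
qed

subsection \<open>Moment expansion of a mixture density\<close>

abbreviation idx :: "nat => nat => nat" where "idx \<equiv> enum_MI d"

definition hw :: "nat => real" where "hw k = (1 / 2) ^ deg d (idx k)"

definition e0 :: "nat => obs => real" where "e0 k x = \<rho> ^ deg d (idx k) * psi (idx k) x"

lemma hw_pos: "hw k > 0" by (simp add: hw_def)

lemma hw_summable: "summable hw"
proof -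
  have "(\<lambda>\<alpha>. \<bar>\<Prod>l=1..d. (1 / 2 :: real) ^ \<alpha> l\<bar>) summable_on MI d"
    by (rule product_series_summable[where f="\<lambda>l n. (1 / 2) ^ n"]) simp
  from summable_enum_MI[OF d_pos this] show ?thesis
    by (rule back_subst[of summable]) (auto simp: hw_def deg_def power_sum abs_prod)
qed

lemma e0_measurable[measurable]: "e0 k \<in> borel_measurable \<mu>"
  unfolding e0_def[abs_def] by measurable

lemma e0_bound: "\<bar>e0 k x\<bar> \<le> maj \<rho> x"
  using psi_bound[of \<rho> "idx k" x] rho(2) by (simp add: e0_def abs_mult mult.commute)

lemma psi_e0: "psi (idx k) x * \<rho>1 ^ deg d (idx k) = hw k * e0 k x"
  by (simp add: hw_def e0_def \<rho>_def power_mult_distrib power_divide)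

text \<open>
  The expansion of the components is integrated term by term; the majorant at twice the radius of
  the parameter set leaves summable geometric weights.
\<close>

lemma f_expansion:
  assumes g: "g \<in> G"
  shows "(\<lambda>k. mom (idx k) g * psi (idx k) x) sums (f g x / comp_density d b \<theta>0 x)"
    and "summable (\<lambda>k. \<bar>mom (idx k) g * psi (idx k) x\<bar>)"
proof -
  interpret prob_space g by (rule G_prob[OF g])
  have b: "\<bar>mono (idx k) \<theta> * psi (idx k) x\<bar> \<le> hw k * maj \<rho> x" if "\<theta> \<in> \<Theta>" for k \<theta>
  proof -
    have "\<bar>mono (idx k) \<theta> * psi (idx k) x\<bar> \<le> \<bar>psi (idx k) x * \<rho>1 ^ deg d (idx k)\<bar>"
      using mult_right_mono[OF mono_bound[OF that, of "idx k"], of "\<bar>psi (idx k) x\<bar>"] rho by (simp add: abs_mult mult.commute)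
    also have "\<dots> \<le> hw k * maj \<rho> x"
      unfolding psi_e0 abs_mult using e0_bound[of k x] hw_pos[of k] by simp
    finally show ?thesis .
  qed
  have hs: "summable (\<lambda>k. hw k * maj \<rho> x)" using hw_summable by (rule summable_mult2)
  have i: "integrable g (\<lambda>\<theta>. mono (idx k) \<theta> * psi (idx k) x)" for k using mono_integrable[OF g] by simp
  have Eb: "(LINT \<theta>|g. norm (mono (idx k) \<theta> * psi (idx k) x)) \<le> hw k * maj \<rho> x" for k
    by (rule integral_le_const[OF integrable_norm[OF i]], rule AE_I2) (simp only: G_space[OF g] real_norm_def b)
  have "(\<lambda>k. LINT \<theta>|g. mono (idx k) \<theta> * psi (idx k) x) sums (LINT \<theta>|g. (\<Sum>k. mono (idx k) \<theta> * psi (idx k) x))"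
  proof (rule sums_integral[OF i])
    show "AE \<theta> in g. summable (\<lambda>k. norm (mono (idx k) \<theta> * psi (idx k) x))"
    proof (rule AE_I2)
      fix \<theta> assume "\<theta> \<in> space g"
      then show "summable (\<lambda>k. norm (mono (idx k) \<theta> * psi (idx k) x))"
        by (intro summable_comparison_test[OF _ hs]) (use b in \<open>auto simp: G_space[OF g]\<close>)
    qed
    show "summable (\<lambda>k. LINT \<theta>|g. norm (mono (idx k) \<theta> * psi (idx k) x))"
      by (rule summable_comparison_test[OF _ hs]) (use Eb in \<open>auto simp: integral_nonneg\<close>)
  qed
  moreover have "(\<Sum>k. mono (idx k) \<theta> * psi (idx k) x) = comp_density d b \<theta> x / comp_density d b \<theta>0 x" for \<theta>
    using has_sum_enum_MI[OF d_pos density_expansion[of \<theta> x]] by (simp add: sums_iff)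
  ultimately show "(\<lambda>k. mom (idx k) g * psi (idx k) x) sums (f g x / comp_density d b \<theta>0 x)"
    by (simp add: mom_eq mix_density_def)
  have "\<bar>mom (idx k) g * psi (idx k) x\<bar> \<le> hw k * maj \<rho> x" for k
    using integral_norm_bound[of g "\<lambda>\<theta>. mono (idx k) \<theta> * psi (idx k) x"] Eb[of k] by (simp add: mom_eq)
  then show "summable (\<lambda>k. \<bar>mom (idx k) g * psi (idx k) x\<bar>)"
    by (intro summable_comparison_test[OF _ hs]) auto
qed

text \<open>
  Absolute convergence permits the grouping by total degree that defines the scores.
\<close>

lemma f_expansion_by_degree:
  assumes g: "g \<in> G"
  shows "(\<lambda>k. \<Sum>\<alpha>\<in>multi_indices d k. mom \<alpha> g * psi \<alpha> x) sums (f g x / comp_density d b \<theta>0 x)"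
proof (rule has_sum_by_degree)
  have "((\<lambda>k. mom (idx k) g * psi (idx k) x) has_sum (f g x / comp_density d b \<theta>0 x)) UNIV"
    by (rule norm_summable_imp_has_sum) (use f_expansion[OF g] in auto)
  then show "((\<lambda>\<alpha>. mom \<alpha> g * psi \<alpha> x) has_sum (f g x / comp_density d b \<theta>0 x)) (MI d)"
    using has_sum_reindex_bij_betw[OF bij_enum_MI[OF d_pos], of "\<lambda>\<alpha>. mom \<alpha> g * psi \<alpha> x"] by simp
qed

subsection \<open>The law of an observation\<close>

definition P0 :: "obs measure" where "P0 = mix_dist d b g0"

lemma sets_P0[measurable_cong]: "sets P0 = sets \<mu>" and space_P0: "space P0 = space \<mu>"
  by (simp_all add: P0_def mix_dist_def)

lemma P0_integral:
  fixes h :: "obs => real"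
  assumes "h \<in> borel_measurable \<mu>"
  shows "integrable P0 h \<longleftrightarrow> integrable \<mu> (\<lambda>x. h x * f g0 x)" "(LINT x|P0. h x) = (LINT x|\<mu>. h x * f g0 x)"
proof -
  have f0: "AE x in \<mu>. 0 \<le> f g0 x" using f_pos[OF g0_in] by (simp add: less_imp_le)
  show "integrable P0 h \<longleftrightarrow> integrable \<mu> (\<lambda>x. h x * f g0 x)"
    unfolding P0_def mix_dist_def using integrable_density[OF assms f_measurable[OF g0_in] f0] by (simp add: mult.commute)
  show "(LINT x|P0. h x) = (LINT x|\<mu>. h x * f g0 x)"
    unfolding P0_def mix_dist_def using integral_density[OF assms f_measurable[OF g0_in] f0] by (simp add: mult.commute)
qed

lemma P0_prob: "prob_space P0"
proof
  have "emeasure P0 (space P0) = (\<integral>\<^sup>+x. ennreal (f g0 x) \<partial>\<mu>)"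
    unfolding P0_def mix_dist_def using f_measurable[OF g0_in]
    by (subst emeasure_density) (auto intro!: nn_integral_cong)
  also have "\<dots> = ennreal (LINT x|\<mu>. f g0 x)"
    using f_integral[OF g0_in] f_pos[OF g0_in] by (intro nn_integral_eq_integral) (auto simp: less_imp_le)
  finally show "emeasure P0 (space P0) = 1" by (simp add: f_integral[OF g0_in])
qed

lemma maj_P0_integrable: "integrable P0 (\<lambda>x. maj \<rho> x ^ j)"
proof -
  have "\<bar>maj \<rho> x ^ j\<bar> \<le> 1 * maj \<rho> x ^ j" for x using maj_nonneg[of \<rho> x] rho by simp
  then show ?thesis using mix_integral(1)[OF g0_in, of "\<lambda>x. maj \<rho> x ^ j" 1 j] by (simp add: P0_integral(1))
qed

lemma psi_P0_L2: "L2_fun P0 (psi \<alpha>)"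
  unfolding L2_fun_def
proof
  show "psi \<alpha> \<in> borel_measurable P0" using psi_measurable by (simp cong: measurable_cong_sets)
  have "\<bar>(psi \<alpha> x)\<^sup>2\<bar> \<le> (inverse (\<rho> ^ deg d \<alpha>))\<^sup>2 * maj \<rho> x ^ 2" for x
    using power_mono[OF psi_le_maj[of \<alpha> x], of 2] by (simp add: power_mult_distrib)
  then show "integrable P0 (\<lambda>x. (psi \<alpha> x)\<^sup>2)"
    using mix_integral(1)[OF g0_in, of "\<lambda>x. (psi \<alpha> x)\<^sup>2" "(inverse (\<rho> ^ deg d \<alpha>))\<^sup>2" 2] by (simp add: P0_integral(1))
qed

end

section \<open>The likelihood ratio statistic\<close>

context mixture_model
begin

lemma mom_bound: "g \<in> G ==> \<bar>mom \<alpha> g\<bar> \<le> \<rho>1 ^ deg d \<alpha>"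
proof -
  assume g: "g \<in> G"
  interpret prob_space g by (rule G_prob[OF g])
  have "\<bar>mom \<alpha> g\<bar> \<le> (LINT \<theta>|g. \<bar>mono \<alpha> \<theta>\<bar>)" unfolding mom_eq by (rule integral_abs_bound)
  also have "\<dots> \<le> \<rho>1 ^ deg d \<alpha>"
    by (rule integral_le_const[OF integrable_abs[OF mono_integrable[OF g]]], rule AE_I2) (simp only: G_space[OF g] mono_bound)
  finally show ?thesis .
qed

text \<open>
  Rescaled moments: they lie in the box given by \<open>hw\<close>, and the functions
  \<open>e0\<close> have the common majorant \<open>maj \<rho>\<close>.
\<close>

definition nc :: "param measure => nat => real" where
  "nc g k = mom (idx k) g / \<rho> ^ deg d (idx k)"

lemma nc_bound: "g \<in> G ==> \<bar>nc g k\<bar> \<le> hw k"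
proof -
  assume "g \<in> G"
  then have "\<bar>nc g k\<bar> \<le> \<rho>1 ^ deg d (idx k) / \<rho> ^ deg d (idx k)"
    unfolding nc_def abs_divide using rho(2) mom_bound by (simp add: divide_right_mono)
  also have "\<dots> = hw k" using rho(1) by (simp add: hw_def \<rho>_def power_mult_distrib power_divide)
  finally show ?thesis .
qed

lemma nc_series: "g \<in> G ==> (\<lambda>k. nc g k * e0 k x) sums (f g x / comp_density d b \<theta>0 x)"
  using f_expansion(1)[of g x] rho(2) by (simp add: nc_def e0_def)

definition single :: "nat => nat => nat => nat" where "single l j = (\<lambda>i\<in>{1..d}. if i = l then j else 0)"

lemma mono_single: "l \<in> {1..d} ==> mono (single l j) \<theta> = (\<theta> l - \<theta>0 l) ^ j"
  unfolding mono_def single_def by (subst prod.remove[of _ l]) (auto intro!: prod.neutral)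

text \<open>
  The moment expansion makes the likelihood a continuous function of a point in a compact subset
  of \<open>\<ell>\<^sub>1\<close>; a countable dense subset of mixing distributions therefore exhausts the supremum.
\<close>

lemma countable_dense_mixtures:
  "\<exists>G'\<subseteq>G. countable G' \<and> (\<forall>g\<in>G. \<exists>h. (\<forall>n. h n \<in> G') \<and> (\<forall>x. (\<lambda>n::nat. f (h n) x) \<longlonglongrightarrow> f g x))"
proof -
  let ?Q = "\<lambda>n F D. finite F \<and> F \<subseteq> G \<and> summable D \<and> (\<forall>k. 0 \<le> D k) \<and> suminf D \<le> inverse (Suc n) \<and>
     (\<forall>g\<in>G. \<exists>h\<in>F. \<forall>k. \<bar>nc g k - nc h k\<bar> \<le> D k)"
  have "\<exists>F D. ?Q n F D" for n
    by (rule finite_coefficient_net[where w=hw]) (use hw_summable hw_pos nc_bound in \<open>auto simp: less_imp_le\<close>)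
  then have "\<forall>n. \<exists>FD. ?Q n (fst FD) (snd FD)" by simp
  from choice[OF this] obtain FD where "\<forall>n. ?Q n (fst (FD n)) (snd (FD n))" by (rule exE)
  then obtain F D where FD: "\<And>n. ?Q n (F n) (D n)" by (rule_tac that[of "\<lambda>n. fst (FD n)" "\<lambda>n. snd (FD n)"]) (erule spec)
  then have FD': "finite (F n)" "F n \<subseteq> G" "summable (D n)" "0 \<le> D n k" "suminf (D n) \<le> inverse (Suc n)" for n k by auto
  have "\<exists>h. (\<forall>n. h n \<in> (\<Union>n. F n)) \<and> (\<forall>x. (\<lambda>n. f (h n) x) \<longlonglongrightarrow> f g x)" if g: "g \<in> G" for g
  proof -
    have "\<forall>n. \<exists>h. h \<in> F n \<and> (\<forall>k. \<bar>nc g k - nc h k\<bar> \<le> D n k)" using FD g by blast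
    from choice[OF this] obtain h where h: "\<And>n. h n \<in> F n" "\<And>n k. \<bar>nc g k - nc (h n) k\<bar> \<le> D n k" by blast
    have hG: "h n \<in> G" for n using h(1) FD'(2) by blast
    have "(\<lambda>n. f (h n) x) \<longlonglongrightarrow> f g x" for x
    proof -
      let ?c = "comp_density d b \<theta>0 x"
      have c: "?c > 0" by (rule comp_pos[OF \<theta>0_in])
      have "\<bar>f (h n) x / ?c - f g x / ?c\<bar> \<le> inverse (Suc n) * maj \<rho> x" for n
      proof -
        have s: "(\<lambda>k. (nc g k - nc (h n) k) * e0 k x) sums (f g x / ?c - f (h n) x / ?c)"
          using sums_diff[OF nc_series[OF g, of x] nc_series[OF hG, of n x]] by (simp add: left_diff_distrib)
        have le: "\<bar>(nc g k - nc (h n) k) * e0 k x\<bar> \<le> D n k * maj \<rho> x" for k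
          unfolding abs_mult by (rule mult_mono[OF h(2) e0_bound FD'(4)]) simp
        have Ds: "summable (\<lambda>k. D n k * maj \<rho> x)" by (rule summable_mult2[OF FD'(3)])
        have s2: "summable (\<lambda>k. \<bar>(nc g k - nc (h n) k) * e0 k x\<bar>)"
          by (rule summable_comparison_test[OF _ Ds]) (use le in auto)
        have "\<bar>f g x / ?c - f (h n) x / ?c\<bar> \<le> (\<Sum>k. D n k * maj \<rho> x)"
          unfolding sums_unique[OF s] by (rule order_trans[OF summable_rabs[OF s2] suminf_le[OF le s2 Ds]])
        also have "\<dots> = suminf (D n) * maj \<rho> x" by (rule suminf_mult2[symmetric, OF FD'(3)])
        also have "\<dots> \<le> inverse (Suc n) * maj \<rho> x"
          by (rule mult_right_mono[OF FD'(5) maj_nonneg]) (use rho(2) in simp)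
        finally show ?thesis by (simp add: abs_minus_commute)
      qed
      moreover have "(\<lambda>n. inverse (real (Suc n)) * maj \<rho> x) \<longlonglongrightarrow> 0 * maj \<rho> x"
        by (rule tendsto_mult[OF LIMSEQ_inverse_real_of_nat tendsto_const])
      ultimately have "(\<lambda>n. f (h n) x / ?c - f g x / ?c) \<longlonglongrightarrow> 0"
        by (intro Lim_null_comparison[of "\<lambda>n. f (h n) x / ?c - f g x / ?c" "\<lambda>n. inverse (real (Suc n)) * maj \<rho> x"]) (simp_all del: of_nat_Suc)
      then have "(\<lambda>n. f (h n) x / ?c * ?c) \<longlonglongrightarrow> f g x / ?c * ?c"
        by (rule tendsto_mult[OF LIM_zero_cancel tendsto_const])
      then show ?thesis using c by simp
    qed
    then show ?thesis using h(1) by blast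
  qed
  moreover have "countable (\<Union>n. F n)" by (rule countable_UN[OF countableI_type countable_finite[OF FD'(1)]])
  moreover have "(\<Union>n. F n) \<subseteq> G" by (rule UN_least) (rule FD'(2))
  ultimately show ?thesis by (intro exI[of _ "\<Union>n. F n"] conjI ballI)
qed

text \<open>
  Realised as a two-stage experiment: a biased coin selects the mixing distribution.
\<close>

lemma convex_mixture:
  assumes g: "g \<in> G" and h: "h \<in> G" and t: "0 \<le> t" "t \<le> 1"
  shows "\<exists>m\<in>G. \<forall>x. f m x = (1 - t) * f g x + t * f h x"
proof -
  let ?B = "measure_pmf (bernoulli_pmf t)" and ?N = "\<lambda>c. if c then h else g"
  have s: "sets (?N c) = sets g0" for c using g h g0_in by (simp add: mixing_dists_def)
  have N: "?N \<in> measurable ?B (prob_algebra g0)"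
    using G_prob[OF g] G_prob[OF h] s by (auto simp: measurable_def space_prob_algebra split: if_splits)
  have B: "?B \<in> space (prob_algebra ?B)" by (simp add: space_prob_algebra measure_pmf.prob_space_axioms)
  let ?m = "?B \<bind> ?N"
  have m: "?m \<in> G"
    unfolding mixing_dists_def using prob_space_bind'[OF B N] sets_bind'[OF B N] g0_in by (simp add: mixing_dists_def)
  have "f ?m x = (1 - t) * f g x + t * f h x" for x
  proof -
    let ?c = "\<lambda>\<theta>. comp_density d b \<theta> x"
    have nn: "(\<integral>\<^sup>+\<theta>. ennreal (?c \<theta>) \<partial>k) = ennreal (f k x)" if "k \<in> G" for k
      unfolding mix_density_def
      by (rule nn_integral_eq_integral[OF comp_integrable[OF that]], rule AE_I2, rule less_imp_le, rule comp_pos)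
        (simp only: G_space[OF that])
    have cm: "(\<lambda>\<theta>. ennreal (?c \<theta>)) \<in> borel_measurable g0"
      using G_measurable[OF g0_in comp_measurable_param] by simp
    have "ennreal (f ?m x) = (\<integral>\<^sup>+c. \<integral>\<^sup>+\<theta>. ennreal (?c \<theta>) \<partial>?N c \<partial>?B)"
      using nn[OF m] nn_integral_bind[OF cm measurable_prob_algebraD[OF N]] by simp
    also have "\<dots> = (\<integral>\<^sup>+c. ennreal (f (?N c) x) \<partial>?B)" using nn g h by (intro nn_integral_cong) auto
    also have "\<dots> = ennreal (f h x) * ennreal t + ennreal (f g x) * ennreal (1 - t)"
      using t by (subst nn_integral_measure_pmf_support[of UNIV]) (auto simp: UNIV_bool)
    also have "\<dots> = ennreal ((1 - t) * f g x + t * f h x)"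
      using f_pos[OF g, of x] f_pos[OF h, of x] t by (simp add: ennreal_plus ennreal_mult mult.commute add.commute)
    finally show ?thesis using f_pos[OF m, of x] f_pos[OF g, of x] f_pos[OF h, of x] t
      by (subst (asm) ennreal_inj) (auto simp: less_imp_le)
  qed
  with m show ?thesis by blast
qed

end

locale npmle_model = mixture_model d b \<theta>0 \<Theta> R g0 + prob_space M
  for d b \<theta>0 \<Theta> R g0 and M :: "'w measure" +
  fixes X :: "nat => 'w => obs" and ghat :: "nat => 'w => param measure" and L :: "nat => 'w => real"
  assumes X_indep: "indep_vars (\<lambda>_. base_measure d b) X {1..}"
    and X_density: "\<And>i. i \<ge> 1 ==> distributed M (base_measure d b) (X i) (\<lambda>x. ennreal (mix_density d b g0 x))"
    and npmle: "\<And>n \<omega>. n \<ge> 1 ==> \<omega> \<in> space M ==> is_npmle d b \<Theta> n (\<lambda>i. X i \<omega>) (ghat n \<omega>)"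
    and L_eq_lr_stat: "\<And>n \<omega>. L n \<omega> = lr_stat d b n (\<lambda>i. X i \<omega>) (ghat n \<omega>) g0"
begin

sublocale iid_sample M P0 X
proof unfold_locales
  show "indep_vars (\<lambda>_. P0) X {1..}"
    using X_indep unfolding indep_vars_def by (simp add: sets_P0 cong: measurable_cong_sets)
  show "distr M P0 (X i) = P0" if "i \<ge> 1" for i
  proof -
    have "distr M P0 (X i) = distr M \<mu> (X i)" by (rule distr_cong) (simp_all add: sets_P0)
    also have "\<dots> = P0" using distributed_distr_eq_density[OF X_density[OF that]] by (simp add: P0_def mix_dist_def)
    finally show ?thesis .
  qed
qed

definition ell :: "param measure => nat => 'w => real" where
  "ell g n \<omega> = 2 * (\<Sum>i=1..n. ln (f g (X i \<omega>) / f g0 (X i \<omega>)))"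

lemma ell_eq: "g \<in> G ==> ell g n \<omega> = lr_stat d b n (\<lambda>i. X i \<omega>) g g0"
  using f_pos f_pos[OF g0_in] by (simp add: ell_def lr_stat_def log_lik_def ln_div sum_subtractf less_imp_neq[symmetric])

lemma ghat_in: "n \<ge> 1 ==> \<omega> \<in> space M ==> ghat n \<omega> \<in> G"
  using npmle by (simp add: is_npmle_def)

lemma L_ell: "n \<ge> 1 ==> \<omega> \<in> space M ==> L n \<omega> = ell (ghat n \<omega>) n \<omega>"
  using ell_eq[OF ghat_in] L_eq_lr_stat by simp

lemma ell_le_L: "n \<ge> 1 ==> \<omega> \<in> space M ==> g \<in> G ==> ell g n \<omega> \<le> L n \<omega>"
  using npmle[of n \<omega>] by (simp add: ell_eq L_eq_lr_stat lr_stat_def is_npmle_def)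

lemma ell_g0: "ell g0 n \<omega> = 0"
  using f_pos[OF g0_in] by (simp add: ell_def less_imp_neq[symmetric])

lemma L_ge_0: "n \<ge> 1 ==> \<omega> \<in> space M ==> 0 \<le> L n \<omega>"
  using ell_le_L[OF _ _ g0_in] by (simp add: ell_g0)

lemma ell_measurable: "g \<in> G ==> ell g n \<in> borel_measurable M"
  unfolding ell_def[abs_def]
proof (intro borel_measurable_times borel_measurable_const borel_measurable_sum)
  fix i assume g: "g \<in> G" and i: "i \<in> {1..n}"
  have [measurable]: "f g \<in> borel_measurable P0" "f g0 \<in> borel_measurable P0"
    using f_measurable[OF g] f_measurable[OF g0_in] by (simp_all cong: measurable_cong_sets add: sets_P0)
  have "(\<lambda>x. ln (f g x / f g0 x)) \<in> borel_measurable P0" by measurable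
  then show "(\<lambda>\<omega>. ln (f g (X i \<omega>) / f g0 (X i \<omega>))) \<in> borel_measurable M"
    using i by (intro X_compose) auto
qed

text \<open>
  The maximiser need not depend measurably on the sample, but its value does: it is a supremum
  over countably many mixing distributions.
\<close>

lemma L_borel_measurable: "n \<ge> 1 ==> L n \<in> borel_measurable M"
proof -
  assume n: "n \<ge> 1"
  obtain G' where G': "G' \<subseteq> G" "countable G'"
    "\<And>g. g \<in> G ==> \<exists>h. (\<forall>n. h n \<in> G') \<and> (\<forall>x. (\<lambda>n. f (h n) x) \<longlonglongrightarrow> f g x)"
    using countable_dense_mixtures by blast
  have "L n \<omega> \<le> a \<longleftrightarrow> (\<forall>h\<in>G'. ell h n \<omega> \<le> a)" if \<omega>: "\<omega> \<in> space M" for \<omega> a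
  proof
    assume "L n \<omega> \<le> a"
    then show "\<forall>h\<in>G'. ell h n \<omega> \<le> a" using ell_le_L[OF n \<omega>] G'(1) by fastforce
  next
    assume le: "\<forall>h\<in>G'. ell h n \<omega> \<le> a"
    obtain h where h: "\<And>m. h m \<in> G'" "\<And>x. (\<lambda>m. f (h m) x) \<longlonglongrightarrow> f (ghat n \<omega>) x"
      using G'(3)[OF ghat_in[OF n \<omega>]] by blast
    have "(\<lambda>m. ell (h m) n \<omega>) \<longlonglongrightarrow> ell (ghat n \<omega>) n \<omega>"
      unfolding ell_def using f_pos[OF ghat_in[OF n \<omega>]] f_pos[OF g0_in]
      by (intro tendsto_mult_left tendsto_sum tendsto_ln tendsto_divide[OF h(2) tendsto_const]) (simp_all add: less_imp_neq[symmetric])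
    then have "ell (ghat n \<omega>) n \<omega> \<le> a" by (rule LIMSEQ_le_const2) (use le h(1) in blast)
    then show "L n \<omega> \<le> a" by (simp add: L_ell[OF n \<omega>])
  qed
  then have eq: "{\<omega> \<in> space M. L n \<omega> \<le> a} = {\<omega> \<in> space M. \<forall>h\<in>G'. ell h n \<omega> \<le> a}" for a by auto
  show "L n \<in> borel_measurable M"
    unfolding borel_measurable_iff_le eq
  proof
    fix a
    show "{\<omega> \<in> space M. \<forall>h\<in>G'. ell h n \<omega> \<le> a} \<in> sets M"
    proof (rule sets.sets_Collect_countable_All'[OF _ G'(2)])
      fix h assume "h \<in> G'"
      then have [measurable]: "ell h n \<in> borel_measurable M" using G'(1) ell_measurable by blast
      show "{\<omega> \<in> space M. ell h n \<omega> \<le> a} \<in> sets M" by measurable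
    qed
  qed
qed

end

section \<open>Finitely discrete mixing distributions\<close>

subsection \<open>Moment differences are controlled by the chi-square distance\<close>

text \<open>
  High powers are to be traded for finitely many low ones at a geometric price; only the rates of
  growth of quotient and remainder matter for this.
\<close>

definition power_division :: "real poly => real => (nat => nat => real) => (nat => real => real) => bool" where
  "power_division p B q K \<longleftrightarrow> (\<forall>n t. t ^ n = (\<Sum>j<degree p. q n j * t ^ j) + poly p t * K n t) \<and>
    (\<forall>n j. \<bar>q n j\<bar> \<le> B ^ n) \<and> (\<forall>n t. \<bar>t\<bar> \<le> B - 1 \<longrightarrow> \<bar>K n t\<bar> \<le> B ^ n)"

text \<open>
  Multiplication by \<open>t\<close> followed by one reduction step multiplies the bounds by at
  most \<open>B\<close>.
\<close>

lemma monic_division_growth: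
  fixes p :: "real poly"
  assumes p: "lead_coeff p = 1" "degree p \<ge> 1" and B: "\<And>j. j < degree p ==> \<bar>coeff p j\<bar> \<le> B - 1" "B \<ge> 1"
  shows "\<exists>q K. power_division p B q K"
proof -
  define m where "m = degree p - 1"
  have m: "degree p = Suc m" using p(2) by (simp add: m_def)
  let ?s = "\<lambda>v j. (if j = 0 then 0 else v (j - 1)) - v m * (if j \<le> m then coeff p j else 0)"
  define q where "q = rec_nat (\<lambda>j. if j = 0 then 1 else 0) (\<lambda>_ v. ?s v)"
  define K where "K = rec_nat (\<lambda>t. 0) (\<lambda>n k t. t * k t + q n m)"
  have q0: "q 0 = (\<lambda>j. if j = 0 then 1 else 0)" and qS: "q (Suc n) = ?s (q n)" for n unfolding q_def by simp_all
  have K0: "K 0 = (\<lambda>t. 0)" and KS: "K (Suc n) = (\<lambda>t. t * K n t + q n m)" for n unfolding K_def by simp_all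
  have qb: "\<bar>q n j\<bar> \<le> B ^ n" for n j
  proof (induction n arbitrary: j)
    case (Suc n)
    have "\<bar>q (Suc n) j\<bar> \<le> \<bar>if j = 0 then 0 else q n (j - 1)\<bar> + \<bar>q n m * (if j \<le> m then coeff p j else 0)\<bar>"
      unfolding qS by (rule abs_triangle_ineq4)
    also have "\<dots> \<le> B ^ n + B ^ n * (B - 1)"
    proof (rule add_mono)
      show "\<bar>q n m * (if j \<le> m then coeff p j else 0)\<bar> \<le> B ^ n * (B - 1)"
        unfolding abs_mult using Suc[of m] B m by (intro mult_mono) auto
    qed (use Suc B in auto)
    also have "\<dots> = B ^ Suc n" by (simp add: algebra_simps)
    finally show ?case .
  qed (simp add: q0)
  have Kb: "\<bar>K n t\<bar> \<le> B ^ n" if t: "\<bar>t\<bar> \<le> B - 1" for n t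
  proof (induction n)
    case (Suc n)
    have "\<bar>K (Suc n) t\<bar> \<le> \<bar>t\<bar> * \<bar>K n t\<bar> + \<bar>q n m\<bar>" unfolding KS abs_mult[symmetric] by (rule abs_triangle_ineq)
    also have "\<dots> \<le> (B - 1) * B ^ n + B ^ n" using t Suc qb B by (intro add_mono mult_mono) auto
    also have "\<dots> = B ^ Suc n" by (simp add: algebra_simps)
    finally show ?case .
  qed (simp add: K0)
  have div: "t ^ n = (\<Sum>j<degree p. q n j * t ^ j) + poly p t * K n t" for n t
  proof (induction n)
    case 0
    show ?case by (simp add: q0 K0 m if_distrib[of "\<lambda>a. a * _"] sum.delta' cong: if_cong)
  next
    case (Suc n)
    have pt: "poly p t = (\<Sum>j\<le>m. coeff p j * t ^ j) + t ^ Suc m"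
      unfolding poly_altdef m using p(1) by (simp add: m)
    have "(\<Sum>j\<le>m. q (Suc n) j * t ^ j) = (\<Sum>j\<le>m. (if j = 0 then 0 else q n (j - 1)) * t ^ j) - q n m * (\<Sum>j\<le>m. coeff p j * t ^ j)"
      unfolding qS by (simp add: left_diff_distrib sum_subtractf sum_distrib_left mult.assoc)
    also have "(\<Sum>j\<le>m. (if j = 0 then 0 else q n (j - 1)) * t ^ j) = t * (\<Sum>j<m. q n j * t ^ j)"
      by (cases m) (simp_all add: sum.atMost_Suc_shift lessThan_Suc_atMost sum_distrib_left mult_ac del: sum.atMost_Suc)
    finally have "(\<Sum>j\<le>m. q (Suc n) j * t ^ j) = t * (\<Sum>j<m. q n j * t ^ j) - q n m * (\<Sum>j\<le>m. coeff p j * t ^ j)" .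
    moreover have "t ^ Suc n = t * ((\<Sum>j<m. q n j * t ^ j) + q n m * t ^ m) + t * (poly p t * K n t)"
      using Suc by (simp add: m distrib_left)
    ultimately show ?case
      unfolding KS m lessThan_Suc_atMost pt by (simp add: algebra_simps)
  qed
  have "power_division p B q K" unfolding power_division_def using div qb Kb by blast
  then show ?thesis by blast
qed

text \<open>
  The bound \<open>R\<close> on the parameters may always be enlarged; it is assumed to dominate
  the coefficients of the division polynomials as well.
\<close>

locale finite_mixture = mixture_model d b \<theta>0 \<Theta> R g0 for d b \<theta>0 \<Theta> R g0 +
  fixes T :: "param set"
  assumes T_finite: "finite T" and T_sub: "T \<subseteq> \<Theta>" and T_full: "emeasure g0 T = 1"
    and \<theta>0_atom: "emeasure g0 {\<theta>0} > 0"
    and R_large: "\<And>l j. l \<in> {1..d} ==> j < degree (\<Prod>\<tau>\<in>T. [:\<theta>0 l - \<tau> l, 1:]\<^sup>2) ==>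
      \<bar>coeff (\<Prod>\<tau>\<in>T. [:\<theta>0 l - \<tau> l, 1:]\<^sup>2) j\<bar> \<le> 2 * R"
begin

definition c0 :: real where "c0 = measure g0 {\<theta>0}"

definition rt :: "obs => real" where "rt x = comp_density d b \<theta>0 x / f g0 x"

lemma c0_pos: "c0 > 0"
proof -
  interpret prob_space g0 by (rule G_prob[OF g0_in])
  show ?thesis using \<theta>0_atom by (simp add: c0_def emeasure_eq_measure)
qed

text \<open>
  The atom at \<open>\<theta>0\<close> keeps the mixture density from falling below a multiple of
  the component there; this makes all density ratios square integrable.
\<close>

lemma comp_le_f: "c0 * comp_density d b \<theta>0 x \<le> f g0 x"
proof -
  interpret prob_space g0 by (rule G_prob[OF g0_in])
  have s: "{\<theta>0} \<in> sets g0" using \<theta>0_atom by (metis emeasure_notin_sets less_irrefl)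
  have "c0 * comp_density d b \<theta>0 x = (LINT \<theta>|g0. indicator {\<theta>0} \<theta> * comp_density d b \<theta>0 x)"
    using s by (simp add: c0_def)
  also have "\<dots> \<le> f g0 x" unfolding mix_density_def
  proof (rule integral_mono[OF _ comp_integrable[OF g0_in]])
    show "integrable g0 (\<lambda>\<theta>. indicator {\<theta>0} \<theta> * comp_density d b \<theta>0 x)"
      using s by (intro integrable_mult_left integrable_real_indicator) (simp_all add: less_top[symmetric])
    fix \<theta> assume "\<theta> \<in> space g0"
    then have "comp_density d b \<theta> x > 0" by (intro comp_pos) (simp only: G_space[OF g0_in])
    then show "indicator {\<theta>0} \<theta> * comp_density d b \<theta>0 x \<le> comp_density d b \<theta> x" by (auto simp: indicator_def less_imp_le simp del: split_paired_All)
  qed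
  finally show ?thesis .
qed

lemma rt_bound: "0 \<le> rt x" "rt x \<le> 1 / c0"
  using comp_le_f[of x] c0_pos comp_pos[OF \<theta>0_in, of x] f_pos[OF g0_in, of x] by (simp_all add: rt_def field_simps)

lemma rt_measurable[measurable]: "rt \<in> borel_measurable \<mu>"
proof -
  have "comp_density d b \<theta>0 \<in> borel_measurable \<mu>"
    using \<theta>0 by (intro comp_density_measurable) (auto simp: param_space_def PiE_iff)
  then show ?thesis unfolding rt_def[abs_def] using f_measurable[OF g0_in] by simp
qed

definition dev :: "param measure => obs => real" where "dev g x = f g x / f g0 x - 1"

abbreviation chi where "chi g \<equiv> chi_div d b g g0"

lemma dev_f0: "dev g x * f g0 x = f g x - f g0 x"
  using f_pos[OF g0_in, of x] by (simp add: dev_def field_simps)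

lemma dev_L2: "g \<in> G ==> L2_fun P0 (dev g)"
  unfolding L2_fun_def
proof
  assume g: "g \<in> G"
  show m: "dev g \<in> borel_measurable P0"
    using f_measurable[OF g] f_measurable[OF g0_in] unfolding dev_def[abs_def] by (simp cong: measurable_cong_sets)
  have "\<bar>dev g x\<bar> \<le> 1 / c0 * maj \<rho> x + 1" for x
  proof -
    have fb: "f g x \<le> comp_density d b \<theta>0 x * maj \<rho> x"
    proof -
      interpret prob_space g by (rule G_prob[OF g])
      show ?thesis unfolding mix_density_def
        by (rule integral_le_const[OF comp_integrable[OF g]], rule AE_I2) (simp only: G_space[OF g] comp_bound)
    qed
    have "f g x / f g0 x \<le> rt x * maj \<rho> x"
      using divide_right_mono[OF fb, of "f g0 x"] f_pos[OF g0_in, of x] by (simp add: rt_def)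
    also have "\<dots> \<le> 1 / c0 * maj \<rho> x" using rt_bound maj_nonneg[of \<rho> x] rho(2) by (intro mult_right_mono) auto
    finally have "f g x / f g0 x \<le> 1 / c0 * maj \<rho> x" .
    moreover have "f g x / f g0 x > 0" using f_pos[OF g, of x] f_pos[OF g0_in, of x] by simp
    ultimately show ?thesis unfolding dev_def by linarith
  qed
  note le = this
  show "integrable P0 (\<lambda>x. (dev g x)\<^sup>2)"
  proof (rule Bochner_Integration.integrable_bound)
    show "integrable P0 (\<lambda>x. (1 / c0)\<^sup>2 * maj \<rho> x ^ 2 + 2 / c0 * maj \<rho> x ^ 1 + maj \<rho> x ^ 0)"
      by (intro Bochner_Integration.integrable_add integrable_mult_right maj_P0_integrable)
    show "AE x in P0. norm ((dev g x)\<^sup>2) \<le> norm ((1 / c0)\<^sup>2 * maj \<rho> x ^ 2 + 2 / c0 * maj \<rho> x ^ 1 + maj \<rho> x ^ 0)"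
    proof (rule AE_I2)
      fix x
      have "(dev g x)\<^sup>2 \<le> (1 / c0 * maj \<rho> x + 1)\<^sup>2" using power_mono[OF le[of x] abs_ge_zero, of 2] by simp
      also have "\<dots> = (1 / c0)\<^sup>2 * maj \<rho> x ^ 2 + 2 / c0 * maj \<rho> x ^ 1 + maj \<rho> x ^ 0" by (simp add: power2_sum power_mult_distrib power_divide)
      finally show "norm ((dev g x)\<^sup>2) \<le> norm ((1 / c0)\<^sup>2 * maj \<rho> x ^ 2 + 2 / c0 * maj \<rho> x ^ 1 + maj \<rho> x ^ 0)" by simp
    qed
  qed (use m in simp)
qed

lemma chi_eq: "chi g = sqrt (LINT x|P0. (dev g x)\<^sup>2)"
  by (simp add: chi_div_def P0_def dev_def)

lemma chi_nonneg: "chi g \<ge> 0"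
  by (simp add: chi_eq)

lemma dev_measurable: "g \<in> G ==> dev g \<in> borel_measurable \<mu>"
  using f_measurable f_measurable[OF g0_in] unfolding dev_def[abs_def] by simp

lemma psi_dev_integral:
  assumes g: "g \<in> G"
  shows "(LINT x|P0. psi \<alpha> x * dev g x) = \<kappa> \<alpha> * (mom \<alpha> g - mom \<alpha> g0)"
proof -
  have "(LINT x|P0. psi \<alpha> x * dev g x) = (LINT x|\<mu>. psi \<alpha> x * f g x - psi \<alpha> x * f g0 x)"
    using dev_measurable[OF g] by (subst P0_integral(2)) (simp_all add: mult.assoc dev_f0 right_diff_distrib)
  then show ?thesis
    using psi_mix_integral[OF g, of \<alpha>] psi_mix_integral[OF g0_in, of \<alpha>] by (simp add: right_diff_distrib)
qed

definition mom_const :: "(nat => nat) => real" where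
  "mom_const \<alpha> = sqrt (LINT x|P0. (psi \<alpha> x)\<^sup>2) / \<kappa> \<alpha>"

lemma mom_const_nonneg: "mom_const \<alpha> \<ge> 0"
  using \<kappa>_pos[of \<alpha>] by (simp add: mom_const_def)

text \<open>
  Cauchy--Schwarz applied to the unbiased function \<open>psi \<alpha>\<close> and the deviation
  of the density ratio.
\<close>

lemma single_moment_bound:
  assumes g: "g \<in> G" shows "\<bar>mom \<alpha> g - mom \<alpha> g0\<bar> \<le> mom_const \<alpha> * chi g"
proof -
  have "\<kappa> \<alpha> * \<bar>mom \<alpha> g - mom \<alpha> g0\<bar> \<le> sqrt (LINT x|P0. (psi \<alpha> x)\<^sup>2) * chi g"
    using L2_Cauchy_Schwarz[OF psi_P0_L2[of \<alpha>] dev_L2[OF g]] \<kappa>_pos[of \<alpha>]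
    unfolding psi_dev_integral[OF g] chi_eq[symmetric] abs_mult by (simp only: abs_of_pos)
  then show ?thesis using \<kappa>_pos[of \<alpha>] by (simp add: mom_const_def pos_le_divide_eq mult.commute)
qed

text \<open>
  The constants obtained for single moments outgrow every geometric rate.  A geometric rate comes
  from dividing every power of a coordinate by the polynomial with double zeros at the values that
  this coordinate takes on the support: the remainder lies in a fixed
  finite-dimensional space, and the quotient is multiplied by a nonnegative polynomial whose
  \<open>g0\<close>-integral is zero, so that its integral is itself a moment difference.
\<close>

definition vp :: "nat => real poly" where "vp l = (\<Prod>\<tau>\<in>T. [:\<theta>0 l - \<tau> l, 1:]\<^sup>2)"

lemma vp_poly: "poly (vp l) (\<theta> l - \<theta>0 l) = (\<Prod>\<tau>\<in>T. (\<theta> l - \<tau> l)\<^sup>2)"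
  by (simp add: vp_def poly_prod)

lemma vp_nonneg: "poly (vp l) (\<theta> l - \<theta>0 l) \<ge> 0"
  unfolding vp_poly by (intro prod_nonneg) auto

lemma vp_zero: "\<theta> \<in> T ==> poly (vp l) (\<theta> l - \<theta>0 l) = 0"
  unfolding vp_poly using T_finite by auto

lemma T_nonempty: "T \<noteq> {}"
  using T_full by auto

lemma vp_monic: "lead_coeff (vp l) = 1"
  unfolding vp_def lead_coeff_prod by (simp add: lead_coeff_power)

lemma vp_degree: "degree (vp l) \<ge> 1"
proof (rule ccontr)
  assume "\<not> degree (vp l) \<ge> 1"
  then have z: "degree (vp l) = 0" by simp
  then obtain a where a: "vp l = [:a:]" by (rule degree_eq_zeroE)
  then have "a = 1" using vp_monic[of l] by simp
  then show False using a T_nonempty vp_zero[of _ l] by auto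
qed

lemma AE_T: "AE \<theta> in g0. \<theta> \<in> T"
proof -
  interpret prob_space g0 by (rule G_prob[OF g0_in])
  have "T \<in> sets g0" using T_full by (metis emeasure_notin_sets zero_neq_one)
  then show ?thesis using T_full by (simp add: AE_in_set_eq_1 emeasure_eq_measure)
qed

lemma vp_integral_bound:
  assumes l: "l \<in> {1..d}"
  shows "\<exists>C\<ge>0. \<forall>g\<in>G. integrable g (\<lambda>\<theta>. poly (vp l) (\<theta> l - \<theta>0 l)) \<and> (LINT \<theta>|g. poly (vp l) (\<theta> l - \<theta>0 l)) \<le> C * chi g"
proof (intro exI conjI ballI)
  let ?C = "\<Sum>j\<le>degree (vp l). \<bar>coeff (vp l) j\<bar> * mom_const (single l j)"
  show "0 \<le> ?C" using mom_const_nonneg by (intro sum_nonneg) auto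
  fix g assume g: "g \<in> G"
  have eq: "poly (vp l) (\<theta> l - \<theta>0 l) = (\<Sum>j\<le>degree (vp l). coeff (vp l) j * mono (single l j) \<theta>)" for \<theta>
    unfolding poly_altdef mono_single[OF l] ..
  have i: "integrable h (\<lambda>\<theta>. poly (vp l) (\<theta> l - \<theta>0 l))"
    "(LINT \<theta>|h. poly (vp l) (\<theta> l - \<theta>0 l)) = (\<Sum>j\<le>degree (vp l). coeff (vp l) j * mom (single l j) h)" if h: "h \<in> G" for h
    unfolding eq mom_eq using mono_integrable[OF h] by simp_all
  show "integrable g (\<lambda>\<theta>. poly (vp l) (\<theta> l - \<theta>0 l))" by (rule i(1)[OF g])
  have "(LINT \<theta>|g0. poly (vp l) (\<theta> l - \<theta>0 l)) = 0"
    by (rule integral_eq_zero_AE) (use AE_T in \<open>eventually_elim, simp add: vp_zero\<close>)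
  then have "(LINT \<theta>|g. poly (vp l) (\<theta> l - \<theta>0 l)) = (\<Sum>j\<le>degree (vp l). coeff (vp l) j * (mom (single l j) g - mom (single l j) g0))"
    using i(2)[OF g] i(2)[OF g0_in] by (simp add: right_diff_distrib sum_subtractf)
  also have "\<dots> \<le> (\<Sum>j\<le>degree (vp l). \<bar>coeff (vp l) j\<bar> * (mom_const (single l j) * chi g))"
  proof (rule sum_mono)
    fix j
    have "coeff (vp l) j * (mom (single l j) g - mom (single l j) g0) \<le> \<bar>coeff (vp l) j\<bar> * \<bar>mom (single l j) g - mom (single l j) g0\<bar>"
      unfolding abs_mult[symmetric] by (rule abs_ge_self)
    also have "\<dots> \<le> \<bar>coeff (vp l) j\<bar> * (mom_const (single l j) * chi g)" by (intro mult_left_mono single_moment_bound g) simp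
    finally show "coeff (vp l) j * (mom (single l j) g - mom (single l j) g0) \<le> \<bar>coeff (vp l) j\<bar> * (mom_const (single l j) * chi g)" .
  qed
  also have "\<dots> = ?C * chi g" by (simp add: sum_distrib_right mult.assoc)
  finally show "(LINT \<theta>|g. poly (vp l) (\<theta> l - \<theta>0 l)) \<le> ?C * chi g" .
qed

text \<open>
  The monomial is compared with the product over the coordinates of the remainders of its factors.
  The difference is at most a geometric factor times the sum of the division polynomials, whose
  integrals are of the order of the chi-square distance, and it vanishes on the support of
  \<open>g0\<close>.
\<close>

theorem moment_bound: "\<exists>C\<ge>0. \<forall>g\<in>G. \<forall>\<alpha>. \<bar>mom \<alpha> g - mom \<alpha> g0\<bar> \<le> C * \<rho>1 ^ deg d \<alpha> * chi g"
proof -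
  have cb: "\<bar>coeff (vp l) j\<bar> \<le> \<rho>1 - 1" if "l \<in> {1..d}" "j < degree (vp l)" for l j
    using R_large[of l j] that unfolding vp_def[symmetric] \<rho>1_def by simp
  have "\<forall>l\<in>{1..d}. \<exists>q. \<exists>K. power_division (vp l) \<rho>1 q K"
    using monic_division_growth[OF vp_monic vp_degree cb rho(1)] by (rule ballI)
  from bchoice[OF this] obtain q where q: "\<forall>l\<in>{1..d}. \<exists>K. power_division (vp l) \<rho>1 (q l) K" by (rule exE)
  from bchoice[OF q] obtain K where qK': "\<forall>l\<in>{1..d}. power_division (vp l) \<rho>1 (q l) (K l)" by (rule exE)
  note qK = bspec[OF qK']
  have qd: "t ^ n = (\<Sum>j<degree (vp l). q l n j * t ^ j) + poly (vp l) t * K l n t"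
    and qb: "\<bar>q l n j\<bar> \<le> \<rho>1 ^ n" and Kb: "\<bar>t\<bar> \<le> \<rho>1 - 1 ==> \<bar>K l n t\<bar> \<le> \<rho>1 ^ n" if "l \<in> {1..d}" for l n t j
    using qK[OF that] unfolding power_division_def by blast+
  define Q where "Q l n t = (\<Sum>j<degree (vp l). q l n j * t ^ j)" for l n and t :: real
  define V where "V = (\<Sum>l=1..d. \<Sum>j\<le>degree (vp l). \<bar>coeff (vp l) j\<bar> * \<rho>1 ^ j)"
  have tb: "\<bar>\<theta> l - \<theta>0 l\<bar> \<le> \<rho>1 - 1" if "\<theta> \<in> \<Theta>" "l \<in> {1..d}" for \<theta> l
    using \<Theta>_diff[OF that(1) \<theta>0_in that(2)] by (simp add: \<rho>1_def)
  have Vb: "poly (vp l) (\<theta> l - \<theta>0 l) \<le> V" if th: "\<theta> \<in> \<Theta>" and l: "l \<in> {1..d}" for \<theta> l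
  proof -
    have "poly (vp l) (\<theta> l - \<theta>0 l) \<le> (\<Sum>j\<le>degree (vp l). \<bar>coeff (vp l) j\<bar> * \<rho>1 ^ j)"
      unfolding poly_altdef
    proof (rule sum_mono)
      fix j
      have "\<bar>(\<theta> l - \<theta>0 l) ^ j\<bar> \<le> \<rho>1 ^ j" unfolding power_abs using tb[OF th l] by (intro power_mono) auto
      then show "coeff (vp l) j * (\<theta> l - \<theta>0 l) ^ j \<le> \<bar>coeff (vp l) j\<bar> * \<rho>1 ^ j"
        by (rule_tac order_trans[OF abs_ge_self]) (simp add: abs_mult mult_left_mono)
    qed
    also have "\<dots> \<le> V" unfolding V_def using rho(1) l
      by (intro member_le_sum[of l "{1..d}" "\<lambda>l. \<Sum>j\<le>degree (vp l). \<bar>coeff (vp l) j\<bar> * \<rho>1 ^ j"]) (auto intro!: sum_nonneg)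
    finally show ?thesis .
  qed
  have V0: "V \<ge> 0" unfolding V_def using rho(1) by (intro sum_nonneg) auto
  (* divided by C1 times a power of the radius, all factors are at most 1, as product differences require *)
  define C1 where "C1 = 1 + V"
  have C1: "C1 \<ge> 1" using V0 by (simp add: C1_def)
  have diff: "\<bar>mono \<alpha> \<theta> - (\<Prod>l=1..d. Q l (\<alpha> l) (\<theta> l - \<theta>0 l))\<bar>
      \<le> C1 ^ d * \<rho>1 ^ deg d \<alpha> * (\<Sum>l=1..d. poly (vp l) (\<theta> l - \<theta>0 l))" if th: "\<theta> \<in> \<Theta>" for \<alpha> \<theta>
  proof -
    let ?t = "\<lambda>l. \<theta> l - \<theta>0 l"
    let ?z = "\<lambda>l. ?t l ^ \<alpha> l / (C1 * \<rho>1 ^ \<alpha> l)" and ?w = "\<lambda>l. Q l (\<alpha> l) (?t l) / (C1 * \<rho>1 ^ \<alpha> l)"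
    have r1: "\<rho>1 ^ n > 0" for n using rho(1) by simp
    have dz: "\<bar>?t l ^ \<alpha> l - Q l (\<alpha> l) (?t l)\<bar> \<le> poly (vp l) (?t l) * \<rho>1 ^ \<alpha> l" if l: "l \<in> {1..d}" for l
    proof -
      have "?t l ^ \<alpha> l - Q l (\<alpha> l) (?t l) = poly (vp l) (?t l) * K l (\<alpha> l) (?t l)"
        unfolding Q_def using qd[OF l, of "?t l" "\<alpha> l"] by linarith
      then show ?thesis
        using mult_left_mono[OF Kb[OF l tb[OF th l], of "\<alpha> l"] vp_nonneg[of l \<theta>]] vp_nonneg[of l \<theta>] by (simp only: abs_mult abs_of_nonneg)
    qed
    have zp: "\<bar>?t l ^ \<alpha> l\<bar> \<le> \<rho>1 ^ \<alpha> l" if l: "l \<in> {1..d}" for l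
      unfolding power_abs using tb[OF th l] by (intro power_mono) auto
    have z: "norm (?z l) \<le> 1" if l: "l \<in> {1..d}" for l
    proof -
      have "\<bar>?t l ^ \<alpha> l\<bar> \<le> 1 * \<rho>1 ^ \<alpha> l" using zp[OF l] by simp
      also have "\<dots> \<le> C1 * \<rho>1 ^ \<alpha> l" using C1 r1[of "\<alpha> l"] by (intro mult_right_mono) auto
      finally show ?thesis using C1 r1[of "\<alpha> l"] by (simp add: abs_mult)
    qed
    have w: "norm (?w l) \<le> 1" if l: "l \<in> {1..d}" for l
    proof -
      have "\<bar>Q l (\<alpha> l) (?t l)\<bar> \<le> \<rho>1 ^ \<alpha> l + poly (vp l) (?t l) * \<rho>1 ^ \<alpha> l" using dz[OF l] zp[OF l] by linarith
      also have "\<dots> \<le> \<rho>1 ^ \<alpha> l + V * \<rho>1 ^ \<alpha> l" using Vb[OF th l] r1[of "\<alpha> l"] by (intro add_left_mono mult_right_mono) auto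
      also have "\<dots> = C1 * \<rho>1 ^ \<alpha> l" by (simp add: C1_def distrib_right)
      finally show ?thesis using C1 r1[of "\<alpha> l"] by (simp add: abs_mult)
    qed
    have P: "(\<Prod>l=1..d. C1 * \<rho>1 ^ \<alpha> l) = C1 ^ d * \<rho>1 ^ deg d \<alpha>" by (simp add: prod.distrib deg_def power_sum)
    have cancel: "(\<Prod>l=1..d. h l) = (\<Prod>l=1..d. h l / (C1 * \<rho>1 ^ \<alpha> l)) * (C1 ^ d * \<rho>1 ^ deg d \<alpha>)" for h :: "nat => real"
      unfolding P[symmetric] prod.distrib[symmetric] using C1 rho(1) by (intro prod.cong) auto
    have "\<bar>mono \<alpha> \<theta> - (\<Prod>l=1..d. Q l (\<alpha> l) (?t l))\<bar> = \<bar>(\<Prod>l=1..d. ?z l) - (\<Prod>l=1..d. ?w l)\<bar> * (C1 ^ d * \<rho>1 ^ deg d \<alpha>)"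
      unfolding mono_def cancel[of "\<lambda>l. ?t l ^ \<alpha> l"] cancel[of "\<lambda>l. Q l (\<alpha> l) (?t l)"] left_diff_distrib[symmetric] abs_mult
      using C1 r1[of "deg d \<alpha>"] by simp
    also have "\<dots> \<le> (\<Sum>l=1..d. norm (?z l - ?w l)) * (C1 ^ d * \<rho>1 ^ deg d \<alpha>)"
      using norm_prod_diff[of "{1..d}" ?z ?w, OF z w] C1 r1[of "deg d \<alpha>"] by (intro mult_right_mono) auto
    also have "\<dots> \<le> (\<Sum>l=1..d. poly (vp l) (?t l)) * (C1 ^ d * \<rho>1 ^ deg d \<alpha>)"
    proof (intro mult_right_mono sum_mono)
      fix l assume l: "l \<in> {1..d}"
      have "norm (?z l - ?w l) = \<bar>?t l ^ \<alpha> l - Q l (\<alpha> l) (?t l)\<bar> / (C1 * \<rho>1 ^ \<alpha> l)"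
        using C1 r1[of "\<alpha> l"] by (simp add: diff_divide_distrib[symmetric] abs_mult)
      also have "\<dots> \<le> (poly (vp l) (?t l) * \<rho>1 ^ \<alpha> l) / (1 * \<rho>1 ^ \<alpha> l)"
        using dz[OF l] C1 r1[of "\<alpha> l"] vp_nonneg[of l \<theta>] by (intro frac_le mult_right_mono) auto
      also have "\<dots> = poly (vp l) (?t l)" using rho(1) by simp
      finally show "norm (?z l - ?w l) \<le> poly (vp l) (?t l)" .
    qed (use C1 r1[of "deg d \<alpha>"] in auto)
    finally show ?thesis by (simp add: mult.commute)
  qed
  have "\<forall>l. \<exists>C. l \<in> {1..d} \<longrightarrow> C \<ge> 0 \<and> (\<forall>g\<in>G. integrable g (\<lambda>\<theta>. poly (vp l) (\<theta> l - \<theta>0 l)) \<and> (LINT \<theta>|g. poly (vp l) (\<theta> l - \<theta>0 l)) \<le> C * chi g)"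
    using vp_integral_bound by blast
  from choice[OF this] obtain Cv where "\<forall>l. l \<in> {1..d} \<longrightarrow> Cv l \<ge> 0 \<and> (\<forall>g\<in>G. integrable g (\<lambda>\<theta>. poly (vp l) (\<theta> l - \<theta>0 l)) \<and> (LINT \<theta>|g. poly (vp l) (\<theta> l - \<theta>0 l)) \<le> Cv l * chi g)" by (rule exE)
  then have Cv: "\<And>l. l \<in> {1..d} ==> Cv l \<ge> 0"
    "\<And>l g. l \<in> {1..d} ==> g \<in> G ==> integrable g (\<lambda>\<theta>. poly (vp l) (\<theta> l - \<theta>0 l))"
    "\<And>l g. l \<in> {1..d} ==> g \<in> G ==> (LINT \<theta>|g. poly (vp l) (\<theta> l - \<theta>0 l)) \<le> Cv l * chi g" by simp_all
  define I where "I = (\<Pi>\<^sub>E l\<in>{1..d}. {..<degree (vp l)})"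
  have fI: "finite I" unfolding I_def by (intro finite_PiE) auto
  have QI: "(\<Prod>l=1..d. Q l (\<alpha> l) (\<theta> l - \<theta>0 l)) = (\<Sum>\<beta>\<in>I. (\<Prod>l=1..d. q l (\<alpha> l) (\<beta> l)) * mono \<beta> \<theta>)" for \<alpha> \<theta>
    unfolding Q_def I_def mono_def prod.distrib[symmetric] by (rule prod_sum_PiE) auto
  define C where "C = C1 ^ d * (\<Sum>l=1..d. Cv l) + (\<Sum>\<beta>\<in>I. mom_const \<beta>)"
  have C0: "C \<ge> 0" unfolding C_def using C1 Cv(1) mom_const_nonneg by (intro add_nonneg_nonneg mult_nonneg_nonneg sum_nonneg) auto
  have "\<bar>mom \<alpha> g - mom \<alpha> g0\<bar> \<le> C * \<rho>1 ^ deg d \<alpha> * chi g" if g: "g \<in> G" for g \<alpha>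
  proof -
    let ?D = "\<lambda>\<theta>. mono \<alpha> \<theta> - (\<Prod>l=1..d. Q l (\<alpha> l) (\<theta> l - \<theta>0 l))" and ?a = "\<lambda>\<beta>. \<Prod>l=1..d. q l (\<alpha> l) (\<beta> l)"
      and ?E = "C1 ^ d * \<rho>1 ^ deg d \<alpha>"
    have E0: "?E \<ge> 0" using C1 rho(1) by simp
    have Qi: "integrable h (\<lambda>\<theta>. \<Prod>l=1..d. Q l (\<alpha> l) (\<theta> l - \<theta>0 l))"
      "(LINT \<theta>|h. (\<Prod>l=1..d. Q l (\<alpha> l) (\<theta> l - \<theta>0 l))) = (\<Sum>\<beta>\<in>I. ?a \<beta> * mom \<beta> h)" if "h \<in> G" for h
      unfolding QI mom_eq using mono_integrable[OF that] by simp_all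
    have Di: "integrable h ?D" "(LINT \<theta>|h. ?D \<theta>) = mom \<alpha> h - (\<Sum>\<beta>\<in>I. ?a \<beta> * mom \<beta> h)" if "h \<in> G" for h
      using Qi[OF that] mono_integrable[OF that, of \<alpha>] by (simp_all add: mom_eq)
    have "(LINT \<theta>|g0. ?D \<theta>) = 0"
    proof (rule integral_eq_zero_AE)
      show "AE \<theta> in g0. ?D \<theta> = 0" using AE_T
      proof eventually_elim
        case (elim \<theta>)
        then show ?case using diff[of \<theta> \<alpha>] T_sub vp_zero[OF elim] by auto
      qed
    qed
    then have "mom \<alpha> g - mom \<alpha> g0 = (LINT \<theta>|g. ?D \<theta>) + (\<Sum>\<beta>\<in>I. ?a \<beta> * (mom \<beta> g - mom \<beta> g0))"
      using Di(2)[OF g] Di(2)[OF g0_in] by (simp add: right_diff_distrib sum_subtractf)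
    moreover have "\<bar>LINT \<theta>|g. ?D \<theta>\<bar> \<le> ?E * ((\<Sum>l=1..d. Cv l) * chi g)"
    proof -
      have "\<bar>LINT \<theta>|g. ?D \<theta>\<bar> \<le> (LINT \<theta>|g. \<bar>?D \<theta>\<bar>)" by (rule integral_abs_bound)
      also have "\<dots> \<le> (LINT \<theta>|g. ?E * (\<Sum>l=1..d. poly (vp l) (\<theta> l - \<theta>0 l)))"
        using Di(1)[OF g] Cv(2)[OF _ g] diff
        by (intro integral_mono integrable_abs integrable_mult_right Bochner_Integration.integrable_sum) (auto simp: G_space[OF g])
      also have "\<dots> = ?E * (\<Sum>l=1..d. LINT \<theta>|g. poly (vp l) (\<theta> l - \<theta>0 l))"
        using Cv(2)[OF _ g] by (subst integral_mult_right_zero, subst Bochner_Integration.integral_sum) auto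
      also have "\<dots> \<le> ?E * (\<Sum>l=1..d. Cv l * chi g)" using Cv(3)[OF _ g] by (intro mult_left_mono sum_mono E0) auto
      finally show ?thesis by (simp add: sum_distrib_right)
    qed
    moreover have "\<bar>\<Sum>\<beta>\<in>I. ?a \<beta> * (mom \<beta> g - mom \<beta> g0)\<bar> \<le> (\<Sum>\<beta>\<in>I. \<rho>1 ^ deg d \<alpha> * (mom_const \<beta> * chi g))"
    proof (rule order_trans[OF sum_abs sum_mono])
      fix \<beta>
      have "\<bar>?a \<beta>\<bar> \<le> (\<Prod>l=1..d. \<rho>1 ^ \<alpha> l)" unfolding abs_prod using qb by (intro prod_mono) auto
      then have "\<bar>?a \<beta>\<bar> \<le> \<rho>1 ^ deg d \<alpha>" by (simp add: deg_def power_sum)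
      then show "\<bar>?a \<beta> * (mom \<beta> g - mom \<beta> g0)\<bar> \<le> \<rho>1 ^ deg d \<alpha> * (mom_const \<beta> * chi g)"
        unfolding abs_mult using single_moment_bound[OF g, of \<beta>] rho(1) by (intro mult_mono) auto
    qed
    moreover have "(\<Sum>\<beta>\<in>I. \<rho>1 ^ deg d \<alpha> * (mom_const \<beta> * chi g)) = \<rho>1 ^ deg d \<alpha> * ((\<Sum>\<beta>\<in>I. mom_const \<beta>) * chi g)"
      by (simp add: sum_distrib_left sum_distrib_right)
    ultimately have "\<bar>mom \<alpha> g - mom \<alpha> g0\<bar> \<le> ?E * ((\<Sum>l=1..d. Cv l) * chi g) + \<rho>1 ^ deg d \<alpha> * ((\<Sum>\<beta>\<in>I. mom_const \<beta>) * chi g)" by linarith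
    also have "\<dots> = C * \<rho>1 ^ deg d \<alpha> * chi g" by (simp add: C_def algebra_simps)
    finally show ?thesis .
  qed
  then show ?thesis using C0 by blast
qed

end

subsection \<open>The class of scores\<close>

context finite_mixture
begin

abbreviation S where "S \<equiv> score_set d b \<Theta> g0 \<theta>0"

definition zero_index :: "nat => nat" where "zero_index = (\<lambda>l\<in>{1..d}. 0)"

lemma mom_zero: "g \<in> G ==> mom zero_index g = 1"
  unfolding mom_eq zero_index_def mono_zero using prob_space.prob_space[OF G_prob] by simp

lemma multi_indices_0: "multi_indices d 0 = {zero_index}"
proof (rule set_eqI)
  fix \<alpha>
  show "\<alpha> \<in> multi_indices d 0 \<longleftrightarrow> \<alpha> \<in> {zero_index}"
    unfolding multi_indices_def zero_index_def by (auto simp: PiE_iff extensional_def fun_eq_iff)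
qed

text \<open>
  The term of degree zero drops out since all moments of order zero are \<open>1\<close>.  The
  identity also holds when the distance is zero, as both sides are then zero.
\<close>

lemma score_eq:
  assumes g: "g \<in> G" shows "score d b g0 \<theta>0 g x = dev g x / chi g"
proof -
  let ?c = "comp_density d b \<theta>0 x"
  let ?D = "\<lambda>k. \<Sum>\<alpha>\<in>multi_indices d k. (mom \<alpha> g - mom \<alpha> g0) * psi \<alpha> x"
  have "?D sums (f g x / ?c - f g0 x / ?c)"
    using sums_diff[OF f_expansion_by_degree[OF g, of x] f_expansion_by_degree[OF g0_in, of x]]
    by (simp add: left_diff_distrib sum_subtractf)
  moreover have "?D 0 = 0" by (simp add: multi_indices_0 mom_zero[OF g] mom_zero[OF g0_in])
  ultimately have s: "(\<lambda>k. ?D (Suc k)) sums (f g x / ?c - f g0 x / ?c)" by (subst sums_Suc_iff) simp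
  have t: "(\<Sum>\<alpha>\<in>multi_indices d k. (mom \<alpha> g - mom \<alpha> g0) / (multi_fact d \<alpha> * chi g) * score_poly d b \<theta>0 \<alpha> x) = ?D k / chi g" for k
    unfolding sum_divide_distrib
  proof (rule sum.cong[OF refl])
    fix \<alpha>
    have "multi_fact d \<alpha> \<noteq> 0" by (simp add: multi_fact_def)
    then show "(mom \<alpha> g - mom \<alpha> g0) / (multi_fact d \<alpha> * chi g) * score_poly d b \<theta>0 \<alpha> x = (mom \<alpha> g - mom \<alpha> g0) * psi \<alpha> x / chi g"
      by (simp add: score_poly_eq)
  qed
  have "score d b g0 \<theta>0 g x = (sqrt (rt x) * sqrt (rt x)) * (\<Sum>k. ?D (Suc k) / chi g)"
    unfolding score_def t rt_def[symmetric] by (simp only: mult_ac)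
  also have "\<dots> = rt x * ((f g x / ?c - f g0 x / ?c) / chi g)"
    using sums_unique[OF sums_divide[OF s, of "chi g"]] rt_bound(1)[of x] by simp
  also have "\<dots> = rt x * (f g x / ?c - f g0 x / ?c) / chi g" by simp
  also have "rt x * (f g x / ?c - f g0 x / ?c) = dev g x"
    using f_pos[OF g0_in, of x] comp_pos[OF \<theta>0_in, of x] by (simp add: rt_def dev_def field_simps)
  finally show ?thesis .
qed

lemma score_set_eq: "S = {(\<lambda>x. dev g x / chi g) | g. g \<in> G \<and> g \<noteq> g0}"
  using score_eq unfolding score_set_def by (intro Collect_cong ex_cong1) (auto simp: fun_eq_iff)

lemma score_obtain:
  assumes "s \<in> S" obtains g where "g \<in> G" "s = (\<lambda>x. dev g x / chi g)"
  using assms unfolding score_set_eq by blast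

lemma chi_zero: assumes g: "g \<in> G" and z: "chi g = 0" shows "f g x = f g0 x"
proof -
  have "mom \<alpha> g = mom \<alpha> g0" for \<alpha> using single_moment_bound[OF g, of \<alpha>] z by simp
  then have "f g x / comp_density d b \<theta>0 x = f g0 x / comp_density d b \<theta>0 x"
    using f_expansion(1)[OF g, of x] f_expansion(1)[OF g0_in, of x] by (simp only: \<open>\<And>\<alpha>. mom \<alpha> g = mom \<alpha> g0\<close>) (rule sums_unique2)
  then show ?thesis using comp_pos[OF \<theta>0_in, of x] by simp
qed

lemma dev_mean: "g \<in> G ==> (LINT x|P0. dev g x) = 0"
  using psi_dev_integral[of g zero_index] unfolding zero_index_def psi_zero
  unfolding zero_index_def[symmetric] by (simp add: mom_zero g0_in)

lemma score_L2: "s \<in> S ==> L2_fun P0 s"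
proof -
  assume "s \<in> S"
  then obtain g where g: "g \<in> G" "s = (\<lambda>x. dev g x / chi g)" by (rule score_obtain)
  show ?thesis using L2_fun_scale[OF dev_L2[OF g(1)], of "1 / chi g"] by (simp add: g(2))
qed

lemma score_mean: "s \<in> S ==> (LINT x|P0. s x) = 0"
  by (erule score_obtain) (simp add: dev_mean)

lemma score_norm: assumes "s \<in> S" shows "(LINT x|P0. (s x)\<^sup>2) = 1 \<or> (\<forall>x\<in>space P0. s x = 0)"
proof -
  obtain g where g: "g \<in> G" "s = (\<lambda>x. dev g x / chi g)" using assms by (rule score_obtain)
  have nn: "(LINT x|P0. (dev g x)\<^sup>2) \<ge> 0" by simp
  show ?thesis
  proof (cases "chi g = 0")
    case False
    then have "(LINT x|P0. (dev g x)\<^sup>2) \<noteq> 0" by (simp add: chi_eq)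
    moreover have "(chi g)\<^sup>2 = (LINT x|P0. (dev g x)\<^sup>2)" using nn by (simp add: chi_eq)
    ultimately show ?thesis by (simp add: g(2) power_divide)
  qed (simp add: g(2))
qed

definition ec :: "nat => obs => real" where "ec k x = rt x * e0 k x"

text \<open>
  The coefficient of a score is written as an integral against the score, so that it does not
  depend on the mixing distribution representing the score and is Lipschitz in \<open>L\<^sub>2\<close>.
\<close>

definition cc :: "(obs => real) => nat => real" where
  "cc s k = (LINT x|P0. psi (idx k) x * s x) / (\<kappa> (idx k) * \<rho> ^ deg d (idx k))"

lemma cc_eq:
  assumes g: "g \<in> G"
  shows "cc (\<lambda>x. dev g x / chi g) k = (nc g k - nc g0 k) / chi g"
proof -
  have eq: "(LINT x|P0. psi (idx k) x * (dev g x / chi g)) = \<kappa> (idx k) * (mom (idx k) g - mom (idx k) g0) / chi g"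
    unfolding psi_dev_integral[OF g, of "idx k", symmetric] by simp
  have "cc (\<lambda>x. dev g x / chi g) k = (mom (idx k) g - mom (idx k) g0) / \<rho> ^ deg d (idx k) / chi g"
    unfolding cc_def eq using \<kappa>_pos[of "idx k"] by simp
  then show ?thesis by (simp only: nc_def diff_divide_distrib)
qed

text \<open>
  The moment bound places the coefficients in a summable box.
\<close>

lemma score_series: "\<exists>w C. lipschitz_series P0 S cc w ec (\<lambda>x. maj \<rho> x / c0) C"
proof -
  obtain C where C: "C \<ge> 0" "\<And>g \<alpha>. g \<in> G ==> \<bar>mom \<alpha> g - mom \<alpha> g0\<bar> \<le> C * \<rho>1 ^ deg d \<alpha> * chi g"
    using moment_bound by blast
  let ?r = "\<lambda>k. \<rho> ^ deg d (idx k)"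
  let ?C = "\<lambda>k. sqrt (LINT x|P0. (psi (idx k) x)\<^sup>2) / (\<kappa> (idx k) * ?r k)"
  have r0: "?r k > 0" for k using rho(2) by simp
  interpret P0: prob_space P0 by (rule P0_prob)
  have "lipschitz_series P0 S cc (\<lambda>k. C * hw k) ec (\<lambda>x. maj \<rho> x / c0) ?C"
  proof unfold_locales
    show "summable (\<lambda>k. C * hw k)" using hw_summable by (rule summable_mult)
    show "0 \<le> C * hw k" for k using C hw_pos[of k] by simp
    show "\<bar>cc s k\<bar> \<le> C * hw k" if s: "s \<in> S" for s k
    proof -
      obtain g where g: "g \<in> G" "s = (\<lambda>x. dev g x / chi g)" using s by (rule score_obtain)
      have hw: "hw k = \<rho>1 ^ deg d (idx k) / ?r k" using rho(1) by (simp add: hw_def \<rho>_def power_mult_distrib power_divide)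
      have "\<bar>cc s k\<bar> = \<bar>mom (idx k) g - mom (idx k) g0\<bar> / (?r k * chi g)"
        unfolding g(2) cc_eq[OF g(1)] nc_def using r0[of k] chi_nonneg[of g] by (simp add: diff_divide_distrib[symmetric] abs_mult)
      also have "\<dots> \<le> (C * \<rho>1 ^ deg d (idx k) * chi g) / (?r k * chi g)"
        using C(2)[OF g(1), of "idx k"] r0[of k] chi_nonneg[of g] by (intro divide_right_mono) auto
      also have "\<dots> \<le> C * hw k" unfolding hw using r0[of k] C(1) rho(1) by (cases "chi g = 0") auto
      finally show ?thesis .
    qed
    show "ec k \<in> borel_measurable P0" for k
    proof -
      have "ec k \<in> borel_measurable \<mu>" unfolding ec_def[abs_def] by (intro borel_measurable_times rt_measurable e0_measurable)
      then show ?thesis by (simp cong: measurable_cong_sets)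
    qed
    show "\<bar>ec k x\<bar> \<le> maj \<rho> x / c0" for k x
      using mult_mono[OF rt_bound(2) e0_bound[of k x], of x] rt_bound(1)[of x] c0_pos by (simp add: ec_def abs_mult)
    show "(\<lambda>x. maj \<rho> x / c0) \<in> borel_measurable P0"
    proof -
      have "(\<lambda>x. maj \<rho> x / c0) \<in> borel_measurable \<mu>" by (intro borel_measurable_divide maj_measurable borel_measurable_const)
      then show ?thesis by (simp cong: measurable_cong_sets)
    qed
    show "integrable P0 (\<lambda>x. (maj \<rho> x / c0) ^ 4)" using maj_P0_integrable[of 4] by (simp add: power_divide)
    show "s x = (\<Sum>k. cc s k * ec k x)" if s: "s \<in> S" for s x
    proof -
      obtain g where g: "g \<in> G" "s = (\<lambda>x. dev g x / chi g)" using s by (rule score_obtain)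
      have "(\<lambda>k. (nc g k - nc g0 k) * e0 k x) sums (f g x / comp_density d b \<theta>0 x - f g0 x / comp_density d b \<theta>0 x)"
        using sums_diff[OF nc_series[OF g(1), of x] nc_series[OF g0_in, of x]] by (simp add: left_diff_distrib)
      from sums_mult[OF this, of "rt x / chi g"]
      have "(\<lambda>k. cc s k * ec k x) sums (rt x / chi g * (f g x / comp_density d b \<theta>0 x - f g0 x / comp_density d b \<theta>0 x))"
        unfolding g(2) cc_eq[OF g(1)] ec_def by (simp add: mult_ac)
      also have "rt x / chi g * (f g x / comp_density d b \<theta>0 x - f g0 x / comp_density d b \<theta>0 x) = s x"
      proof -
        have "rt x * (f g x / comp_density d b \<theta>0 x - f g0 x / comp_density d b \<theta>0 x) = dev g x"
          using f_pos[OF g0_in, of x] comp_pos[OF \<theta>0_in, of x] by (simp add: rt_def dev_def field_simps)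
        then show ?thesis unfolding g(2) by simp
      qed
      finally show ?thesis by (rule sums_unique)
    qed
    show "\<bar>cc s k - cc t k\<bar> \<le> ?C k * L2_dist P0 s t" if s: "s \<in> S" and t: "t \<in> S" for s t k
    proof -
      have st: "L2_fun P0 (\<lambda>x. s x - t x)" using L2_fun_add[OF score_L2[OF s] score_L2[OF t], of "-1"] by simp
      have "(LINT x|P0. psi (idx k) x * s x) - (LINT x|P0. psi (idx k) x * t x) = (LINT x|P0. psi (idx k) x * (s x - t x))"
        using L2_fun_inner_integrable[OF psi_P0_L2 score_L2[OF s]] L2_fun_inner_integrable[OF psi_P0_L2 score_L2[OF t]]
        by (simp add: right_diff_distrib)
      then have "\<bar>cc s k - cc t k\<bar> = \<bar>LINT x|P0. psi (idx k) x * (s x - t x)\<bar> / (\<kappa> (idx k) * ?r k)"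
        unfolding cc_def diff_divide_distrib[symmetric] abs_divide using \<kappa>_pos[of "idx k"] r0[of k] by simp
      also have "\<dots> \<le> (sqrt (LINT x|P0. (psi (idx k) x)\<^sup>2) * L2_dist P0 s t) / (\<kappa> (idx k) * ?r k)"
        unfolding L2_dist_def using L2_Cauchy_Schwarz[OF psi_P0_L2 st] \<kappa>_pos[of "idx k"] r0[of k] by (intro divide_right_mono) auto
      finally show ?thesis by simp
    qed
  qed
  then show ?thesis by blast
qed

end

subsection \<open>Convergence of the statistic\<close>

locale finite_npmle = finite_mixture d b \<theta>0 \<Theta> R g0 T + npmle_model d b \<theta>0 \<Theta> R g0 M X ghat L
  for d b \<theta>0 \<Theta> R g0 T and M :: "'w measure" and X ghat L
begin

definition submodels :: "((obs => real) \<times> real) set" where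
  "submodels = {(s, \<epsilon>). s \<in> S \<and> 0 \<le> \<epsilon> \<and> (\<exists>h\<in>G. \<forall>x. f h x = f g0 x * (1 + \<epsilon> * s x))}"

text \<open>
  The maximum likelihood estimator is itself a step of length \<open>chi\<close> in the direction
  of its score, and convexity provides all shorter steps.
\<close>

lemma score_likelihood_model: "\<exists>w. lr_model M P0 X S cc w ec (\<lambda>x. maj \<rho> x / c0) submodels L"
proof -
  obtain w C where ser: "lipschitz_series P0 S cc w ec (\<lambda>x. maj \<rho> x / c0) C" using score_series by blast
  interpret ser: lipschitz_series P0 S cc w ec "\<lambda>x. maj \<rho> x / c0" C by (rule ser)
  have ratio: "f h x / f g0 x = 1 + \<epsilon> * s x" if "\<forall>x. f h x = f g0 x * (1 + \<epsilon> * s x)" for h \<epsilon> s x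
    using spec[OF that, of x] f_pos[OF g0_in, of x] by simp
  have "lr_model M P0 X S cc w ec (\<lambda>x. maj \<rho> x / c0) submodels L"
  proof unfold_locales
    show "(LINT x|P0. s x) = 0" if "s \<in> S" for s by (rule score_mean[OF that])
    show "(LINT x|P0. (s x)\<^sup>2) = 1 \<or> (\<forall>x\<in>space P0. s x = 0)" if "s \<in> S" for s by (rule score_norm[OF that])
    show "s \<in> S \<and> 0 \<le> \<epsilon> \<and> (\<forall>x\<in>space P0. 1 + \<epsilon> * s x > 0)" if m: "(s, \<epsilon>) \<in> submodels" for s \<epsilon>
    proof -
      obtain h where h: "h \<in> G" "\<forall>x. f h x = f g0 x * (1 + \<epsilon> * s x)" using m by (auto simp: submodels_def)
      have "1 + \<epsilon> * s x > 0" for x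
        using ratio[OF h(2), of x] divide_pos_pos[OF f_pos[OF h(1), of x] f_pos[OF g0_in, of x]] by simp
      then show ?thesis using m by (simp add: submodels_def)
    qed
    show "\<exists>\<epsilon>0>0. \<forall>\<epsilon>. 0 \<le> \<epsilon> \<and> \<epsilon> \<le> \<epsilon>0 \<longrightarrow> (s, \<epsilon>) \<in> submodels" if s: "s \<in> S" for s
    proof -
      obtain g where g: "g \<in> G" "s = (\<lambda>x. dev g x / chi g)" using s by (rule score_obtain)
      show ?thesis
      proof (cases "chi g = 0")
        case True
        have "(s, \<epsilon>) \<in> submodels" if "\<epsilon> \<ge> 0" for \<epsilon>
          using that s g0_in by (auto simp: submodels_def g(2) True)
        then show ?thesis by (intro exI[of _ 1]) simp
      next
        case False
        then have c: "chi g > 0" using chi_nonneg[of g] by simp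
        have "(s, \<epsilon>) \<in> submodels" if e: "0 \<le> \<epsilon>" "\<epsilon> \<le> chi g" for \<epsilon>
        proof -
          obtain m where m: "m \<in> G" "\<And>x. f m x = (1 - \<epsilon> / chi g) * f g0 x + \<epsilon> / chi g * f g x"
            using convex_mixture[OF g0_in g(1), of "\<epsilon> / chi g"] e c by auto
          have "f m x = f g0 x * (1 + \<epsilon> * s x)" for x
          proof -
            have "f g x = f g0 x + dev g x * f g0 x" by (simp add: dev_f0)
            then show ?thesis unfolding m(2) g(2) by (simp add: algebra_simps)
          qed
          then show ?thesis using s e m(1) by (auto simp: submodels_def)
        qed
        then show ?thesis using c by blast
      qed
    qed
    show "0 \<le> L n \<omega>" if "n \<ge> 1" "\<omega> \<in> space M" for n \<omega> by (rule L_ge_0[OF that])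
    show "2 * (\<Sum>i=1..n. ln (1 + \<epsilon> * s (X i \<omega>))) \<le> L n \<omega>" if n: "n \<ge> 1" "\<omega> \<in> space M" and m: "(s, \<epsilon>) \<in> submodels" for n \<omega> s \<epsilon>
    proof -
      obtain h where h: "h \<in> G" "\<forall>x. f h x = f g0 x * (1 + \<epsilon> * s x)" using m by (auto simp: submodels_def)
      show ?thesis using ell_le_L[OF n h(1)] unfolding ell_def ratio[OF h(2)] .
    qed
    show "L n \<omega> = 0 \<or> (\<exists>s \<epsilon>. (s, \<epsilon>) \<in> submodels \<and> L n \<omega> = 2 * (\<Sum>i=1..n. ln (1 + \<epsilon> * s (X i \<omega>))))" if n: "n \<ge> 1" "\<omega> \<in> space M" for n \<omega>
    proof (cases "chi (ghat n \<omega>) = 0 \<or> ghat n \<omega> = g0")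
      case True
      then have "f (ghat n \<omega>) x = f g0 x" for x using chi_zero[OF ghat_in[OF n], of x] by (elim disjE) simp_all
      then have "ell (ghat n \<omega>) n \<omega> = 0" using ell_g0[of n \<omega>] by (simp add: ell_def)
      then show ?thesis using L_ell[OF n] by simp
    next
      case False
      let ?g = "ghat n \<omega>"
      let ?s = "\<lambda>x. dev ?g x / chi ?g"
      have eq: "\<forall>x. f ?g x = f g0 x * (1 + chi ?g * ?s x)"
        using False dev_f0[of ?g] by (simp add: distrib_left mult.commute)
      have "?s \<in> S" using False ghat_in[OF n] unfolding score_set_eq by blast
      then have "(?s, chi ?g) \<in> submodels" unfolding submodels_def mem_Collect_eq prod.case using eq ghat_in[OF n] chi_nonneg[of ?g] by blast
      moreover have "L n \<omega> = 2 * (\<Sum>i=1..n. ln (1 + chi ?g * ?s (X i \<omega>)))"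
        unfolding L_ell[OF n] ell_def ratio[OF eq] ..
      ultimately show ?thesis by blast
    qed
    show "L n \<in> borel_measurable M" if "n \<ge> 1" for n by (rule L_borel_measurable[OF that])
  qed
  then show ?thesis by blast
qed

theorem likelihood_ratio_converges:
  fixes N :: "'v measure"
  assumes "tight_gaussian_process N P0 S Z"
  shows "weak_conv_m (\<lambda>n. distr M borel (L n)) (distr N borel (sup_sq_pos S Z))"
  using score_likelihood_model lr_model.likelihood_ratio_limit[OF _ assms] by blast

end

section \<open>Mixing distributions that are not finitely discrete\<close>

text \<open>
  If every coordinate had finitely many values, the distribution would live on their product.
\<close>

lemma (in mixture_model) infinite_marginal:
  assumes "\<not> finitely_discrete g0"
  shows "\<exists>l\<in>{1..d}. \<forall>F. finite F \<longrightarrow> \<not> (AE \<theta> in g0. \<theta> l \<in> F)"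
proof (rule ccontr)
  assume "\<not> ?thesis"
  then have "\<forall>l\<in>{1..d}. \<exists>F. finite F \<and> (AE \<theta> in g0. \<theta> l \<in> F)" by blast
  from bchoice[OF this] obtain F where F: "\<forall>l\<in>{1..d}. finite (F l) \<and> (AE \<theta> in g0. \<theta> l \<in> F l)" by (rule exE)
  interpret prob_space g0 by (rule G_prob[OF g0_in])
  define A where "A = {\<theta> \<in> space g0. \<forall>l\<in>{1..d}. \<theta> l \<in> F l}"
  have "A \<subseteq> {1..d} \<rightarrow>\<^sub>E UNIV" using \<Theta>_sub unfolding A_def G_space[OF g0_in] by (auto simp: param_space_def PiE_iff)
  then have "A \<subseteq> Pi\<^sub>E {1..d} F" unfolding A_def by (auto simp: PiE_iff)
  then have fin: "finite A" by (rule finite_subset) (use F in \<open>auto intro!: finite_PiE\<close>)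
  have A: "A \<in> events" unfolding A_def
  proof (rule sets.sets_Collect_finite_All)
    fix l assume l: "l \<in> {1..d}"
    have "F l \<in> sets borel" using F l by (intro borel_closed finite_imp_closed) auto
    from measurable_sets[OF G_measurable[OF g0_in coordinate_param_measurable[OF l]] this]
    show "{\<theta> \<in> space g0. \<theta> l \<in> F l} \<in> events" by (simp add: vimage_def Collect_conj_eq Int_commute)
  qed simp
  have "AE \<theta> in g0. \<forall>l\<in>{1..d}. \<theta> l \<in> F l" using F by (intro AE_finite_allI) auto
  then have "AE \<theta> in g0. \<theta> \<in> A" unfolding A_def using AE_space by eventually_elim simp
  then have "emeasure g0 A = 1" using AE_in_set_eq_1[OF A] by (simp add: emeasure_eq_measure)
  then have "finitely_discrete g0" unfolding finitely_discrete_def using fin by (intro exI[of _ A]) (auto simp: A_def)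
  with assms show False by blast
qed

subsection \<open>Scores of tilted mixing distributions\<close>

locale tilted_mixture = mixture_model d b \<theta>0 \<Theta> R g0 for d b \<theta>0 \<Theta> R g0 +
  fixes l :: nat
  assumes l_in: "l \<in> {1..d}"
    and marginal_infinite: "\<And>F. finite F ==> \<not> (AE \<theta> in g0. \<theta> l \<in> F)"
begin

definition pl :: "real poly => param => real" where "pl p \<theta> = poly p (\<theta> l - \<theta>0 l)"

definition pb :: "real poly => real" where "pb p = (\<Sum>j\<le>degree p. \<bar>coeff p j\<bar> * \<rho>1 ^ j)"

text \<open>
  The derivative, relative to the true density, of the mixture density in the direction of a
  polynomial in coordinate \<open>l\<close>.
\<close>

definition tilt :: "real poly => obs => real" where
  "tilt p x = (LINT \<theta>|g0. pl p \<theta> * comp_density d b \<theta> x) / f g0 x"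

lemma pl_eq: "pl p \<theta> = (\<Sum>j\<le>degree p. coeff p j * mono (single l j) \<theta>)"
  unfolding pl_def poly_altdef mono_single[OF l_in] ..

lemma pl_measurable: "pl p \<in> borel_measurable (\<Pi>\<^sub>M l\<in>{1..d}. borel)"
  unfolding pl_eq[abs_def] by (intro borel_measurable_sum borel_measurable_times borel_measurable_const mono_measurable)

lemma deg_single: "deg d (single l j) = j"
  unfolding deg_def single_def using l_in by (subst sum.remove[of _ l]) (auto intro!: sum.neutral)

lemma pl_bound: "\<theta> \<in> \<Theta> ==> \<bar>pl p \<theta>\<bar> \<le> pb p"
proof -
  assume th: "\<theta> \<in> \<Theta>"
  have "\<bar>pl p \<theta>\<bar> \<le> (\<Sum>j\<le>degree p. \<bar>coeff p j * mono (single l j) \<theta>\<bar>)" unfolding pl_eq by (rule sum_abs)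
  also have "\<dots> \<le> pb p"
    unfolding pb_def abs_mult using mono_bound[OF th, of "single l _"] by (intro sum_mono mult_left_mono) (auto simp: deg_single)
  finally show ?thesis .
qed

lemma pb_nonneg: "0 \<le> pb p"
  using pl_bound[OF \<theta>0_in, of p] by linarith

lemma pl_mult_integrable:
  assumes h: "h \<in> borel_measurable (\<Pi>\<^sub>M l\<in>{1..d}. borel)" "\<And>\<theta>. \<theta> \<in> \<Theta> ==> \<bar>h \<theta>\<bar> \<le> B"
  shows "integrable g0 (\<lambda>\<theta>. pl p \<theta> * h \<theta>)"
proof (rule G_integrable[OF g0_in])
  show "(\<lambda>\<theta>. pl p \<theta> * h \<theta>) \<in> borel_measurable (\<Pi>\<^sub>M l\<in>{1..d}. borel)" by (intro borel_measurable_times pl_measurable h(1))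
  show "\<bar>pl p \<theta> * h \<theta>\<bar> \<le> pb p * B" if "\<theta> \<in> \<Theta>" for \<theta>
    unfolding abs_mult using pl_bound[OF that] h(2)[OF that] pb_nonneg by (intro mult_mono) auto
qed

lemmas pl_comp_integrable = pl_mult_integrable[OF comp_measurable_param comp_abs_bound]
lemmas pl_mono_integrable = pl_mult_integrable[OF mono_measurable mono_bound]
lemmas pl_pl_integrable = pl_mult_integrable[OF pl_measurable pl_bound]

lemma pl_integrable: "integrable g0 (pl p)"
  by (rule G_integrable[OF g0_in pl_measurable pl_bound])

lemma tilt_add: "tilt (p + q) x = tilt p x + tilt q x"
proof -
  have "(LINT \<theta>|g0. pl (p + q) \<theta> * comp_density d b \<theta> x) =
      (LINT \<theta>|g0. pl p \<theta> * comp_density d b \<theta> x + pl q \<theta> * comp_density d b \<theta> x)"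
    by (simp add: pl_def distrib_right)
  then show ?thesis by (simp add: tilt_def pl_comp_integrable add_divide_distrib)
qed

lemma tilt_smult: "tilt (smult a p) x = a * tilt p x"
  by (simp add: tilt_def pl_def mult.assoc)

text \<open>
  Tilting \<open>g0\<close> by a centred polynomial in one coordinate stays inside the class of mixing
  distributions, and its density ratio is affine in the size of the tilt.
\<close>

lemma tilted_mixture:
  assumes p0: "(LINT \<theta>|g0. pl p \<theta>) = 0" and t: "\<bar>t\<bar> * pb p \<le> 1 / 2"
  shows "\<exists>h\<in>G. (\<forall>x. f h x = f g0 x * (1 + t * tilt p x)) \<and>
    (\<forall>\<alpha>. mom \<alpha> h = mom \<alpha> g0 + t * (LINT \<theta>|g0. pl p \<theta> * mono \<alpha> \<theta>))"
proof -
  interpret prob_space g0 by (rule G_prob[OF g0_in])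
  let ?w = "\<lambda>\<theta>. 1 + t * pl p \<theta>"
  let ?h = "density g0 (\<lambda>\<theta>. ennreal (?w \<theta>))"
  have wpos: "0 \<le> ?w \<theta>" if "\<theta> \<in> \<Theta>" for \<theta>
  proof -
    have "\<bar>t * pl p \<theta>\<bar> \<le> \<bar>t\<bar> * pb p" unfolding abs_mult by (intro mult_left_mono pl_bound that) simp
    then show ?thesis using t by linarith
  qed
  then have w0: "AE \<theta> in g0. 0 \<le> ?w \<theta>" by (intro AE_I2) (simp only: G_space[OF g0_in])
  have plm: "pl p \<in> borel_measurable g0" by (rule G_measurable[OF g0_in pl_measurable])
  have wm: "?w \<in> borel_measurable g0" using plm by simp
  have "emeasure ?h (space ?h) = (\<integral>\<^sup>+\<theta>. ennreal (?w \<theta>) \<partial>g0)"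
    using wm by (subst emeasure_density) (auto intro!: nn_integral_cong)
  also have "\<dots> = ennreal (LINT \<theta>|g0. ?w \<theta>)" using pl_integrable w0 by (intro nn_integral_eq_integral) auto
  also have "(LINT \<theta>|g0. ?w \<theta>) = 1" using pl_integrable p0 by (simp add: prob_space)
  finally have "prob_space ?h" by (intro prob_spaceI) simp
  then have hG: "?h \<in> G" using g0_in by (simp add: mixing_dists_def)
  have int: "(LINT \<theta>|?h. u \<theta>) = (LINT \<theta>|g0. u \<theta>) + t * (LINT \<theta>|g0. pl p \<theta> * u \<theta>)"
    if u: "u \<in> borel_measurable (\<Pi>\<^sub>M l\<in>{1..d}. borel)" "\<And>\<theta>. \<theta> \<in> \<Theta> ==> \<bar>u \<theta>\<bar> \<le> B" for u :: "param => real" and B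
  proof -
    have ui: "integrable g0 u" "integrable g0 (\<lambda>\<theta>. pl p \<theta> * u \<theta>)"
      using G_integrable[OF g0_in u] pl_mult_integrable[OF u] by auto
    have "(LINT \<theta>|?h. u \<theta>) = (LINT \<theta>|g0. ?w \<theta> * u \<theta>)"
      using integral_density[OF G_measurable[OF g0_in u(1)] wm w0] by simp
    also have "\<dots> = (LINT \<theta>|g0. u \<theta> + t * (pl p \<theta> * u \<theta>))" by (simp add: algebra_simps)
    also have "\<dots> = (LINT \<theta>|g0. u \<theta>) + t * (LINT \<theta>|g0. pl p \<theta> * u \<theta>)" using ui by simp
    finally show ?thesis .
  qed
  have "f ?h x = f g0 x * (1 + t * tilt p x)" for x
    using int[OF comp_measurable_param comp_abs_bound, of x] f_pos[OF g0_in, of x]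
    by (simp add: mix_density_def[symmetric] tilt_def distrib_left)
  moreover have "mom \<alpha> ?h = mom \<alpha> g0 + t * (LINT \<theta>|g0. pl p \<theta> * mono \<alpha> \<theta>)" for \<alpha>
    unfolding mom_eq by (rule int[OF mono_measurable mono_bound])
  ultimately show ?thesis using hG by blast
qed

lemma centred_tilt:
  assumes p0: "(LINT \<theta>|g0. pl p \<theta>) = 0"
  obtains t h where "t > 0" "h \<in> G" "\<forall>x. f h x = f g0 x * (1 + t * tilt p x)"
    "\<forall>\<alpha>. mom \<alpha> h = mom \<alpha> g0 + t * (LINT \<theta>|g0. pl p \<theta> * mono \<alpha> \<theta>)"
proof -
  (* keeps the weight of the tilt at least 1/2 *)
  define t where "t = 1 / (2 * (pb p + 1))"
  have t: "t > 0" "\<bar>t\<bar> * pb p \<le> 1 / 2" using pb_nonneg[of p] by (auto simp: t_def field_simps)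
  from tilted_mixture[OF p0 t(2)] show ?thesis by (elim bexE conjE) (rule that[OF t(1)])
qed

lemma tilt_measurable:
  assumes p0: "(LINT \<theta>|g0. pl p \<theta>) = 0" shows "tilt p \<in> borel_measurable \<mu>"
proof -
  obtain t h where th': "t > 0" "h \<in> G" "\<forall>x. f h x = f g0 x * (1 + t * tilt p x)"
    "\<forall>\<alpha>. mom \<alpha> h = mom \<alpha> g0 + t * (LINT \<theta>|g0. pl p \<theta> * mono \<alpha> \<theta>)"
    by (rule centred_tilt[OF p0])
  note th = th'(1,2) spec[OF th'(3)] spec[OF th'(4)]
  have "tilt p x = (f h x / f g0 x - 1) / t" for x
    using th(1) f_pos[OF g0_in, of x] by (simp add: th(3))
  then have eq: "tilt p = (\<lambda>x. (f h x / f g0 x - 1) / t)" by (rule ext)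
  show ?thesis unfolding eq using f_measurable[OF th(2)] f_measurable[OF g0_in] by simp
qed

lemma tilt_bound: "\<bar>tilt p x\<bar> \<le> pb p"
proof -
  have "\<bar>LINT \<theta>|g0. pl p \<theta> * comp_density d b \<theta> x\<bar> \<le> (LINT \<theta>|g0. \<bar>pl p \<theta> * comp_density d b \<theta> x\<bar>)"
    by (rule integral_abs_bound)
  also have "\<dots> \<le> (LINT \<theta>|g0. pb p * comp_density d b \<theta> x)"
  proof (rule integral_mono)
    show "\<bar>pl p \<theta> * comp_density d b \<theta> x\<bar> \<le> pb p * comp_density d b \<theta> x" if "\<theta> \<in> space g0" for \<theta>
    proof -
      have th: "\<theta> \<in> \<Theta>" using that by (simp only: G_space[OF g0_in])
      show ?thesis using mult_right_mono[OF pl_bound[OF th, of p], of "comp_density d b \<theta> x"] comp_pos[OF th, of x] by (simp add: abs_mult)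
    qed
  qed (use pl_comp_integrable comp_integrable[OF g0_in] in auto)
  also have "\<dots> = pb p * f g0 x" by (simp add: mix_density_def)
  finally show ?thesis using f_pos[OF g0_in, of x] by (simp add: tilt_def pos_divide_le_eq)
qed

lemma tilt_integral:
  assumes p0: "(LINT \<theta>|g0. pl p \<theta>) = 0"
  shows "(LINT x|P0. tilt p x) = 0" "(LINT x|P0. psi \<alpha> x * tilt p x) = \<kappa> \<alpha> * (LINT \<theta>|g0. pl p \<theta> * mono \<alpha> \<theta>)"
proof -
  obtain t h where th': "t > 0" "h \<in> G" "\<forall>x. f h x = f g0 x * (1 + t * tilt p x)"
    "\<forall>\<alpha>. mom \<alpha> h = mom \<alpha> g0 + t * (LINT \<theta>|g0. pl p \<theta> * mono \<alpha> \<theta>)"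
    by (rule centred_tilt[OF p0])
  note th = th'(1,2) spec[OF th'(3)] spec[OF th'(4)]
  have eq: "tilt p x * f g0 x = (1 / t) * (f h x - f g0 x)" for x
    using th(1) by (simp add: th(3) field_simps)
  have "(LINT x|P0. tilt p x) = (LINT x|\<mu>. (1 / t) * (f h x - f g0 x))"
    unfolding eq[symmetric] by (rule P0_integral(2)[OF tilt_measurable[OF p0]])
  then show "(LINT x|P0. tilt p x) = 0" using f_integral[OF th(2)] f_integral[OF g0_in] by simp
  have "(LINT x|P0. psi \<alpha> x * tilt p x) = (LINT x|\<mu>. psi \<alpha> x * (tilt p x * f g0 x))"
    using P0_integral(2)[OF borel_measurable_times[OF psi_measurable tilt_measurable[OF p0]]] by (simp add: mult.assoc)
  also have "\<dots> = (LINT x|\<mu>. (1 / t) * (psi \<alpha> x * f h x - psi \<alpha> x * f g0 x))"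
    unfolding eq by (simp add: right_diff_distrib mult.left_commute)
  also have "\<dots> = (1 / t) * (\<kappa> \<alpha> * mom \<alpha> h - \<kappa> \<alpha> * mom \<alpha> g0)"
    using psi_mix_integral[OF th(2), of \<alpha>] psi_mix_integral[OF g0_in, of \<alpha>] by simp
  also have "\<dots> = \<kappa> \<alpha> * (LINT \<theta>|g0. pl p \<theta> * mono \<alpha> \<theta>)" using th(1) by (simp add: th(4) distrib_left)
  finally show "(LINT x|P0. psi \<alpha> x * tilt p x) = \<kappa> \<alpha> * (LINT \<theta>|g0. pl p \<theta> * mono \<alpha> \<theta>)" .
qed

lemma tilt_power_integrable:
  assumes p0: "(LINT \<theta>|g0. pl p \<theta>) = 0" shows "integrable P0 (\<lambda>x. tilt p x ^ j)"
proof -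
  interpret P0: prob_space P0 by (rule P0_prob)
  have m: "(\<lambda>x. tilt p x ^ j) \<in> borel_measurable P0"
    using tilt_measurable[OF p0] by (simp cong: measurable_cong_sets)
  show ?thesis
    by (rule P0.integrable_const_bound[where B="pb p ^ j"]) (use m tilt_bound power_mono[OF tilt_bound abs_ge_zero] in \<open>auto simp: power_abs\<close>)
qed

lemma tilt_L2: "(LINT \<theta>|g0. pl p \<theta>) = 0 ==> L2_fun P0 (tilt p)"
  unfolding L2_fun_def using tilt_measurable[of p] tilt_power_integrable[of p 2] by (simp cong: measurable_cong_sets)

text \<open>
  If the tilt leaves the density unchanged, then by unbiasedness the polynomial is orthogonal to all
  monomials under \<open>g0\<close>, hence to itself; it then vanishes almost surely and the coordinate has finitely many values.
\<close>

lemma tilt_nonzero: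
  assumes p0: "(LINT \<theta>|g0. pl p \<theta>) = 0" and p: "p \<noteq> 0"
  shows "L2_inner P0 (tilt p) (tilt p) \<noteq> 0"
proof
  assume z: "L2_inner P0 (tilt p) (tilt p) = 0"
  have m0: "(LINT \<theta>|g0. pl p \<theta> * mono \<alpha> \<theta>) = 0" for \<alpha>
  proof -
    have "L2_inner P0 (tilt p) (psi \<alpha>) = 0" by (rule L2_inner_null[OF tilt_L2[OF p0] z])
    then have "\<kappa> \<alpha> * (LINT \<theta>|g0. pl p \<theta> * mono \<alpha> \<theta>) = 0"
      unfolding tilt_integral(2)[OF p0, symmetric] by (simp add: L2_inner_def mult.commute)
    then show ?thesis using \<kappa>_pos[of \<alpha>] by simp
  qed
  have "pl p \<theta> * pl p \<theta> = (\<Sum>j\<le>degree p. coeff p j * (pl p \<theta> * mono (single l j) \<theta>))" for \<theta>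
    unfolding pl_eq[of p \<theta>] by (simp add: sum_distrib_left sum_distrib_right mult_ac)
  then have "(LINT \<theta>|g0. pl p \<theta> * pl p \<theta>) = (\<Sum>j\<le>degree p. coeff p j * (LINT \<theta>|g0. pl p \<theta> * mono (single l j) \<theta>))"
    using pl_mono_integrable by simp
  then have "(LINT \<theta>|g0. pl p \<theta> * pl p \<theta>) = 0" by (simp add: m0)
  then have "AE \<theta> in g0. pl p \<theta> * pl p \<theta> = 0"
    using integral_nonneg_eq_0_iff_AE[OF pl_pl_integrable[of p p]] by simp
  then have "AE \<theta> in g0. \<theta> l \<in> (\<lambda>t. t + \<theta>0 l) ` {t. poly p t = 0}"
    by eventually_elim (auto simp: pl_def image_iff intro!: exI[of _ "_ - \<theta>0 l"])
  moreover have "finite ((\<lambda>t. t + \<theta>0 l) ` {t. poly p t = 0})" using poly_roots_finite[OF p] by simp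
  ultimately show False using marginal_infinite by blast
qed

definition tilts :: "nat => (obs => real) set" where
  "tilts n = {tilt p | p. degree p \<le> n \<and> (LINT \<theta>|g0. pl p \<theta>) = 0}"

lemma pl_add_integral: "(LINT \<theta>|g0. pl (p + q) \<theta>) = (LINT \<theta>|g0. pl p \<theta>) + (LINT \<theta>|g0. pl q \<theta>)"
proof -
  have "pl (p + q) = (\<lambda>\<theta>. pl p \<theta> + pl q \<theta>)" by (simp add: pl_def fun_eq_iff)
  then show ?thesis using pl_integrable[of p] pl_integrable[of q] by simp
qed

lemma pl_smult_integral: "(LINT \<theta>|g0. pl (smult a p) \<theta>) = a * (LINT \<theta>|g0. pl p \<theta>)"
  by (simp add: pl_def)

lemma tilts_combination:
  assumes "\<And>k. k < (N::nat) ==> u k \<in> tilts n"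
  shows "(\<lambda>x. \<Sum>k<N. a k * u k x) \<in> tilts n"
  using assms
proof (induction N)
  case 0
  have "(\<lambda>x. 0) = tilt 0" by (simp add: tilt_def pl_def fun_eq_iff)
  then show ?case by (auto simp: tilts_def pl_def intro!: exI[of _ 0])
next
  case (Suc N)
  then have "(\<lambda>x. \<Sum>k<N. a k * u k x) \<in> tilts n" by simp
  then obtain p where p: "(\<lambda>x. \<Sum>k<N. a k * u k x) = tilt p" "degree p \<le> n" "(LINT \<theta>|g0. pl p \<theta>) = 0" by (auto simp: tilts_def)
  obtain q where q: "u N = tilt q" "degree q \<le> n" "(LINT \<theta>|g0. pl q \<theta>) = 0" using Suc(2)[of N] by (auto simp: tilts_def)
  have "(\<lambda>x. \<Sum>k<Suc N. a k * u k x) = tilt (p + smult (a N) q)"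
    using fun_cong[OF p(1)] by (intro ext) (simp add: tilt_add tilt_smult q(1))
  moreover have "degree (p + smult (a N) q) \<le> n" using p(2) q(2) by (intro degree_add_le order_trans[OF degree_smult_le])
  moreover have "(LINT \<theta>|g0. pl (p + smult (a N) q) \<theta>) = 0" by (simp add: pl_add_integral pl_smult_integral p(3) q(3))
  ultimately show ?case unfolding tilts_def by blast
qed

definition cpow :: "nat => real poly" where
  "cpow n = monom 1 (Suc n) + smult (- (LINT \<theta>|g0. pl (monom 1 (Suc n)) \<theta>)) 1"

lemma cpow_centred: "(LINT \<theta>|g0. pl (cpow n) \<theta>) = 0"
proof -
  have "(LINT \<theta>|g0. pl 1 \<theta>) = 1" using prob_space.prob_space[OF G_prob[OF g0_in]] by (simp add: pl_def)
  then show ?thesis unfolding cpow_def pl_add_integral pl_smult_integral by simp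
qed

sublocale L2_sequence P0 "\<lambda>n. tilt (cpow n)"
  by unfold_locales (rule tilt_L2[OF cpow_centred])

text \<open>
  The residual of the \<open>n\<close>-th vector has leading coefficient \<open>1\<close> in
  degree \<open>n + 1\<close>, since the preceding ones have smaller degree.  Hence it never
  vanishes.
\<close>

lemma gs_tilt: "gs n \<in> tilts (Suc n)" and gs_unit: "L2_inner P0 (gs n) (gs n) = 1"
proof -
  have "gs n \<in> tilts (Suc n) \<and> L2_inner P0 (gs n) (gs n) = 1"
  proof (induction n rule: less_induct)
    case (less n)
    have "tilts (Suc k) \<subseteq> tilts n" if "k < n" for k using that unfolding tilts_def by force
    then have "(\<lambda>x. \<Sum>k<n. L2_inner P0 (tilt (cpow n)) (gs k) * gs k x) \<in> tilts n"
      using less by (intro tilts_combination) blast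
    then obtain q where q: "(\<lambda>x. \<Sum>k<n. L2_inner P0 (tilt (cpow n)) (gs k) * gs k x) = tilt q" "degree q \<le> n" "(LINT \<theta>|g0. pl q \<theta>) = 0"
      by (auto simp: tilts_def)
    define p where "p = cpow n + smult (-1) q"
    have res: "res n = tilt p"
    proof
      fix x
      show "res n x = tilt p x" using fun_cong[OF q(1), of x] by (simp only: gs_residual_def p_def tilt_add tilt_smult)
    qed
    have p0: "(LINT \<theta>|g0. pl p \<theta>) = 0" unfolding p_def pl_add_integral pl_smult_integral cpow_centred q(3) by simp
    have "coeff p (Suc n) = 1" using q(2) by (simp add: p_def cpow_def coeff_eq_0)
    then have "p \<noteq> 0" by auto
    from tilt_nonzero[OF p0 this] have nz: "L2_inner P0 (res n) (res n) > 0"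
      unfolding res using L2_inner_nonneg[of P0 "tilt p"] by linarith
    let ?a = "1 / sqrt (L2_inner P0 (res n) (res n))"
    have gs: "gs n = tilt (smult ?a p)"
      by (subst gram_schmidt_eq) (simp add: res tilt_smult fun_eq_iff)
    have "degree (cpow n) \<le> Suc n" unfolding cpow_def
      by (intro degree_add_le order_trans[OF degree_monom_le] order_trans[OF degree_smult_le]) auto
    then have "degree p \<le> Suc n" unfolding p_def using q(2) by (intro degree_add_le order_trans[OF degree_smult_le]) auto
    then have 1: "gs n \<in> tilts (Suc n)"
      unfolding tilts_def gs using p0 order_trans[OF degree_smult_le, of p "Suc n" ?a] by (auto simp: pl_smult_integral)
    have "L2_inner P0 (gs n) (gs n) \<noteq> 0"
      unfolding gs by (rule tilt_nonzero) (use p0 \<open>p \<noteq> 0\<close> nz in \<open>auto simp: pl_smult_integral\<close>)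
    then have "gs n \<noteq> (\<lambda>_. 0)" by (auto simp: L2_inner_def)
    then show ?case using 1 gs_normal[of n] by blast
  qed
  then show "gs n \<in> tilts (Suc n)" "L2_inner P0 (gs n) (gs n) = 1" by auto
qed

end

subsection \<open>Divergence of the statistic\<close>

lemma std_normal_tail_pos: "measure std_normal_distribution {..a} < 1"
proof -
  interpret prob_space std_normal_distribution using prob_space_normal_density[of 1 0] by simp
  have "prob {a<..} \<noteq> 0"
  proof
    assume "prob {a<..} = 0"
    then have "emeasure std_normal_distribution {a<..} = 0" by (simp add: emeasure_eq_measure)
    then have "AE x in lborel. x \<notin> {a<..}"
      by (subst (asm) emeasure_density) (auto simp: nn_integral_0_iff_AE indicator_def normal_density_pos[THEN less_imp_neq, symmetric] normal_density_pos not_le[symmetric] not_less split: if_splits)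
    then have "{a<..} \<in> null_sets lborel" by (subst AE_iff_null_sets) auto
    then have "{a<..<a+1} \<in> null_sets lborel" by (rule null_sets_subset) auto
    then have "emeasure lborel {a<..<a+1} = 0" by (rule null_setsD1)
    then show False by simp
  qed
  moreover have "prob (UNIV - {a<..}) = 1 - prob {a<..}" using prob_compl[of "{a<..}"] by simp
  moreover have "UNIV - {a<..} = {..a}" by auto
  ultimately show ?thesis using measure_nonneg[of std_normal_distribution "{a<..}"] by (simp add: less_le)
qed

lemma std_normal_orthant:
  "measure (\<Pi>\<^sub>M i\<in>range (\<lambda>n::nat. n). std_normal_distribution) {\<omega> \<in> space (\<Pi>\<^sub>M i\<in>range (\<lambda>n. n). std_normal_distribution). \<forall>j\<in>{..<k}. \<omega> j \<le> a}
     = measure std_normal_distribution {..a} ^ k"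
proof -
  interpret product_prob_space "\<lambda>_::nat. std_normal_distribution" "range (\<lambda>n::nat. n)"
    by (intro product_prob_spaceI prob_space_normal_density) simp
  let ?N = "\<Pi>\<^sub>M i\<in>range (\<lambda>n::nat. n). std_normal_distribution"
  have "emeasure ?N {\<omega> \<in> space ?N. \<forall>j\<in>{..<k}. \<omega> j \<in> {..a}} = (\<Prod>j\<in>{..<k}. emeasure std_normal_distribution {..a})"
    by (rule emeasure_PiM_Collect) auto
  also have "\<dots> = ennreal (measure std_normal_distribution {..a} ^ k)" by (simp add: M.emeasure_eq_measure ennreal_power)
  finally show ?thesis by (simp add: measure_def)
qed

locale tilted_npmle = tilted_mixture d b \<theta>0 \<Theta> R g0 l + npmle_model d b \<theta>0 \<Theta> R g0 M X ghat L
  for d b \<theta>0 \<Theta> R g0 l and M :: "'w measure" and X ghat L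
begin

lemma gs_facts:
  shows "gs j \<in> borel_measurable P0" "(LINT x|P0. gs j x) = 0" "(LINT x|P0. (gs j x)\<^sup>2) = 1" "integrable P0 (\<lambda>x. gs j x ^ i)"
proof -
  obtain p where p: "gs j = tilt p" "(LINT \<theta>|g0. pl p \<theta>) = 0" using gs_tilt[of j] by (auto simp: tilts_def)
  show "gs j \<in> borel_measurable P0" unfolding p(1) using tilt_measurable[OF p(2)] by (simp cong: measurable_cong_sets)
  show "(LINT x|P0. gs j x) = 0" unfolding p(1) by (rule tilt_integral(1)[OF p(2)])
  show "integrable P0 (\<lambda>x. gs j x ^ i)" unfolding p(1) by (rule tilt_power_integrable[OF p(2)])
  show "(LINT x|P0. (gs j x)\<^sup>2) = 1" using gs_unit[of j] by (simp add: L2_inner_def power2_eq_square)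
qed

text \<open>
  The tilts of small size are competitors in the maximum defining the statistic.
\<close>

lemma mostly_L_ge_score:
  assumes \<zeta>: "\<zeta> > 0"
  shows "mostly \<zeta> (\<lambda>n \<omega>. (max (emp n (gs j) \<omega>) 0)\<^sup>2 - 1 \<le> L n \<omega>)"
proof -
  obtain p where p: "gs j = tilt p" "(LINT \<theta>|g0. pl p \<theta>) = 0" using gs_tilt[of j] by (auto simp: tilts_def)
  define \<epsilon>0 where "\<epsilon>0 = 1 / (2 * (pb p + 1))"
  have e0: "\<epsilon>0 > 0" using pb_nonneg[of p] by (simp add: \<epsilon>0_def add_pos_nonneg)
  have "2 * (\<Sum>i=1..n. ln (1 + \<epsilon> * gs j (X i \<omega>))) \<le> L n \<omega>"
    if e: "0 \<le> \<epsilon>" "\<epsilon> \<le> \<epsilon>0" and n: "n \<ge> 1" "\<omega> \<in> space M" for \<epsilon> n \<omega>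
  proof -
    have "\<bar>\<epsilon>\<bar> * pb p \<le> \<epsilon>0 * pb p" using e pb_nonneg[of p] by (intro mult_right_mono) auto
    also have "\<dots> \<le> 1 / 2" using pb_nonneg[of p] by (simp add: \<epsilon>0_def field_simps)
    finally obtain h where h: "h \<in> G" "\<And>x. f h x = f g0 x * (1 + \<epsilon> * tilt p x)" using tilted_mixture[OF p(2)] by blast
    have "f h x / f g0 x = 1 + \<epsilon> * gs j x" for x using h(2) f_pos[OF g0_in, of x] by (simp add: p(1))
    then show ?thesis using ell_le_L[OF n h(1)] by (simp add: ell_def)
  qed
  note le = this
  have "mostly \<zeta> (\<lambda>n \<omega>. \<exists>\<epsilon>. 0 \<le> \<epsilon> \<and> \<epsilon> \<le> \<epsilon>0 \<and>
     (max (emp n (gs j) \<omega>) 0)\<^sup>2 - 1 \<le> 2 * (\<Sum>i=1..n. ln (1 + \<epsilon> * gs j (X i \<omega>))))"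
    by (rule likelihood_lower_bound[OF gs_facts(1,2,3,4) _ \<zeta> e0]) simp
  then show ?thesis
  proof (rule mostly_mono)
    show "\<forall>\<^sub>F n in sequentially. \<forall>\<omega>\<in>space M. (\<exists>\<epsilon>. 0 \<le> \<epsilon> \<and> \<epsilon> \<le> \<epsilon>0 \<and>
        (max (emp n (gs j) \<omega>) 0)\<^sup>2 - 1 \<le> 2 * (\<Sum>i=1..n. ln (1 + \<epsilon> * gs j (X i \<omega>)))) \<longrightarrow> (max (emp n (gs j) \<omega>) 0)\<^sup>2 - 1 \<le> L n \<omega>"
      using eventually_ge_at_top[of 1]
    proof eventually_elim
      case (elim n)
      show ?case
      proof (intro ballI impI, elim exE conjE)
        fix \<omega> \<epsilon>
        assume "\<omega> \<in> space M" "0 \<le> \<epsilon>" "\<epsilon> \<le> \<epsilon>0" and ge: "(max (emp n (gs j) \<omega>) 0)\<^sup>2 - 1 \<le> 2 * (\<Sum>i=1..n. ln (1 + \<epsilon> * gs j (X i \<omega>)))"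
        then have "2 * (\<Sum>i=1..n. ln (1 + \<epsilon> * gs j (X i \<omega>))) \<le> L n \<omega>" using elim by (intro le)
        with ge show "(max (emp n (gs j) \<omega>) 0)\<^sup>2 - 1 \<le> L n \<omega>" by (rule order_trans)
      qed
    qed
  qed
qed

text \<open>
  Finitely many orthonormal scores behave like independent standard normal variables; with
  sufficiently many of them the largest one exceeds a given bound with probability close to one.
\<close>

theorem likelihood_ratio_diverges: "(\<lambda>n. measure M {\<omega> \<in> space M. L n \<omega> > K}) \<longlonglongrightarrow> 1"
proof -
  define a where "a = sqrt (max K 0 + 1)"
  have a: "a \<ge> 0" "a\<^sup>2 = max K 0 + 1" by (auto simp: a_def)
  have ev: "\<forall>\<^sub>F n in sequentially. prob {\<omega> \<in> space M. L n \<omega> \<le> K} \<le> \<epsilon>" if \<epsilon>: "\<epsilon> > 0" for \<epsilon>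
  proof -
    let ?\<Phi> = "measure std_normal_distribution {..a + 1}"
    have "(\<lambda>k. ?\<Phi> ^ k) \<longlonglongrightarrow> 0" using std_normal_tail_pos[of "a + 1"] by (intro LIMSEQ_realpow_zero) auto
    then have "\<forall>\<^sub>F k in sequentially. ?\<Phi> ^ k < \<epsilon> / 3" using \<epsilon> by (intro order_tendstoD) auto
    then obtain k where k: "?\<Phi> ^ k < \<epsilon> / 3" by (auto simp: eventually_sequentially)
    define N where "N = (\<Pi>\<^sub>M i\<in>range (\<lambda>n::nat. n). std_normal_distribution)"
    note N = std_normal_sequence[of "\<lambda>n::nat. n", folded N_def, OF inj_on_id2]
    interpret N: prob_space N by (rule N)
    have NP: "measure N {\<omega> \<in> space N. \<forall>j\<in>{..<k}. \<omega> j \<le> a + 1} = ?\<Phi> ^ k"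
      unfolding N_def by (rule std_normal_orthant)
    interpret two_systems M N "{..<k}" "\<lambda>n j. emp n (gs j)" "\<lambda>j \<omega>. \<omega> j"
      by unfold_locales (use gs_facts N in auto)
    have gL2: "L2_fun P0 (gs j)" for j by (rule gs_L2)
    have char: "(\<lambda>n. CLINT \<omega>|M. iexp (\<Sum>j\<in>{..<k}. u j * emp n (gs j) \<omega>)) \<longlonglongrightarrow> (CLINT \<omega>|N. iexp (\<Sum>j\<in>{..<k}. u j * \<omega> j))" for u
    proof -
      let ?s = "\<lambda>x. \<Sum>j<k. u j * gs j x"
      have s: "L2_fun P0 ?s" by (rule L2_fun_sum) (auto intro: gL2)
      have "(LINT x|P0. (?s x)\<^sup>2) = L2_inner P0 ?s ?s" by (simp add: L2_inner_def power2_eq_square)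
      also have "\<dots> = (\<Sum>i<k. u i * L2_inner P0 (gs i) ?s)" by (rule L2_inner_sum) (auto intro: gL2 s)
      also have "\<dots> = (\<Sum>i<k. (u i)\<^sup>2)"
      proof (rule sum.cong[OF refl])
        fix i assume i: "i \<in> {..<k}"
        have "L2_inner P0 (gs i) ?s = (\<Sum>j<k. u j * L2_inner P0 (gs j) (gs i))"
          by (subst L2_inner_commute) (rule L2_inner_sum, auto intro: gL2)
        also have "\<dots> = (\<Sum>j<k. if j = i then u i else 0)"
          using gs_orthogonal gs_unit by (intro sum.cong) auto
        also have "\<dots> = u i" using i by simp
        finally show "u i * L2_inner P0 (gs i) ?s = (u i)\<^sup>2" by (simp add: power2_eq_square)
      qed
      finally have sq: "(LINT x|P0. (?s x)\<^sup>2) = (\<Sum>i<k. (u i)\<^sup>2)" .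
      have i1: "integrable P0 (gs j)" for j using gs_facts(4)[of j 1] by simp
      have "(LINT x|P0. ?s x) = 0" using i1 gs_facts(2) by simp
      from emp_char_limit[OF _ _ this] s
      have "(\<lambda>n. CLINT \<omega>|M. iexp (emp n ?s \<omega>)) \<longlonglongrightarrow> complex_of_real (exp (- (\<Sum>i<k. (u i)\<^sup>2) / 2))"
        by (simp add: L2_fun_def sq)
      then show ?thesis unfolding N(3) using i1 by (simp add: emp_sum)
    qed
    have tr: "\<forall>\<^sub>F n in sequentially. prob {\<omega> \<in> space M. \<forall>j\<in>{..<k}. emp n (gs j) \<omega> \<le> a} \<le>
        N.prob {\<omega> \<in> space N. \<forall>j\<in>{..<k}. \<omega> j \<le> a + 1} + \<epsilon> / 3"
    proof (rule orthant_transfer(1)[where V=1])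
      show "expectation (\<lambda>\<omega>. (emp n (gs j) \<omega>)\<^sup>2) \<le> 1" "integrable M (\<lambda>\<omega>. (emp n (gs j) \<omega>)\<^sup>2)" for n j
        using emp_square[OF gs_facts(1) gs_facts(4)[of j 2], of n] gs_facts(3)[of j] by auto
      have d: "distr N borel (\<lambda>\<omega>. \<omega> j) = gaussian_measure 0 1" for j
      proof (rule gaussian_measure_unique)
        show "(CLINT \<omega>|N. iexp (t * \<omega> j)) = complex_of_real (exp (- (t\<^sup>2 * 1\<^sup>2) / 2))" for t
        proof -
          have e: "(\<Sum>k<Suc j. (if k = j then t else 0) * \<omega> k) = t * \<omega> j" for \<omega> :: "nat => real" by simp
          have "(\<Sum>k<Suc j. (if k = j then t else 0)\<^sup>2) = (\<Sum>k<Suc j. if k = j then t\<^sup>2 else 0)" by (rule sum.cong) auto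
          then show ?thesis using N(3)[where K="Suc j" and b="\<lambda>k. if k = j then t else 0"] unfolding e by simp
        qed
      qed (use N in auto)
      have gm: "integrable (distr N borel (\<lambda>\<omega>. \<omega> j)) (\<lambda>x. x\<^sup>2)" "(LINT x|distr N borel (\<lambda>\<omega>. \<omega> j). x\<^sup>2) = 1" for j
        unfolding d using gaussian_measure_moments(3,4)[of 1 0] by simp_all
      have sq: "(\<lambda>x::real. x\<^sup>2) \<in> borel_measurable borel" by simp
      show "integrable N (\<lambda>\<omega>. (\<omega> j)\<^sup>2)" for j using gm(1)[of j] unfolding integrable_distr_eq[OF N(2) sq] .
      show "N.expectation (\<lambda>\<omega>. (\<omega> j)\<^sup>2) \<le> 1" for j using gm(2)[of j] unfolding integral_distr[OF N(2) sq] by simp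
    qed (use char \<epsilon> in auto)
    have "mostly (real (card {..<k}) * (\<epsilon> / 3 / (real k + 1))) (\<lambda>n \<omega>. \<forall>j\<in>{..<k}. (max (emp n (gs j) \<omega>) 0)\<^sup>2 - 1 \<le> L n \<omega>)"
      using \<epsilon> by (intro mostly_finite_ball mostly_L_ge_score) auto
    moreover have "real (card {..<k}) * (\<epsilon> / 3 / (real k + 1)) \<le> \<epsilon> / 3" using \<epsilon> by (simp add: field_simps)
    ultimately have mo: "mostly (\<epsilon> / 3) (\<lambda>n \<omega>. \<forall>j\<in>{..<k}. (max (emp n (gs j) \<omega>) 0)\<^sup>2 - 1 \<le> L n \<omega>)"
      unfolding mostly_def by (elim eventually_mono) (meson order_trans)
    show ?thesis using tr mo[unfolded mostly_def] eventually_ge_at_top[of 1]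
    proof eventually_elim
      case (elim n)
      then obtain B where B: "B \<in> events" "prob B \<le> \<epsilon> / 3"
        "\<forall>\<omega>\<in>space M - B. \<forall>j\<in>{..<k}. (max (emp n (gs j) \<omega>) 0)\<^sup>2 - 1 \<le> L n \<omega>" by blast
      let ?A = "{\<omega> \<in> space M. \<forall>j\<in>{..<k}. emp n (gs j) \<omega> \<le> a}"
      have A: "?A \<in> events" by measurable
      have "prob {\<omega> \<in> space M. L n \<omega> \<le> K} \<le> prob (?A \<union> B)"
      proof (rule finite_measure_mono)
        show "?A \<union> B \<in> events" using A B by auto
        show "{\<omega> \<in> space M. L n \<omega> \<le> K} \<subseteq> ?A \<union> B"
        proof
          fix \<omega> assume w: "\<omega> \<in> {\<omega> \<in> space M. L n \<omega> \<le> K}"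
          have "emp n (gs j) \<omega> \<le> a" if "j \<in> {..<k}" "\<omega> \<notin> B" for j
          proof -
            have "(max (emp n (gs j) \<omega>) 0)\<^sup>2 \<le> L n \<omega> + 1" using B(3) w that by force
            also have "\<dots> \<le> a\<^sup>2" unfolding a(2) using w by (simp add: le_max_iff_disj)
            finally have "max (emp n (gs j) \<omega>) 0 \<le> a" using a(1) by (rule power2_le_imp_le)
            then show ?thesis by simp
          qed
          then show "\<omega> \<in> ?A \<union> B" using w by blast
        qed
      qed
      also have "\<dots> \<le> prob ?A + prob B" using A B by (intro measure_Un_le) auto
      finally show ?case using elim(1) B(2) k unfolding NP by linarith
    qed
  qed
  have lim: "(\<lambda>n. prob {\<omega> \<in> space M. L n \<omega> \<le> K}) \<longlonglongrightarrow> 0"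
  proof (rule tendstoI)
    fix \<epsilon> :: real assume "\<epsilon> > 0"
    then have "\<forall>\<^sub>F n in sequentially. prob {\<omega> \<in> space M. L n \<omega> \<le> K} \<le> \<epsilon> / 2" by (intro ev) simp
    then show "\<forall>\<^sub>F n in sequentially. dist (prob {\<omega> \<in> space M. L n \<omega> \<le> K}) 0 < \<epsilon>"
      by eventually_elim (use \<open>\<epsilon> > 0\<close> measure_nonneg in auto)
  qed
  have "\<forall>\<^sub>F n in sequentially. prob {\<omega> \<in> space M. L n \<omega> > K} = 1 - prob {\<omega> \<in> space M. L n \<omega> \<le> K}"
    using eventually_ge_at_top[of 1]
  proof eventually_elim
    case (elim n)
    have [measurable]: "L n \<in> borel_measurable M" by (rule L_borel_measurable[OF elim])
    have "{\<omega> \<in> space M. L n \<omega> > K} = space M - {\<omega> \<in> space M. L n \<omega> \<le> K}" by auto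
    then show ?case using prob_compl[of "{\<omega> \<in> space M. L n \<omega> \<le> K}"] by simp
  qed
  moreover have "(\<lambda>n. 1 - prob {\<omega> \<in> space M. L n \<omega> \<le> K}) \<longlonglongrightarrow> 1 - 0" by (intro tendsto_diff tendsto_const lim)
  ultimately show ?thesis by (simp add: tendsto_cong)
qed

end

section \<open>Asymptotics of the likelihood ratio statistic\<close>

theorem theorem3p1:
  fixes d b :: nat
    and \<Theta> :: "param set"
    and g0 :: "param measure"
    and M :: "'w measure"
    and X :: "nat \<Rightarrow> 'w \<Rightarrow> obs"
    and ghat :: "nat \<Rightarrow> 'w \<Rightarrow> param measure"
    and L :: "nat \<Rightarrow> 'w \<Rightarrow> real"
  assumes "d \<ge> 1"
    and "b \<le> d"
    and "\<Theta> \<subseteq> param_space d b"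
    and "bounded_params d \<Theta>"
    and "g0 \<in> mixing_dists d \<Theta>"
    and "prob_space M"
    and "prob_space.indep_vars M (\<lambda>_. base_measure d b) X {1..}"
    and "\<And>i. i \<ge> 1 \<Longrightarrow>
           distributed M (base_measure d b) (X i) (\<lambda>x. ennreal (mix_density d b g0 x))"
    and "\<And>n \<omega>. n \<ge> 1 \<Longrightarrow> \<omega> \<in> space M \<Longrightarrow> is_npmle d b \<Theta> n (\<lambda>i. X i \<omega>) (ghat n \<omega>)"
    and L_def: "\<And>n \<omega>. L n \<omega> = lr_stat d b n (\<lambda>i. X i \<omega>) (ghat n \<omega>) g0"
  shows "(finitely_discrete g0 \<longrightarrow> (\<forall>\<theta>0. support_point g0 \<theta>0 \<longrightarrow>
            (\<exists>(N :: ((obs \<Rightarrow> real) \<Rightarrow> real) measure) G.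
               tight_gaussian_process N (mix_dist d b g0) (score_set d b \<Theta> g0 \<theta>0) G) \<and>
            (\<forall>(N :: 'v measure) G.
               tight_gaussian_process N (mix_dist d b g0) (score_set d b \<Theta> g0 \<theta>0) G \<longrightarrow>
               weak_conv_m (\<lambda>n. distr M borel (L n))
                 (distr N borel (sup_sq_pos (score_set d b \<Theta> g0 \<theta>0) G)))))
       \<and> (\<not> finitely_discrete g0 \<longrightarrow>
            (\<forall>K::real. (\<lambda>n. measure M {\<omega> \<in> space M. L n \<omega> > K}) \<longlonglongrightarrow> 1))"
proof -
  from \<open>g0 \<in> mixing_dists d \<Theta>\<close> have g0: "prob_space g0" by (simp add: mixing_dists_def)
  have sp: "space g0 = \<Theta>" by (rule space_mixing) fact+
  obtain R where R: "\<And>\<theta> l. \<theta> \<in> \<Theta> \<Longrightarrow> l \<in> {1..d} \<Longrightarrow> \<bar>\<theta> l\<bar> \<le> R"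
    using \<open>bounded_params d \<Theta>\<close> unfolding bounded_params_def by blast
  have mixture: "mixture_model d b \<theta>0 \<Theta> R' g0" if "\<theta>0 \<in> \<Theta>" "R \<le> R'" for \<theta>0 R'
  proof unfold_locales
    show "\<bar>\<theta> l\<bar> \<le> R'" if "\<theta> \<in> \<Theta>" "l \<in> {1..d}" for \<theta> l using R[OF that] \<open>R \<le> R'\<close> by simp
  qed (use that assms in auto)
  have npmle: "npmle_model d b \<theta>0 \<Theta> R' g0 M X ghat L" if "\<theta>0 \<in> \<Theta>" "R \<le> R'" for \<theta>0 R'
    using mixture[OF that] assms(6-10) by (simp add: npmle_model_def npmle_model_axioms_def)
  show ?thesis
  proof (intro conjI impI allI)
    fix \<theta>0 assume "finitely_discrete g0" and \<theta>0: "support_point g0 \<theta>0"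
    then obtain T where T: "finite T" "T \<subseteq> \<Theta>" "emeasure g0 T = 1" by (auto simp: finitely_discrete_def sp)
    define c where "c l j = \<bar>coeff (\<Prod>\<tau>\<in>T. [:\<theta>0 l - \<tau> l, 1:]\<^sup>2) j\<bar>" for l j
    define n where "n l = degree (\<Prod>\<tau>\<in>T. [:\<theta>0 l - \<tau> l, 1:]\<^sup>2)" for l
    (* the bound on the parameters is enlarged to dominate the coefficients of the division polynomials *)
    define R' where "R' = \<bar>R\<bar> + (\<Sum>l=1..d. \<Sum>j<n l. c l j)"
    have c0: "c l j \<ge> 0" for l j by (simp add: c_def)
    have le: "R \<le> R'" using c0 by (simp add: R'_def sum_nonneg add_increasing2)
    have large: "c l j \<le> 2 * R'" if "l \<in> {1..d}" "j < n l" for l j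
    proof -
      have "c l j \<le> (\<Sum>j<n l. c l j)" using that c0 by (intro member_le_sum) auto
      also have "\<dots> \<le> (\<Sum>l=1..d. \<Sum>j<n l. c l j)"
        by (rule member_le_sum[of l "{1..d}" "\<lambda>l. \<Sum>j<n l. c l j"]) (use that c0 in \<open>auto intro: sum_nonneg\<close>)
      also have "\<dots> \<le> 2 * R'" using c0 by (simp add: R'_def sum_nonneg)
      finally show ?thesis .
    qed
    have in\<Theta>: "\<theta>0 \<in> \<Theta>" and atom: "emeasure g0 {\<theta>0} > 0" using \<theta>0 by (auto simp: support_point_def sp)
    interpret mixture_model d b \<theta>0 \<Theta> R' g0 by (rule mixture[OF in\<Theta> le])
    interpret npmle_model d b \<theta>0 \<Theta> R' g0 M X ghat L by (rule npmle[OF in\<Theta> le])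
    interpret finite_mixture d b \<theta>0 \<Theta> R' g0 T
      by unfold_locales (use T atom large in \<open>simp_all add: c_def n_def\<close>)
    interpret finite_npmle d b \<theta>0 \<Theta> R' g0 T M X ghat L ..
    show "\<exists>(N :: ((obs \<Rightarrow> real) \<Rightarrow> real) measure) G.
        tight_gaussian_process N (mix_dist d b g0) (score_set d b \<Theta> g0 \<theta>0) G"
    proof -
      obtain w C where s: "lipschitz_series P0 S cc w ec (\<lambda>x. maj \<rho> x / c0) C" using score_series by blast
      (* distinct constant functions index the independent standard normal coordinates *)
      have "inj (\<lambda>k::nat. (\<lambda>_. real k) :: obs \<Rightarrow> real)" by (auto simp: inj_def fun_eq_iff)
      from lipschitz_series.tight_gaussian_process_exists[OF s this] show ?thesis by (simp only: P0_def)
    qed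
    fix N :: "'v measure" and G
    assume "tight_gaussian_process N (mix_dist d b g0) (score_set d b \<Theta> g0 \<theta>0) G"
    then show "weak_conv_m (\<lambda>n. distr M borel (L n)) (distr N borel (sup_sq_pos (score_set d b \<Theta> g0 \<theta>0) G))"
      by (intro likelihood_ratio_converges) (simp only: P0_def)
  next
    fix K :: real
    assume nd: "\<not> finitely_discrete g0"
    obtain \<theta>0 where in\<Theta>: "\<theta>0 \<in> \<Theta>" using prob_space.not_empty[OF g0] by (auto simp: sp)
    interpret mixture_model d b \<theta>0 \<Theta> R g0 by (rule mixture[OF in\<Theta> order_refl])
    interpret npmle_model d b \<theta>0 \<Theta> R g0 M X ghat L by (rule npmle[OF in\<Theta> order_refl])
    obtain l where l: "l \<in> {1..d}" "\<And>F. finite F \<Longrightarrow> \<not> (AE \<theta> in g0. \<theta> l \<in> F)"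
      using infinite_marginal[OF nd] by blast
    interpret tilted_mixture d b \<theta>0 \<Theta> R g0 l by unfold_locales (use l in auto)
    interpret tilted_npmle d b \<theta>0 \<Theta> R g0 l M X ghat L ..
    show "(\<lambda>n. measure M {\<omega> \<in> space M. L n \<omega> > K}) \<longlonglongrightarrow> 1" by (rule likelihood_ratio_diverges)
  qed
qed

end
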